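(* Let $\mathcal{B}$ be a $\mathcal{V}$-category with powers and enough cofibrantly-weighted limits, and let $U\colon\mathcal{B}\to\mathcal{A}$ be a $\mathcal{V}$-functor that preserves them (that is, $U$ preserves powers and preserves enough cofibrantly-weighted limits). Then $U$ has a left shrink-adjoint if and only if the underlying ordinary functor $U_0\colon\mathcal{B}_0\to\mathcal{A}_0$ satisfies the solution set condition.
   Context: Standing assumptions: $(\mathcal{V},\otimes,I)$ is a symmetric monoidal closed (complete and cocomplete) monoidal model category in the sense of Hovey, whose unit object $I$ is cofibrant; $[X,Y]$ denotes the internal hom. For a $\mathcal{V}$-category $\mathcal{C}$, $\mathcal{C}_0$ is its underlying ordinary category, so $\mathcal{C}_0(A,B)=\mathcal{V}(I,\mathcal{C}(A,B))$ (the set of morphisms $I\to\mathcal{C}(A,B)$ in $\mathcal{V}$); morphisms of $\mathcal{C}$ are morphisms of $\mathcal{C}_0$. Intervals and homotopies: an interval $(J,d,c,e)$ is an object $J\in\mathcal{V}$ with a factorisation $I+I\xrightarrow{(d\ c)}J\xrightarrow{e}I$ of the codiagonal with $(d\ c)$ a cofibration and $e$ a weak equivalence. Shrinkable morphisms: a morphism $f\colon A\to B$ in a $\mathcal{V}$-category $\mathcal{C}$ is shrinkable if there are a morphism $s\colon B\to A$ with $f\circ s=1_B$, an interval $(J,d,c,e)$, and a morphism $h\colon J\to\mathcal{C}(A,A)$ in $\mathcal{V}$ with $hd=1_A$, $hc=s\circ f$ (viewed as maps $I\to\mathcal{C}(A,A)$) and $\mathcal{C}(A,f)\circ h=f\circ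 e\colon J\to\mathcal{C}(A,B)$. This applies in particular to $\mathcal{C}=\mathcal{V}$. Left shrink-adjoint: for a $\mathcal{V}$-functor $U\colon\mathcal{B}\to\mathcal{A}$, a shrink-reflection of $A\in\mathcal{A}$ is a morphism $\eta_A\colon A\to UA'$ with $A'\in\mathcal{B}$ such that for all $B\in\mathcal{B}$ the composite $\mathcal{B}(A',B)\xrightarrow{U}\mathcal{A}(UA',UB)\xrightarrow{\mathcal{A}(\eta_A,UB)}\mathcal{A}(A,UB)$ is a shrinkable morphism in $\mathcal{V}$. $U$ has a left shrink-adjoint if each object of $\mathcal{A}$ has a shrink-reflection. Solution set condition for $U_0$: for each $A\in\mathcal{A}$ there is a small set of morphisms $\{\eta_i\colon A\to UB_i\}$ such that every morphism $A\to UB$ factors as $Ug\circ\eta_i$ for some $i$ and some $g\colon B_i\to B$; equivalently, each ordinary comma category $A/U_0$ has a weakly initial set of objects. Powers: the power $X\pitchfork B$ of $B\in\mathcal{B}$ by $X\in\mathcal{V}$ is defined by isomorphisms $\mathcal{B}(C,X\pitchfork B)\cong[X,\mathcal{B}(C,B)]$, $\mathcal{V}$-natural in $C$. "With powers" means all such exist. Cofibrant weights: for a small $\mathcal{V}$-category $\mathcal{D}$, a morphism $p\colon F\to G$ in $[\mathcal{D},\mathcal{V}]$ is a (pointwise) trivial fibration if each component is a trivial fibration in $\mathcal{V}$; an object $Q\in[\mathcal{D},\mathcal{V}]$ is cofibrant if $[\mathcal{D},\mathcal{V}](Q,p)\colon[\mathcal{D},\mathcal{V}](Q,F)\to[\mathcal{D},\mathcal{V}](Q,G)$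 is a trivial fibration in $\mathcal{V}$ for each pointwise trivial fibration $p\colon F\to G$. Enough cofibrantly-weighted limits: let $\mathcal{I}$ be the unit $\mathcal{V}$-category (one object, with endomorphism object $I$), and write $I\colon\mathcal{I}\to\mathcal{V}$ for the $\mathcal{V}$-functor selecting the object $I$. $\mathcal{B}$ has enough cofibrantly-weighted limits if for each small $\mathcal{V}$-category $\mathcal{D}$ and each $\mathcal{V}$-functor $P\colon\mathcal{D}\to\mathcal{I}$ there are a cofibrant weight $Q\colon\mathcal{D}\to\mathcal{V}$ and a pointwise trivial fibration $Q\to IP$ such that $\mathcal{B}$ has all $Q$-weighted limits; $U\colon\mathcal{B}\to\mathcal{A}$ preserves enough cofibrantly-weighted limits if for each such $\mathcal{D}$ and $P$ there is such a $Q$ for which $U$ preserves $Q$-weighted limits. *)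

theory Defs
  imports "HOL-Library.Equipollence"
begin

section \<open>Smallness\<close>

text \<open>
  A universe is represented by a type \<open>'u\<close>: a set, of elements of any type, is small if its
  cardinality is strictly less than that of \<open>'u\<close>. The conditions below say that the cardinality
  of \<open>'u\<close> is infinite, regular and a strong limit, so that the small sets are, up to bijection,
  the elements of a Grothendieck universe. The uncountable case is the usual notion of smallness;
  for countable \<open>'u\<close> the small sets are the finite ones.
\<close>

definition small :: "'u itself \<Rightarrow> 'x set \<Rightarrow> bool" where
  "small (u :: 'u itself) X \<longleftrightarrow> X \<prec> (UNIV :: 'u set)"

definition universe :: "'u itself \<Rightarrow> bool" where
  "universe (u :: 'u itself) \<longleftrightarrow>
     infinite (UNIV :: 'u set) \<and>
     (\<forall>X :: 'u set. small u X \<longrightarrow> small u (Pow X)) \<and>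
     (\<forall>(X :: 'u set) (F :: 'u \<Rightarrow> 'u set).
        small u X \<and> (\<forall>x\<in>X. small u (F x)) \<longrightarrow> small u (\<Union>x\<in>X. F x))"


section \<open>Ordinary categories\<close>

record ('o, 'a) cat =
  Obj :: "'o set"
  Arr :: "'a set"
  Dom :: "'a \<Rightarrow> 'o"
  Cod :: "'a \<Rightarrow> 'o"
  Ident :: "'o \<Rightarrow> 'a"
  Comp :: "'a \<Rightarrow> 'a \<Rightarrow> 'a"  (infixr "\<cdot>\<index>" 55)

definition hom :: "('o, 'a, 'z) cat_scheme \<Rightarrow> 'o \<Rightarrow> 'o \<Rightarrow> 'a set" where
  "hom C a b = {f \<in> Arr C. Dom C f = a \<and> Cod C f = b}"

definition is_category :: "('o, 'a, 'z) cat_scheme \<Rightarrow> bool" where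
  "is_category C \<longleftrightarrow>
     (\<forall>f\<in>Arr C. Dom C f \<in> Obj C \<and> Cod C f \<in> Obj C) \<and>
     (\<forall>a\<in>Obj C. Ident C a \<in> hom C a a) \<and>
     (\<forall>a b c f g. f \<in> hom C a b \<and> g \<in> hom C b c \<longrightarrow> g \<cdot>\<^bsub>C\<^esub> f \<in> hom C a c) \<and>
     (\<forall>a b f. f \<in> hom C a b \<longrightarrow> f \<cdot>\<^bsub>C\<^esub> Ident C a = f \<and> Ident C b \<cdot>\<^bsub>C\<^esub> f = f) \<and>
     (\<forall>a b c d f g h. f \<in> hom C a b \<and> g \<in> hom C b c \<and> h \<in> hom C c d \<longrightarrow>
        h \<cdot>\<^bsub>C\<^esub> (g \<cdot>\<^bsub>C\<^esub> f) = (h \<cdot>\<^bsub>C\<^esub> g) \<cdot>\<^bsub>C\<^esub> f)"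

definition locally_small :: "'u itself \<Rightarrow> ('o, 'a, 'z) cat_scheme \<Rightarrow> bool" where
  "locally_small u C \<longleftrightarrow> (\<forall>a\<in>Obj C. \<forall>b\<in>Obj C. small u (hom C a b))"

definition inverse_arrows :: "('o, 'a, 'z) cat_scheme \<Rightarrow> 'a \<Rightarrow> 'a \<Rightarrow> bool" where
  "inverse_arrows C f g \<longleftrightarrow>
     f \<in> Arr C \<and> g \<in> hom C (Cod C f) (Dom C f) \<and>
     g \<cdot>\<^bsub>C\<^esub> f = Ident C (Dom C f) \<and> f \<cdot>\<^bsub>C\<^esub> g = Ident C (Cod C f)"

definition is_iso :: "('o, 'a, 'z) cat_scheme \<Rightarrow> 'a \<Rightarrow> bool" where
  "is_iso C f \<longleftrightarrow> (\<exists>g. inverse_arrows C f g)"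

definition inv_arr :: "('o, 'a, 'z) cat_scheme \<Rightarrow> 'a \<Rightarrow> 'a" where
  "inv_arr C f = (THE g. inverse_arrows C f g)"

record ('o, 'a, 'p, 'b) functr =
  FObj :: "'o \<Rightarrow> 'p"
  FArr :: "'a \<Rightarrow> 'b"

definition is_functor ::
  "('o, 'a, 'z) cat_scheme \<Rightarrow> ('p, 'b, 'w) cat_scheme \<Rightarrow> ('o, 'a, 'p, 'b) functr \<Rightarrow> bool" where
  "is_functor C D F \<longleftrightarrow>
     (\<forall>a\<in>Obj C. FObj F a \<in> Obj D \<and> FArr F (Ident C a) = Ident D (FObj F a)) \<and>
     (\<forall>a b f. f \<in> hom C a b \<longrightarrow> FArr F f \<in> hom D (FObj F a) (FObj F b)) \<and>
     (\<forall>a b c f g. f \<in> hom C a b \<and> g \<in> hom C b c \<longrightarrow>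
        FArr F (g \<cdot>\<^bsub>C\<^esub> f) = FArr F g \<cdot>\<^bsub>D\<^esub> FArr F f)"

definition is_cone ::
  "('i, 'j, 'w) cat_scheme \<Rightarrow> ('o, 'a, 'z) cat_scheme \<Rightarrow> ('i, 'j, 'o, 'a) functr \<Rightarrow>
   'o \<Rightarrow> ('i \<Rightarrow> 'a) \<Rightarrow> bool" where
  "is_cone J C F L p \<longleftrightarrow>
     L \<in> Obj C \<and> (\<forall>i\<in>Obj J. p i \<in> hom C L (FObj F i)) \<and>
     (\<forall>i j u. u \<in> hom J i j \<longrightarrow> FArr F u \<cdot>\<^bsub>C\<^esub> p i = p j)"

definition is_limit ::
  "('i, 'j, 'w) cat_scheme \<Rightarrow> ('o, 'a, 'z) cat_scheme \<Rightarrow> ('i, 'j, 'o, 'a) functr \<Rightarrow>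
   'o \<Rightarrow> ('i \<Rightarrow> 'a) \<Rightarrow> bool" where
  "is_limit J C F L p \<longleftrightarrow>
     is_cone J C F L p \<and>
     (\<forall>X q. is_cone J C F X q \<longrightarrow> (\<exists>!t. t \<in> hom C X L \<and> (\<forall>i\<in>Obj J. p i \<cdot>\<^bsub>C\<^esub> t = q i)))"

definition is_cocone ::
  "('i, 'j, 'w) cat_scheme \<Rightarrow> ('o, 'a, 'z) cat_scheme \<Rightarrow> ('i, 'j, 'o, 'a) functr \<Rightarrow>
   'o \<Rightarrow> ('i \<Rightarrow> 'a) \<Rightarrow> bool" where
  "is_cocone J C F L p \<longleftrightarrow>
     L \<in> Obj C \<and> (\<forall>i\<in>Obj J. p i \<in> hom C (FObj F i) L) \<and>
     (\<forall>i j u. u \<in> hom J i j \<longrightarrow> p j \<cdot>\<^bsub>C\<^esub> FArr F u = p i)"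

definition is_colimit ::
  "('i, 'j, 'w) cat_scheme \<Rightarrow> ('o, 'a, 'z) cat_scheme \<Rightarrow> ('i, 'j, 'o, 'a) functr \<Rightarrow>
   'o \<Rightarrow> ('i \<Rightarrow> 'a) \<Rightarrow> bool" where
  "is_colimit J C F L p \<longleftrightarrow>
     is_cocone J C F L p \<and>
     (\<forall>X q. is_cocone J C F X q \<longrightarrow> (\<exists>!t. t \<in> hom C L X \<and> (\<forall>i\<in>Obj J. t \<cdot>\<^bsub>C\<^esub> p i = q i)))"

text \<open>
  Every small category is isomorphic to one whose objects and arrows are elements of \<open>'u\<close>, so it
  suffices to let the shape of a small diagram range over such categories.
\<close>

definition small_complete :: "'u itself \<Rightarrow> ('o, 'a, 'z) cat_scheme \<Rightarrow> bool" where
  "small_complete u C \<longleftrightarrow>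
     (\<forall>(J :: ('u, 'u) cat) F.
        is_category J \<and> small u (Obj J) \<and> small u (Arr J) \<and> is_functor J C F \<longrightarrow>
        (\<exists>L p. is_limit J C F L p))"

definition small_cocomplete :: "'u itself \<Rightarrow> ('o, 'a, 'z) cat_scheme \<Rightarrow> bool" where
  "small_cocomplete u C \<longleftrightarrow>
     (\<forall>(J :: ('u, 'u) cat) F.
        is_category J \<and> small u (Obj J) \<and> small u (Arr J) \<and> is_functor J C F \<longrightarrow>
        (\<exists>L p. is_colimit J C F L p))"

definition is_initial :: "('o, 'a, 'z) cat_scheme \<Rightarrow> 'o \<Rightarrow> bool" where
  "is_initial C z \<longleftrightarrow> z \<in> Obj C \<and> (\<forall>x\<in>Obj C. \<exists>!f. f \<in> hom C z x)"

definition is_coproduct ::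
  "('o, 'a, 'z) cat_scheme \<Rightarrow> 'o \<Rightarrow> 'o \<Rightarrow> 'o \<Rightarrow> 'a \<Rightarrow> 'a \<Rightarrow> bool" where
  "is_coproduct C a b s i j \<longleftrightarrow>
     i \<in> hom C a s \<and> j \<in> hom C b s \<and>
     (\<forall>x f g. f \<in> hom C a x \<and> g \<in> hom C b x \<longrightarrow>
        (\<exists>!t. t \<in> hom C s x \<and> t \<cdot>\<^bsub>C\<^esub> i = f \<and> t \<cdot>\<^bsub>C\<^esub> j = g))"

definition is_pushout ::
  "('o, 'a, 'z) cat_scheme \<Rightarrow> 'a \<Rightarrow> 'a \<Rightarrow> 'o \<Rightarrow> 'a \<Rightarrow> 'a \<Rightarrow> bool" where
  "is_pushout C f g w i j \<longleftrightarrow>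
     f \<in> Arr C \<and> g \<in> Arr C \<and> Dom C f = Dom C g \<and>
     i \<in> hom C (Cod C f) w \<and> j \<in> hom C (Cod C g) w \<and> i \<cdot>\<^bsub>C\<^esub> f = j \<cdot>\<^bsub>C\<^esub> g \<and>
     (\<forall>x u v. u \<in> hom C (Cod C f) x \<and> v \<in> hom C (Cod C g) x \<and> u \<cdot>\<^bsub>C\<^esub> f = v \<cdot>\<^bsub>C\<^esub> g \<longrightarrow>
        (\<exists>!t. t \<in> hom C w x \<and> t \<cdot>\<^bsub>C\<^esub> i = u \<and> t \<cdot>\<^bsub>C\<^esub> j = v))"

text \<open>The small family \<open>{\<eta>\<^sub>i : a \<rightarrow> F b\<^sub>i}\<close> is given as the set of the pairs \<open>(b\<^sub>i, \<eta>\<^sub>i)\<close>.\<close>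

definition solution_set_condition ::
  "'u itself \<Rightarrow> ('o, 'a, 'z) cat_scheme \<Rightarrow> ('p, 'b, 'w) cat_scheme \<Rightarrow>
   ('o, 'a, 'p, 'b) functr \<Rightarrow> bool" where
  "solution_set_condition u C D F \<longleftrightarrow>
     (\<forall>a\<in>Obj D. \<exists>S. small u S \<and>
        (\<forall>(b, \<eta>)\<in>S. b \<in> Obj C \<and> \<eta> \<in> hom D a (FObj F b)) \<and>
        (\<forall>c\<in>Obj C. \<forall>f\<in>hom D a (FObj F c).
           \<exists>(b, \<eta>)\<in>S. \<exists>g\<in>hom C b c. f = FArr F g \<cdot>\<^bsub>D\<^esub> \<eta>))"


section \<open>Symmetric monoidal closed categories\<close>

record ('o, 'a) smc = "('o, 'a) cat" +
  Tensor :: "'o \<Rightarrow> 'o \<Rightarrow> 'o"  (infixr "\<otimes>\<index>" 70)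
  TensorA :: "'a \<Rightarrow> 'a \<Rightarrow> 'a"  (infixr "\<odot>\<index>" 70)
  Unit :: "'o"
  Assoc :: "'o \<Rightarrow> 'o \<Rightarrow> 'o \<Rightarrow> 'a"
  LUnit :: "'o \<Rightarrow> 'a"
  RUnit :: "'o \<Rightarrow> 'a"
  Symm :: "'o \<Rightarrow> 'o \<Rightarrow> 'a"
  IHom :: "'o \<Rightarrow> 'o \<Rightarrow> 'o"
  Ev :: "'o \<Rightarrow> 'o \<Rightarrow> 'a"

definition is_symmetric_monoidal :: "('o, 'a, 'z) smc_scheme \<Rightarrow> bool" where
  "is_symmetric_monoidal V \<longleftrightarrow>
     is_category V \<and> Unit V \<in> Obj V \<and>
     \<comment> \<open>the tensor product is a functor of two variables\<close>
     (\<forall>X\<in>Obj V. \<forall>Y\<in>Obj V. X \<otimes>\<^bsub>V\<^esub> Y \<in> Obj V \<and>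
        Ident V X \<odot>\<^bsub>V\<^esub> Ident V Y = Ident V (X \<otimes>\<^bsub>V\<^esub> Y)) \<and>
     (\<forall>X X' Y Y' f g. f \<in> hom V X X' \<and> g \<in> hom V Y Y' \<longrightarrow>
        f \<odot>\<^bsub>V\<^esub> g \<in> hom V (X \<otimes>\<^bsub>V\<^esub> Y) (X' \<otimes>\<^bsub>V\<^esub> Y')) \<and>
     (\<forall>X X' X'' Y Y' Y'' f f' g g'.
        f \<in> hom V X X' \<and> f' \<in> hom V X' X'' \<and> g \<in> hom V Y Y' \<and> g' \<in> hom V Y' Y'' \<longrightarrow>
        (f' \<cdot>\<^bsub>V\<^esub> f) \<odot>\<^bsub>V\<^esub> (g' \<cdot>\<^bsub>V\<^esub> g) = (f' \<odot>\<^bsub>V\<^esub> g') \<cdot>\<^bsub>V\<^esub> (f \<odot>\<^bsub>V\<^esub> g)) \<and>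
     \<comment> \<open>natural isomorphisms\<close>
     (\<forall>X\<in>Obj V. \<forall>Y\<in>Obj V. \<forall>Z\<in>Obj V.
        is_iso V (Assoc V X Y Z) \<and>
        Assoc V X Y Z \<in> hom V ((X \<otimes>\<^bsub>V\<^esub> Y) \<otimes>\<^bsub>V\<^esub> Z) (X \<otimes>\<^bsub>V\<^esub> (Y \<otimes>\<^bsub>V\<^esub> Z))) \<and>
     (\<forall>X\<in>Obj V. is_iso V (LUnit V X) \<and> LUnit V X \<in> hom V (Unit V \<otimes>\<^bsub>V\<^esub> X) X) \<and>
     (\<forall>X\<in>Obj V. is_iso V (RUnit V X) \<and> RUnit V X \<in> hom V (X \<otimes>\<^bsub>V\<^esub> Unit V) X) \<and>
     (\<forall>X\<in>Obj V. \<forall>Y\<in>Obj V. Symm V X Y \<in> hom V (X \<otimes>\<^bsub>V\<^esub> Y) (Y \<otimes>\<^bsub>V\<^esub> X)) \<and>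
     (\<forall>X X' Y Y' Z Z' f g h. f \<in> hom V X X' \<and> g \<in> hom V Y Y' \<and> h \<in> hom V Z Z' \<longrightarrow>
        Assoc V X' Y' Z' \<cdot>\<^bsub>V\<^esub> ((f \<odot>\<^bsub>V\<^esub> g) \<odot>\<^bsub>V\<^esub> h) = (f \<odot>\<^bsub>V\<^esub> (g \<odot>\<^bsub>V\<^esub> h)) \<cdot>\<^bsub>V\<^esub> Assoc V X Y Z) \<and>
     (\<forall>X X' f. f \<in> hom V X X' \<longrightarrow>
        LUnit V X' \<cdot>\<^bsub>V\<^esub> (Ident V (Unit V) \<odot>\<^bsub>V\<^esub> f) = f \<cdot>\<^bsub>V\<^esub> LUnit V X \<and>
        RUnit V X' \<cdot>\<^bsub>V\<^esub> (f \<odot>\<^bsub>V\<^esub> Ident V (Unit V)) = f \<cdot>\<^bsub>V\<^esub> RUnit V X) \<and>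
     (\<forall>X X' Y Y' f g. f \<in> hom V X X' \<and> g \<in> hom V Y Y' \<longrightarrow>
        Symm V X' Y' \<cdot>\<^bsub>V\<^esub> (f \<odot>\<^bsub>V\<^esub> g) = (g \<odot>\<^bsub>V\<^esub> f) \<cdot>\<^bsub>V\<^esub> Symm V X Y) \<and>
     \<comment> \<open>pentagon, triangle, symmetry, hexagon\<close>
     (\<forall>W\<in>Obj V. \<forall>X\<in>Obj V. \<forall>Y\<in>Obj V. \<forall>Z\<in>Obj V.
        Assoc V W X (Y \<otimes>\<^bsub>V\<^esub> Z) \<cdot>\<^bsub>V\<^esub> Assoc V (W \<otimes>\<^bsub>V\<^esub> X) Y Z =
        (Ident V W \<odot>\<^bsub>V\<^esub> Assoc V X Y Z) \<cdot>\<^bsub>V\<^esub> Assoc V W (X \<otimes>\<^bsub>V\<^esub> Y) Z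
          \<cdot>\<^bsub>V\<^esub> (Assoc V W X Y \<odot>\<^bsub>V\<^esub> Ident V Z)) \<and>
     (\<forall>X\<in>Obj V. \<forall>Y\<in>Obj V.
        (Ident V X \<odot>\<^bsub>V\<^esub> LUnit V Y) \<cdot>\<^bsub>V\<^esub> Assoc V X (Unit V) Y = RUnit V X \<odot>\<^bsub>V\<^esub> Ident V Y) \<and>
     (\<forall>X\<in>Obj V. \<forall>Y\<in>Obj V. Symm V Y X \<cdot>\<^bsub>V\<^esub> Symm V X Y = Ident V (X \<otimes>\<^bsub>V\<^esub> Y)) \<and>
     (\<forall>X\<in>Obj V. \<forall>Y\<in>Obj V. \<forall>Z\<in>Obj V.
        Assoc V Y Z X \<cdot>\<^bsub>V\<^esub> Symm V X (Y \<otimes>\<^bsub>V\<^esub> Z) \<cdot>\<^bsub>V\<^esub> Assoc V X Y Z =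
        (Ident V Y \<odot>\<^bsub>V\<^esub> Symm V X Z) \<cdot>\<^bsub>V\<^esub> Assoc V Y X Z \<cdot>\<^bsub>V\<^esub> (Symm V X Y \<odot>\<^bsub>V\<^esub> Ident V Z))"

definition is_smcc :: "('o, 'a, 'z) smc_scheme \<Rightarrow> bool" where
  "is_smcc V \<longleftrightarrow>
     is_symmetric_monoidal V \<and>
     (\<forall>X\<in>Obj V. \<forall>Y\<in>Obj V.
        IHom V X Y \<in> Obj V \<and> Ev V X Y \<in> hom V (IHom V X Y \<otimes>\<^bsub>V\<^esub> X) Y) \<and>
     (\<forall>X\<in>Obj V. \<forall>Y\<in>Obj V. \<forall>Z\<in>Obj V. \<forall>f\<in>hom V (Z \<otimes>\<^bsub>V\<^esub> X) Y.
        \<exists>!g. g \<in> hom V Z (IHom V X Y) \<and> Ev V X Y \<cdot>\<^bsub>V\<^esub> (g \<odot>\<^bsub>V\<^esub> Ident V X) = f)"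

text \<open>The adjunct \<open>Z \<rightarrow> [X, Y]\<close> of \<open>f : Z \<otimes> X \<rightarrow> Y\<close>.\<close>

definition adjunct :: "('o, 'a, 'z) smc_scheme \<Rightarrow> 'o \<Rightarrow> 'o \<Rightarrow> 'o \<Rightarrow> 'a \<Rightarrow> 'a" where
  "adjunct V Z X Y f =
     (THE g. g \<in> hom V Z (IHom V X Y) \<and> Ev V X Y \<cdot>\<^bsub>V\<^esub> (g \<odot>\<^bsub>V\<^esub> Ident V X) = f)"

text \<open>The element \<open>I \<rightarrow> [X, Y]\<close> corresponding to \<open>f : X \<rightarrow> Y\<close>.\<close>

definition name_of :: "('o, 'a, 'z) smc_scheme \<Rightarrow> 'a \<Rightarrow> 'a" where
  "name_of V f = adjunct V (Unit V) (Dom V f) (Cod V f) (f \<cdot>\<^bsub>V\<^esub> LUnit V (Dom V f))"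


section \<open>Monoidal model categories in the sense of Hovey\<close>

definition is_square :: "('o, 'a, 'z) cat_scheme \<Rightarrow> 'a \<Rightarrow> 'a \<Rightarrow> 'a \<Rightarrow> 'a \<Rightarrow> bool" where
  "is_square C f g u v \<longleftrightarrow>
     f \<in> Arr C \<and> g \<in> Arr C \<and> u \<in> hom C (Dom C f) (Dom C g) \<and> v \<in> hom C (Cod C f) (Cod C g) \<and>
     g \<cdot>\<^bsub>C\<^esub> u = v \<cdot>\<^bsub>C\<^esub> f"

definition is_retract :: "('o, 'a, 'z) cat_scheme \<Rightarrow> 'a \<Rightarrow> 'a \<Rightarrow> bool" where
  "is_retract C f g \<longleftrightarrow>
     (\<exists>u v u' v'. is_square C f g u v \<and> is_square C g f u' v' \<and>
        u' \<cdot>\<^bsub>C\<^esub> u = Ident C (Dom C f) \<and> v' \<cdot>\<^bsub>C\<^esub> v = Ident C (Cod C f))"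

definition has_lifting :: "('o, 'a, 'z) cat_scheme \<Rightarrow> 'a \<Rightarrow> 'a \<Rightarrow> bool" where
  "has_lifting C f g \<longleftrightarrow>
     (\<forall>u v. is_square C f g u v \<longrightarrow>
        (\<exists>t\<in>hom C (Cod C f) (Dom C g). t \<cdot>\<^bsub>C\<^esub> f = u \<and> g \<cdot>\<^bsub>C\<^esub> t = v))"

definition is_wide_subcategory :: "('o, 'a, 'z) cat_scheme \<Rightarrow> 'a set \<Rightarrow> bool" where
  "is_wide_subcategory C W \<longleftrightarrow>
     W \<subseteq> Arr C \<and> (\<forall>a\<in>Obj C. Ident C a \<in> W) \<and>
     (\<forall>f\<in>W. \<forall>g\<in>W. Dom C g = Cod C f \<longrightarrow> g \<cdot>\<^bsub>C\<^esub> f \<in> W)"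

text \<open>
  \<open>L\<close> and \<open>R\<close> are the two functors on the category of arrows, on objects; \<open>M f g u v\<close> is the
  arrow from the middle object of \<open>f\<close> to that of \<open>g\<close> induced by the square \<open>(u, v) : f \<rightarrow> g\<close>.
\<close>

definition functorial_factorisation ::
  "('o, 'a, 'z) cat_scheme \<Rightarrow> ('a \<Rightarrow> 'a) \<Rightarrow> ('a \<Rightarrow> 'a) \<Rightarrow> ('a \<Rightarrow> 'a \<Rightarrow> 'a \<Rightarrow> 'a \<Rightarrow> 'a) \<Rightarrow> bool" where
  "functorial_factorisation C L R M \<longleftrightarrow>
     (\<forall>f\<in>Arr C. L f \<in> Arr C \<and> R f \<in> Arr C \<and>
        Dom C (L f) = Dom C f \<and> Cod C (L f) = Dom C (R f) \<and> Cod C (R f) = Cod C f \<and>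
        R f \<cdot>\<^bsub>C\<^esub> L f = f) \<and>
     (\<forall>f g u v. is_square C f g u v \<longrightarrow>
        is_square C (L f) (L g) u (M f g u v) \<and> is_square C (R f) (R g) (M f g u v) v) \<and>
     (\<forall>f\<in>Arr C. M f f (Ident C (Dom C f)) (Ident C (Cod C f)) = Ident C (Cod C (L f))) \<and>
     (\<forall>f g h u v u' v'. is_square C f g u v \<and> is_square C g h u' v' \<longrightarrow>
        M f h (u' \<cdot>\<^bsub>C\<^esub> u) (v' \<cdot>\<^bsub>C\<^esub> v) = M g h u' v' \<cdot>\<^bsub>C\<^esub> M f g u v)"

record ('o, 'a) smmc = "('o, 'a) smc" +
  Weq :: "'a set"
  Cof :: "'a set"
  Fib :: "'a set"
  CofL :: "'a \<Rightarrow> 'a"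
  TFibR :: "'a \<Rightarrow> 'a"
  CofM :: "'a \<Rightarrow> 'a \<Rightarrow> 'a \<Rightarrow> 'a \<Rightarrow> 'a"
  TCofL :: "'a \<Rightarrow> 'a"
  FibR :: "'a \<Rightarrow> 'a"
  TCofM :: "'a \<Rightarrow> 'a \<Rightarrow> 'a \<Rightarrow> 'a \<Rightarrow> 'a"

definition is_model_structure :: "('o, 'a, 'z) smmc_scheme \<Rightarrow> bool" where
  "is_model_structure V \<longleftrightarrow>
     is_wide_subcategory V (Weq V) \<and> is_wide_subcategory V (Cof V) \<and>
     is_wide_subcategory V (Fib V) \<and>
     functorial_factorisation V (CofL V) (TFibR V) (CofM V) \<and>
     functorial_factorisation V (TCofL V) (FibR V) (TCofM V) \<and>
     \<comment> \<open>two out of three\<close>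
     (\<forall>f\<in>Arr V. \<forall>g\<in>Arr V. Dom V g = Cod V f \<longrightarrow>
        (f \<in> Weq V \<and> g \<in> Weq V \<longrightarrow> g \<cdot>\<^bsub>V\<^esub> f \<in> Weq V) \<and>
        (f \<in> Weq V \<and> g \<cdot>\<^bsub>V\<^esub> f \<in> Weq V \<longrightarrow> g \<in> Weq V) \<and>
        (g \<in> Weq V \<and> g \<cdot>\<^bsub>V\<^esub> f \<in> Weq V \<longrightarrow> f \<in> Weq V)) \<and>
     (\<forall>f g. is_retract V f g \<longrightarrow>
        (g \<in> Weq V \<longrightarrow> f \<in> Weq V) \<and> (g \<in> Cof V \<longrightarrow> f \<in> Cof V) \<and> (g \<in> Fib V \<longrightarrow> f \<in> Fib V)) \<and>
     (\<forall>f\<in>Cof V. \<forall>g\<in>Fib V. f \<in> Weq V \<or> g \<in> Weq V \<longrightarrow> has_lifting V f g) \<and>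
     (\<forall>f\<in>Arr V. CofL V f \<in> Cof V \<and> TFibR V f \<in> Fib V \<inter> Weq V \<and>
        TCofL V f \<in> Cof V \<inter> Weq V \<and> FibR V f \<in> Fib V)"

definition cofibrant :: "('o, 'a, 'z) smmc_scheme \<Rightarrow> 'o \<Rightarrow> bool" where
  "cofibrant V X \<longleftrightarrow> X \<in> Obj V \<and> (\<exists>z f. is_initial V z \<and> f \<in> hom V z X \<and> f \<in> Cof V)"

definition pushout_product_axiom :: "('o, 'a, 'z) smmc_scheme \<Rightarrow> bool" where
  "pushout_product_axiom V \<longleftrightarrow>
     (\<forall>f\<in>Cof V. \<forall>g\<in>Cof V. \<forall>w i j t.
        is_pushout V (Ident V (Dom V f) \<odot>\<^bsub>V\<^esub> g) (f \<odot>\<^bsub>V\<^esub> Ident V (Dom V g)) w i j \<and>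
        t \<in> hom V w (Cod V f \<otimes>\<^bsub>V\<^esub> Cod V g) \<and>
        t \<cdot>\<^bsub>V\<^esub> i = f \<odot>\<^bsub>V\<^esub> Ident V (Cod V g) \<and> t \<cdot>\<^bsub>V\<^esub> j = Ident V (Cod V f) \<odot>\<^bsub>V\<^esub> g \<longrightarrow>
        t \<in> Cof V \<and> (f \<in> Weq V \<or> g \<in> Weq V \<longrightarrow> t \<in> Weq V))"

text \<open>
  The cofibrant replacement of the unit is obtained by factorising \<open>0 \<rightarrow> I\<close>; it is the second
  factor \<open>TFibR V f\<close> that is tensored with cofibrant objects.
\<close>

definition unit_axiom :: "('o, 'a, 'z) smmc_scheme \<Rightarrow> bool" where
  "unit_axiom V \<longleftrightarrow>
     (\<forall>z f X. is_initial V z \<and> f \<in> hom V z (Unit V) \<and> cofibrant V X \<longrightarrow>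
        TFibR V f \<odot>\<^bsub>V\<^esub> Ident V X \<in> Weq V \<and> Ident V X \<odot>\<^bsub>V\<^esub> TFibR V f \<in> Weq V)"

definition is_monoidal_model_category :: "'u itself \<Rightarrow> ('o, 'a, 'z) smmc_scheme \<Rightarrow> bool" where
  "is_monoidal_model_category u V \<longleftrightarrow>
     is_smcc V \<and> locally_small u V \<and> small_complete u V \<and> small_cocomplete u V \<and>
     is_model_structure V \<and> pushout_product_axiom V \<and> unit_axiom V"


section \<open>Enriched categories, functors and natural transformations\<close>

text \<open>\<open>VComp C a b c\<close> is the composition \<open>C(b, c) \<otimes> C(a, b) \<rightarrow> C(a, c)\<close>.\<close>

record ('c, 'o, 'a) vcat =
  VObj :: "'c set"
  VHom :: "'c \<Rightarrow> 'c \<Rightarrow> 'o"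
  VId :: "'c \<Rightarrow> 'a"
  VComp :: "'c \<Rightarrow> 'c \<Rightarrow> 'c \<Rightarrow> 'a"

definition is_vcat :: "('o, 'a, 'z) smc_scheme \<Rightarrow> ('c, 'o, 'a) vcat \<Rightarrow> bool" where
  "is_vcat V C \<longleftrightarrow>
     (\<forall>a\<in>VObj C. \<forall>b\<in>VObj C. VHom C a b \<in> Obj V) \<and>
     (\<forall>a\<in>VObj C. VId C a \<in> hom V (Unit V) (VHom C a a)) \<and>
     (\<forall>a\<in>VObj C. \<forall>b\<in>VObj C. \<forall>c\<in>VObj C.
        VComp C a b c \<in> hom V (VHom C b c \<otimes>\<^bsub>V\<^esub> VHom C a b) (VHom C a c)) \<and>
     (\<forall>a\<in>VObj C. \<forall>b\<in>VObj C. \<forall>c\<in>VObj C. \<forall>d\<in>VObj C.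
        VComp C a b d \<cdot>\<^bsub>V\<^esub> (VComp C b c d \<odot>\<^bsub>V\<^esub> Ident V (VHom C a b)) =
        VComp C a c d \<cdot>\<^bsub>V\<^esub> (Ident V (VHom C c d) \<odot>\<^bsub>V\<^esub> VComp C a b c)
          \<cdot>\<^bsub>V\<^esub> Assoc V (VHom C c d) (VHom C b c) (VHom C a b)) \<and>
     (\<forall>a\<in>VObj C. \<forall>b\<in>VObj C.
        VComp C a b b \<cdot>\<^bsub>V\<^esub> (VId C b \<odot>\<^bsub>V\<^esub> Ident V (VHom C a b)) = LUnit V (VHom C a b) \<and>
        VComp C a a b \<cdot>\<^bsub>V\<^esub> (Ident V (VHom C a b) \<odot>\<^bsub>V\<^esub> VId C a) = RUnit V (VHom C a b))"

record ('c, 'd, 'a) vfun =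
  VFObj :: "'c \<Rightarrow> 'd"
  VFArr :: "'c \<Rightarrow> 'c \<Rightarrow> 'a"

definition is_vfunctor ::
  "('o, 'a, 'z) smc_scheme \<Rightarrow> ('c, 'o, 'a) vcat \<Rightarrow> ('d, 'o, 'a) vcat \<Rightarrow> ('c, 'd, 'a) vfun \<Rightarrow> bool" where
  "is_vfunctor V C D F \<longleftrightarrow>
     (\<forall>a\<in>VObj C. VFObj F a \<in> VObj D) \<and>
     (\<forall>a\<in>VObj C. \<forall>b\<in>VObj C.
        VFArr F a b \<in> hom V (VHom C a b) (VHom D (VFObj F a) (VFObj F b))) \<and>
     (\<forall>a\<in>VObj C. VFArr F a a \<cdot>\<^bsub>V\<^esub> VId C a = VId D (VFObj F a)) \<and>
     (\<forall>a\<in>VObj C. \<forall>b\<in>VObj C. \<forall>c\<in>VObj C.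
        VFArr F a c \<cdot>\<^bsub>V\<^esub> VComp C a b c =
        VComp D (VFObj F a) (VFObj F b) (VFObj F c) \<cdot>\<^bsub>V\<^esub> (VFArr F b c \<odot>\<^bsub>V\<^esub> VFArr F a b))"

definition vfun_comp ::
  "('o, 'a, 'z) smc_scheme \<Rightarrow> ('d, 'e, 'a) vfun \<Rightarrow> ('c, 'd, 'a) vfun \<Rightarrow> ('c, 'e, 'a) vfun" where
  "vfun_comp V G F =
     \<lparr>VFObj = \<lambda>a. VFObj G (VFObj F a),
      VFArr = \<lambda>a b. VFArr G (VFObj F a) (VFObj F b) \<cdot>\<^bsub>V\<^esub> VFArr F a b\<rparr>"

text \<open>The component at \<open>a\<close> of a \<open>V\<close>-natural transformation is an element \<open>I \<rightarrow> D(F a, G a)\<close>.\<close>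

definition is_vnat ::
  "('o, 'a, 'z) smc_scheme \<Rightarrow> ('c, 'o, 'a) vcat \<Rightarrow> ('d, 'o, 'a) vcat \<Rightarrow>
   ('c, 'd, 'a) vfun \<Rightarrow> ('c, 'd, 'a) vfun \<Rightarrow> ('c \<Rightarrow> 'a) \<Rightarrow> bool" where
  "is_vnat V C D F G \<alpha> \<longleftrightarrow>
     (\<forall>a\<in>VObj C. \<alpha> a \<in> hom V (Unit V) (VHom D (VFObj F a) (VFObj G a))) \<and>
     (\<forall>a\<in>VObj C. \<forall>b\<in>VObj C.
        VComp D (VFObj F a) (VFObj F b) (VFObj G b) \<cdot>\<^bsub>V\<^esub> (\<alpha> b \<odot>\<^bsub>V\<^esub> VFArr F a b)
          \<cdot>\<^bsub>V\<^esub> inv_arr V (LUnit V (VHom C a b)) =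
        VComp D (VFObj F a) (VFObj G a) (VFObj G b) \<cdot>\<^bsub>V\<^esub> (VFArr G a b \<odot>\<^bsub>V\<^esub> \<alpha> a)
          \<cdot>\<^bsub>V\<^esub> inv_arr V (RUnit V (VHom C a b)))"

text \<open>\<open>g \<circ> f : I \<rightarrow> C(a, c)\<close> for \<open>f : I \<rightarrow> C(a, b)\<close> and \<open>g : I \<rightarrow> C(b, c)\<close>.\<close>

definition el_comp ::
  "('o, 'a, 'z) smc_scheme \<Rightarrow> ('c, 'o, 'a) vcat \<Rightarrow> 'c \<Rightarrow> 'c \<Rightarrow> 'c \<Rightarrow> 'a \<Rightarrow> 'a \<Rightarrow> 'a" where
  "el_comp V C a b c g f = VComp C a b c \<cdot>\<^bsub>V\<^esub> (g \<odot>\<^bsub>V\<^esub> f) \<cdot>\<^bsub>V\<^esub> inv_arr V (LUnit V (Unit V))"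

text \<open>\<open>C(a, f) : C(a, b) \<rightarrow> C(a, c)\<close> for \<open>f : I \<rightarrow> C(b, c)\<close>.\<close>

definition post_comp ::
  "('o, 'a, 'z) smc_scheme \<Rightarrow> ('c, 'o, 'a) vcat \<Rightarrow> 'c \<Rightarrow> 'c \<Rightarrow> 'c \<Rightarrow> 'a \<Rightarrow> 'a" where
  "post_comp V C a b c f =
     VComp C a b c \<cdot>\<^bsub>V\<^esub> (f \<odot>\<^bsub>V\<^esub> Ident V (VHom C a b)) \<cdot>\<^bsub>V\<^esub> inv_arr V (LUnit V (VHom C a b))"

text \<open>\<open>C(f, c) : C(b, c) \<rightarrow> C(a, c)\<close> for \<open>f : I \<rightarrow> C(a, b)\<close>.\<close>

definition pre_comp ::
  "('o, 'a, 'z) smc_scheme \<Rightarrow> ('c, 'o, 'a) vcat \<Rightarrow> 'c \<Rightarrow> 'c \<Rightarrow> 'c \<Rightarrow> 'a \<Rightarrow> 'a" where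
  "pre_comp V C a b c f =
     VComp C a b c \<cdot>\<^bsub>V\<^esub> (Ident V (VHom C b c) \<odot>\<^bsub>V\<^esub> f) \<cdot>\<^bsub>V\<^esub> inv_arr V (RUnit V (VHom C b c))"

text \<open>An arrow \<open>a \<rightarrow> b\<close> of the underlying category is a triple \<open>(a, b, f)\<close> with \<open>f : I \<rightarrow> C(a, b)\<close>.\<close>

definition underlying_cat ::
  "('o, 'a, 'z) smc_scheme \<Rightarrow> ('c, 'o, 'a) vcat \<Rightarrow> ('c, 'c \<times> 'c \<times> 'a) cat" where
  "underlying_cat V C =
     \<lparr>Obj = VObj C,
      Arr = {(a, b, f). a \<in> VObj C \<and> b \<in> VObj C \<and> f \<in> hom V (Unit V) (VHom C a b)},
      Dom = \<lambda>(a, b, f). a,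
      Cod = \<lambda>(a, b, f). b,
      Ident = \<lambda>a. (a, a, VId C a),
      Comp = \<lambda>(b', c, g) (a, b, f). (a, c, el_comp V C a b c g f)\<rparr>"

definition underlying_functor ::
  "('o, 'a, 'z) smc_scheme \<Rightarrow> ('c, 'd, 'a) vfun \<Rightarrow> ('c, 'c \<times> 'c \<times> 'a, 'd, 'd \<times> 'd \<times> 'a) functr" where
  "underlying_functor V F =
     \<lparr>FObj = VFObj F,
      FArr = \<lambda>(a, b, f). (VFObj F a, VFObj F b, VFArr F a b \<cdot>\<^bsub>V\<^esub> f)\<rparr>"

text \<open>The category \<open>V\<close> as a \<open>V\<close>-category.\<close>

definition self_vcat :: "('o, 'a, 'z) smc_scheme \<Rightarrow> ('o, 'o, 'a) vcat" where
  "self_vcat V =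
     \<lparr>VObj = Obj V,
      VHom = IHom V,
      VId = \<lambda>X. name_of V (Ident V X),
      VComp = \<lambda>X Y Z. adjunct V (IHom V Y Z \<otimes>\<^bsub>V\<^esub> IHom V X Y) X Z
        (Ev V Y Z \<cdot>\<^bsub>V\<^esub> (Ident V (IHom V Y Z) \<odot>\<^bsub>V\<^esub> Ev V X Y)
           \<cdot>\<^bsub>V\<^esub> Assoc V (IHom V Y Z) (IHom V X Y) X)\<rparr>"

definition op_vcat :: "('o, 'a, 'z) smc_scheme \<Rightarrow> ('c, 'o, 'a) vcat \<Rightarrow> ('c, 'o, 'a) vcat" where
  "op_vcat V C =
     \<lparr>VObj = VObj C,
      VHom = \<lambda>a b. VHom C b a,
      VId = VId C,
      VComp = \<lambda>a b c. VComp C c b a \<cdot>\<^bsub>V\<^esub> Symm V (VHom C c b) (VHom C b a)\<rparr>"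

definition unit_vcat :: "('o, 'a, 'z) smc_scheme \<Rightarrow> (unit, 'o, 'a) vcat" where
  "unit_vcat V =
     \<lparr>VObj = {()},
      VHom = \<lambda>_ _. Unit V,
      VId = \<lambda>_. Ident V (Unit V),
      VComp = \<lambda>_ _ _. LUnit V (Unit V)\<rparr>"

text \<open>The \<open>V\<close>-functor from the unit \<open>V\<close>-category to \<open>V\<close> selecting the unit object.\<close>

definition unit_select :: "('o, 'a, 'z) smc_scheme \<Rightarrow> (unit, 'o, 'a) vfun" where
  "unit_select V =
     \<lparr>VFObj = \<lambda>_. Unit V,
      VFArr = \<lambda>_ _. name_of V (Ident V (Unit V))\<rparr>"

text \<open>The representable \<open>V\<close>-functors \<open>C(c, -) : C \<rightarrow> V\<close> and \<open>C(-, c) : C\<^sup>o\<^sup>p \<rightarrow> V\<close>.\<close>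

definition hom_from ::
  "('o, 'a, 'z) smc_scheme \<Rightarrow> ('c, 'o, 'a) vcat \<Rightarrow> 'c \<Rightarrow> ('c, 'o, 'a) vfun" where
  "hom_from V C c =
     \<lparr>VFObj = \<lambda>a. VHom C c a,
      VFArr = \<lambda>a b. adjunct V (VHom C a b) (VHom C c a) (VHom C c b) (VComp C c a b)\<rparr>"

definition hom_to ::
  "('o, 'a, 'z) smc_scheme \<Rightarrow> ('c, 'o, 'a) vcat \<Rightarrow> 'c \<Rightarrow> ('c, 'o, 'a) vfun" where
  "hom_to V C c =
     \<lparr>VFObj = \<lambda>a. VHom C a c,
      VFArr = \<lambda>a b. adjunct V (VHom C b a) (VHom C a c) (VHom C b c)
        (VComp C b a c \<cdot>\<^bsub>V\<^esub> Symm V (VHom C b a) (VHom C a c))\<rparr>"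


section \<open>Powers and weighted limits\<close>

text \<open>
  The morphism \<open>C(c, l) \<rightarrow> [X, C(c, b)]\<close> induced by \<open>\<kappa> : X \<rightarrow> C(l, b)\<close> and composition.
\<close>

definition induced ::
  "('o, 'a, 'z) smc_scheme \<Rightarrow> ('c, 'o, 'a) vcat \<Rightarrow> 'o \<Rightarrow> 'c \<Rightarrow> 'c \<Rightarrow> 'a \<Rightarrow> 'c \<Rightarrow> 'a" where
  "induced V C X b l \<kappa> c =
     adjunct V (VHom C c l) X (VHom C c b)
       (VComp C c l b \<cdot>\<^bsub>V\<^esub> (\<kappa> \<odot>\<^bsub>V\<^esub> Ident V (VHom C c l)) \<cdot>\<^bsub>V\<^esub> Symm V (VHom C c l) X)"

text \<open>\<open>p\<close>, with the isomorphisms \<open>\<phi> c : C(c, p) \<cong> [X, C(c, b)]\<close>, is the power of \<open>b\<close> by \<open>X\<close>.\<close>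

definition is_power ::
  "('o, 'a, 'z) smc_scheme \<Rightarrow> ('c, 'o, 'a) vcat \<Rightarrow> 'o \<Rightarrow> 'c \<Rightarrow> 'c \<Rightarrow> ('c \<Rightarrow> 'a) \<Rightarrow> bool" where
  "is_power V C X b p \<phi> \<longleftrightarrow>
     p \<in> VObj C \<and>
     (\<forall>c\<in>VObj C. \<phi> c \<in> hom V (VHom C c p) (IHom V X (VHom C c b)) \<and> is_iso V (\<phi> c)) \<and>
     is_vnat V (op_vcat V C) (self_vcat V)
       (hom_to V C p) (vfun_comp V (hom_from V (self_vcat V) X) (hom_to V C b))
       (\<lambda>c. name_of V (\<phi> c))"

definition has_powers :: "('o, 'a, 'z) smc_scheme \<Rightarrow> ('c, 'o, 'a) vcat \<Rightarrow> bool" where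
  "has_powers V C \<longleftrightarrow> (\<forall>X\<in>Obj V. \<forall>b\<in>VObj C. \<exists>p \<phi>. is_power V C X b p \<phi>)"

text \<open>The universal morphism \<open>X \<rightarrow> C(p, b)\<close> of a power: the adjunct of \<open>\<phi> p\<close> applied to the identity.\<close>

definition power_counit ::
  "('o, 'a, 'z) smc_scheme \<Rightarrow> ('c, 'o, 'a) vcat \<Rightarrow> 'o \<Rightarrow> 'c \<Rightarrow> 'c \<Rightarrow> ('c \<Rightarrow> 'a) \<Rightarrow> 'a" where
  "power_counit V C X b p \<phi> =
     Ev V X (VHom C p b) \<cdot>\<^bsub>V\<^esub> ((\<phi> p \<cdot>\<^bsub>V\<^esub> VId C p) \<odot>\<^bsub>V\<^esub> Ident V X) \<cdot>\<^bsub>V\<^esub> inv_arr V (LUnit V X)"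

text \<open>
  Preservation: the image \<open>X \<rightarrow> C(p, b) \<rightarrow> D(U p, U b)\<close> of the universal morphism of a power
  exhibits \<open>U p\<close> as the power of \<open>U b\<close> by \<open>X\<close>.
\<close>

definition preserves_powers ::
  "('o, 'a, 'z) smc_scheme \<Rightarrow> ('c, 'o, 'a) vcat \<Rightarrow> ('d, 'o, 'a) vcat \<Rightarrow> ('c, 'd, 'a) vfun \<Rightarrow> bool" where
  "preserves_powers V C D U \<longleftrightarrow>
     (\<forall>X\<in>Obj V. \<forall>b\<in>VObj C. \<forall>p \<phi>. is_power V C X b p \<phi> \<longrightarrow>
        is_power V D X (VFObj U b) (VFObj U p)
          (induced V D X (VFObj U b) (VFObj U p) (VFArr U p b \<cdot>\<^bsub>V\<^esub> power_counit V C X b p \<phi>)))"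

text \<open>
  For \<open>V\<close>-functors \<open>F, G : D \<rightarrow> V\<close>, the object \<open>E\<close> with the projections \<open>\<pi> d : E \<rightarrow> [F d, G d]\<close> is
  the hom-object \<open>[D, V](F, G)\<close>, that is, the end of \<open>[F d, G d]\<close> over \<open>d\<close>. The two composites
  in the definition of a wedge are morphisms \<open>D(d, d') \<otimes> E \<rightarrow> [F d, G d']\<close>.
\<close>

definition is_hom_wedge ::
  "('o, 'a, 'z) smc_scheme \<Rightarrow> ('d, 'o, 'a) vcat \<Rightarrow> ('d, 'o, 'a) vfun \<Rightarrow> ('d, 'o, 'a) vfun \<Rightarrow>
   'o \<Rightarrow> ('d \<Rightarrow> 'a) \<Rightarrow> bool" where
  "is_hom_wedge V D F G E \<pi> \<longleftrightarrow>
     E \<in> Obj V \<and>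
     (\<forall>d\<in>VObj D. \<pi> d \<in> hom V E (IHom V (VFObj F d) (VFObj G d))) \<and>
     (\<forall>d\<in>VObj D. \<forall>d'\<in>VObj D.
        VComp (self_vcat V) (VFObj F d) (VFObj G d) (VFObj G d') \<cdot>\<^bsub>V\<^esub> (VFArr G d d' \<odot>\<^bsub>V\<^esub> \<pi> d) =
        VComp (self_vcat V) (VFObj F d) (VFObj F d') (VFObj G d') \<cdot>\<^bsub>V\<^esub> (\<pi> d' \<odot>\<^bsub>V\<^esub> VFArr F d d')
          \<cdot>\<^bsub>V\<^esub> Symm V (VHom D d d') E)"

definition is_hom_object ::
  "('o, 'a, 'z) smc_scheme \<Rightarrow> ('d, 'o, 'a) vcat \<Rightarrow> ('d, 'o, 'a) vfun \<Rightarrow> ('d, 'o, 'a) vfun \<Rightarrow>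
   'o \<Rightarrow> ('d \<Rightarrow> 'a) \<Rightarrow> bool" where
  "is_hom_object V D F G E \<pi> \<longleftrightarrow>
     is_hom_wedge V D F G E \<pi> \<and>
     (\<forall>E' \<pi>'. is_hom_wedge V D F G E' \<pi>' \<longrightarrow>
        (\<exists>!t. t \<in> hom V E' E \<and> (\<forall>d\<in>VObj D. \<pi> d \<cdot>\<^bsub>V\<^esub> t = \<pi>' d)))"

text \<open>
  A limit of \<open>S : D \<rightarrow> C\<close> weighted by \<open>Q : D \<rightarrow> V\<close>, given by the object \<open>l\<close> and the universal
  cylinder \<open>\<mu> : Q \<rightarrow> C(l, S -)\<close>: for each \<open>c\<close>, the morphisms \<open>C(c, l) \<rightarrow> [Q d, C(c, S d)]\<close> induced
  by \<open>\<mu>\<close> exhibit \<open>C(c, l)\<close> as \<open>[D, V](Q, C(c, S -))\<close>.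
\<close>

definition is_wlimit ::
  "('o, 'a, 'z) smc_scheme \<Rightarrow> ('d, 'o, 'a) vcat \<Rightarrow> ('c, 'o, 'a) vcat \<Rightarrow>
   ('d, 'o, 'a) vfun \<Rightarrow> ('d, 'c, 'a) vfun \<Rightarrow> 'c \<Rightarrow> ('d \<Rightarrow> 'a) \<Rightarrow> bool" where
  "is_wlimit V D C Q S l \<mu> \<longleftrightarrow>
     l \<in> VObj C \<and>
     (\<forall>d\<in>VObj D. \<mu> d \<in> hom V (VFObj Q d) (VHom C l (VFObj S d))) \<and>
     is_vnat V D (self_vcat V) Q (vfun_comp V (hom_from V C l) S) (\<lambda>d. name_of V (\<mu> d)) \<and>
     (\<forall>c\<in>VObj C.
        is_hom_object V D Q (vfun_comp V (hom_from V C c) S)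
          (VHom C c l) (\<lambda>d. induced V C (VFObj Q d) (VFObj S d) l (\<mu> d) c))"

definition has_wlimits ::
  "('o, 'a, 'z) smc_scheme \<Rightarrow> ('d, 'o, 'a) vcat \<Rightarrow> ('d, 'o, 'a) vfun \<Rightarrow> ('c, 'o, 'a) vcat \<Rightarrow> bool" where
  "has_wlimits V D Q C \<longleftrightarrow>
     (\<forall>S. is_vfunctor V D C S \<longrightarrow> (\<exists>l \<mu>. is_wlimit V D C Q S l \<mu>))"

definition preserves_wlimits ::
  "('o, 'a, 'z) smc_scheme \<Rightarrow> ('d, 'o, 'a) vcat \<Rightarrow> ('d, 'o, 'a) vfun \<Rightarrow>
   ('c, 'o, 'a) vcat \<Rightarrow> ('e, 'o, 'a) vcat \<Rightarrow> ('c, 'e, 'a) vfun \<Rightarrow> bool" where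
  "preserves_wlimits V D Q B A U \<longleftrightarrow>
     (\<forall>S l \<mu>. is_vfunctor V D B S \<and> is_wlimit V D B Q S l \<mu> \<longrightarrow>
        is_wlimit V D A Q (vfun_comp V U S) (VFObj U l) (\<lambda>d. VFArr U l (VFObj S d) \<cdot>\<^bsub>V\<^esub> \<mu> d))"


section \<open>Cofibrant weights\<close>

definition pointwise_trivial_fibration ::
  "('o, 'a, 'z) smmc_scheme \<Rightarrow> ('d, 'o, 'a) vcat \<Rightarrow> ('d, 'o, 'a) vfun \<Rightarrow> ('d, 'o, 'a) vfun \<Rightarrow>
   ('d \<Rightarrow> 'a) \<Rightarrow> bool" where
  "pointwise_trivial_fibration V D F G p \<longleftrightarrow>
     (\<forall>d\<in>VObj D. p d \<in> hom V (VFObj F d) (VFObj G d) \<and> p d \<in> Fib V \<inter> Weq V) \<and>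
     is_vnat V D (self_vcat V) F G (\<lambda>d. name_of V (p d))"

text \<open>
  In the following definition \<open>t : [D, V](Q, F) \<rightarrow> [D, V](Q, G)\<close> is the morphism \<open>[D, V](Q, p)\<close>.
\<close>

definition cofibrant_weight ::
  "('o, 'a, 'z) smmc_scheme \<Rightarrow> ('d, 'o, 'a) vcat \<Rightarrow> ('d, 'o, 'a) vfun \<Rightarrow> bool" where
  "cofibrant_weight V D Q \<longleftrightarrow>
     (\<forall>F G p E \<pi> E' \<pi>' t.
        is_vfunctor V D (self_vcat V) F \<and> is_vfunctor V D (self_vcat V) G \<and>
        pointwise_trivial_fibration V D F G p \<and>
        is_hom_object V D Q F E \<pi> \<and> is_hom_object V D Q G E' \<pi>' \<and> t \<in> hom V E E' \<and>
        (\<forall>d\<in>VObj D. \<pi>' d \<cdot>\<^bsub>V\<^esub> t =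
           post_comp V (self_vcat V) (VFObj Q d) (VFObj F d) (VFObj G d) (name_of V (p d)) \<cdot>\<^bsub>V\<^esub> \<pi> d) \<longrightarrow>
        t \<in> Fib V \<inter> Weq V)"

text \<open>
  A cofibrant weight with a pointwise trivial fibration to the composite of \<open>P : D \<rightarrow> \<I>\<close> and the
  functor \<open>\<I> \<rightarrow> V\<close> selecting the unit object.
\<close>

definition cofibrant_replacement_weight ::
  "('o, 'a, 'z) smmc_scheme \<Rightarrow> ('d, 'o, 'a) vcat \<Rightarrow> ('d, unit, 'a) vfun \<Rightarrow> ('d, 'o, 'a) vfun \<Rightarrow> bool" where
  "cofibrant_replacement_weight V D P Q \<longleftrightarrow>
     is_vfunctor V D (self_vcat V) Q \<and> cofibrant_weight V D Q \<and>
     (\<exists>q. pointwise_trivial_fibration V D Q (vfun_comp V (unit_select V) P) q)"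

text \<open>
  Every small \<open>V\<close>-category is isomorphic to one whose objects are elements of \<open>'u\<close>.
\<close>

definition enough_cofibrantly_weighted_limits ::
  "'u itself \<Rightarrow> ('o, 'a, 'z) smmc_scheme \<Rightarrow> ('c, 'o, 'a) vcat \<Rightarrow> bool" where
  "enough_cofibrantly_weighted_limits u V B \<longleftrightarrow>
     (\<forall>(D :: ('u, 'o, 'a) vcat) P.
        is_vcat V D \<and> small u (VObj D) \<and> is_vfunctor V D (unit_vcat V) P \<longrightarrow>
        (\<exists>Q. cofibrant_replacement_weight V D P Q \<and> has_wlimits V D Q B))"

definition preserves_enough_cofibrantly_weighted_limits ::
  "'u itself \<Rightarrow> ('o, 'a, 'z) smmc_scheme \<Rightarrow> ('c, 'o, 'a) vcat \<Rightarrow> ('d, 'o, 'a) vcat \<Rightarrow>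
   ('c, 'd, 'a) vfun \<Rightarrow> bool" where
  "preserves_enough_cofibrantly_weighted_limits u V B A U \<longleftrightarrow>
     (\<forall>(D :: ('u, 'o, 'a) vcat) P.
        is_vcat V D \<and> small u (VObj D) \<and> is_vfunctor V D (unit_vcat V) P \<longrightarrow>
        (\<exists>Q. cofibrant_replacement_weight V D P Q \<and> has_wlimits V D Q B \<and>
             preserves_wlimits V D Q B A U))"


section \<open>Shrinkable morphisms and shrink-adjoints\<close>

definition is_interval :: "('o, 'a, 'z) smmc_scheme \<Rightarrow> 'o \<Rightarrow> 'a \<Rightarrow> 'a \<Rightarrow> 'a \<Rightarrow> bool" where
  "is_interval V J d c e \<longleftrightarrow>
     d \<in> hom V (Unit V) J \<and> c \<in> hom V (Unit V) J \<and> e \<in> hom V J (Unit V) \<and>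
     (\<exists>s i j t. is_coproduct V (Unit V) (Unit V) s i j \<and>
        t \<in> hom V s J \<and> t \<cdot>\<^bsub>V\<^esub> i = d \<and> t \<cdot>\<^bsub>V\<^esub> j = c \<and> t \<in> Cof V) \<and>
     e \<cdot>\<^bsub>V\<^esub> d = Ident V (Unit V) \<and> e \<cdot>\<^bsub>V\<^esub> c = Ident V (Unit V) \<and> e \<in> Weq V"

definition shrinkable ::
  "('o, 'a, 'z) smmc_scheme \<Rightarrow> ('c, 'o, 'a) vcat \<Rightarrow> 'c \<Rightarrow> 'c \<Rightarrow> 'a \<Rightarrow> bool" where
  "shrinkable V C a b f \<longleftrightarrow>
     f \<in> hom V (Unit V) (VHom C a b) \<and>
     (\<exists>s J d c e h.
        s \<in> hom V (Unit V) (VHom C b a) \<and> el_comp V C b a b f s = VId C b \<and>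
        is_interval V J d c e \<and> h \<in> hom V J (VHom C a a) \<and>
        h \<cdot>\<^bsub>V\<^esub> d = VId C a \<and> h \<cdot>\<^bsub>V\<^esub> c = el_comp V C a b a s f \<and>
        post_comp V C a a b f \<cdot>\<^bsub>V\<^esub> h = f \<cdot>\<^bsub>V\<^esub> e)"

text \<open>A morphism of \<open>V\<close> is shrinkable if it is so in \<open>V\<close> considered as a \<open>V\<close>-category.\<close>

definition shrinkable_in_base :: "('o, 'a, 'z) smmc_scheme \<Rightarrow> 'a \<Rightarrow> bool" where
  "shrinkable_in_base V f \<longleftrightarrow>
     f \<in> Arr V \<and> shrinkable V (self_vcat V) (Dom V f) (Cod V f) (name_of V f)"

definition shrink_reflection ::
  "('o, 'a, 'z) smmc_scheme \<Rightarrow> ('c, 'o, 'a) vcat \<Rightarrow> ('d, 'o, 'a) vcat \<Rightarrow> ('c, 'd, 'a) vfun \<Rightarrow>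
   'd \<Rightarrow> 'c \<Rightarrow> 'a \<Rightarrow> bool" where
  "shrink_reflection V B A U a a' \<eta> \<longleftrightarrow>
     a' \<in> VObj B \<and> \<eta> \<in> hom V (Unit V) (VHom A a (VFObj U a')) \<and>
     (\<forall>b\<in>VObj B. shrinkable_in_base V
        (pre_comp V A a (VFObj U a') (VFObj U b) \<eta> \<cdot>\<^bsub>V\<^esub> VFArr U a' b))"

definition has_left_shrink_adjoint ::
  "('o, 'a, 'z) smmc_scheme \<Rightarrow> ('c, 'o, 'a) vcat \<Rightarrow> ('d, 'o, 'a) vcat \<Rightarrow> ('c, 'd, 'a) vfun \<Rightarrow> bool" where
  "has_left_shrink_adjoint V B A U \<longleftrightarrow>
     (\<forall>a\<in>VObj A. \<exists>a' \<eta>. shrink_reflection V B A U a a' \<eta>)"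

end

theory Submission
  imports Defs
begin

text \<open>
  The proof is Freyd's, carried out up to homotopy in the comma \<open>V\<close>-category \<open>a / U\<close>.

  If \<open>\<eta> : a \<rightarrow> U a'\<close> is a shrink-reflection, the maps \<open>B(a', b) \<rightarrow> A(a, U b)\<close> have sections. So every arrow
  \<open>a \<rightarrow> U b\<close> factors through \<open>\<eta>\<close>, and \<open>\<eta>\<close> alone is a solution set (\<open>shrink_reflection_weakly_initial\<close>).

  Conversely, let a solution set for \<open>a\<close> span the small full sub-\<open>V\<close>-category \<open>D\<close> of \<open>a / U\<close>. The constant
  weight on \<open>D\<close> has a cofibrant replacement \<open>Q\<close> for which \<open>B\<close> has and \<open>U\<close> preserves the limit \<open>l\<close> of
  \<open>D \<rightarrow> B\<close>. By preservation the cone from \<open>a\<close> gives \<open>\<eta> : a \<rightarrow> U l\<close> (\<open>ex_cone\<close>). The weight has points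
  \<open>I \<rightarrow> Q s\<close>, as \<open>I\<close> is cofibrant, and these give projections of \<open>l\<close>, so that \<open>(l, \<eta>)\<close> is weakly initial.
  It is initial up to homotopy for two reasons.

  \<^item> Any two points of \<open>Q s\<close> are joined by an interval, as \<open>Q s \<rightarrow> I\<close> is a trivial fibration. Applied to
    the family enlarged by \<open>l\<close> and a further object \<open>z\<close>, this makes two arrows \<open>v, v' : l \<rightarrow> z\<close> homotopic
    after composition with an endomorphism \<open>t\<close> of \<open>l\<close> that factors through a member of the solution set
    (\<open>projections_homotopic\<close>, \<open>homotopically_initial\<close>).

  \<^item> Such a \<open>t\<close> is homotopic to the identity, because it is induced by an endomorphism \<open>Q \<rightarrow> D(s, -) \<rightarrow> Q\<close>
    over the constant weight and \<open>[D, V](Q, Q) \<rightarrow> [D, V](Q, IP)\<close> is a trivial fibration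
    (\<open>cofibrant_weight_homotopy\<close>, \<open>endomorphism_homotopic\<close>).

  The homotopies \<open>v \<simeq> v \<circ> t \<simeq> v' \<circ> t\<close> are glued by a pushout of intervals (\<open>interval_concat\<close>). Finally,
  powers by \<open>A(a, U b)\<close> and by \<open>B(l, b)\<close> translate weak initiality of \<open>(l, \<eta>)\<close> into a section of
  \<open>B(l, b) \<rightarrow> A(a, U b)\<close> and the homotopy into a homotopy from the identity, constant over \<open>A(a, U b)\<close>
  (\<open>shrink_reflection\<close>).

  Enriched composition is handled through families of arrows \<open>X \<rightarrow> C(a, b)\<close>, and the universal properties
  of hom-objects, weighted limits and powers are stated for them with the parameter object on the right.
  Once these properties are established, the symmetry of \<open>V\<close> no longer occurs in the argument.
\<close>

section \<open>Small sets\<close>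

lemma small_iff_ordLess:
  "small (u :: 'u itself) X \<longleftrightarrow> (card_of X, card_of (UNIV :: 'u set)) \<in> ordLess"
proof -
  have "small u X \<longleftrightarrow> \<not> (UNIV :: 'u set) \<lesssim> X"
    unfolding small_def lesspoll_def
    by (metis eqpoll_imp_lepoll eqpoll_sym lepoll_antisym ordLeq_total card_of_ordLeq card_of_Well_order lepoll_def)
  then show ?thesis
    by (metis card_of_ordLess lepoll_def)
qed

lemma universe_infinite: "universe (u :: 'u itself) \<Longrightarrow> infinite (UNIV :: 'u set)"
  by (simp add: universe_def)

lemma small_finite: "universe u \<Longrightarrow> finite X \<Longrightarrow> small u X"
  unfolding small_def by (metis universe_infinite finite_lesspoll_infinite)

lemma small_Plus: "universe u \<Longrightarrow> small u X \<Longrightarrow> small u Y \<Longrightarrow> small u (X <+> Y)"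
  unfolding small_iff_ordLess by (metis universe_infinite card_of_Plus_ordLess_infinite)

lemma small_Times:
  assumes u: "universe (u :: 'u itself)" and "small u X" and "small u Y"
  shows "small u (X \<times> Y)"
proof (cases "finite X \<and> finite Y")
  case True
  then show ?thesis
    by (simp add: small_finite[OF u])
next
  case False
  then have "infinite (X <+> Y)"
    by (simp add: finite_Plus_iff)
  then have "(card_of ((X <+> Y) \<times> (X <+> Y)), card_of (X <+> Y)) \<in> ordIso"
    by (rule card_of_Times_same_infinite)
  then have "(X <+> Y) \<times> (X <+> Y) \<approx> X <+> Y"
    by (simp add: eqpoll_iff_card_of_ordIso)
  moreover have "small u (X <+> Y)"
    using assms by (simp add: small_Plus)
  moreover have "X \<times> Y \<lesssim> (X <+> Y) \<times> (X <+> Y)"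
    unfolding lepoll_def by (rule exI[of _ "map_prod Inl Inr"]) (auto simp: inj_on_def)
  ultimately show ?thesis
    unfolding small_def by (meson eq_lesspoll_trans lesspoll_trans1)
qed

lemma small_image: "small u X \<Longrightarrow> small u (f ` X)"
  unfolding small_def by (meson image_lepoll lesspoll_trans1)

lemma small_insert:
  assumes "universe u" and "small u X"
  shows "small u (insert x X)"
proof -
  have "insert x X = (\<lambda>s. case s of Inl a \<Rightarrow> a | Inr b \<Rightarrow> b) ` ({x} <+> X)"
    by (force simp: image_iff)
  then show ?thesis
    using assms by (metis finite.emptyI finite.insertI small_Plus small_finite small_image)
qed

lemma small_embedding: "small (u :: 'u itself) X \<Longrightarrow> \<exists>\<iota> :: 'x \<Rightarrow> 'u. inj_on \<iota> X"
  unfolding small_def by (meson lepoll_def lesspoll_imp_lepoll)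


section \<open>Ordinary categories, their small limits and colimits\<close>

lemma in_hom: "f \<in> hom C a b \<longleftrightarrow> f \<in> Arr C \<and> Dom C f = a \<and> Cod C f = b"
  by (auto simp: hom_def)

lemma all_hom_iff:
  "(\<forall>i j u. u \<in> hom C i j \<longrightarrow> P i j u) \<longleftrightarrow> (\<forall>u\<in>Arr C. P (Dom C u) (Cod C u) u)"
  by (auto simp: in_hom)

locale ordinary_category =
  fixes C :: "('o, 'a, 'z) cat_scheme" (structure)
  assumes category: "is_category C"
begin

lemma Dom_Obj [simp]: "f \<in> Arr C \<Longrightarrow> Dom C f \<in> Obj C"
  and Cod_Obj [simp]: "f \<in> Arr C \<Longrightarrow> Cod C f \<in> Obj C"
  using category by (auto simp: is_category_def)

lemma Ident_Arr [simp]: "x \<in> Obj C \<Longrightarrow> Ident C x \<in> Arr C"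
  and Dom_Ident [simp]: "x \<in> Obj C \<Longrightarrow> Dom C (Ident C x) = x"
  and Cod_Ident [simp]: "x \<in> Obj C \<Longrightarrow> Cod C (Ident C x) = x"
  using category by (auto simp: is_category_def hom_def)

lemma comp_in_hom: "f \<in> hom C x y \<Longrightarrow> g \<in> hom C y z \<Longrightarrow> g \<cdot> f \<in> hom C x z"
  using category by (auto simp: is_category_def)

lemma comp_Arr [simp]: "f \<in> Arr C \<Longrightarrow> g \<in> Arr C \<Longrightarrow> Dom C g = Cod C f \<Longrightarrow> g \<cdot> f \<in> Arr C"
  and Dom_comp [simp]: "f \<in> Arr C \<Longrightarrow> g \<in> Arr C \<Longrightarrow> Dom C g = Cod C f \<Longrightarrow> Dom C (g \<cdot> f) = Dom C f"
  and Cod_comp [simp]: "f \<in> Arr C \<Longrightarrow> g \<in> Arr C \<Longrightarrow> Dom C g = Cod C f \<Longrightarrow> Cod C (g \<cdot> f) = Cod C g"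
  using comp_in_hom[of f _ _ g] by (auto simp: in_hom)

lemma comp_Ident [simp]: "f \<in> Arr C \<Longrightarrow> Dom C f = x \<Longrightarrow> f \<cdot> Ident C x = f"
  and Ident_comp [simp]: "f \<in> Arr C \<Longrightarrow> Cod C f = x \<Longrightarrow> Ident C x \<cdot> f = f"
  using category by (auto simp: is_category_def in_hom)

lemma assoc [simp]:
  "f \<in> Arr C \<Longrightarrow> g \<in> Arr C \<Longrightarrow> h \<in> Arr C \<Longrightarrow> Dom C g = Cod C f \<Longrightarrow> Dom C h = Cod C g \<Longrightarrow>
    (h \<cdot> g) \<cdot> f = h \<cdot> (g \<cdot> f)"
  using category unfolding is_category_def in_hom by metis

lemma inverse_arrows_unique:
  assumes "inverse_arrows C f g" and "inverse_arrows C f h"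
  shows "g = h"
proof -
  have "g = (h \<cdot> f) \<cdot> g"
    using assms by (simp add: inverse_arrows_def in_hom)
  also have "\<dots> = h \<cdot> (f \<cdot> g)"
    using assms by (subst assoc) (auto simp: inverse_arrows_def in_hom)
  finally show ?thesis
    using assms by (simp add: inverse_arrows_def in_hom)
qed

lemma inverse_arrows_inv_arr: "is_iso C f \<Longrightarrow> inverse_arrows C f (inv_arr C f)"
  unfolding is_iso_def inv_arr_def by (metis inverse_arrows_unique theI)

lemma inv_arr_simps [simp]:
  assumes "is_iso C f"
  shows "inv_arr C f \<in> Arr C" and "Dom C (inv_arr C f) = Cod C f"
    and "Cod C (inv_arr C f) = Dom C f"
    and "inv_arr C f \<cdot> f = Ident C (Dom C f)" and "f \<cdot> inv_arr C f = Ident C (Cod C f)"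
  using inverse_arrows_inv_arr[OF assms] by (auto simp: inverse_arrows_def in_hom)

lemma is_iso_Arr: "is_iso C f \<Longrightarrow> f \<in> Arr C"
  by (auto simp: is_iso_def inverse_arrows_def)

lemma inv_arr_comp_cancel [simp]:
  assumes "is_iso C f" and "g \<in> Arr C"
  shows "Cod C g = Dom C f \<Longrightarrow> inv_arr C f \<cdot> (f \<cdot> g) = g"
    and "Cod C g = Cod C f \<Longrightarrow> f \<cdot> (inv_arr C f \<cdot> g) = g"
  using assms is_iso_Arr[OF assms(1)] by (simp_all flip: assoc)

lemma iso_cancel_left:
  assumes "is_iso C f" and "g \<in> Arr C" and "h \<in> Arr C" and "Cod C g = Dom C f" and "Cod C h = Dom C f"
    and "f \<cdot> g = f \<cdot> h"
  shows "g = h"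
  using assms by (metis inv_arr_comp_cancel(1))

lemma iso_cancel_right:
  assumes "is_iso C f" and "g \<in> Arr C" and "h \<in> Arr C" and "Dom C g = Cod C f" and "Dom C h = Cod C f"
    and "g \<cdot> f = h \<cdot> f"
  shows "g = h"
proof -
  have "(g \<cdot> f) \<cdot> inv_arr C f = (h \<cdot> f) \<cdot> inv_arr C f"
    using assms by simp
  then show ?thesis
    unfolding \<open>g \<cdot> f = h \<cdot> f\<close> using assms is_iso_Arr[OF assms(1)] by (metis assoc comp_Ident inv_arr_simps(1,3,5))
qed

end

definition opposite :: "('o, 'a, 'z) cat_scheme \<Rightarrow> ('o, 'a) cat" where
  "opposite C =
     \<lparr>Obj = Obj C, Arr = Arr C, Dom = Cod C, Cod = Dom C, Ident = Ident C,
      Comp = \<lambda>g f. f \<cdot>\<^bsub>C\<^esub> g\<rparr>"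

lemma opposite_simps [simp]:
  "Obj (opposite C) = Obj C" "Arr (opposite C) = Arr C" "Dom (opposite C) = Cod C"
  "Cod (opposite C) = Dom C" "Ident (opposite C) = Ident C"
  "g \<cdot>\<^bsub>opposite C\<^esub> f = f \<cdot>\<^bsub>C\<^esub> g" "hom (opposite C) a b = hom C b a"
  by (auto simp: opposite_def hom_def)

lemma is_category_opposite:
  assumes "is_category C"
  shows "is_category (opposite C)"
proof -
  interpret ordinary_category C
    using assms by unfold_locales
  show ?thesis
    unfolding is_category_def by (auto simp: in_hom)
qed

lemma opposite_opposite [simp]: "opposite (opposite C) = (C :: ('o, 'a) cat)"
  by (simp add: opposite_def)

lemma is_functor_opposite: "is_functor (opposite J) C F \<longleftrightarrow> is_functor J (opposite C) F"
  unfolding is_functor_def by (simp; blast)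

lemma is_limit_opposite: "is_limit (opposite J) (opposite C) F L p \<longleftrightarrow> is_colimit J C F L p"
  unfolding is_limit_def is_colimit_def is_cone_def is_cocone_def by (simp; blast)

lemma small_complete_opposite:
  assumes "small_cocomplete u C"
  shows "small_complete u (opposite C)"
  unfolding small_complete_def
proof (intro allI impI)
  fix J :: "('a, 'a) cat" and F :: "('a, 'a, 'b, 'c) functr"
  assume J: "is_category J \<and> small u (Obj J) \<and> small u (Arr J) \<and> is_functor J (opposite C) F"
  then have "is_functor (opposite J) C F"
    by (simp add: is_functor_opposite)
  with J obtain L p where "is_colimit (opposite J) C F L p"
    using assms is_category_opposite[of J] unfolding small_cocomplete_def by fastforce
  then have "is_limit J (opposite C) F L p"
    using is_limit_opposite[of "opposite J" C F L p] by simp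
  then show "\<exists>L p. is_limit J (opposite C) F L p"
    by blast
qed

text \<open>
  Shapes of any type are transported along embeddings of their objects and arrows into the universe,
  so that concrete shapes can be built from sums and products of index types.
\<close>

lemma small_limit_exists:
  fixes u :: "'u itself" and J :: "('i, 'j) cat"
  assumes "small_complete u C" and "is_category J"
    and "small u (Obj J)" and "small u (Arr J)" and "is_functor J C F"
  shows "\<exists>L p. is_limit J C F L p"
proof -
  interpret J: ordinary_category J
    using assms by unfold_locales
  obtain \<iota> :: "'i \<Rightarrow> 'u" where \<iota>: "inj_on \<iota> (Obj J)"
    using assms small_embedding by metis
  obtain \<theta> :: "'j \<Rightarrow> 'u" where \<theta>: "inj_on \<theta> (Arr J)"
    using assms small_embedding by metis
  define o' where "o' = inv_into (Obj J) \<iota>"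
  define a' where "a' = inv_into (Arr J) \<theta>"
  have o' [simp]: "x \<in> Obj J \<Longrightarrow> o' (\<iota> x) = x" for x
    using \<iota> by (simp add: o'_def)
  have a' [simp]: "x \<in> Arr J \<Longrightarrow> a' (\<theta> x) = x" for x
    using \<theta> by (simp add: a'_def)
  define K where "K =
    \<lparr>Obj = \<iota> ` Obj J, Arr = \<theta> ` Arr J, Dom = \<lambda>f. \<iota> (Dom J (a' f)), Cod = \<lambda>f. \<iota> (Cod J (a' f)),
     Ident = \<lambda>x. \<theta> (Ident J (o' x)), Comp = \<lambda>g f. \<theta> (a' g \<cdot>\<^bsub>J\<^esub> a' f)\<rparr>"
  define G where "G = \<lparr>FObj = \<lambda>x. FObj F (o' x), FArr = \<lambda>f. FArr F (a' f)\<rparr>"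
  have homK: "f \<in> hom K x y \<longleftrightarrow>
      (\<exists>x' y' f'. x' \<in> Obj J \<and> y' \<in> Obj J \<and> f' \<in> hom J x' y' \<and> x = \<iota> x' \<and> y = \<iota> y' \<and> f = \<theta> f')" for f x y
    unfolding in_hom by (auto simp: K_def; metis J.Dom_Obj J.Cod_Obj)
  have eqs: "\<iota> x = \<iota> y \<longleftrightarrow> x = y" if "x \<in> Obj J" "y \<in> Obj J" for x y
    using \<iota> that by (meson inj_onD)
  have comps: "g \<cdot>\<^bsub>K\<^esub> f = \<theta> (a' g \<cdot>\<^bsub>J\<^esub> a' f)" "Ident K x = \<theta> (Ident J (o' x))" 
    "Obj K = \<iota> ` Obj J" "Arr K = \<theta> ` Arr J" for g f x
    by (auto simp: K_def)
  have "is_category K"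
    unfolding is_category_def homK comps
    by (auto simp: K_def in_hom eqs)
      (metis J.Ident_Arr J.Dom_Ident J.Cod_Ident,
       metis J.comp_Arr J.Dom_comp J.Cod_comp J.Dom_Obj J.Cod_Obj)
  moreover have "is_functor K C G"
    using assms(5) unfolding is_functor_def homK comps
    by (auto simp: G_def in_hom eqs)
  moreover have "small u (Obj K)" "small u (Arr K)"
    using assms by (auto simp: K_def intro: small_image)
  ultimately obtain L p where lim: "is_limit K C G L p"
    using assms(1) unfolding small_complete_def by blast
  have cone: "is_cone K C G X (\<lambda>i. q (o' i)) \<longleftrightarrow> is_cone J C F X q" for X q
    unfolding is_cone_def all_hom_iff comps by (auto simp: G_def K_def)
  have cone': "is_cone K C G X q \<longleftrightarrow> is_cone J C F X (\<lambda>i. q (\<iota> i))" for X q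
    unfolding is_cone_def all_hom_iff comps by (auto simp: G_def K_def)
  have "is_limit J C F L (\<lambda>i. p (\<iota> i))"
    unfolding is_limit_def
  proof (intro conjI allI impI)
    show "is_cone J C F L (\<lambda>i. p (\<iota> i))"
      using lim unfolding is_limit_def cone' by blast
    fix X q
    assume "is_cone J C F X q"
    then have "\<exists>!t. t \<in> hom C X L \<and> (\<forall>i\<in>Obj K. p i \<cdot>\<^bsub>C\<^esub> t = q (o' i))"
      using lim cone[of X q] unfolding is_limit_def by blast
    then show "\<exists>!t. t \<in> hom C X L \<and> (\<forall>i\<in>Obj J. p (\<iota> i) \<cdot>\<^bsub>C\<^esub> t = q i)"
      by (simp add: comps(3))
  qed
  then show ?thesis
    by blast
qed


text \<open>
  The shape of a family of cospans \<open>M (s y) \<rightarrow> N y \<leftarrow> M (t y)\<close>. Every composite in it has an identity as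
  a factor, which makes the category axioms trivial. Pullbacks and the hom-objects of a functor
  \<open>V\<close>-category are both limits of diagrams of this shape.
\<close>

definition bipartite_shape ::
  "'x set \<Rightarrow> 'y set \<Rightarrow> ('y \<Rightarrow> 'x) \<Rightarrow> ('y \<Rightarrow> 'x) \<Rightarrow> ('x + 'y, ('x + 'y) + ('y \<times> bool)) cat" where
  "bipartite_shape X Y s t =
     \<lparr>Obj = X <+> Y,
      Arr = (X <+> Y) <+> (Y \<times> UNIV),
      Dom = \<lambda>f. case f of Inl i \<Rightarrow> i | Inr (y, b) \<Rightarrow> Inl (if b then s y else t y),
      Cod = \<lambda>f. case f of Inl i \<Rightarrow> i | Inr (y, b) \<Rightarrow> Inr y,
      Ident = Inl,
      Comp = \<lambda>g f. case g of Inl i \<Rightarrow> f | Inr h \<Rightarrow> g\<rparr>"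

lemma ball_Plus: "(\<forall>i\<in>X <+> Y. P i) \<longleftrightarrow> (\<forall>x\<in>X. P (Inl x)) \<and> (\<forall>y\<in>Y. P (Inr y))"
  by auto

lemma ex_joint_equalizer:
  fixes u :: "'u itself" and C :: "('o, 'a, 'z) cat_scheme"
  assumes u: "universe u" and C: "small_complete u C" and "is_category C"
    and X: "small u X" and Y: "small u Y"
    and M: "\<And>x. x \<in> X \<Longrightarrow> M x \<in> Obj C" and N: "\<And>y. y \<in> Y \<Longrightarrow> N y \<in> Obj C"
    and st: "\<And>y. y \<in> Y \<Longrightarrow> s y \<in> X \<and> t y \<in> X"
    and f: "\<And>y. y \<in> Y \<Longrightarrow> f y \<in> hom C (M (s y)) (N y)"
    and g: "\<And>y. y \<in> Y \<Longrightarrow> g y \<in> hom C (M (t y)) (N y)"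
  shows "\<exists>L p. L \<in> Obj C \<and> (\<forall>x\<in>X. p x \<in> hom C L (M x)) \<and>
    (\<forall>y\<in>Y. f y \<cdot>\<^bsub>C\<^esub> p (s y) = g y \<cdot>\<^bsub>C\<^esub> p (t y)) \<and>
    (\<forall>W r. W \<in> Obj C \<and> (\<forall>x\<in>X. r x \<in> hom C W (M x)) \<and>
       (\<forall>y\<in>Y. f y \<cdot>\<^bsub>C\<^esub> r (s y) = g y \<cdot>\<^bsub>C\<^esub> r (t y)) \<longrightarrow>
       (\<exists>!h. h \<in> hom C W L \<and> (\<forall>x\<in>X. p x \<cdot>\<^bsub>C\<^esub> h = r x)))"
proof -
  interpret ordinary_category C
    using assms by unfold_locales
  define J where "J = bipartite_shape X Y s t"
  define F where "F = \<lparr>FObj = case_sum M N,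
     FArr = \<lambda>v. case v of Inl i \<Rightarrow> Ident C (case_sum M N i) | Inr (y, b) \<Rightarrow> if b then f y else g y\<rparr>"
  have J: "is_category J"
    unfolding is_category_def by (auto simp: J_def bipartite_shape_def in_hom st split: if_splits)
  have F: "is_functor J C F"
    unfolding is_functor_def using M N f g
    by (auto simp: J_def F_def bipartite_shape_def in_hom st split: if_splits)
  have small_arrows: "small u ((X <+> Y) <+> (Y \<times> (UNIV :: bool set)))"
    by (intro small_Plus[OF u] small_Times[OF u] X Y small_finite[OF u]) simp
  then have "small u (Obj J)" "small u (Arr J)"
    by (auto simp: J_def bipartite_shape_def intro: small_Plus[OF u X Y])
  then obtain L p where lim: "is_limit J C F L p"
    using small_limit_exists[OF C J _ _ F] by blast
  have cone: "is_cone J C F W q \<longleftrightarrow>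
      W \<in> Obj C \<and> (\<forall>x\<in>X. q (Inl x) \<in> hom C W (M x)) \<and>
      (\<forall>y\<in>Y. q (Inr y) \<in> hom C W (N y) \<and>
        f y \<cdot>\<^bsub>C\<^esub> q (Inl (s y)) = q (Inr y) \<and> g y \<cdot>\<^bsub>C\<^esub> q (Inl (t y)) = q (Inr y))" for W q
  proof -
    show ?thesis
      unfolding is_cone_def all_hom_iff
      by (auto simp: J_def F_def bipartite_shape_def ball_Plus in_hom)
  qed
  have lim': "\<exists>!h. h \<in> hom C W L \<and> (\<forall>x\<in>X. p (Inl x) \<cdot>\<^bsub>C\<^esub> h = r x)"
    if W: "W \<in> Obj C" "\<forall>x\<in>X. r x \<in> hom C W (M x)"
      "\<forall>y\<in>Y. f y \<cdot>\<^bsub>C\<^esub> r (s y) = g y \<cdot>\<^bsub>C\<^esub> r (t y)" for W r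
  proof -
    define q where "q = case_sum r (\<lambda>y. f y \<cdot>\<^bsub>C\<^esub> r (s y))"
    have "is_cone J C F W q"
      unfolding cone using W f g st by (auto simp: q_def intro!: comp_in_hom)
    then have "\<exists>!h. h \<in> hom C W L \<and> (\<forall>i\<in>Obj J. p i \<cdot>\<^bsub>C\<^esub> h = q i)"
      using lim unfolding is_limit_def by blast
    moreover have "(\<forall>i\<in>Obj J. p i \<cdot>\<^bsub>C\<^esub> h = q i) \<longleftrightarrow> (\<forall>x\<in>X. p (Inl x) \<cdot>\<^bsub>C\<^esub> h = r x)"
      if h: "h \<in> hom C W L" for h
    proof
      assume *: "\<forall>x\<in>X. p (Inl x) \<cdot>\<^bsub>C\<^esub> h = r x"
      have "p (Inr y) \<cdot>\<^bsub>C\<^esub> h = f y \<cdot>\<^bsub>C\<^esub> r (s y)" if "y \<in> Y" for y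
        using lim h f[OF that] st[OF that] * that unfolding is_limit_def cone in_hom
        by (metis assoc)
      with * show "\<forall>i\<in>Obj J. p i \<cdot>\<^bsub>C\<^esub> h = q i"
        by (auto simp: J_def bipartite_shape_def q_def)
    qed (simp add: J_def bipartite_shape_def q_def ball_Plus)
    ultimately show ?thesis
      by (metis (no_types, lifting))
  qed
  show ?thesis
    using lim lim' unfolding is_limit_def cone
    by (intro exI[of _ L] exI[of _ "\<lambda>x. p (Inl x)"]) auto
qed

lemma ex_pullback:
  fixes u :: "'u itself"
  assumes u: "universe u" and "small_complete u C" and C: "is_category C"
    and f: "f \<in> hom C a c" and g: "g \<in> hom C b c"
  shows "\<exists>w i j. i \<in> hom C w a \<and> j \<in> hom C w b \<and> f \<cdot>\<^bsub>C\<^esub> i = g \<cdot>\<^bsub>C\<^esub> j \<and>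
    (\<forall>x v v'. v \<in> hom C x a \<and> v' \<in> hom C x b \<and> f \<cdot>\<^bsub>C\<^esub> v = g \<cdot>\<^bsub>C\<^esub> v' \<longrightarrow>
      (\<exists>!t. t \<in> hom C x w \<and> i \<cdot>\<^bsub>C\<^esub> t = v \<and> j \<cdot>\<^bsub>C\<^esub> t = v'))"
proof -
  interpret ordinary_category C
    using C by unfold_locales
  have "\<exists>L p. L \<in> Obj C \<and> (\<forall>x\<in>UNIV. p x \<in> hom C L (if x then a else b)) \<and>
    (\<forall>y\<in>{()}. f \<cdot>\<^bsub>C\<^esub> p True = g \<cdot>\<^bsub>C\<^esub> p False) \<and>
    (\<forall>W r. W \<in> Obj C \<and> (\<forall>x\<in>UNIV. r x \<in> hom C W (if x then a else b)) \<and>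
       (\<forall>y\<in>{()}. f \<cdot>\<^bsub>C\<^esub> r True = g \<cdot>\<^bsub>C\<^esub> r False) \<longrightarrow>
       (\<exists>!h. h \<in> hom C W L \<and> (\<forall>x\<in>UNIV. p x \<cdot>\<^bsub>C\<^esub> h = r x)))"
    using f g
    by (intro ex_joint_equalizer[OF assms(1-3), where M = "\<lambda>x. if x then a else b" and N = "\<lambda>_. c"
          and s = "\<lambda>_. True" and t = "\<lambda>_. False" and f = "\<lambda>_. f" and g = "\<lambda>_. g"])
      (auto simp: small_finite[OF u] in_hom)
  then obtain L p where
    L': "L \<in> Obj C" "\<forall>x\<in>UNIV. p x \<in> hom C L (if x then a else b)"
      "\<forall>y\<in>{()}. f \<cdot>\<^bsub>C\<^esub> p True = g \<cdot>\<^bsub>C\<^esub> p False"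
    and *: "\<forall>W r. W \<in> Obj C \<and> (\<forall>x\<in>UNIV. r x \<in> hom C W (if x then a else b)) \<and>
       (\<forall>y\<in>{()}. f \<cdot>\<^bsub>C\<^esub> r True = g \<cdot>\<^bsub>C\<^esub> r False) \<longrightarrow>
       (\<exists>!h. h \<in> hom C W L \<and> (\<forall>x\<in>UNIV. p x \<cdot>\<^bsub>C\<^esub> h = r x))"
    by (elim exE conjE) (rule that)
  have L: "p True \<in> hom C L a" "p False \<in> hom C L b" "f \<cdot>\<^bsub>C\<^esub> p True = g \<cdot>\<^bsub>C\<^esub> p False"
    using L'(2)[rule_format, of True] L'(2)[rule_format, of False] L'(3) by auto
  have "\<exists>!h. h \<in> hom C x L \<and> p True \<cdot>\<^bsub>C\<^esub> h = v \<and> p False \<cdot>\<^bsub>C\<^esub> h = v'"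
    if "v \<in> hom C x a" "v' \<in> hom C x b" "f \<cdot>\<^bsub>C\<^esub> v = g \<cdot>\<^bsub>C\<^esub> v'" for x v v'
  proof -
    have "x \<in> Obj C"
      using that(1) by (auto simp: in_hom)
    then show ?thesis
      using *[rule_format, of x "\<lambda>b. if b then v else v'"] that by (simp add: all_bool_eq)
  qed
  with L show ?thesis
    by blast
qed


lemma ex_pushout:
  fixes u :: "'u itself"
  assumes u: "universe u" and cocomplete: "small_cocomplete u C" and C: "is_category C"
    and f: "f \<in> hom C c a" and g: "g \<in> hom C c b"
  shows "\<exists>w i j. is_pushout C f g w i j"
proof -
  note pullback = ex_pullback[OF u small_complete_opposite[OF cocomplete] is_category_opposite[OF C],
      of f a c g b, unfolded opposite_simps, OF f g]
  then obtain w i j where "i \<in> hom C a w" "j \<in> hom C b w" "i \<cdot>\<^bsub>C\<^esub> f = j \<cdot>\<^bsub>C\<^esub> g"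
    and "\<forall>x v v'. v \<in> hom C a x \<and> v' \<in> hom C b x \<and> v \<cdot>\<^bsub>C\<^esub> f = v' \<cdot>\<^bsub>C\<^esub> g \<longrightarrow>
      (\<exists>!t. t \<in> hom C w x \<and> t \<cdot>\<^bsub>C\<^esub> i = v \<and> t \<cdot>\<^bsub>C\<^esub> j = v')"
    by (elim exE conjE) (rule that)
  moreover have "f \<in> Arr C" "g \<in> Arr C" "Dom C f = c" "Dom C g = c" "Cod C f = a" "Cod C g = b"
    using f g by (auto simp: in_hom)
  ultimately have "is_pushout C f g w i j"
    unfolding is_pushout_def by simp
  then show ?thesis
    by blast
qed

section \<open>Intervals in a model category\<close>

locale model_category = ordinary_category V
  for V :: "('o, 'a, 'z) smmc_scheme" (structure) +
  assumes model: "is_model_structure V"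
    and pushouts: "f \<in> hom V c a \<Longrightarrow> g \<in> hom V c b \<Longrightarrow> \<exists>w i j. is_pushout V f g w i j"
begin

lemma Cof_Arr: "f \<in> Cof V \<Longrightarrow> f \<in> Arr V"
  and Fib_Arr: "f \<in> Fib V \<Longrightarrow> f \<in> Arr V"
  using model by (auto simp: is_model_structure_def is_wide_subcategory_def)

lemma Ident_Weq: "x \<in> Obj V \<Longrightarrow> Ident V x \<in> Weq V"
  using model by (auto simp: is_model_structure_def is_wide_subcategory_def)

lemma Weq_two_of_three:
  assumes "f \<in> Arr V" and "g \<in> Arr V" and "Dom V g = Cod V f"
  shows "f \<in> Weq V \<Longrightarrow> g \<in> Weq V \<Longrightarrow> g \<cdot> f \<in> Weq V"
    and "f \<in> Weq V \<Longrightarrow> g \<cdot> f \<in> Weq V \<Longrightarrow> g \<in> Weq V"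
    and "g \<in> Weq V \<Longrightarrow> g \<cdot> f \<in> Weq V \<Longrightarrow> f \<in> Weq V"
  using model assms unfolding is_model_structure_def by meson+

lemma lifting:
  assumes "f \<in> Cof V" and "g \<in> Fib V" and "f \<in> Weq V \<or> g \<in> Weq V"
    and "u \<in> hom V (Dom V f) (Dom V g)" and "v \<in> hom V (Cod V f) (Cod V g)" and "g \<cdot> u = v \<cdot> f"
  obtains t where "t \<in> hom V (Cod V f) (Dom V g)" and "t \<cdot> f = u" and "g \<cdot> t = v"
proof -
  have "has_lifting V f g"
    using model assms unfolding is_model_structure_def by meson
  moreover have "is_square V f g u v"
    using assms by (simp add: is_square_def Cof_Arr Fib_Arr)
  ultimately show ?thesis
    using that unfolding has_lifting_def by blast
qed

lemma factorisation:
  assumes "f \<in> hom V x y"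
  obtains m l r where "l \<in> hom V x m" and "r \<in> hom V m y" and "r \<cdot> l = f"
    and "l \<in> Cof V" and "r \<in> Fib V \<inter> Weq V"
proof -
  have "functorial_factorisation V (CofL V) (TFibR V) (CofM V)"
    and *: "\<forall>f\<in>Arr V. CofL V f \<in> Cof V \<and> TFibR V f \<in> Fib V \<inter> Weq V"
    using model by (simp_all add: is_model_structure_def)
  then have "CofL V f \<in> hom V x (Cod V (CofL V f))" "TFibR V f \<in> hom V (Cod V (CofL V f)) y"
      "TFibR V f \<cdot> CofL V f = f"
    using assms by (auto simp: functorial_factorisation_def in_hom)
  then show ?thesis
    using that assms * by (meson in_hom)
qed

lemma factorisation':
  assumes "f \<in> hom V x y"
  obtains m l r where "l \<in> hom V x m" and "r \<in> hom V m y" and "r \<cdot> l = f"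
    and "l \<in> Cof V \<inter> Weq V" and "r \<in> Fib V"
proof -
  have "functorial_factorisation V (TCofL V) (FibR V) (TCofM V)"
    and *: "\<forall>f\<in>Arr V. TCofL V f \<in> Cof V \<inter> Weq V \<and> FibR V f \<in> Fib V"
    using model by (simp_all add: is_model_structure_def)
  then have "TCofL V f \<in> hom V x (Cod V (TCofL V f))" "FibR V f \<in> hom V (Cod V (TCofL V f)) y"
      "FibR V f \<cdot> TCofL V f = f"
    using assms by (auto simp: functorial_factorisation_def in_hom)
  then show ?thesis
    using that assms * by (meson in_hom)
qed

text \<open>
  The retract argument: it turns a lifting property into membership of one of the classes, and so
  replaces closure axioms for pushouts.
\<close>

lemma retract_of_left_factor:
  assumes f: "f \<in> hom V x y" and l: "l \<in> hom V x m" and r: "r \<in> hom V m y" and "r \<cdot> l = f"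
    and lift: "has_lifting V f r"
  shows "is_retract V f l"
proof -
  have arr: "f \<in> Arr V" "Dom V f = x" "Cod V f = y" "l \<in> Arr V" "Dom V l = x" "Cod V l = m"
    "r \<in> Arr V" "Dom V r = m" "Cod V r = y" "x \<in> Obj V" "y \<in> Obj V"
    using f l r by (auto simp: in_hom)
  have "is_square V f r l (Ident V y)"
    using arr \<open>r \<cdot> l = f\<close> by (simp add: is_square_def in_hom)
  then obtain t where "t \<in> hom V (Cod V f) (Dom V r)" and t: "t \<cdot> f = l" "r \<cdot> t = Ident V y"
    using lift unfolding has_lifting_def by blast
  then have arr_t: "t \<in> Arr V" "Dom V t = y" "Cod V t = m"
    using arr by (simp_all add: in_hom)
  have "is_square V f l (Ident V x) t" "is_square V l f (Ident V x) r"
    using t arr arr_t \<open>r \<cdot> l = f\<close> by (simp_all add: is_square_def in_hom)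
  then show ?thesis
    using t arr unfolding is_retract_def by (metis Ident_Arr Dom_Ident Ident_comp Cod_Ident)
qed

lemma Cof_if_lifting:
  assumes "f \<in> Arr V" and lift: "\<And>g. g \<in> Fib V \<inter> Weq V \<Longrightarrow> has_lifting V f g"
  shows "f \<in> Cof V"
proof -
  obtain m l r where "l \<in> hom V (Dom V f) m" "r \<in> hom V m (Cod V f)" "r \<cdot> l = f"
    "l \<in> Cof V" "r \<in> Fib V \<inter> Weq V"
    using factorisation[of f "Dom V f" "Cod V f"] assms(1) by (auto simp: in_hom)
  then have "is_retract V f l" and "l \<in> Cof V"
    using assms retract_of_left_factor[of f "Dom V f" "Cod V f"] by (auto simp: in_hom)
  then show ?thesis
    using model unfolding is_model_structure_def by meson
qed

lemma trivial_Cof_if_lifting: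
  assumes "f \<in> Arr V" and lift: "\<And>g. g \<in> Fib V \<Longrightarrow> has_lifting V f g"
  shows "f \<in> Cof V \<inter> Weq V"
proof -
  obtain m l r where "l \<in> hom V (Dom V f) m" "r \<in> hom V m (Cod V f)" "r \<cdot> l = f"
    "l \<in> Cof V \<inter> Weq V" "r \<in> Fib V"
    using factorisation'[of f "Dom V f" "Cod V f"] assms(1) by (auto simp: in_hom)
  then have "is_retract V f l" and "l \<in> Cof V" and "l \<in> Weq V"
    using assms retract_of_left_factor[of f "Dom V f" "Cod V f"] by (auto simp: in_hom)
  then show ?thesis
    using model unfolding is_model_structure_def by (meson IntI)
qed

lemma pushout_universal:
  assumes "is_pushout V f g w i j" and "u \<in> hom V (Cod V f) x" and "v \<in> hom V (Cod V g) x"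
    and "u \<cdot> f = v \<cdot> g"
  shows "\<exists>!t. t \<in> hom V w x \<and> t \<cdot> i = u \<and> t \<cdot> j = v"
  using assms unfolding is_pushout_def by simp

lemma pushout_has_lifting:
  assumes po: "is_pushout V f g w i j" and lift: "has_lifting V f p"
  shows "has_lifting V j p"
  unfolding has_lifting_def
proof (intro allI impI)
  fix u v
  assume sq: "is_square V j p u v"
  have h: "f \<in> Arr V" "g \<in> Arr V" "Dom V f = Dom V g" "i \<in> hom V (Cod V f) w" "j \<in> hom V (Cod V g) w"
    "i \<cdot> f = j \<cdot> g"
    using po unfolding is_pushout_def by auto
  have s: "u \<in> hom V (Cod V g) (Dom V p)" "v \<in> hom V w (Cod V p)" "p \<cdot> u = v \<cdot> j" "p \<in> Arr V"
    using sq h by (auto simp: is_square_def in_hom)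
  have "p \<cdot> (u \<cdot> g) = (v \<cdot> j) \<cdot> g"
    using h s by (simp add: in_hom flip: s(3))
  also have "\<dots> = (v \<cdot> i) \<cdot> f"
    using h s by (simp add: in_hom)
  finally have "is_square V f p (u \<cdot> g) (v \<cdot> i)"
    using h s by (simp add: is_square_def in_hom)
  then obtain t where t: "t \<in> hom V (Cod V f) (Dom V p)" "t \<cdot> f = u \<cdot> g" "p \<cdot> t = v \<cdot> i"
    using lift unfolding has_lifting_def by blast
  obtain r where r: "r \<in> hom V w (Dom V p)" "r \<cdot> i = t" "r \<cdot> j = u"
    using pushout_universal[OF po t(1) s(1) t(2)] by blast
  have "\<exists>!k. k \<in> hom V w (Cod V p) \<and> k \<cdot> i = v \<cdot> i \<and> k \<cdot> j = v \<cdot> j"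
    using h s by (intro pushout_universal[OF po]) (auto simp: in_hom)
  moreover have "(p \<cdot> r) \<cdot> i = v \<cdot> i" "(p \<cdot> r) \<cdot> j = v \<cdot> j"
    using h s r t by (auto simp: in_hom)
  ultimately have "p \<cdot> r = v"
    using h s r t by (metis comp_in_hom in_hom)
  then show "\<exists>t\<in>hom V (Cod V j) (Dom V p). t \<cdot> j = u \<and> p \<cdot> t = v"
    using r h by (auto simp: in_hom)
qed

lemma Cof_pushout:
  assumes "is_pushout V f g w i j" and "f \<in> Cof V"
  shows "j \<in> Cof V"
proof (rule Cof_if_lifting)
  show "j \<in> Arr V"
    using assms by (auto simp: is_pushout_def in_hom)
  show "has_lifting V j p" if "p \<in> Fib V \<inter> Weq V" for p
    using pushout_has_lifting[OF assms(1)] model assms(2) that unfolding is_model_structure_def by blast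
qed

lemma trivial_Cof_pushout:
  assumes "is_pushout V f g w i j" and "f \<in> Cof V \<inter> Weq V"
  shows "j \<in> Cof V \<inter> Weq V"
proof (rule trivial_Cof_if_lifting)
  show "j \<in> Arr V"
    using assms by (auto simp: is_pushout_def in_hom)
  show "has_lifting V j p" if "p \<in> Fib V" for p
    using pushout_has_lifting[OF assms(1)] model assms(2) that unfolding is_model_structure_def by blast
qed

lemma is_pushout_sym: "is_pushout V f g w i j \<Longrightarrow> is_pushout V g f w j i"
  unfolding is_pushout_def by metis

lemma cofibrant_lifting:
  assumes "cofibrant V x" and "p \<in> Fib V \<inter> Weq V" and "p \<in> hom V e b" and "v \<in> hom V x b"
  obtains t where "t \<in> hom V x e" and "p \<cdot> t = v"
proof -
  obtain z f where z: "is_initial V z" "f \<in> hom V z x" "f \<in> Cof V"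
    using assms(1) by (auto simp: cofibrant_def)
  obtain g where g: "g \<in> hom V z e"
    using z(1) assms(3) unfolding is_initial_def in_hom by (metis Dom_Obj)
  have "p \<cdot> g = v \<cdot> f"
    using z(1) g z(2) assms(3,4) Cod_Obj[of p] unfolding is_initial_def
    by (metis comp_in_hom in_hom)
  then obtain t where "t \<in> hom V (Cod V f) (Dom V p)" "p \<cdot> t = v"
    using lifting[OF z(3), of p g v] assms z g by (auto simp: in_hom)
  then show ?thesis
    using that assms z by (auto simp: in_hom)
qed

text \<open>Binary copowers of a cofibrant object are pushouts along the map from the initial object.\<close>

lemma cofibrant_coproduct:
  assumes "cofibrant V x"
  obtains s i j where "is_coproduct V x x s i j" and "i \<in> Cof V" and "j \<in> Cof V"
proof -
  obtain z f where z: "is_initial V z" "f \<in> hom V z x" "f \<in> Cof V"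
    using assms(1) by (auto simp: cofibrant_def)
  obtain s i j where po: "is_pushout V f f s i j"
    using pushouts[OF z(2) z(2)] by blast
  have "i \<in> Cof V" "j \<in> Cof V"
    using Cof_pushout[OF po z(3)] Cof_pushout[OF is_pushout_sym[OF po] z(3)] by auto
  moreover have "is_coproduct V x x s i j"
    unfolding is_coproduct_def
  proof (intro conjI allI impI)
    show "i \<in> hom V x s" "j \<in> hom V x s"
      using po z by (auto simp: is_pushout_def in_hom)
    fix y g h
    assume gh: "g \<in> hom V x y \<and> h \<in> hom V x y"
    then have "g \<cdot> f \<in> hom V z y" "h \<cdot> f \<in> hom V z y" "y \<in> Obj V"
      using z by (auto simp: in_hom)
    then have "g \<cdot> f = h \<cdot> f"
      using z(1) unfolding is_initial_def by blast
    then show "\<exists>!t. t \<in> hom V s y \<and> t \<cdot> i = g \<and> t \<cdot> j = h"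
      using pushout_universal[OF po, of g y h] gh z(2) by (simp add: in_hom)
  qed
  ultimately show ?thesis
    using that by blast
qed

end

locale model_category_with_unit = model_category +
  assumes unit: "cofibrant V (Unit V)"
begin

lemma Unit_Obj [simp]: "Unit V \<in> Obj V"
  using unit by (simp add: cofibrant_def)

text \<open>Only the weak equivalence matters for an interval: the cofibration is obtained by factorisation.\<close>

lemma interval_over:
  assumes "x \<in> hom V (Unit V) K" and "y \<in> hom V (Unit V) K" and "\<epsilon> \<in> hom V K (Unit V)" and "\<epsilon> \<in> Weq V"
    and "\<epsilon> \<cdot> x = Ident V (Unit V)" and "\<epsilon> \<cdot> y = Ident V (Unit V)"
  obtains J d c e h where "is_interval V J d c e" and "h \<in> hom V J K"
    and "h \<cdot> d = x" and "h \<cdot> c = y" and "\<epsilon> \<cdot> h = e"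
proof -
  obtain s i j where cop: "is_coproduct V (Unit V) (Unit V) s i j"
    using cofibrant_coproduct[OF unit] by blast
  then have ij: "i \<in> hom V (Unit V) s" "j \<in> hom V (Unit V) s"
    by (auto simp: is_coproduct_def)
  obtain g where g: "g \<in> hom V s K" "g \<cdot> i = x" "g \<cdot> j = y"
    using cop assms unfolding is_coproduct_def by blast
  obtain J l r where J: "l \<in> hom V s J" "r \<in> hom V J K" "r \<cdot> l = g" "l \<in> Cof V" "r \<in> Fib V \<inter> Weq V"
    using factorisation[OF g(1)] by blast
  have eq: "r \<cdot> (l \<cdot> i) = x" "r \<cdot> (l \<cdot> j) = y"
    using J g ij by (auto simp: in_hom simp flip: assoc)
  have "is_interval V J (l \<cdot> i) (l \<cdot> j) (\<epsilon> \<cdot> r)"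
    unfolding is_interval_def
  proof (intro conjI exI)
    show "is_coproduct V (Unit V) (Unit V) s i j" "l \<in> hom V s J" "l \<cdot> i = l \<cdot> i" "l \<cdot> j = l \<cdot> j" "l \<in> Cof V"
      using cop J by auto
    show "\<epsilon> \<cdot> r \<in> Weq V"
      using J assms Weq_two_of_three(1)[of r \<epsilon>] by (auto simp: in_hom)
  qed (use J ij assms eq in \<open>auto simp: in_hom\<close>)
  then show ?thesis
    using that[of J "l \<cdot> i" "l \<cdot> j" "\<epsilon> \<cdot> r" r] J eq by auto
qed

lemma ex_interval: "\<exists>J d c e. is_interval V J d c e"
proof -
  have id: "Ident V (Unit V) \<in> hom V (Unit V) (Unit V)" "Ident V (Unit V) \<in> Weq V"
    "Ident V (Unit V) \<cdot> Ident V (Unit V) = Ident V (Unit V)"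
    by (simp_all add: in_hom Ident_Weq)
  show ?thesis
    by (rule interval_over[OF id(1) id(1) id(1) id(2) id(3) id(3)]) blast
qed

lemma interval_hom:
  assumes "is_interval V J d c e"
  shows "d \<in> hom V (Unit V) J" and "c \<in> hom V (Unit V) J" and "e \<in> hom V J (Unit V)"
    and "e \<cdot> d = Ident V (Unit V)" and "e \<cdot> c = Ident V (Unit V)" and "e \<in> Weq V" and "J \<in> Obj V"
proof -
  show "d \<in> hom V (Unit V) J" "c \<in> hom V (Unit V) J" "e \<in> hom V J (Unit V)"
    "e \<cdot> d = Ident V (Unit V)" "e \<cdot> c = Ident V (Unit V)" "e \<in> Weq V"
    using assms by (simp_all add: is_interval_def)
  then show "J \<in> Obj V"
    using Cod_Obj[of d] by (simp add: in_hom)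
qed

lemma interval_lifting:
  assumes J: "is_interval V J d c e" and p: "p \<in> Fib V \<inter> Weq V" "p \<in> hom V E B"
    and xy: "x \<in> hom V (Unit V) E" "y \<in> hom V (Unit V) E"
    and v: "v \<in> hom V J B" "p \<cdot> x = v \<cdot> d" "p \<cdot> y = v \<cdot> c"
  obtains w where "w \<in> hom V J E" and "w \<cdot> d = x" and "w \<cdot> c = y" and "p \<cdot> w = v"
proof -
  obtain s i j t where cop: "is_coproduct V (Unit V) (Unit V) s i j"
    and t: "t \<in> hom V s J" "t \<cdot> i = d" "t \<cdot> j = c" "t \<in> Cof V"
    using J by (auto simp: is_interval_def)
  then have ij: "i \<in> hom V (Unit V) s" "j \<in> hom V (Unit V) s"
    by (auto simp: is_coproduct_def)
  obtain g where g: "g \<in> hom V s E" "g \<cdot> i = x" "g \<cdot> j = y"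
    using cop xy unfolding is_coproduct_def by blast
  have "v \<cdot> d \<in> hom V (Unit V) B" "v \<cdot> c \<in> hom V (Unit V) B"
    using v(1) interval_hom(1,2)[OF J] by (simp_all add: in_hom)
  then have "\<exists>!k. k \<in> hom V s B \<and> k \<cdot> i = v \<cdot> d \<and> k \<cdot> j = v \<cdot> c"
    using cop unfolding is_coproduct_def by simp
  moreover have "(p \<cdot> g) \<cdot> i = v \<cdot> d" "(p \<cdot> g) \<cdot> j = v \<cdot> c" "(v \<cdot> t) \<cdot> i = v \<cdot> d" "(v \<cdot> t) \<cdot> j = v \<cdot> c"
    "p \<cdot> g \<in> hom V s B" "v \<cdot> t \<in> hom V s B"
    using p(2) g ij t v by (simp_all add: in_hom)
  ultimately have "p \<cdot> g = v \<cdot> t"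
    by metis
  then obtain w where "w \<in> hom V (Cod V t) (Dom V p)" "w \<cdot> t = g" "p \<cdot> w = v"
    using lifting[OF t(4), of p g v] p t(1) g(1) v(1) by (auto simp: in_hom)
  moreover from this have "(w \<cdot> t) \<cdot> i = w \<cdot> d" "(w \<cdot> t) \<cdot> j = w \<cdot> c"
    using t(1-3) p(2) ij assoc[of i t w] assoc[of j t w] by (simp_all add: in_hom del: assoc)
  ultimately show ?thesis
    using that[of w] t(1) p(2) g by (simp add: in_hom)
qed

text \<open>
  An endpoint lifts against trivial fibrations in two steps, the other endpoint first, which is
  possible because the unit is cofibrant, and then the whole interval.
\<close>

lemma interval_endpoint_trivial_Cof:
  assumes J: "is_interval V J d c e"
  shows "c \<in> Cof V \<inter> Weq V"
proof (rule trivial_Cof_if_lifting)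
  show "c \<in> Arr V"
    using interval_hom[OF J] by (simp add: in_hom)
  fix p
  assume p: "p \<in> Fib V"
  have "c \<in> Weq V"
    using Weq_two_of_three(3)[of c e] interval_hom[OF J] by (simp add: in_hom Ident_Weq)
  moreover have "c \<in> Cof V"
  proof (rule Cof_if_lifting)
    fix p
    assume p: "p \<in> Fib V \<inter> Weq V"
    show "has_lifting V c p"
      unfolding has_lifting_def
    proof (intro allI impI)
      fix y v
      assume "is_square V c p y v"
      then have s: "y \<in> hom V (Unit V) (Dom V p)" "v \<in> hom V J (Cod V p)" "p \<cdot> y = v \<cdot> c"
          "p \<in> hom V (Dom V p) (Cod V p)" 
        using interval_hom[OF J] by (auto simp: is_square_def in_hom)
      then have "v \<cdot> d \<in> hom V (Unit V) (Cod V p)"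
        using interval_hom(1)[OF J] comp_in_hom by blast
      then obtain x where "x \<in> hom V (Unit V) (Dom V p)" "p \<cdot> x = v \<cdot> d"
        using cofibrant_lifting[OF unit p s(4)] by blast
      then obtain w where "w \<in> hom V J (Dom V p)" "w \<cdot> c = y" "p \<cdot> w = v"
        using interval_lifting[OF J p s(4) _ s(1) s(2) _ s(3)] by metis
      then show "\<exists>t\<in>hom V (Cod V c) (Dom V p). t \<cdot> c = y \<and> p \<cdot> t = v"
        using interval_hom(2)[OF J] by (auto simp: in_hom)
    qed
  qed (use interval_hom[OF J] in \<open>simp add: in_hom\<close>)
  ultimately show "has_lifting V c p"
    using model p unfolding is_model_structure_def by blast
qed

text \<open>
  Two intervals are glued along a trivial cofibration, so that the result is still weakly equivalent
  to the unit.
\<close>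

lemma interval_concat:
  assumes J: "is_interval V J d c e" and J': "is_interval V J' d' c' e'"
    and h: "h \<in> hom V J X" "h' \<in> hom V J' X" "h \<cdot> c = h' \<cdot> d'"
    and z: "z \<in> hom V (Unit V) Y" and p: "p \<in> hom V X Y" "p \<cdot> h = z \<cdot> e" "p \<cdot> h' = z \<cdot> e'"
  obtains K a b \<epsilon> k where "is_interval V K a b \<epsilon>" and "k \<in> hom V K X"
    and "k \<cdot> a = h \<cdot> d" and "k \<cdot> b = h' \<cdot> c'" and "p \<cdot> k = z \<cdot> \<epsilon>"
proof -
  note i = interval_hom[OF J] and i' = interval_hom[OF J']
  obtain w l l' where po: "is_pushout V c d' w l l'"
    using pushouts[OF i(2) i'(1)] by blast
  then have l: "l \<in> hom V J w" "l' \<in> hom V J' w" "l \<cdot> c = l' \<cdot> d'"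
    using i i' by (auto simp: is_pushout_def in_hom)
  have univ: "\<exists>!t. t \<in> hom V w x \<and> t \<cdot> l = u \<and> t \<cdot> l' = v"
    if "u \<in> hom V J x" "v \<in> hom V J' x" "u \<cdot> c = v \<cdot> d'" for x u v
    using pushout_universal[OF po, of u x v] that i i' by (simp add: in_hom)
  have "l' \<in> Weq V"
    using trivial_Cof_pushout[OF po interval_endpoint_trivial_Cof[OF J]] by blast
  obtain \<epsilon> where \<epsilon>: "\<epsilon> \<in> hom V w (Unit V)" "\<epsilon> \<cdot> l = e" "\<epsilon> \<cdot> l' = e'"
    using univ[of e "Unit V" e'] i i' by metis
  obtain k where k: "k \<in> hom V w X" "k \<cdot> l = h" "k \<cdot> l' = h'"
    using univ[of h X h'] h by metis
  have "\<exists>!t. t \<in> hom V w Y \<and> t \<cdot> l = z \<cdot> e \<and> t \<cdot> l' = z \<cdot> e'"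
    using i i' z by (intro univ) (simp_all add: in_hom)
  moreover have "(p \<cdot> k) \<cdot> l = z \<cdot> e" "(p \<cdot> k) \<cdot> l' = z \<cdot> e'" "(z \<cdot> \<epsilon>) \<cdot> l = z \<cdot> e" "(z \<cdot> \<epsilon>) \<cdot> l' = z \<cdot> e'"
    "p \<cdot> k \<in> hom V w Y" "z \<cdot> \<epsilon> \<in> hom V w Y"
    using l \<epsilon> k p z by (simp_all add: in_hom)
  ultimately have pk: "p \<cdot> k = z \<cdot> \<epsilon>"
    by metis
  have "\<epsilon> \<in> Weq V"
    using Weq_two_of_three(2)[of l' \<epsilon>] \<open>l' \<in> Weq V\<close> \<epsilon> l i' by (simp add: in_hom)
  moreover have "\<epsilon> \<cdot> (l \<cdot> d) = (\<epsilon> \<cdot> l) \<cdot> d" "\<epsilon> \<cdot> (l' \<cdot> c') = (\<epsilon> \<cdot> l') \<cdot> c'"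
    using \<epsilon>(1) l i i' by (simp_all add: in_hom)
  then have "\<epsilon> \<cdot> (l \<cdot> d) = Ident V (Unit V)" "\<epsilon> \<cdot> (l' \<cdot> c') = Ident V (Unit V)"
    using \<epsilon> i i' by simp_all
  moreover have "l \<cdot> d \<in> hom V (Unit V) w" "l' \<cdot> c' \<in> hom V (Unit V) w"
    using comp_in_hom l i i' by blast+
  ultimately obtain K a b \<epsilon>' q where K: "is_interval V K a b \<epsilon>'" "q \<in> hom V K w"
      "q \<cdot> a = l \<cdot> d" "q \<cdot> b = l' \<cdot> c'" "\<epsilon> \<cdot> q = \<epsilon>'"
    using interval_over[of "l \<cdot> d" w "l' \<cdot> c'" \<epsilon>] \<epsilon>(1) by blast
  show ?thesis
  proof (rule that[of K a b \<epsilon>' "k \<cdot> q"])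
    show "k \<cdot> q \<in> hom V K X"
      using K k comp_in_hom by blast
    show "p \<cdot> (k \<cdot> q) = z \<cdot> \<epsilon>'"
    proof -
      have "p \<cdot> (k \<cdot> q) = (p \<cdot> k) \<cdot> q"
        using K(2) k(1) p(1) by (simp add: in_hom)
      also have "\<dots> = z \<cdot> \<epsilon>'"
        unfolding pk using K(2,5) \<epsilon>(1) z by (simp add: in_hom)
      finally show ?thesis .
    qed
    have "(k \<cdot> q) \<cdot> a = (k \<cdot> l) \<cdot> d" "(k \<cdot> q) \<cdot> b = (k \<cdot> l') \<cdot> c'"
      using K(2-4) k(1) l i i' interval_hom(1,2)[OF K(1)] by (simp_all add: in_hom)
    then show "(k \<cdot> q) \<cdot> a = h \<cdot> d" "(k \<cdot> q) \<cdot> b = h' \<cdot> c'"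
      using k by auto
  qed (rule K)
qed

end

section \<open>Coherence and currying in a symmetric monoidal closed category\<close>

locale closed_monoidal = ordinary_category V
  for V :: "('o, 'a, 'z) smc_scheme" (structure) +
  assumes smcc: "is_smcc V"
begin

lemma symmetric_monoidal: "is_symmetric_monoidal V"
  using smcc by (simp add: is_smcc_def)

text \<open>The conjuncts of the definition, in their order there.\<close>

lemmas monoidal_axioms =
  symmetric_monoidal[unfolded is_symmetric_monoidal_def, THEN conjunct1]
  symmetric_monoidal[unfolded is_symmetric_monoidal_def, THEN conjunct2, THEN conjunct1]
  symmetric_monoidal[unfolded is_symmetric_monoidal_def, THEN conjunct2, THEN conjunct2, THEN conjunct1]
  symmetric_monoidal[unfolded is_symmetric_monoidal_def, THEN conjunct2, THEN conjunct2, THEN conjunct2, THEN conjunct1]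
  symmetric_monoidal[unfolded is_symmetric_monoidal_def, THEN conjunct2, THEN conjunct2, THEN conjunct2, THEN conjunct2, THEN conjunct1]
  symmetric_monoidal[unfolded is_symmetric_monoidal_def, THEN conjunct2, THEN conjunct2, THEN conjunct2, THEN conjunct2, THEN conjunct2, THEN conjunct1]
  symmetric_monoidal[unfolded is_symmetric_monoidal_def, THEN conjunct2, THEN conjunct2, THEN conjunct2, THEN conjunct2, THEN conjunct2, THEN conjunct2, THEN conjunct1]
  symmetric_monoidal[unfolded is_symmetric_monoidal_def, THEN conjunct2, THEN conjunct2, THEN conjunct2, THEN conjunct2, THEN conjunct2, THEN conjunct2, THEN conjunct2, THEN conjunct1]
  symmetric_monoidal[unfolded is_symmetric_monoidal_def, THEN conjunct2, THEN conjunct2, THEN conjunct2, THEN conjunct2, THEN conjunct2, THEN conjunct2, THEN conjunct2, THEN conjunct2, THEN conjunct1]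
  symmetric_monoidal[unfolded is_symmetric_monoidal_def, THEN conjunct2, THEN conjunct2, THEN conjunct2, THEN conjunct2, THEN conjunct2, THEN conjunct2, THEN conjunct2, THEN conjunct2, THEN conjunct2, THEN conjunct1]
  symmetric_monoidal[unfolded is_symmetric_monoidal_def, THEN conjunct2, THEN conjunct2, THEN conjunct2, THEN conjunct2, THEN conjunct2, THEN conjunct2, THEN conjunct2, THEN conjunct2, THEN conjunct2, THEN conjunct2, THEN conjunct1]
  symmetric_monoidal[unfolded is_symmetric_monoidal_def, THEN conjunct2, THEN conjunct2, THEN conjunct2, THEN conjunct2, THEN conjunct2, THEN conjunct2, THEN conjunct2, THEN conjunct2, THEN conjunct2, THEN conjunct2, THEN conjunct2, THEN conjunct1]
  symmetric_monoidal[unfolded is_symmetric_monoidal_def, THEN conjunct2, THEN conjunct2, THEN conjunct2, THEN conjunct2, THEN conjunct2, THEN conjunct2, THEN conjunct2, THEN conjunct2, THEN conjunct2, THEN conjunct2, THEN conjunct2, THEN conjunct2, THEN conjunct1]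
  symmetric_monoidal[unfolded is_symmetric_monoidal_def, THEN conjunct2, THEN conjunct2, THEN conjunct2, THEN conjunct2, THEN conjunct2, THEN conjunct2, THEN conjunct2, THEN conjunct2, THEN conjunct2, THEN conjunct2, THEN conjunct2, THEN conjunct2, THEN conjunct2, THEN conjunct1]
  symmetric_monoidal[unfolded is_symmetric_monoidal_def, THEN conjunct2, THEN conjunct2, THEN conjunct2, THEN conjunct2, THEN conjunct2, THEN conjunct2, THEN conjunct2, THEN conjunct2, THEN conjunct2, THEN conjunct2, THEN conjunct2, THEN conjunct2, THEN conjunct2, THEN conjunct2, THEN conjunct1]
  symmetric_monoidal[unfolded is_symmetric_monoidal_def, THEN conjunct2, THEN conjunct2, THEN conjunct2, THEN conjunct2, THEN conjunct2, THEN conjunct2, THEN conjunct2, THEN conjunct2, THEN conjunct2, THEN conjunct2, THEN conjunct2, THEN conjunct2, THEN conjunct2, THEN conjunct2, THEN conjunct2]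

lemma Unit_in_Obj [simp]: "Unit V \<in> Obj V"
  and tensor_Obj [simp]: "X \<in> Obj V \<Longrightarrow> Y \<in> Obj V \<Longrightarrow> X \<otimes> Y \<in> Obj V"
  and tensor_Ident [simp]: "X \<in> Obj V \<Longrightarrow> Y \<in> Obj V \<Longrightarrow> Ident V X \<odot> Ident V Y = Ident V (X \<otimes> Y)"
  using monoidal_axioms(2,3) by simp_all

lemma tensor_Arr [simp]: "f \<in> Arr V \<Longrightarrow> g \<in> Arr V \<Longrightarrow> f \<odot> g \<in> Arr V"
  and Dom_tensor [simp]: "f \<in> Arr V \<Longrightarrow> g \<in> Arr V \<Longrightarrow> Dom V (f \<odot> g) = Dom V f \<otimes> Dom V g"
  and Cod_tensor [simp]: "f \<in> Arr V \<Longrightarrow> g \<in> Arr V \<Longrightarrow> Cod V (f \<odot> g) = Cod V f \<otimes> Cod V g"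
  using monoidal_axioms(4) unfolding in_hom by simp_all

lemma interchange [simp]:
  assumes "f \<in> Arr V" and "g \<in> Arr V" and "f' \<in> Arr V" and "g' \<in> Arr V"
    and "Dom V f' = Cod V f" and "Dom V g' = Cod V g"
  shows "(f' \<odot> g') \<cdot> (f \<odot> g) = (f' \<cdot> f) \<odot> (g' \<cdot> g)"
  by (rule monoidal_axioms(5)[rule_format, symmetric]) (use assms in \<open>simp add: in_hom\<close>)

lemma interchange_tail [simp]:
  assumes "f \<in> Arr V" and "g \<in> Arr V" and "f' \<in> Arr V" and "g' \<in> Arr V" and "x \<in> Arr V"
    and "Dom V f' = Cod V f" and "Dom V g' = Cod V g" and "Cod V x = Dom V f \<otimes> Dom V g"
  shows "(f' \<odot> g') \<cdot> ((f \<odot> g) \<cdot> x) = ((f' \<cdot> f) \<odot> (g' \<cdot> g)) \<cdot> x"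
proof -
  have "(f' \<odot> g') \<cdot> ((f \<odot> g) \<cdot> x) = ((f' \<odot> g') \<cdot> (f \<odot> g)) \<cdot> x"
    using assms by (subst assoc) simp_all
  then show ?thesis
    using assms by (simp del: assoc)
qed

lemma Assoc_iso [simp]: "X \<in> Obj V \<Longrightarrow> Y \<in> Obj V \<Longrightarrow> Z \<in> Obj V \<Longrightarrow> is_iso V (Assoc V X Y Z)"
  and Assoc_hom: "X \<in> Obj V \<Longrightarrow> Y \<in> Obj V \<Longrightarrow> Z \<in> Obj V \<Longrightarrow>
    Assoc V X Y Z \<in> hom V ((X \<otimes> Y) \<otimes> Z) (X \<otimes> (Y \<otimes> Z))"
  and LUnit_iso [simp]: "X \<in> Obj V \<Longrightarrow> is_iso V (LUnit V X)"
  and LUnit_hom: "X \<in> Obj V \<Longrightarrow> LUnit V X \<in> hom V (Unit V \<otimes> X) X"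
  and RUnit_iso [simp]: "X \<in> Obj V \<Longrightarrow> is_iso V (RUnit V X)"
  and RUnit_hom: "X \<in> Obj V \<Longrightarrow> RUnit V X \<in> hom V (X \<otimes> Unit V) X"
  and Symm_hom: "X \<in> Obj V \<Longrightarrow> Y \<in> Obj V \<Longrightarrow> Symm V X Y \<in> hom V (X \<otimes> Y) (Y \<otimes> X)"
  using monoidal_axioms(6-9) by simp_all

lemma structure_simps [simp]:
  "X \<in> Obj V \<Longrightarrow> Y \<in> Obj V \<Longrightarrow> Z \<in> Obj V \<Longrightarrow> Assoc V X Y Z \<in> Arr V"
  "X \<in> Obj V \<Longrightarrow> Y \<in> Obj V \<Longrightarrow> Z \<in> Obj V \<Longrightarrow> Dom V (Assoc V X Y Z) = (X \<otimes> Y) \<otimes> Z"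
  "X \<in> Obj V \<Longrightarrow> Y \<in> Obj V \<Longrightarrow> Z \<in> Obj V \<Longrightarrow> Cod V (Assoc V X Y Z) = X \<otimes> (Y \<otimes> Z)"
  "X \<in> Obj V \<Longrightarrow> LUnit V X \<in> Arr V"
  "X \<in> Obj V \<Longrightarrow> Dom V (LUnit V X) = Unit V \<otimes> X"
  "X \<in> Obj V \<Longrightarrow> Cod V (LUnit V X) = X"
  "X \<in> Obj V \<Longrightarrow> RUnit V X \<in> Arr V"
  "X \<in> Obj V \<Longrightarrow> Dom V (RUnit V X) = X \<otimes> Unit V"
  "X \<in> Obj V \<Longrightarrow> Cod V (RUnit V X) = X"
  "X \<in> Obj V \<Longrightarrow> Y \<in> Obj V \<Longrightarrow> Symm V X Y \<in> Arr V"
  "X \<in> Obj V \<Longrightarrow> Y \<in> Obj V \<Longrightarrow> Dom V (Symm V X Y) = X \<otimes> Y"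
  "X \<in> Obj V \<Longrightarrow> Y \<in> Obj V \<Longrightarrow> Cod V (Symm V X Y) = Y \<otimes> X"
  using Assoc_hom LUnit_hom RUnit_hom Symm_hom unfolding in_hom by simp_all

lemma Assoc_natural:
  assumes "f \<in> Arr V" and "g \<in> Arr V" and "h \<in> Arr V" and "Cod V f = X" and "Cod V g = Y" and "Cod V h = Z"
  shows "Assoc V X Y Z \<cdot> ((f \<odot> g) \<odot> h) = (f \<odot> (g \<odot> h)) \<cdot> Assoc V (Dom V f) (Dom V g) (Dom V h)"
by (rule monoidal_axioms(10)[rule_format]) (use assms in \<open>simp add: in_hom\<close>)

lemma LUnit_natural:
  assumes "f \<in> Arr V" and "Cod V f = X"
  shows "LUnit V X \<cdot> (Ident V (Unit V) \<odot> f) = f \<cdot> LUnit V (Dom V f)"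
    and "RUnit V X \<cdot> (f \<odot> Ident V (Unit V)) = f \<cdot> RUnit V (Dom V f)"
using monoidal_axioms(11)[rule_format, of f "Dom V f" X] assms by (simp_all add: in_hom)

lemma Symm_natural:
  assumes "f \<in> Arr V" and "g \<in> Arr V" and "Cod V f = X" and "Cod V g = Y"
  shows "Symm V X Y \<cdot> (f \<odot> g) = (g \<odot> f) \<cdot> Symm V (Dom V f) (Dom V g)"
by (rule monoidal_axioms(12)[rule_format]) (use assms in \<open>simp add: in_hom\<close>)

lemma pentagon:
  assumes "W \<in> Obj V" and "X \<in> Obj V" and "Y \<in> Obj V" and "Z \<in> Obj V"
  shows "Assoc V W X (Y \<otimes> Z) \<cdot> Assoc V (W \<otimes> X) Y Z =
    (Ident V W \<odot> Assoc V X Y Z) \<cdot> Assoc V W (X \<otimes> Y) Z \<cdot> (Assoc V W X Y \<odot> Ident V Z)"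
  using monoidal_axioms(13) assms by blast

lemma triangle:
  assumes "X \<in> Obj V" and "Y \<in> Obj V"
  shows "(Ident V X \<odot> LUnit V Y) \<cdot> Assoc V X (Unit V) Y = RUnit V X \<odot> Ident V Y"
  using monoidal_axioms(14) assms by blast

lemma Symm_Symm [simp]:
  assumes "X \<in> Obj V" and "Y \<in> Obj V"
  shows "Symm V Y X \<cdot> Symm V X Y = Ident V (X \<otimes> Y)"
  using monoidal_axioms(15) assms by blast

lemma hexagon:
  assumes "X \<in> Obj V" and "Y \<in> Obj V" and "Z \<in> Obj V"
  shows "Assoc V Y Z X \<cdot> Symm V X (Y \<otimes> Z) \<cdot> Assoc V X Y Z =
    (Ident V Y \<odot> Symm V X Z) \<cdot> Assoc V Y X Z \<cdot> (Symm V X Y \<odot> Ident V Z)"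
  using monoidal_axioms(16) assms by blast

lemma Symm_Symm_tail [simp]:
  "X \<in> Obj V \<Longrightarrow> Y \<in> Obj V \<Longrightarrow> f \<in> Arr V \<Longrightarrow> Cod V f = X \<otimes> Y \<Longrightarrow> Symm V Y X \<cdot> (Symm V X Y \<cdot> f) = f"
  by (simp flip: assoc)

lemma Symm_iso [simp]: "X \<in> Obj V \<Longrightarrow> Y \<in> Obj V \<Longrightarrow> is_iso V (Symm V X Y)"
  unfolding is_iso_def by (rule exI[of _ "Symm V Y X"]) (simp add: inverse_arrows_def in_hom)

text \<open>Naturality in the form needed for rewriting inside a longer composite.\<close>

lemma Assoc_natural_tail:
  assumes "f \<in> Arr V" and "g \<in> Arr V" and "h \<in> Arr V" and "Cod V f = X" and "Cod V g = Y" and "Cod V h = Z"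
    and "x \<in> Arr V" and "Cod V x = (Dom V f \<otimes> Dom V g) \<otimes> Dom V h"
  shows "Assoc V X Y Z \<cdot> ((f \<odot> g) \<odot> h) \<cdot> x = (f \<odot> (g \<odot> h)) \<cdot> Assoc V (Dom V f) (Dom V g) (Dom V h) \<cdot> x"
proof -
  have "(Assoc V X Y Z \<cdot> ((f \<odot> g) \<odot> h)) \<cdot> x = ((f \<odot> (g \<odot> h)) \<cdot> Assoc V (Dom V f) (Dom V g) (Dom V h)) \<cdot> x"
    using assms by (simp only: Assoc_natural)
  then show ?thesis
    using assms Cod_Obj[of f] Cod_Obj[of g] Cod_Obj[of h] by simp
qed

lemma Assoc_natural_Ident:
  assumes "X \<in> Obj V" and "Y \<in> Obj V" and "h \<in> Arr V" and "Cod V h = Z"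
  shows "Assoc V X Y Z \<cdot> (Ident V (X \<otimes> Y) \<odot> h) =
    (Ident V X \<odot> (Ident V Y \<odot> h)) \<cdot> Assoc V X Y (Dom V h)"
  using Assoc_natural[of "Ident V X" "Ident V Y" h X Y Z] assms by simp

lemma LUnit_natural_tail:
  assumes "f \<in> Arr V" and "Cod V f = X" and "x \<in> Arr V"
  shows "Cod V x = Unit V \<otimes> Dom V f \<Longrightarrow> LUnit V X \<cdot> (Ident V (Unit V) \<odot> f) \<cdot> x = f \<cdot> LUnit V (Dom V f) \<cdot> x"
    and "Cod V x = Dom V f \<otimes> Unit V \<Longrightarrow> RUnit V X \<cdot> (f \<odot> Ident V (Unit V)) \<cdot> x = f \<cdot> RUnit V (Dom V f) \<cdot> x"
proof -
  show "LUnit V X \<cdot> (Ident V (Unit V) \<odot> f) \<cdot> x = f \<cdot> LUnit V (Dom V f) \<cdot> x"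
    if "Cod V x = Unit V \<otimes> Dom V f"
  proof -
    have "(LUnit V X \<cdot> (Ident V (Unit V) \<odot> f)) \<cdot> x = (f \<cdot> LUnit V (Dom V f)) \<cdot> x"
      using assms by (simp only: LUnit_natural)
    then show ?thesis
      using assms that Cod_Obj[of f] by simp
  qed
  show "RUnit V X \<cdot> (f \<odot> Ident V (Unit V)) \<cdot> x = f \<cdot> RUnit V (Dom V f) \<cdot> x"
    if "Cod V x = Dom V f \<otimes> Unit V"
  proof -
    have "(RUnit V X \<cdot> (f \<odot> Ident V (Unit V))) \<cdot> x = (f \<cdot> RUnit V (Dom V f)) \<cdot> x"
      using assms by (simp only: LUnit_natural)
    then show ?thesis
      using assms that Cod_Obj[of f] by simp
  qed
qed

lemma inv_LUnit_natural:
  assumes "f \<in> Arr V" and "Dom V f = X"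
  shows "inv_arr V (LUnit V (Cod V f)) \<cdot> f = (Ident V (Unit V) \<odot> f) \<cdot> inv_arr V (LUnit V X)"
    and "inv_arr V (RUnit V (Cod V f)) \<cdot> f = (f \<odot> Ident V (Unit V)) \<cdot> inv_arr V (RUnit V X)"
proof -
  have X: "X \<in> Obj V" "Cod V f \<in> Obj V"
    using assms by auto
  have "LUnit V (Cod V f) \<cdot> (inv_arr V (LUnit V (Cod V f)) \<cdot> f) =
      LUnit V (Cod V f) \<cdot> ((Ident V (Unit V) \<odot> f) \<cdot> inv_arr V (LUnit V X))"
    using assms X LUnit_natural_tail(1)[of f "Cod V f" "inv_arr V (LUnit V X)"] by simp
  then show "inv_arr V (LUnit V (Cod V f)) \<cdot> f = (Ident V (Unit V) \<odot> f) \<cdot> inv_arr V (LUnit V X)"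
    using assms X by - (rule iso_cancel_left[OF LUnit_iso[OF X(2)]], simp_all)
  have "RUnit V (Cod V f) \<cdot> (inv_arr V (RUnit V (Cod V f)) \<cdot> f) =
      RUnit V (Cod V f) \<cdot> ((f \<odot> Ident V (Unit V)) \<cdot> inv_arr V (RUnit V X))"
    using assms X LUnit_natural_tail(2)[of f "Cod V f" "inv_arr V (RUnit V X)"] by simp
  then show "inv_arr V (RUnit V (Cod V f)) \<cdot> f = (f \<odot> Ident V (Unit V)) \<cdot> inv_arr V (RUnit V X)"
    using assms X by - (rule iso_cancel_left[OF RUnit_iso[OF X(2)]], simp_all)
qed

lemma tensor_iso:
  assumes f: "is_iso V f" and g: "is_iso V g"
  shows "is_iso V (f \<odot> g)"
proof -
  have "f \<in> Arr V" "g \<in> Arr V"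
    using f g by (auto intro: is_iso_Arr)
  then have "inverse_arrows V (f \<odot> g) (inv_arr V f \<odot> inv_arr V g)"
    using f g by (simp add: inverse_arrows_def in_hom)
  then show ?thesis
    unfolding is_iso_def by blast
qed

lemma comp_iso:
  assumes f: "is_iso V f" and g: "is_iso V g" and "Dom V g = Cod V f"
  shows "is_iso V (g \<cdot> f)"
proof -
  have "f \<in> Arr V" "g \<in> Arr V"
    using f g by (auto intro: is_iso_Arr)
  then have "inverse_arrows V (g \<cdot> f) (inv_arr V f \<cdot> inv_arr V g)"
    using f g assms(3) by (simp add: inverse_arrows_def in_hom)
  then show ?thesis
    unfolding is_iso_def by blast
qed

lemma Ident_iso [simp]: "X \<in> Obj V \<Longrightarrow> is_iso V (Ident V X)"
  unfolding is_iso_def by (rule exI[of _ "Ident V X"]) (simp add: inverse_arrows_def in_hom)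

text \<open>Tensoring with the unit is faithful, because it is naturally isomorphic to the identity.\<close>

lemma tensor_Unit_faithful:
  assumes "f \<in> hom V X Y" and "g \<in> hom V X Y"
  shows "Ident V (Unit V) \<odot> f = Ident V (Unit V) \<odot> g \<Longrightarrow> f = g"
    and "f \<odot> Ident V (Unit V) = g \<odot> Ident V (Unit V) \<Longrightarrow> f = g"
proof -
  have *: "f \<in> Arr V" "g \<in> Arr V" "Dom V f = X" "Dom V g = X" "Cod V f = Y" "Cod V g = Y" "X \<in> Obj V" "Y \<in> Obj V"
    using assms by (auto simp: in_hom)
  show "f = g" if "Ident V (Unit V) \<odot> f = Ident V (Unit V) \<odot> g"
    using * that LUnit_natural(1)[of f Y] LUnit_natural(1)[of g Y]
    by (intro iso_cancel_right[of "LUnit V X" f g]) simp_all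
  show "f = g" if "f \<odot> Ident V (Unit V) = g \<odot> Ident V (Unit V)"
    using * that LUnit_natural(2)[of f Y] LUnit_natural(2)[of g Y]
    by (intro iso_cancel_right[of "RUnit V X" f g]) simp_all
qed

text \<open>
  Kelly's consequences of pentagon and triangle. The first two follow from the pentagon with units
  inserted, after which a factor \<open>I\<close> is cancelled by faithfulness.
\<close>

lemma RUnit_tensor:
  assumes [simp]: "X \<in> Obj V" "Y \<in> Obj V"
  shows "(Ident V X \<odot> RUnit V Y) \<cdot> Assoc V X Y (Unit V) = RUnit V (X \<otimes> Y)"
proof -
  let ?I = "Unit V"
  have "Assoc V X Y ?I \<cdot> (((Ident V X \<odot> RUnit V Y) \<cdot> Assoc V X Y ?I) \<odot> Ident V ?I)
      = Assoc V X Y ?I \<cdot> ((Ident V X \<odot> RUnit V Y) \<odot> Ident V ?I) \<cdot> (Assoc V X Y ?I \<odot> Ident V ?I)"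
    by simp
  also have "\<dots> = (Ident V X \<odot> (RUnit V Y \<odot> Ident V ?I)) \<cdot> Assoc V X (Y \<otimes> ?I) ?I \<cdot> (Assoc V X Y ?I \<odot> Ident V ?I)"
    by (subst Assoc_natural_tail) simp_all
  also have "\<dots> = (Ident V X \<odot> (Ident V Y \<odot> LUnit V ?I)) \<cdot>
      (Ident V X \<odot> Assoc V Y ?I ?I) \<cdot> Assoc V X (Y \<otimes> ?I) ?I \<cdot> (Assoc V X Y ?I \<odot> Ident V ?I)"
    by (simp add: triangle)
  also have "\<dots> = (Ident V X \<odot> (Ident V Y \<odot> LUnit V ?I)) \<cdot>
      (Assoc V X Y (?I \<otimes> ?I) \<cdot> Assoc V (X \<otimes> Y) ?I ?I)"
    by (simp only: pentagon Unit_in_Obj assms)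
  also have "\<dots> = ((Ident V X \<odot> (Ident V Y \<odot> LUnit V ?I)) \<cdot> Assoc V X Y (?I \<otimes> ?I)) \<cdot> Assoc V (X \<otimes> Y) ?I ?I"
    by simp
  also have "\<dots> = (Assoc V X Y ?I \<cdot> (Ident V (X \<otimes> Y) \<odot> LUnit V ?I)) \<cdot> Assoc V (X \<otimes> Y) ?I ?I"
    by (simp add: Assoc_natural_Ident del: assoc)
  also have "\<dots> = Assoc V X Y ?I \<cdot> (RUnit V (X \<otimes> Y) \<odot> Ident V ?I)"
    by (simp add: triangle)
  finally have "((Ident V X \<odot> RUnit V Y) \<cdot> Assoc V X Y ?I) \<odot> Ident V ?I = RUnit V (X \<otimes> Y) \<odot> Ident V ?I"
    by (rule iso_cancel_left[rotated -1]) simp_all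
  then show ?thesis
    by (rule tensor_Unit_faithful(2)[rotated -1]) (simp_all add: in_hom)
qed

lemma LUnit_tensor:
  assumes [simp]: "X \<in> Obj V" "Y \<in> Obj V"
  shows "LUnit V (X \<otimes> Y) \<cdot> Assoc V (Unit V) X Y = LUnit V X \<odot> Ident V Y"
proof -
  let ?I = "Unit V"
  let ?b = "Assoc V ?I (?I \<otimes> X) Y \<cdot> (Assoc V ?I ?I X \<odot> Ident V Y)"
  have "(Ident V ?I \<odot> (LUnit V (X \<otimes> Y) \<cdot> Assoc V ?I X Y)) \<cdot> ?b
      = (Ident V ?I \<odot> LUnit V (X \<otimes> Y)) \<cdot> ((Ident V ?I \<odot> Assoc V ?I X Y) \<cdot> ?b)"
    by simp
  also have "\<dots> = (Ident V ?I \<odot> LUnit V (X \<otimes> Y)) \<cdot> (Assoc V ?I ?I (X \<otimes> Y) \<cdot> Assoc V (?I \<otimes> ?I) X Y)"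
    by (simp only: pentagon Unit_in_Obj assms)
  also have "\<dots> = ((Ident V ?I \<odot> LUnit V (X \<otimes> Y)) \<cdot> Assoc V ?I ?I (X \<otimes> Y)) \<cdot> Assoc V (?I \<otimes> ?I) X Y"
    by simp
  also have "\<dots> = (RUnit V ?I \<odot> (Ident V X \<odot> Ident V Y)) \<cdot> Assoc V (?I \<otimes> ?I) X Y"
    by (simp add: triangle del: assoc)
  also have "\<dots> = Assoc V ?I X Y \<cdot> ((RUnit V ?I \<odot> Ident V X) \<odot> Ident V Y)"
    using Assoc_natural[of "RUnit V ?I" "Ident V X" "Ident V Y" ?I X Y] by simp
  also have "\<dots> = Assoc V ?I X Y \<cdot> (((Ident V ?I \<odot> LUnit V X) \<cdot> Assoc V ?I ?I X) \<odot> Ident V Y)"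
    by (simp add: triangle)
  also have "\<dots> = Assoc V ?I X Y \<cdot> ((Ident V ?I \<odot> LUnit V X) \<odot> Ident V Y) \<cdot> (Assoc V ?I ?I X \<odot> Ident V Y)"
    by simp
  also have "\<dots> = (Ident V ?I \<odot> (LUnit V X \<odot> Ident V Y)) \<cdot> ?b"
    by (subst Assoc_natural_tail) simp_all
  finally have "Ident V ?I \<odot> (LUnit V (X \<otimes> Y) \<cdot> Assoc V ?I X Y) = Ident V ?I \<odot> (LUnit V X \<odot> Ident V Y)"
    by (rule iso_cancel_right[rotated -1]) (simp_all add: comp_iso tensor_iso)
  then show ?thesis
    by (rule tensor_Unit_faithful(1)[rotated -1]) (simp_all add: in_hom)
qed

lemma LUnit_eq_RUnit: "LUnit V (Unit V) = RUnit V (Unit V)"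
proof -
  let ?I = "Unit V"
  have "LUnit V ?I \<cdot> LUnit V (?I \<otimes> ?I) = LUnit V ?I \<cdot> (Ident V ?I \<odot> LUnit V ?I)"
    using LUnit_natural(1)[of "LUnit V ?I" ?I] by simp
  then have "LUnit V (?I \<otimes> ?I) = Ident V ?I \<odot> LUnit V ?I"
    by (rule iso_cancel_left[rotated -1]) simp_all
  then have "LUnit V ?I \<odot> Ident V ?I = RUnit V ?I \<odot> Ident V ?I"
    using LUnit_tensor[of ?I ?I] triangle[of ?I ?I] by simp
  then show ?thesis
    by (rule tensor_Unit_faithful(2)[rotated -1]) (simp_all add: in_hom)
qed


text \<open>
  Maps \<open>E \<rightarrow> [X, Y]\<close> are uncurried on the right, to \<open>E \<otimes> X \<rightarrow> Y\<close>, or on the left, to \<open>X \<otimes> E \<rightarrow> Y\<close>.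
  The left form keeps the symmetry out of all statements about weighted limits and powers.
\<close>

lemma IHom_Obj [simp]: "X \<in> Obj V \<Longrightarrow> Y \<in> Obj V \<Longrightarrow> IHom V X Y \<in> Obj V"
  and Ev_hom: "X \<in> Obj V \<Longrightarrow> Y \<in> Obj V \<Longrightarrow> Ev V X Y \<in> hom V (IHom V X Y \<otimes> X) Y"
  using smcc unfolding is_smcc_def by blast+

lemma Ev_simps [simp]:
  "X \<in> Obj V \<Longrightarrow> Y \<in> Obj V \<Longrightarrow> Ev V X Y \<in> Arr V"
  "X \<in> Obj V \<Longrightarrow> Y \<in> Obj V \<Longrightarrow> Dom V (Ev V X Y) = IHom V X Y \<otimes> X"
  "X \<in> Obj V \<Longrightarrow> Y \<in> Obj V \<Longrightarrow> Cod V (Ev V X Y) = Y"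
  using Ev_hom unfolding in_hom by simp_all

lemma adjunct_unique:
  assumes "X \<in> Obj V" and "Y \<in> Obj V" and "Z \<in> Obj V" and "f \<in> hom V (Z \<otimes> X) Y"
  shows "\<exists>!g. g \<in> hom V Z (IHom V X Y) \<and> Ev V X Y \<cdot> (g \<odot> Ident V X) = f"
  using smcc assms unfolding is_smcc_def by blast

lemma adjunct:
  assumes "X \<in> Obj V" and "Y \<in> Obj V" and "Z \<in> Obj V" and "f \<in> hom V (Z \<otimes> X) Y"
  shows "adjunct V Z X Y f \<in> hom V Z (IHom V X Y)"
    and "Ev V X Y \<cdot> (adjunct V Z X Y f \<odot> Ident V X) = f"
  using theI'[OF adjunct_unique[OF assms]] unfolding adjunct_def by auto

lemma Ev_cancel:
  assumes "X \<in> Obj V" and "Y \<in> Obj V" and "g \<in> hom V Z (IHom V X Y)" and "h \<in> hom V Z (IHom V X Y)"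
    and "Ev V X Y \<cdot> (g \<odot> Ident V X) = Ev V X Y \<cdot> (h \<odot> Ident V X)"
  shows "g = h"
proof -
  have "Z \<in> Obj V" "Ev V X Y \<cdot> (g \<odot> Ident V X) \<in> hom V (Z \<otimes> X) Y"
    using assms(1-3) by (auto simp: in_hom)
  then show ?thesis
    using adjunct_unique[OF assms(1,2)] assms by metis
qed

definition runcurry :: "'o \<Rightarrow> 'o \<Rightarrow> 'a \<Rightarrow> 'a" where
  "runcurry X Y g = Ev V X Y \<cdot> (g \<odot> Ident V X)"

definition luncurry :: "'o \<Rightarrow> 'o \<Rightarrow> 'a \<Rightarrow> 'a" where
  "luncurry X Y g = Ev V X Y \<cdot> (g \<odot> Ident V X) \<cdot> Symm V X (Dom V g)"

definition lcurry :: "'o \<Rightarrow> 'o \<Rightarrow> 'o \<Rightarrow> 'a \<Rightarrow> 'a" where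
  "lcurry E X Y f = adjunct V E X Y (f \<cdot> Symm V E X)"

lemma uncurry_simps [simp]:
  assumes "X \<in> Obj V" and "Y \<in> Obj V" and "g \<in> Arr V" and "Cod V g = IHom V X Y"
  shows "runcurry X Y g \<in> Arr V" and "Dom V (runcurry X Y g) = Dom V g \<otimes> X" and "Cod V (runcurry X Y g) = Y"
    and "luncurry X Y g \<in> Arr V" and "Dom V (luncurry X Y g) = X \<otimes> Dom V g" and "Cod V (luncurry X Y g) = Y"
  using assms by (simp_all add: runcurry_def luncurry_def)

lemma runcurry_eq:
  assumes "X \<in> Obj V" and "Y \<in> Obj V" and "g \<in> hom V E (IHom V X Y)"
  shows "runcurry X Y g = luncurry X Y g \<cdot> Symm V E X"
proof -
  have "g \<in> Arr V" "Dom V g = E" "Cod V g = IHom V X Y" "E \<in> Obj V"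
    using assms(3) by (auto simp: in_hom)
  then show ?thesis
    using assms(1,2) by (simp add: runcurry_def luncurry_def)
qed

lemma luncurry_lcurry:
  assumes "X \<in> Obj V" and "Y \<in> Obj V" and "E \<in> Obj V" and "f \<in> hom V (X \<otimes> E) Y"
  shows "lcurry E X Y f \<in> hom V E (IHom V X Y)" and "luncurry X Y (lcurry E X Y f) = f"
proof -
  have f: "f \<cdot> Symm V E X \<in> hom V (E \<otimes> X) Y" "f \<in> Arr V" "Dom V f = X \<otimes> E" "Cod V f = Y"
    using assms by (auto simp: in_hom)
  note * = adjunct[OF assms(1-3) f(1)]
  show h: "lcurry E X Y f \<in> hom V E (IHom V X Y)"
    unfolding lcurry_def by (rule *)
  then have h': "Dom V (lcurry E X Y f) = E" "lcurry E X Y f \<in> Arr V" "Cod V (lcurry E X Y f) = IHom V X Y"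
    by (simp_all add: in_hom)
  have "luncurry X Y (lcurry E X Y f) = (Ev V X Y \<cdot> (lcurry E X Y f \<odot> Ident V X)) \<cdot> Symm V X E"
    using assms h' by (simp add: luncurry_def)
  also have "\<dots> = f"
    unfolding lcurry_def *(2) using f assms by simp
  finally show "luncurry X Y (lcurry E X Y f) = f" .
qed

lemma runcurry_cancel:
  assumes "X \<in> Obj V" and "Y \<in> Obj V" and "g \<in> hom V Z (IHom V X Y)" and "h \<in> hom V Z (IHom V X Y)"
    and "runcurry X Y g = runcurry X Y h"
  shows "g = h"
  using assms Ev_cancel unfolding runcurry_def by blast

lemma luncurry_cancel:
  assumes "X \<in> Obj V" and "Y \<in> Obj V" and "g \<in> hom V Z (IHom V X Y)" and "h \<in> hom V Z (IHom V X Y)"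
    and "luncurry X Y g = luncurry X Y h"
  shows "g = h"
  using assms runcurry_cancel runcurry_eq by metis

lemma uncurry_comp:
  assumes "X \<in> Obj V" and "Y \<in> Obj V" and "g \<in> Arr V" and "Cod V g = IHom V X Y"
    and "x \<in> Arr V" and "Cod V x = Dom V g"
  shows "runcurry X Y (g \<cdot> x) = runcurry X Y g \<cdot> (x \<odot> Ident V X)"
    and "luncurry X Y (g \<cdot> x) = luncurry X Y g \<cdot> (Ident V X \<odot> x)"
  using assms Symm_natural[of "Ident V X" x X "Dom V g"] by (simp_all add: runcurry_def luncurry_def)

lemma name_of:
  assumes "f \<in> hom V X Y"
  shows "name_of V f \<in> hom V (Unit V) (IHom V X Y)"
    and "runcurry X Y (name_of V f) = f \<cdot> LUnit V X"
proof -
  have X: "X \<in> Obj V" "Y \<in> Obj V" "f \<cdot> LUnit V X \<in> hom V (Unit V \<otimes> X) Y" "Dom V f = X" "Cod V f = Y"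
    using assms by (auto simp: in_hom)
  show "name_of V f \<in> hom V (Unit V) (IHom V X Y)" "runcurry X Y (name_of V f) = f \<cdot> LUnit V X"
    using adjunct[OF X(1,2) Unit_in_Obj X(3)] X by (simp_all add: name_of_def runcurry_def)
qed

lemma self_vcomp:
  assumes "X \<in> Obj V" "Y \<in> Obj V" "Z \<in> Obj V"
  shows "VComp (self_vcat V) X Y Z \<in> hom V (IHom V Y Z \<otimes> IHom V X Y) (IHom V X Z)"
    and "runcurry X Z (VComp (self_vcat V) X Y Z) =
      Ev V Y Z \<cdot> (Ident V (IHom V Y Z) \<odot> Ev V X Y) \<cdot> Assoc V (IHom V Y Z) (IHom V X Y) X"
proof -
  let ?c = "Ev V Y Z \<cdot> (Ident V (IHom V Y Z) \<odot> Ev V X Y) \<cdot> Assoc V (IHom V Y Z) (IHom V X Y) X"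
  have c: "?c \<in> hom V ((IHom V Y Z \<otimes> IHom V X Y) \<otimes> X) Z"
    using assms(1-3) by (simp add: in_hom)
  show "VComp (self_vcat V) X Y Z \<in> hom V (IHom V Y Z \<otimes> IHom V X Y) (IHom V X Z)"
    "runcurry X Z (VComp (self_vcat V) X Y Z) = ?c"
    using adjunct[OF _ _ _ c] assms by (simp_all add: self_vcat_def runcurry_def)
qed

lemma runcurry_self_comp:
  assumes "X \<in> Obj V" "Y \<in> Obj V" "Z \<in> Obj V" "g \<in> hom V P (IHom V Y Z)" "f \<in> hom V R (IHom V X Y)"
  shows "VComp (self_vcat V) X Y Z \<cdot> (g \<odot> f) \<in> hom V (P \<otimes> R) (IHom V X Z)"
    and "runcurry X Z (VComp (self_vcat V) X Y Z \<cdot> (g \<odot> f)) =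
      runcurry Y Z g \<cdot> (Ident V P \<odot> runcurry X Y f) \<cdot> Assoc V P R X"
proof -
  have arr: "g \<in> Arr V" "f \<in> Arr V" "Dom V g = P" "Dom V f = R" "Cod V g = IHom V Y Z" "Cod V f = IHom V X Y"
    "P \<in> Obj V" "R \<in> Obj V"
    using assms by (auto simp: in_hom)
  let ?c = "Ev V Y Z \<cdot> (Ident V (IHom V Y Z) \<odot> Ev V X Y) \<cdot> Assoc V (IHom V Y Z) (IHom V X Y) X"
  note comp = self_vcomp[OF assms(1-3)]
  show "VComp (self_vcat V) X Y Z \<cdot> (g \<odot> f) \<in> hom V (P \<otimes> R) (IHom V X Z)"
    using comp(1) arr by (simp add: in_hom)
  have "runcurry X Z (VComp (self_vcat V) X Y Z \<cdot> (g \<odot> f)) = ?c \<cdot> ((g \<odot> f) \<odot> Ident V X)"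
    using comp arr assms(1-3) by (simp add: uncurry_comp in_hom)
  also have "\<dots> = Ev V Y Z \<cdot> (Ident V (IHom V Y Z) \<odot> Ev V X Y) \<cdot> (g \<odot> (f \<odot> Ident V X)) \<cdot> Assoc V P R X"
    using arr assms(1-3) by (simp add: Assoc_natural)
  also have "\<dots> = runcurry Y Z g \<cdot> (Ident V P \<odot> runcurry X Y f) \<cdot> Assoc V P R X"
    using arr assms(1-3) by (simp add: runcurry_def)
  finally show "runcurry X Z (VComp (self_vcat V) X Y Z \<cdot> (g \<odot> f)) =
      runcurry Y Z g \<cdot> (Ident V P \<odot> runcurry X Y f) \<cdot> Assoc V P R X" .
qed


text \<open>
  The hexagon on \<open>X\<close>, \<open>I\<close>, \<open>I\<close>, followed by a left unit constraint, is this identity tensored with \<open>I\<close> and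
  followed by the symmetry, which can be cancelled.
\<close>

lemma LUnit_Symm:
  assumes [simp]: "X \<in> Obj V"
  shows "LUnit V X \<cdot> Symm V X (Unit V) = RUnit V X"
proof -
  let ?I = "Unit V"
  have "Symm V X ?I \<cdot> ((LUnit V X \<cdot> Symm V X ?I) \<odot> Ident V ?I)
      = Symm V X ?I \<cdot> (LUnit V X \<odot> Ident V ?I) \<cdot> (Symm V X ?I \<odot> Ident V ?I)"
    by simp
  also have "\<dots> = Symm V X ?I \<cdot> (LUnit V (X \<otimes> ?I) \<cdot> Assoc V ?I X ?I) \<cdot> (Symm V X ?I \<odot> Ident V ?I)"
    by (simp add: LUnit_tensor)
  also have "\<dots> = (Symm V X ?I \<cdot> LUnit V (X \<otimes> ?I)) \<cdot> Assoc V ?I X ?I \<cdot> (Symm V X ?I \<odot> Ident V ?I)"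
    by simp
  also have "\<dots> = LUnit V (?I \<otimes> X) \<cdot> (Ident V ?I \<odot> Symm V X ?I) \<cdot> Assoc V ?I X ?I \<cdot> (Symm V X ?I \<odot> Ident V ?I)"
    using LUnit_natural(1)[of "Symm V X ?I" "?I \<otimes> X"] by (simp flip: assoc)
  also have "\<dots> = LUnit V (?I \<otimes> X) \<cdot> (Assoc V ?I ?I X \<cdot> Symm V X (?I \<otimes> ?I) \<cdot> Assoc V X ?I ?I)"
    by (simp add: hexagon)
  also have "\<dots> = (LUnit V (?I \<otimes> X) \<cdot> Assoc V ?I ?I X) \<cdot> Symm V X (?I \<otimes> ?I) \<cdot> Assoc V X ?I ?I"
    by simp
  also have "\<dots> = ((LUnit V ?I \<odot> Ident V X) \<cdot> Symm V X (?I \<otimes> ?I)) \<cdot> Assoc V X ?I ?I"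
    by (simp add: LUnit_tensor)
  also have "\<dots> = (Symm V X ?I \<cdot> (Ident V X \<odot> LUnit V ?I)) \<cdot> Assoc V X ?I ?I"
    by (simp add: Symm_natural)
  also have "\<dots> = Symm V X ?I \<cdot> (RUnit V X \<odot> Ident V ?I)"
    by (simp add: triangle)
  finally have "(LUnit V X \<cdot> Symm V X ?I) \<odot> Ident V ?I = RUnit V X \<odot> Ident V ?I"
    by (rule iso_cancel_left[rotated -1]) simp_all
  then show ?thesis
    by (rule tensor_Unit_faithful(2)[rotated -1]) (simp_all add: in_hom)
qed


section \<open>Composition of families of arrows of an enriched category\<close>

text \<open>
  A map \<open>X \<rightarrow> C(a, b)\<close> is treated as a family of arrows from \<open>a\<close> to \<open>b\<close>, and
  \<open>VComp C a b c \<cdot> (g \<odot> f)\<close> as the composite of two such families.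
\<close>

lemma vcat_simps [simp]:
  assumes "is_vcat V C"
  shows "a \<in> VObj C \<Longrightarrow> b \<in> VObj C \<Longrightarrow> VHom C a b \<in> Obj V"
    and "a \<in> VObj C \<Longrightarrow> VId C a \<in> Arr V"
    and "a \<in> VObj C \<Longrightarrow> Dom V (VId C a) = Unit V"
    and "a \<in> VObj C \<Longrightarrow> Cod V (VId C a) = VHom C a a"
    and "a \<in> VObj C \<Longrightarrow> b \<in> VObj C \<Longrightarrow> c \<in> VObj C \<Longrightarrow> VComp C a b c \<in> Arr V"
    and "a \<in> VObj C \<Longrightarrow> b \<in> VObj C \<Longrightarrow> c \<in> VObj C \<Longrightarrow> Dom V (VComp C a b c) = VHom C b c \<otimes> VHom C a b"
    and "a \<in> VObj C \<Longrightarrow> b \<in> VObj C \<Longrightarrow> c \<in> VObj C \<Longrightarrow> Cod V (VComp C a b c) = VHom C a c"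
  using assms unfolding is_vcat_def in_hom by simp_all

lemma vcomp_assoc:
  assumes C: "is_vcat V C" and obj: "a \<in> VObj C" "b \<in> VObj C" "c \<in> VObj C" "d \<in> VObj C"
    and "h \<in> hom V X (VHom C c d)" and "g \<in> hom V Y (VHom C b c)" and "f \<in> hom V Z (VHom C a b)"
  shows "VComp C a b d \<cdot> ((VComp C b c d \<cdot> (h \<odot> g)) \<odot> f) =
    VComp C a c d \<cdot> (h \<odot> (VComp C a b c \<cdot> (g \<odot> f))) \<cdot> Assoc V X Y Z"
proof -
  have arr: "h \<in> Arr V" "g \<in> Arr V" "f \<in> Arr V" "Dom V h = X" "Dom V g = Y" "Dom V f = Z"
    "Cod V h = VHom C c d" "Cod V g = VHom C b c" "Cod V f = VHom C a b" "X \<in> Obj V" "Y \<in> Obj V" "Z \<in> Obj V"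
    using assms by (auto simp: in_hom)
  have "VComp C a b d \<cdot> ((VComp C b c d \<cdot> (h \<odot> g)) \<odot> f) =
      (VComp C a b d \<cdot> (VComp C b c d \<odot> Ident V (VHom C a b))) \<cdot> ((h \<odot> g) \<odot> f)"
    using arr C obj by simp
  also have "\<dots> = (VComp C a c d \<cdot> (Ident V (VHom C c d) \<odot> VComp C a b c)
          \<cdot> Assoc V (VHom C c d) (VHom C b c) (VHom C a b)) \<cdot> ((h \<odot> g) \<odot> f)"
    using C obj unfolding is_vcat_def by metis
  also have "\<dots> = VComp C a c d \<cdot> (h \<odot> (VComp C a b c \<cdot> (g \<odot> f))) \<cdot> Assoc V X Y Z"
    using arr C obj by (simp add: Assoc_natural)
  finally show ?thesis .
qed

lemma vcomp_VId:
  assumes C: "is_vcat V C" and obj: "a \<in> VObj C" "b \<in> VObj C" and "f \<in> hom V X (VHom C a b)"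
  shows "VComp C a b b \<cdot> (VId C b \<odot> f) = f \<cdot> LUnit V X"
    and "VComp C a a b \<cdot> (f \<odot> VId C a) = f \<cdot> RUnit V X"
proof -
  have arr: "f \<in> Arr V" "Dom V f = X" "Cod V f = VHom C a b" "X \<in> Obj V"
    using assms by (auto simp: in_hom)
  have ax: "VComp C a b b \<cdot> (VId C b \<odot> Ident V (VHom C a b)) = LUnit V (VHom C a b)"
    "VComp C a a b \<cdot> (Ident V (VHom C a b) \<odot> VId C a) = RUnit V (VHom C a b)"
    using C obj unfolding is_vcat_def by blast+
  have "VComp C a b b \<cdot> (VId C b \<odot> f) = (VComp C a b b \<cdot> (VId C b \<odot> Ident V (VHom C a b))) \<cdot> (Ident V (Unit V) \<odot> f)"
    using arr C obj by simp
  then show "VComp C a b b \<cdot> (VId C b \<odot> f) = f \<cdot> LUnit V X"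
    using arr ax by (simp add: LUnit_natural)
  have "VComp C a a b \<cdot> (f \<odot> VId C a) = (VComp C a a b \<cdot> (Ident V (VHom C a b) \<odot> VId C a)) \<cdot> (f \<odot> Ident V (Unit V))"
    using arr C obj by simp
  then show "VComp C a a b \<cdot> (f \<odot> VId C a) = f \<cdot> RUnit V X"
    using arr ax by (simp add: LUnit_natural)
qed

lemma vfunctor_simps:
  assumes "is_vfunctor V C D F"
  shows "a \<in> VObj C \<Longrightarrow> VFObj F a \<in> VObj D"
    and "a \<in> VObj C \<Longrightarrow> b \<in> VObj C \<Longrightarrow> VFArr F a b \<in> Arr V"
    and "a \<in> VObj C \<Longrightarrow> b \<in> VObj C \<Longrightarrow> Dom V (VFArr F a b) = VHom C a b"
    and "a \<in> VObj C \<Longrightarrow> b \<in> VObj C \<Longrightarrow> Cod V (VFArr F a b) = VHom D (VFObj F a) (VFObj F b)"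
    and "a \<in> VObj C \<Longrightarrow> VFArr F a a \<cdot> VId C a = VId D (VFObj F a)"
  using assms unfolding is_vfunctor_def in_hom by simp_all

lemma vfunctor_vcomp:
  assumes F: "is_vfunctor V C D F" and C: "is_vcat V C" and D: "is_vcat V D"
    and obj: "a \<in> VObj C" "b \<in> VObj C" "c \<in> VObj C"
    and "g \<in> hom V X (VHom C b c)" and "f \<in> hom V Y (VHom C a b)"
  shows "VFArr F a c \<cdot> VComp C a b c \<cdot> (g \<odot> f) =
    VComp D (VFObj F a) (VFObj F b) (VFObj F c) \<cdot> ((VFArr F b c \<cdot> g) \<odot> (VFArr F a b \<cdot> f))"
proof -
  have arr: "g \<in> Arr V" "f \<in> Arr V" "Dom V g = X" "Dom V f = Y"
    "Cod V g = VHom C b c" "Cod V f = VHom C a b"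
    using assms by (auto simp: in_hom)
  have "VFArr F a c \<cdot> VComp C a b c =
      VComp D (VFObj F a) (VFObj F b) (VFObj F c) \<cdot> (VFArr F b c \<odot> VFArr F a b)"
    using F obj unfolding is_vfunctor_def by blast
  then have "(VFArr F a c \<cdot> VComp C a b c) \<cdot> (g \<odot> f) =
      (VComp D (VFObj F a) (VFObj F b) (VFObj F c) \<cdot> (VFArr F b c \<odot> VFArr F a b)) \<cdot> (g \<odot> f)"
    by simp
  then show ?thesis
    using arr C D obj vfunctor_simps[OF F] by simp
qed


text \<open>
  A single arrow \<open>I \<rightarrow> C(a, b)\<close> is a family over \<open>I\<close>. The maps \<open>pre_comp\<close> and \<open>post_comp\<close> agree with
  composition of families only up to a unit constraint, and that constraint is made explicit here once
  and for all.
\<close>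

lemma pre_comp_comp:
  assumes C: "is_vcat V C" and obj: "a \<in> VObj C" "b \<in> VObj C" "c \<in> VObj C"
    and f: "f \<in> hom V (Unit V) (VHom C a b)" and "g \<in> hom V X (VHom C b c)"
  shows "pre_comp V C a b c f \<in> hom V (VHom C b c) (VHom C a c)"
    and "pre_comp V C a b c f \<cdot> g = VComp C a b c \<cdot> (g \<odot> f) \<cdot> inv_arr V (RUnit V X)"
    and "pre_comp V C a b c f \<cdot> g \<cdot> RUnit V X = VComp C a b c \<cdot> (g \<odot> f)"
proof -
  have arr: "g \<in> Arr V" "f \<in> Arr V" "Dom V g = X" "Dom V f = Unit V"
    "Cod V g = VHom C b c" "Cod V f = VHom C a b" "X \<in> Obj V"
    using assms by (auto simp: in_hom)
  show "pre_comp V C a b c f \<in> hom V (VHom C b c) (VHom C a c)"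
    using arr C obj by (simp add: pre_comp_def in_hom)
  show *: "pre_comp V C a b c f \<cdot> g = VComp C a b c \<cdot> (g \<odot> f) \<cdot> inv_arr V (RUnit V X)"
    using arr C obj inv_LUnit_natural(2)[of g X] by (simp add: pre_comp_def)
  have "pre_comp V C a b c f \<cdot> g \<cdot> RUnit V X = (pre_comp V C a b c f \<cdot> g) \<cdot> RUnit V X"
    using arr C obj by (simp add: pre_comp_def)
  then show "pre_comp V C a b c f \<cdot> g \<cdot> RUnit V X = VComp C a b c \<cdot> (g \<odot> f)"
    unfolding * using arr C obj by simp
qed

lemma post_comp_comp:
  assumes C: "is_vcat V C" and obj: "a \<in> VObj C" "b \<in> VObj C" "c \<in> VObj C"
    and f: "f \<in> hom V (Unit V) (VHom C b c)" and "g \<in> hom V X (VHom C a b)"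
  shows "post_comp V C a b c f \<in> hom V (VHom C a b) (VHom C a c)"
    and "post_comp V C a b c f \<cdot> g = VComp C a b c \<cdot> (f \<odot> g) \<cdot> inv_arr V (LUnit V X)"
proof -
  have arr: "g \<in> Arr V" "f \<in> Arr V" "Dom V g = X" "Dom V f = Unit V"
    "Cod V g = VHom C a b" "Cod V f = VHom C b c" "X \<in> Obj V"
    using assms by (auto simp: in_hom)
  show "post_comp V C a b c f \<in> hom V (VHom C a b) (VHom C a c)"
    using arr C obj by (simp add: post_comp_def in_hom)
  show "post_comp V C a b c f \<cdot> g = VComp C a b c \<cdot> (f \<odot> g) \<cdot> inv_arr V (LUnit V X)"
    using arr C obj inv_LUnit_natural(1)[of g X] by (simp add: post_comp_def)
qed

lemma el_comp:
  assumes C: "is_vcat V C" and obj: "a \<in> VObj C" "b \<in> VObj C" "c \<in> VObj C"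
    and f: "f \<in> hom V (Unit V) (VHom C a b)" and "g \<in> hom V (Unit V) (VHom C b c)"
  shows "el_comp V C a b c g f \<in> hom V (Unit V) (VHom C a c)"
    and "el_comp V C a b c g f = pre_comp V C a b c f \<cdot> g"
    and "el_comp V C a b c g f = post_comp V C a b c g \<cdot> f"
proof -
  have arr: "g \<in> Arr V" "f \<in> Arr V" "Dom V g = Unit V" "Dom V f = Unit V"
    "Cod V g = VHom C b c" "Cod V f = VHom C a b"
    using assms by (auto simp: in_hom)
  show "el_comp V C a b c g f \<in> hom V (Unit V) (VHom C a c)"
    using arr C obj by (simp add: el_comp_def in_hom)
  show "el_comp V C a b c g f = pre_comp V C a b c f \<cdot> g"
    using pre_comp_comp(2)[OF assms] by (simp add: el_comp_def LUnit_eq_RUnit)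
  show "el_comp V C a b c g f = post_comp V C a b c g \<cdot> f"
    using post_comp_comp(2)[OF C obj assms(6) f] by (simp add: el_comp_def)
qed


section \<open>Functors with values in the base, and their hom-objects\<close>

text \<open>
  Wedges and hom-objects refer only to these data of a functor to \<open>V\<close>. Representable functors satisfy
  the condition by construction.
\<close>

definition typed_functor :: "('d, 'o, 'a) vcat \<Rightarrow> ('d, 'o, 'a) vfun \<Rightarrow> bool" where
  "typed_functor D F \<longleftrightarrow>
     (\<forall>d\<in>VObj D. VFObj F d \<in> Obj V) \<and>
     (\<forall>d\<in>VObj D. \<forall>d'\<in>VObj D. VFArr F d d' \<in> hom V (VHom D d d') (IHom V (VFObj F d) (VFObj F d')))"

text \<open>The action \<open>D(d, d') \<otimes> F d \<rightarrow> F d'\<close> of a functor to \<open>V\<close>.\<close>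

definition act :: "('d, 'o, 'a) vfun \<Rightarrow> 'd \<Rightarrow> 'd \<Rightarrow> 'a" where
  "act F d d' = runcurry (VFObj F d) (VFObj F d') (VFArr F d d')"

lemma typed_vfunctor: "is_vfunctor V D (self_vcat V) F \<Longrightarrow> typed_functor D F"
  by (simp add: is_vfunctor_def typed_functor_def self_vcat_def)

lemma act_simps [simp]:
  assumes "typed_functor D F" and "d \<in> VObj D" and "d' \<in> VObj D"
  shows "act F d d' \<in> Arr V" and "Dom V (act F d d') = VHom D d d' \<otimes> VFObj F d"
    and "Cod V (act F d d') = VFObj F d'"
  using assms by (simp_all add: typed_functor_def act_def in_hom)

lemma act_vcomp:
  assumes F: "is_vfunctor V D (self_vcat V) F" and D: "is_vcat V D"
    and obj: "a \<in> VObj D" "b \<in> VObj D" "c \<in> VObj D"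
    and "g \<in> hom V X (VHom D b c)" and "f \<in> hom V Y (VHom D a b)" and "x \<in> hom V Z (VFObj F a)"
  shows "act F a c \<cdot> ((VComp D a b c \<cdot> (g \<odot> f)) \<odot> x) =
    act F b c \<cdot> (g \<odot> (act F a b \<cdot> (f \<odot> x))) \<cdot> Assoc V X Y Z"
proof -
  have tF: "typed_functor D F"
    using typed_vfunctor[OF F] .
  have arr: "g \<in> Arr V" "f \<in> Arr V" "x \<in> Arr V" "Dom V g = X" "Dom V f = Y" "Dom V x = Z"
    "Cod V g = VHom D b c" "Cod V f = VHom D a b" "Cod V x = VFObj F a" "X \<in> Obj V" "Y \<in> Obj V" "Z \<in> Obj V"
    using assms by (auto simp: in_hom)
  have o: "VFObj F a \<in> Obj V" "VFObj F b \<in> Obj V" "VFObj F c \<in> Obj V"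
    "VFArr F b c \<in> hom V (VHom D b c) (IHom V (VFObj F b) (VFObj F c))"
    "VFArr F a b \<in> hom V (VHom D a b) (IHom V (VFObj F a) (VFObj F b))"
    "VFArr F a c \<in> hom V (VHom D a c) (IHom V (VFObj F a) (VFObj F c))"
    using tF obj by (simp_all add: typed_functor_def)
  have "VFArr F a c \<cdot> VComp D a b c =
      VComp (self_vcat V) (VFObj F a) (VFObj F b) (VFObj F c) \<cdot> (VFArr F b c \<odot> VFArr F a b)"
    using F obj unfolding is_vfunctor_def by blast
  then have "runcurry (VFObj F a) (VFObj F c) (VFArr F a c \<cdot> VComp D a b c) =
      act F b c \<cdot> (Ident V (VHom D b c) \<odot> act F a b) \<cdot> Assoc V (VHom D b c) (VHom D a b) (VFObj F a)"
    using runcurry_self_comp(2)[OF o(1-5)] by (simp add: act_def)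
  moreover have "runcurry (VFObj F a) (VFObj F c) (VFArr F a c \<cdot> VComp D a b c) =
      act F a c \<cdot> (VComp D a b c \<odot> Ident V (VFObj F a))"
    using o D obj by (simp add: act_def uncurry_comp in_hom)
  ultimately have "(act F a c \<cdot> (VComp D a b c \<odot> Ident V (VFObj F a))) \<cdot> ((g \<odot> f) \<odot> x) =
      (act F b c \<cdot> (Ident V (VHom D b c) \<odot> act F a b) \<cdot> Assoc V (VHom D b c) (VHom D a b) (VFObj F a)) \<cdot> ((g \<odot> f) \<odot> x)"
    by simp
  then show ?thesis
    using arr o D obj tF by (simp add: Assoc_natural)
qed

lemma hom_from_comp:
  assumes C: "is_vcat V C" and S: "is_vfunctor V D C S" and D: "is_vcat V D" and c: "c \<in> VObj C"
  shows "typed_functor D (vfun_comp V (hom_from V C c) S)"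
    and "VFObj (vfun_comp V (hom_from V C c) S) d = VHom C c (VFObj S d)"
    and "d \<in> VObj D \<Longrightarrow> d' \<in> VObj D \<Longrightarrow> act (vfun_comp V (hom_from V C c) S) d d' =
      VComp C c (VFObj S d) (VFObj S d') \<cdot> (VFArr S d d' \<odot> Ident V (VHom C c (VFObj S d)))"
proof -
  show "VFObj (vfun_comp V (hom_from V C c) S) d = VHom C c (VFObj S d)" for d
    by (simp add: vfun_comp_def hom_from_def)
  have adj: "adjunct V (VHom C x y) (VHom C c x) (VHom C c y) (VComp C c x y)
      \<in> hom V (VHom C x y) (IHom V (VHom C c x) (VHom C c y))"
    "runcurry (VHom C c x) (VHom C c y) (adjunct V (VHom C x y) (VHom C c x) (VHom C c y) (VComp C c x y)) = VComp C c x y"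
    if "x \<in> VObj C" "y \<in> VObj C" for x y
    using that C c adjunct[of "VHom C c x" "VHom C c y" "VHom C x y" "VComp C c x y"]
    by (simp_all add: in_hom runcurry_def)
  note s = vfunctor_simps[OF S]
  show t: "typed_functor D (vfun_comp V (hom_from V C c) S)"
    using C c s adj unfolding typed_functor_def by (simp add: vfun_comp_def hom_from_def in_hom)
  show "act (vfun_comp V (hom_from V C c) S) d d' =
      VComp C c (VFObj S d) (VFObj S d') \<cdot> (VFArr S d d' \<odot> Ident V (VHom C c (VFObj S d)))"
    if "d \<in> VObj D" "d' \<in> VObj D" for d d'
    using that C c s adj[of "VFObj S d" "VFObj S d'"]
    by (simp add: act_def vfun_comp_def hom_from_def uncurry_comp in_hom)
qed

text \<open>
  Here the action is multiplication by the scalars \<open>P d d' : D(d, d') \<rightarrow> I\<close>, and functoriality is that of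
  \<open>P\<close> up to the identity of the two unit constraints of \<open>I\<close>.
\<close>

lemma unit_select_comp:
  assumes D: "is_vcat V D" and P: "is_vfunctor V D (unit_vcat V) P"
  shows "is_vfunctor V D (self_vcat V) (vfun_comp V (unit_select V) P)"
    and "VFObj (vfun_comp V (unit_select V) P) d = Unit V"
    and "d \<in> VObj D \<Longrightarrow> d' \<in> VObj D \<Longrightarrow> act (vfun_comp V (unit_select V) P) d d' =
      VFArr P d d' \<cdot> RUnit V (VHom D d d')"
proof -
  let ?I = "Unit V"
  let ?n = "name_of V (Ident V ?I)"
  let ?F = "vfun_comp V (unit_select V) P"
  have F: "VFObj ?F d = ?I" "VFArr ?F d d' = ?n \<cdot> VFArr P d d'" for d d'
    by (simp_all add: vfun_comp_def unit_select_def)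
  then show "VFObj (vfun_comp V (unit_select V) P) d = Unit V" for d
    by simp
  have p: "VFArr P d d' \<in> Arr V" "Dom V (VFArr P d d') = VHom D d d'" "Cod V (VFArr P d d') = ?I"
    if "d \<in> VObj D" "d' \<in> VObj D" for d d'
    using vfunctor_simps[OF P] that by (simp_all add: unit_vcat_def)
  have n: "?n \<in> hom V ?I (IHom V ?I ?I)" "runcurry ?I ?I ?n = LUnit V ?I"
    using name_of[of "Ident V ?I" ?I ?I] by (simp_all add: in_hom)
  have run: "runcurry ?I ?I (?n \<cdot> k) = k \<cdot> RUnit V X" if "k \<in> hom V X ?I" for k X
    using n that by (simp add: uncurry_comp in_hom LUnit_eq_RUnit LUnit_natural)
  show "act ?F d d' = VFArr P d d' \<cdot> RUnit V (VHom D d d')" if "d \<in> VObj D" "d' \<in> VObj D" for d d'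
    using run p that by (simp add: act_def F in_hom)
  show "is_vfunctor V D (self_vcat V) ?F"
    unfolding is_vfunctor_def
  proof (intro conjI ballI)
    fix a assume a: "a \<in> VObj D"
    show "VFObj ?F a \<in> VObj (self_vcat V)"
      by (simp add: F self_vcat_def)
    have "VFArr P a a \<cdot> VId D a = Ident V ?I"
      using vfunctor_simps(5)[OF P a] by (simp add: unit_vcat_def)
    then show "VFArr ?F a a \<cdot> VId D a = VId (self_vcat V) (VFObj ?F a)"
      using a D p n by (simp add: F self_vcat_def in_hom)
  next
    fix a b assume "a \<in> VObj D" "b \<in> VObj D"
    then show "VFArr ?F a b \<in> hom V (VHom D a b) (VHom (self_vcat V) (VFObj ?F a) (VFObj ?F b))"
      using p n by (simp add: F self_vcat_def in_hom)
  next
    fix a b c assume o: "a \<in> VObj D" "b \<in> VObj D" "c \<in> VObj D"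
    let ?ab = "VHom D a b" and ?bc = "VHom D b c"
    have h: "?n \<cdot> VFArr P b c \<in> hom V ?bc (IHom V ?I ?I)" "?n \<cdot> VFArr P a b \<in> hom V ?ab (IHom V ?I ?I)"
      using o p n by (simp_all add: in_hom)
    have "VFArr P a c \<cdot> VComp D a b c = LUnit V ?I \<cdot> (VFArr P b c \<odot> VFArr P a b)"
      using P o unfolding is_vfunctor_def by (simp add: unit_vcat_def)
    then have "runcurry ?I ?I (?n \<cdot> (VFArr P a c \<cdot> VComp D a b c)) =
        LUnit V ?I \<cdot> (VFArr P b c \<odot> VFArr P a b) \<cdot> RUnit V (?bc \<otimes> ?ab)"
      using o p D by (simp add: run in_hom)
    also have "\<dots> = RUnit V ?I \<cdot> (VFArr P b c \<odot> (VFArr P a b \<cdot> RUnit V ?ab)) \<cdot> Assoc V ?bc ?ab ?I"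
      using o p D by (simp add: LUnit_eq_RUnit flip: RUnit_tensor)
    also have "\<dots> = (VFArr P b c \<cdot> RUnit V ?bc) \<cdot> (Ident V ?bc \<odot> (VFArr P a b \<cdot> RUnit V ?ab)) \<cdot> Assoc V ?bc ?ab ?I"
    proof -
      have "RUnit V ?I \<cdot> (VFArr P b c \<odot> Ident V ?I) = VFArr P b c \<cdot> RUnit V ?bc"
        using o p by (simp add: LUnit_natural)
      then have "(RUnit V ?I \<cdot> (VFArr P b c \<odot> Ident V ?I)) \<cdot> (Ident V ?bc \<odot> (VFArr P a b \<cdot> RUnit V ?ab))
          \<cdot> Assoc V ?bc ?ab ?I = (VFArr P b c \<cdot> RUnit V ?bc) \<cdot> (Ident V ?bc \<odot> (VFArr P a b \<cdot> RUnit V ?ab)) \<cdot> Assoc V ?bc ?ab ?I"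
        by simp
      then show ?thesis
        using o p D by simp
    qed
    also have "\<dots> = runcurry ?I ?I (VComp (self_vcat V) ?I ?I ?I \<cdot> ((?n \<cdot> VFArr P b c) \<odot> (?n \<cdot> VFArr P a b)))"
      using o p D runcurry_self_comp(2)[OF _ _ _ h] by (simp add: run in_hom)
    finally have "?n \<cdot> (VFArr P a c \<cdot> VComp D a b c) = VComp (self_vcat V) ?I ?I ?I \<cdot> ((?n \<cdot> VFArr P b c) \<odot> (?n \<cdot> VFArr P a b))"
      using o p D n runcurry_self_comp(1)[OF _ _ _ h]
      by - (rule runcurry_cancel[rotated -1], auto simp: in_hom)
    then show "VFArr ?F a c \<cdot> VComp D a b c =
        VComp (self_vcat V) (VFObj ?F a) (VFObj ?F b) (VFObj ?F c) \<cdot> (VFArr ?F b c \<odot> VFArr ?F a b)"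
      using o p D n by (simp add: F in_hom)
  qed
qed

lemma vnat_self_iff:
  assumes D: "\<And>d d'. d \<in> VObj D \<Longrightarrow> d' \<in> VObj D \<Longrightarrow> VHom D d d' \<in> Obj V"
    and F: "typed_functor D F" and G: "typed_functor D G"
    and p: "\<And>d. d \<in> VObj D \<Longrightarrow> p d \<in> hom V (VFObj F d) (VFObj G d)"
  shows "is_vnat V D (self_vcat V) F G (\<lambda>d. name_of V (p d)) \<longleftrightarrow>
    (\<forall>d\<in>VObj D. \<forall>d'\<in>VObj D. p d' \<cdot> act F d d' = act G d d' \<cdot> (Ident V (VHom D d d') \<odot> p d))"
proof -
  have "VComp (self_vcat V) (VFObj F a) (VFObj F b) (VFObj G b) \<cdot> (name_of V (p b) \<odot> VFArr F a b)
          \<cdot> inv_arr V (LUnit V (VHom D a b)) =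
        VComp (self_vcat V) (VFObj F a) (VFObj G a) (VFObj G b) \<cdot> (VFArr G a b \<odot> name_of V (p a))
          \<cdot> inv_arr V (RUnit V (VHom D a b)) \<longleftrightarrow>
        p b \<cdot> act F a b = act G a b \<cdot> (Ident V (VHom D a b) \<odot> p a)"
    (is "?l = ?r \<longleftrightarrow> ?l' = ?r'")
    if ab: "a \<in> VObj D" "b \<in> VObj D" for a b
  proof -
    let ?X = "VHom D a b"
    have X [simp]: "?X \<in> Obj V"
      using D ab by simp
    have o [simp]: "VFObj F a \<in> Obj V" "VFObj F b \<in> Obj V" "VFObj G a \<in> Obj V" "VFObj G b \<in> Obj V"
      and F': "VFArr F a b \<in> hom V ?X (IHom V (VFObj F a) (VFObj F b))"
      and G': "VFArr G a b \<in> hom V ?X (IHom V (VFObj G a) (VFObj G b))"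
      using F G ab by (simp_all add: typed_functor_def)
    note na = name_of[OF p[OF ab(1)]] and nb = name_of[OF p[OF ab(2)]]
    have pa: "p a \<in> Arr V" "Dom V (p a) = VFObj F a" "Cod V (p a) = VFObj G a"
      "p b \<in> Arr V" "Dom V (p b) = VFObj F b" "Cod V (p b) = VFObj G b"
      using p ab by (simp_all add: in_hom)
    note l = runcurry_self_comp[OF o(1,2,4) nb(1) F'] and r = runcurry_self_comp[OF o(1,3,4) G' na(1)]
    have F'': "VFArr F a b \<in> Arr V" "Dom V (VFArr F a b) = ?X" "Cod V (VFArr F a b) = IHom V (VFObj F a) (VFObj F b)"
      and G'': "VFArr G a b \<in> Arr V" "Dom V (VFArr G a b) = ?X" "Cod V (VFArr G a b) = IHom V (VFObj G a) (VFObj G b)"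
      and n': "name_of V (p a) \<in> Arr V" "Dom V (name_of V (p a)) = Unit V" "Cod V (name_of V (p a)) = IHom V (VFObj F a) (VFObj G a)"
        "name_of V (p b) \<in> Arr V" "Dom V (name_of V (p b)) = Unit V" "Cod V (name_of V (p b)) = IHom V (VFObj F b) (VFObj G b)"
      using F' G' na nb by (simp_all add: in_hom)
    have L: "?l = (VComp (self_vcat V) (VFObj F a) (VFObj F b) (VFObj G b) \<cdot> (name_of V (p b) \<odot> VFArr F a b)) \<cdot> inv_arr V (LUnit V ?X)"
      and R: "?r = (VComp (self_vcat V) (VFObj F a) (VFObj G a) (VFObj G b) \<cdot> (VFArr G a b \<odot> name_of V (p a))) \<cdot> inv_arr V (RUnit V ?X)"
      using self_vcomp(1)[OF o(1,2,4)] self_vcomp(1)[OF o(1,3,4)] F'' G'' n' by (simp_all add: in_hom)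
    have hom: "?l \<in> hom V ?X (IHom V (VFObj F a) (VFObj G b))" "?r \<in> hom V ?X (IHom V (VFObj F a) (VFObj G b))"
      unfolding L R using l(1) r(1) by (auto intro!: comp_in_hom simp: in_hom)
    have "runcurry (VFObj F a) (VFObj G b) ?l =
        (p b \<cdot> LUnit V (VFObj F b) \<cdot> (Ident V (Unit V) \<odot> act F a b) \<cdot> Assoc V (Unit V) ?X (VFObj F a)) \<cdot>
        (inv_arr V (LUnit V ?X) \<odot> Ident V (VFObj F a))"
      unfolding L using l pa ab F by (simp add: uncurry_comp in_hom nb(2) flip: act_def)
    also have "\<dots> = p b \<cdot> (LUnit V (VFObj F b) \<cdot> (Ident V (Unit V) \<odot> act F a b)) \<cdot> Assoc V (Unit V) ?X (VFObj F a) \<cdot>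
        (inv_arr V (LUnit V ?X) \<odot> Ident V (VFObj F a))"
      using pa ab F by simp
    also have "\<dots> = p b \<cdot> act F a b \<cdot> (LUnit V (?X \<otimes> VFObj F a) \<cdot> Assoc V (Unit V) ?X (VFObj F a)) \<cdot>
        (inv_arr V (LUnit V ?X) \<odot> Ident V (VFObj F a))"
      using ab F LUnit_natural(1)[of "act F a b" "VFObj F b"] pa by simp
    also have "\<dots> = ?l'"
      using ab F pa by (simp add: LUnit_tensor)
    finally have l': "runcurry (VFObj F a) (VFObj G b) ?l = ?l'" .
    have "runcurry (VFObj F a) (VFObj G b) ?r =
        (act G a b \<cdot> (Ident V ?X \<odot> (p a \<cdot> LUnit V (VFObj F a))) \<cdot> Assoc V ?X (Unit V) (VFObj F a)) \<cdot>
        (inv_arr V (RUnit V ?X) \<odot> Ident V (VFObj F a))"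
      unfolding R using r pa ab G by (simp add: uncurry_comp in_hom na(2) flip: act_def)
    also have "\<dots> = act G a b \<cdot> (Ident V ?X \<odot> p a) \<cdot> ((Ident V ?X \<odot> LUnit V (VFObj F a)) \<cdot> Assoc V ?X (Unit V) (VFObj F a)) \<cdot>
        (inv_arr V (RUnit V ?X) \<odot> Ident V (VFObj F a))"
      using pa ab G by simp
    also have "\<dots> = ?r'"
      using ab G pa by (simp add: triangle)
    finally have "runcurry (VFObj F a) (VFObj G b) ?r = ?r'" .
    with l' hom show ?thesis
      by (metis o(1,4) runcurry_cancel)
  qed
  then show ?thesis
    using name_of(1)[OF p] unfolding is_vnat_def by (simp add: self_vcat_def)
qed


text \<open>
  A left wedge is a wedge on internal homs, uncurried on the left: a \<open>V\<close>-natural family of maps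
  \<open>F d \<otimes> E \<rightarrow> G d\<close>.
\<close>

definition left_wedge ::
  "('d, 'o, 'a) vcat \<Rightarrow> ('d, 'o, 'a) vfun \<Rightarrow> ('d, 'o, 'a) vfun \<Rightarrow> 'o \<Rightarrow> ('d \<Rightarrow> 'a) \<Rightarrow> bool" where
  "left_wedge D F G E \<rho> \<longleftrightarrow>
     E \<in> Obj V \<and> (\<forall>d\<in>VObj D. \<rho> d \<in> hom V (VFObj F d \<otimes> E) (VFObj G d)) \<and>
     (\<forall>d\<in>VObj D. \<forall>d'\<in>VObj D.
        act G d d' \<cdot> (Ident V (VHom D d d') \<odot> \<rho> d) \<cdot> Assoc V (VHom D d d') (VFObj F d) E =
        \<rho> d' \<cdot> (act F d d' \<odot> Ident V E))"

text \<open>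
  Uncurrying puts \<open>E\<close> on the left of \<open>F d\<close>, and a symmetry moves it to the right. By the hexagon both
  sides of the wedge condition change by the same isomorphism \<open>(D(d, d') \<otimes> E) \<otimes> F d \<rightarrow> (D(d, d') \<otimes> F d) \<otimes> E\<close>.
\<close>

lemma hom_wedge_iff:
  assumes D: "is_vcat V D" and F: "typed_functor D F" and G: "typed_functor D G"
  shows "is_hom_wedge V D F G E \<pi> \<longleftrightarrow>
    (\<forall>d\<in>VObj D. \<pi> d \<in> hom V E (IHom V (VFObj F d) (VFObj G d))) \<and>
    left_wedge D F G E (\<lambda>d. luncurry (VFObj F d) (VFObj G d) (\<pi> d))"
proof -
  have *: "VComp (self_vcat V) (VFObj F d) (VFObj G d) (VFObj G d') \<cdot> (VFArr G d d' \<odot> \<pi> d) =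
        VComp (self_vcat V) (VFObj F d) (VFObj F d') (VFObj G d') \<cdot> (\<pi> d' \<odot> VFArr F d d')
          \<cdot> Symm V (VHom D d d') E \<longleftrightarrow>
        act G d d' \<cdot> (Ident V (VHom D d d') \<odot> luncurry (VFObj F d) (VFObj G d) (\<pi> d)) \<cdot>
          Assoc V (VHom D d d') (VFObj F d) E =
        luncurry (VFObj F d') (VFObj G d') (\<pi> d') \<cdot> (act F d d' \<odot> Ident V E)"
    (is "?l = ?r \<longleftrightarrow> ?l' = ?r'")
    if d: "d \<in> VObj D" "d' \<in> VObj D" and E [simp]: "E \<in> Obj V"
      and \<pi>: "\<forall>d\<in>VObj D. \<pi> d \<in> hom V E (IHom V (VFObj F d) (VFObj G d))" for d d'
  proof -
    let ?X = "VHom D d d'" and ?F = "VFObj F d" and ?F' = "VFObj F d'" and ?G = "VFObj G d" and ?G' = "VFObj G d'"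
    have [simp]: "?X \<in> Obj V" and o [simp]: "?F \<in> Obj V" "?F' \<in> Obj V" "?G \<in> Obj V" "?G' \<in> Obj V"
      and FA: "VFArr F d d' \<in> hom V ?X (IHom V ?F ?F')" and GA: "VFArr G d d' \<in> hom V ?X (IHom V ?G ?G')"
      using D F G d by (simp_all add: typed_functor_def)
    have \<pi>d: "\<pi> d \<in> hom V E (IHom V ?F ?G)" and \<pi>d': "\<pi> d' \<in> hom V E (IHom V ?F' ?G')"
      using \<pi> d by auto
    then have arr: "\<pi> d \<in> Arr V" "Dom V (\<pi> d) = E" "Cod V (\<pi> d) = IHom V ?F ?G"
      "\<pi> d' \<in> Arr V" "Dom V (\<pi> d') = E" "Cod V (\<pi> d') = IHom V ?F' ?G'"
      "VFArr F d d' \<in> Arr V" "Dom V (VFArr F d d') = ?X" "Cod V (VFArr F d d') = IHom V ?F ?F'"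
      "VFArr G d d' \<in> Arr V" "Dom V (VFArr G d d') = ?X" "Cod V (VFArr G d d') = IHom V ?G ?G'"
      using FA GA by (simp_all add: in_hom)
    note acts = act_simps[OF F d] act_simps[OF G d]
    note l = runcurry_self_comp[OF o(1,3,4) GA \<pi>d] and r = runcurry_self_comp[OF o(1,2,4) \<pi>d' FA]
    let ?u = "luncurry ?F ?G (\<pi> d)" and ?u' = "luncurry ?F' ?G' (\<pi> d')"
    have u: "?u \<in> Arr V" "Dom V ?u = ?F \<otimes> E" "Cod V ?u = ?G" "?u' \<in> Arr V" "Dom V ?u' = ?F' \<otimes> E" "Cod V ?u' = ?G'"
      using arr by simp_all
    let ?\<Xi> = "Symm V E (?X \<otimes> ?F) \<cdot> Assoc V E ?X ?F \<cdot> (Symm V ?X E \<odot> Ident V ?F)"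
    have \<Xi>: "is_iso V ?\<Xi>" "?\<Xi> \<in> Arr V" "Dom V ?\<Xi> = (?X \<otimes> E) \<otimes> ?F" "Cod V ?\<Xi> = (?X \<otimes> ?F) \<otimes> E"
      by (simp_all add: comp_iso tensor_iso)
    have "Assoc V ?X ?F E \<cdot> ?\<Xi> = (Assoc V ?X ?F E \<cdot> Symm V E (?X \<otimes> ?F) \<cdot> Assoc V E ?X ?F) \<cdot> (Symm V ?X E \<odot> Ident V ?F)"
      by simp
    also have "\<dots> = (Ident V ?X \<odot> Symm V E ?F) \<cdot> Assoc V ?X E ?F"
      by (subst hexagon) simp_all
    finally have hex: "(Ident V ?X \<odot> Symm V E ?F) \<cdot> Assoc V ?X E ?F = Assoc V ?X ?F E \<cdot> ?\<Xi>"
      by simp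
    have "runcurry ?F ?G' ?l = act G d d' \<cdot> (Ident V ?X \<odot> (?u \<cdot> Symm V E ?F)) \<cdot> Assoc V ?X E ?F"
      using l(2) runcurry_eq[OF o(1,3) \<pi>d] by (simp add: act_def)
    also have "\<dots> = act G d d' \<cdot> (Ident V ?X \<odot> ?u) \<cdot> ((Ident V ?X \<odot> Symm V E ?F) \<cdot> Assoc V ?X E ?F)"
      using u acts by simp
    also have "\<dots> = ?l' \<cdot> ?\<Xi>"
      unfolding hex using u acts by simp
    finally have L: "runcurry ?F ?G' ?l = ?l' \<cdot> ?\<Xi>" .
    have r0: "?r = (VComp (self_vcat V) ?F ?F' ?G' \<cdot> (\<pi> d' \<odot> VFArr F d d')) \<cdot> Symm V ?X E"
      using self_vcomp(1)[OF o(1,2,4)] arr by (simp add: in_hom)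
    have "runcurry ?F ?G' ?r = (?u' \<cdot> Symm V E ?F' \<cdot> (Ident V E \<odot> act F d d') \<cdot> Assoc V E ?X ?F) \<cdot> (Symm V ?X E \<odot> Ident V ?F)"
      unfolding r0 using r arr runcurry_eq[OF o(2,4) \<pi>d'] u acts by (simp add: uncurry_comp in_hom flip: act_def)
    also have "\<dots> = ?u' \<cdot> (Symm V E ?F' \<cdot> (Ident V E \<odot> act F d d')) \<cdot> Assoc V E ?X ?F \<cdot> (Symm V ?X E \<odot> Ident V ?F)"
      using u acts by simp
    also have "\<dots> = ?r' \<cdot> ?\<Xi>"
      using u acts by (simp add: Symm_natural)
    finally have R: "runcurry ?F ?G' ?r = ?r' \<cdot> ?\<Xi>" .
    have "?l \<in> hom V (?X \<otimes> E) (IHom V ?F ?G')" "?r \<in> hom V (?X \<otimes> E) (IHom V ?F ?G')"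
      using l(1) r(1) r0 by (simp_all add: in_hom)
    then have "?l = ?r \<longleftrightarrow> ?l' \<cdot> ?\<Xi> = ?r' \<cdot> ?\<Xi>"
      using L R runcurry_cancel[OF o(1,4)] by metis
    also have "\<dots> \<longleftrightarrow> ?l' = ?r'"
    proof
      assume eq: "?l' \<cdot> ?\<Xi> = ?r' \<cdot> ?\<Xi>"
      show "?l' = ?r'"
        by (rule iso_cancel_right[OF \<Xi>(1) _ _ _ _ eq]) (use u acts in simp_all)
    qed (rule arg_cong)
    finally show ?thesis .
  qed
  have "\<forall>d\<in>VObj D. luncurry (VFObj F d) (VFObj G d) (\<pi> d) \<in> hom V (VFObj F d \<otimes> E) (VFObj G d)"
    if "\<forall>d\<in>VObj D. \<pi> d \<in> hom V E (IHom V (VFObj F d) (VFObj G d))"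
    using that F G by (auto simp: in_hom typed_functor_def)
  then show ?thesis
    unfolding is_hom_wedge_def left_wedge_def using * by auto
qed

lemma hom_object_iff:
  assumes D: "is_vcat V D" and F: "typed_functor D F" and G: "typed_functor D G"
    and \<pi>: "\<And>d. d \<in> VObj D \<Longrightarrow> \<pi> d \<in> hom V E (IHom V (VFObj F d) (VFObj G d))"
  shows "is_hom_object V D F G E \<pi> \<longleftrightarrow>
    left_wedge D F G E (\<lambda>d. luncurry (VFObj F d) (VFObj G d) (\<pi> d)) \<and>
    (\<forall>E' \<rho>. left_wedge D F G E' \<rho> \<longrightarrow>
      (\<exists>!t. t \<in> hom V E' E \<and>
        (\<forall>d\<in>VObj D. luncurry (VFObj F d) (VFObj G d) (\<pi> d) \<cdot> (Ident V (VFObj F d) \<odot> t) = \<rho> d)))"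
proof -
  have o: "VFObj F d \<in> Obj V" "VFObj G d \<in> Obj V" if "d \<in> VObj D" for d
    using F G that by (simp_all add: typed_functor_def)
  have comp: "luncurry (VFObj F d) (VFObj G d) (\<pi> d) \<cdot> (Ident V (VFObj F d) \<odot> t) =
      luncurry (VFObj F d) (VFObj G d) x \<longleftrightarrow> \<pi> d \<cdot> t = x"
    if "d \<in> VObj D" "t \<in> hom V E' E" "x \<in> hom V E' (IHom V (VFObj F d) (VFObj G d))" for d t E' x
  proof -
    have "luncurry (VFObj F d) (VFObj G d) (\<pi> d \<cdot> t) =
        luncurry (VFObj F d) (VFObj G d) (\<pi> d) \<cdot> (Ident V (VFObj F d) \<odot> t)"
      using that \<pi>[of d] o[of d] by (intro uncurry_comp) (simp_all add: in_hom)
    moreover have "\<pi> d \<cdot> t \<in> hom V E' (IHom V (VFObj F d) (VFObj G d))"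
      using comp_in_hom[OF that(2) \<pi>] that(1) by blast
    ultimately show ?thesis
      using luncurry_cancel[of "VFObj F d" "VFObj G d" "\<pi> d \<cdot> t" E' "x"] that(1,3) o[of d] by auto
  qed
  have "(\<forall>E' \<pi>'. is_hom_wedge V D F G E' \<pi>' \<longrightarrow> (\<exists>!t. t \<in> hom V E' E \<and> (\<forall>d\<in>VObj D. \<pi> d \<cdot> t = \<pi>' d))) \<longleftrightarrow>
    (\<forall>E' \<rho>. left_wedge D F G E' \<rho> \<longrightarrow>
      (\<exists>!t. t \<in> hom V E' E \<and>
        (\<forall>d\<in>VObj D. luncurry (VFObj F d) (VFObj G d) (\<pi> d) \<cdot> (Ident V (VFObj F d) \<odot> t) = \<rho> d)))"
    (is "?L \<longleftrightarrow> ?R")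
  proof
    assume L: ?L
    show ?R
    proof (intro allI impI)
      fix E' \<rho>
      assume \<rho>: "left_wedge D F G E' \<rho>"
      define \<pi>' where "\<pi>' d = lcurry E' (VFObj F d) (VFObj G d) (\<rho> d)" for d
      have \<pi>': "\<pi>' d \<in> hom V E' (IHom V (VFObj F d) (VFObj G d))"
        "luncurry (VFObj F d) (VFObj G d) (\<pi>' d) = \<rho> d" if "d \<in> VObj D" for d
        using luncurry_lcurry[OF o[OF that], of E' "\<rho> d"] \<rho> that by (simp_all add: left_wedge_def \<pi>'_def)
      then have "is_hom_wedge V D F G E' \<pi>'"
        unfolding hom_wedge_iff[OF D F G] using \<rho> unfolding left_wedge_def by simp
      then have "\<exists>!t. t \<in> hom V E' E \<and> (\<forall>d\<in>VObj D. \<pi> d \<cdot> t = \<pi>' d)"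
        using L by blast
      moreover have "(\<forall>d\<in>VObj D. luncurry (VFObj F d) (VFObj G d) (\<pi> d) \<cdot> (Ident V (VFObj F d) \<odot> t) = \<rho> d)
          \<longleftrightarrow> (\<forall>d\<in>VObj D. \<pi> d \<cdot> t = \<pi>' d)" if "t \<in> hom V E' E" for t
        using comp[OF _ that \<pi>'(1)] \<pi>'(2) by simp
      ultimately show "\<exists>!t. t \<in> hom V E' E \<and>
          (\<forall>d\<in>VObj D. luncurry (VFObj F d) (VFObj G d) (\<pi> d) \<cdot> (Ident V (VFObj F d) \<odot> t) = \<rho> d)"
        by (metis (no_types, lifting))
    qed
  next
    assume R: ?R
    show ?L
    proof (intro allI impI)
      fix E' \<pi>'
      assume w: "is_hom_wedge V D F G E' \<pi>'"
      then have \<pi>': "\<pi>' d \<in> hom V E' (IHom V (VFObj F d) (VFObj G d))" if "d \<in> VObj D" for d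
        using that by (simp add: is_hom_wedge_def)
      have "left_wedge D F G E' (\<lambda>d. luncurry (VFObj F d) (VFObj G d) (\<pi>' d))"
        using w unfolding hom_wedge_iff[OF D F G] by blast
      then have "\<exists>!t. t \<in> hom V E' E \<and>
        (\<forall>d\<in>VObj D. luncurry (VFObj F d) (VFObj G d) (\<pi> d) \<cdot> (Ident V (VFObj F d) \<odot> t) =
          luncurry (VFObj F d) (VFObj G d) (\<pi>' d))"
        using R by simp
      moreover have "(\<forall>d\<in>VObj D. luncurry (VFObj F d) (VFObj G d) (\<pi> d) \<cdot> (Ident V (VFObj F d) \<odot> t) =
          luncurry (VFObj F d) (VFObj G d) (\<pi>' d)) \<longleftrightarrow> (\<forall>d\<in>VObj D. \<pi> d \<cdot> t = \<pi>' d)" if "t \<in> hom V E' E" for t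
        using comp[OF _ that \<pi>'] by simp
      ultimately show "\<exists>!t. t \<in> hom V E' E \<and> (\<forall>d\<in>VObj D. \<pi> d \<cdot> t = \<pi>' d)"
        by (metis (no_types, lifting))
    qed
  qed
  moreover have "is_hom_wedge V D F G E \<pi> \<longleftrightarrow>
      left_wedge D F G E (\<lambda>d. luncurry (VFObj F d) (VFObj G d) (\<pi> d))"
    using hom_wedge_iff[OF D F G] \<pi> by blast
  ultimately show ?thesis
    unfolding is_hom_object_def by (simp only:)
qed

text \<open>
  The hom-object is the limit of the diagram \<open>[F d, G d] \<rightarrow> [D(d, d') \<otimes> F d, G d'] \<leftarrow> [F d', G d']\<close>, whose
  two maps \<open>f\<close> and \<open>g\<close> are the transposes of the two sides of the left wedge condition.
\<close>

lemma ex_hom_object: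
  fixes u :: "'u itself"
  assumes u: "universe u" and complete: "small_complete u V"
    and D: "is_vcat V D" and small: "small u (VObj D)" and F: "typed_functor D F" and G: "typed_functor D G"
  shows "\<exists>E \<pi>. is_hom_object V D F G E \<pi>"
proof -
  let ?M = "\<lambda>d. IHom V (VFObj F d) (VFObj G d)"
  let ?N = "\<lambda>(d, d'). IHom V (VHom D d d' \<otimes> VFObj F d) (VFObj G d')"
  define \<epsilon> where "\<epsilon> d = luncurry (VFObj F d) (VFObj G d) (Ident V (?M d))" for d
  define f where "f = (\<lambda>(d, d'). lcurry (?M d) (VHom D d d' \<otimes> VFObj F d) (VFObj G d')
    (act G d d' \<cdot> (Ident V (VHom D d d') \<odot> \<epsilon> d) \<cdot> Assoc V (VHom D d d') (VFObj F d) (?M d)))"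
  define g where "g = (\<lambda>(d, d'). lcurry (?M d') (VHom D d d' \<otimes> VFObj F d) (VFObj G d')
    (\<epsilon> d' \<cdot> (act F d d' \<odot> Ident V (?M d'))))"
  have o: "VFObj F d \<in> Obj V" "VFObj G d \<in> Obj V" if "d \<in> VObj D" for d
    using F G that by (simp_all add: typed_functor_def)
  have \<epsilon>: "\<epsilon> d \<in> Arr V" "Dom V (\<epsilon> d) = VFObj F d \<otimes> ?M d" "Cod V (\<epsilon> d) = VFObj G d" if "d \<in> VObj D" for d
    using o[OF that] by (simp_all add: \<epsilon>_def)
  have fg: "f (d, d') \<in> hom V (?M d) (?N (d, d'))" "g (d, d') \<in> hom V (?M d') (?N (d, d'))"
    "luncurry (VHom D d d' \<otimes> VFObj F d) (VFObj G d') (f (d, d')) =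
      act G d d' \<cdot> (Ident V (VHom D d d') \<odot> \<epsilon> d) \<cdot> Assoc V (VHom D d d') (VFObj F d) (?M d)"
    "luncurry (VHom D d d' \<otimes> VFObj F d) (VFObj G d') (g (d, d')) = \<epsilon> d' \<cdot> (act F d d' \<odot> Ident V (?M d'))"
    if d: "d \<in> VObj D" "d' \<in> VObj D" for d d'
  proof -
    have X: "VHom D d d' \<otimes> VFObj F d \<in> Obj V" "VFObj G d' \<in> Obj V" "?M d \<in> Obj V" "?M d' \<in> Obj V"
      using D d o by simp_all
    have 1: "act G d d' \<cdot> (Ident V (VHom D d d') \<odot> \<epsilon> d) \<cdot> Assoc V (VHom D d d') (VFObj F d) (?M d)
        \<in> hom V ((VHom D d d' \<otimes> VFObj F d) \<otimes> ?M d) (VFObj G d')"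
      and 2: "\<epsilon> d' \<cdot> (act F d d' \<odot> Ident V (?M d')) \<in> hom V ((VHom D d d' \<otimes> VFObj F d) \<otimes> ?M d') (VFObj G d')"
      using d D F G o \<epsilon> by (simp_all add: in_hom)
    show "f (d, d') \<in> hom V (?M d) (?N (d, d'))" "g (d, d') \<in> hom V (?M d') (?N (d, d'))"
      "luncurry (VHom D d d' \<otimes> VFObj F d) (VFObj G d') (f (d, d')) =
        act G d d' \<cdot> (Ident V (VHom D d d') \<odot> \<epsilon> d) \<cdot> Assoc V (VHom D d d') (VFObj F d) (?M d)"
      "luncurry (VHom D d d' \<otimes> VFObj F d) (VFObj G d') (g (d, d')) = \<epsilon> d' \<cdot> (act F d d' \<odot> Ident V (?M d'))"
      using luncurry_lcurry[OF X(1,2,3) 1] luncurry_lcurry[OF X(1,2,4) 2] by (simp_all add: f_def g_def)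
  qed
  have wedge: "f (d, d') \<cdot> \<pi> d = g (d, d') \<cdot> \<pi> d' \<longleftrightarrow>
        act G d d' \<cdot> (Ident V (VHom D d d') \<odot> luncurry (VFObj F d) (VFObj G d) (\<pi> d)) \<cdot>
          Assoc V (VHom D d d') (VFObj F d) E =
        luncurry (VFObj F d') (VFObj G d') (\<pi> d') \<cdot> (act F d d' \<odot> Ident V E)"
    if d: "d \<in> VObj D" "d' \<in> VObj D" and E: "E \<in> Obj V"
      and \<pi>: "\<forall>d\<in>VObj D. \<pi> d \<in> hom V E (?M d)" for d d' E \<pi>
  proof -
    have arr: "\<pi> d \<in> Arr V" "Dom V (\<pi> d) = E" "Cod V (\<pi> d) = ?M d" "\<pi> d' \<in> Arr V" "Dom V (\<pi> d') = E" "Cod V (\<pi> d') = ?M d'"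
      using \<pi> d by (auto simp: in_hom)
    have fg_arr: "f (d, d') \<in> Arr V" "Dom V (f (d, d')) = ?M d" "Cod V (f (d, d')) = ?N (d, d')"
      "g (d, d') \<in> Arr V" "Dom V (g (d, d')) = ?M d'" "Cod V (g (d, d')) = ?N (d, d')"
      using fg(1,2)[OF d] by (simp_all add: in_hom)
    have l: "luncurry (VFObj F d) (VFObj G d) (\<pi> d) = \<epsilon> d \<cdot> (Ident V (VFObj F d) \<odot> \<pi> d)" 
      using uncurry_comp(2)[of "VFObj F d" "VFObj G d" "Ident V (?M d)" "\<pi> d"] arr o d by (simp add: \<epsilon>_def)
    have l': "luncurry (VFObj F d') (VFObj G d') (\<pi> d') = \<epsilon> d' \<cdot> (Ident V (VFObj F d') \<odot> \<pi> d')" 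
      using uncurry_comp(2)[of "VFObj F d'" "VFObj G d'" "Ident V (?M d')" "\<pi> d'"] arr o d by (simp add: \<epsilon>_def)
    have X: "VHom D d d' \<otimes> VFObj F d \<in> Obj V" "VFObj G d' \<in> Obj V" "VHom D d d' \<in> Obj V"
      using D d o by simp_all
    have "luncurry (VHom D d d' \<otimes> VFObj F d) (VFObj G d') (f (d, d') \<cdot> \<pi> d) =
        act G d d' \<cdot> (Ident V (VHom D d d') \<odot> luncurry (VFObj F d) (VFObj G d) (\<pi> d)) \<cdot>
          Assoc V (VHom D d d') (VFObj F d) E"
      using arr fg_arr o d D F G \<epsilon> X E by (simp add: uncurry_comp fg l Assoc_natural_Ident)
    moreover have "luncurry (VHom D d d' \<otimes> VFObj F d) (VFObj G d') (g (d, d') \<cdot> \<pi> d') =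
        luncurry (VFObj F d') (VFObj G d') (\<pi> d') \<cdot> (act F d d' \<odot> Ident V E)"
      using arr fg_arr o d D F G \<epsilon> X E by (simp add: uncurry_comp fg l')
    moreover have "f (d, d') \<cdot> \<pi> d \<in> hom V E (?N (d, d'))" "g (d, d') \<cdot> \<pi> d' \<in> hom V E (?N (d, d'))"
      using arr fg_arr by (simp_all add: in_hom)
    ultimately show ?thesis
      using luncurry_cancel[OF X(1,2), of "f (d, d') \<cdot> \<pi> d" E "g (d, d') \<cdot> \<pi> d'"] by auto
  qed
  have iff: "is_hom_wedge V D F G E \<pi> \<longleftrightarrow> E \<in> Obj V \<and> (\<forall>d\<in>VObj D. \<pi> d \<in> hom V E (?M d)) \<and>
      (\<forall>y\<in>VObj D \<times> VObj D. f y \<cdot> \<pi> (fst y) = g y \<cdot> \<pi> (snd y))" for E \<pi>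
  proof (cases "E \<in> Obj V \<and> (\<forall>d\<in>VObj D. \<pi> d \<in> hom V E (?M d))")
    case True
    then have "\<forall>d\<in>VObj D. luncurry (VFObj F d) (VFObj G d) (\<pi> d) \<in> hom V (VFObj F d \<otimes> E) (VFObj G d)"
      using o by (simp add: in_hom)
    moreover note wedge[OF _ _ conjunct1[OF True] conjunct2[OF True]]
    ultimately show ?thesis
      using True unfolding hom_wedge_iff[OF D F G] left_wedge_def by auto
  qed (auto simp: is_hom_wedge_def)
  have "\<exists>L p. L \<in> Obj V \<and> (\<forall>d\<in>VObj D. p d \<in> hom V L (?M d)) \<and>
    (\<forall>y\<in>VObj D \<times> VObj D. f y \<cdot> p (fst y) = g y \<cdot> p (snd y)) \<and>
    (\<forall>W r. W \<in> Obj V \<and> (\<forall>d\<in>VObj D. r d \<in> hom V W (?M d)) \<and>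
       (\<forall>y\<in>VObj D \<times> VObj D. f y \<cdot> r (fst y) = g y \<cdot> r (snd y)) \<longrightarrow>
       (\<exists>!h. h \<in> hom V W L \<and> (\<forall>d\<in>VObj D. p d \<cdot> h = r d)))"
    using fg D o by (intro ex_joint_equalizer[OF u complete category small small_Times[OF u small small], where N = ?N]) auto
  then show ?thesis
    unfolding is_hom_object_def iff by (simp only: conj_assoc) 
qed


text \<open>
  In \<open>V\<close> as a \<open>V\<close>-category, composition of names is composition of maps. This translates the
  definition of shrinkable morphisms into statements about uncurried maps.
\<close>

lemma self_post_comp:
  assumes p: "p \<in> hom V Y Z" and X [simp]: "X \<in> Obj V" and g: "g \<in> hom V E (IHom V X Y)"
  shows "post_comp V (self_vcat V) X Y Z (name_of V p) \<in> hom V (IHom V X Y) (IHom V X Z)"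
    and "runcurry X Z (post_comp V (self_vcat V) X Y Z (name_of V p) \<cdot> g) = p \<cdot> runcurry X Y g"
    and "luncurry X Z (post_comp V (self_vcat V) X Y Z (name_of V p) \<cdot> g) = p \<cdot> luncurry X Y g"
proof -
  have p': "p \<in> Arr V" "Dom V p = Y" "Cod V p = Z" and [simp]: "Y \<in> Obj V" "Z \<in> Obj V"
    and g': "g \<in> Arr V" "Dom V g = E" "Cod V g = IHom V X Y" and E [simp]: "E \<in> Obj V"
    using p g by (auto simp: in_hom)
  note n = name_of[OF p]
  then have n': "name_of V p \<in> Arr V" "Dom V (name_of V p) = Unit V" "Cod V (name_of V p) = IHom V Y Z"
    by (simp_all add: in_hom)
  have id: "Ident V (IHom V X Y) \<in> hom V (IHom V X Y) (IHom V X Y)"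
    by (simp add: in_hom)
  let ?c = "VComp (self_vcat V) X Y Z \<cdot> (name_of V p \<odot> Ident V (IHom V X Y))"
  let ?h = "post_comp V (self_vcat V) X Y Z (name_of V p)"
  note c = runcurry_self_comp[OF X \<open>Y \<in> Obj V\<close> \<open>Z \<in> Obj V\<close> n(1) id]
  have h: "?h = ?c \<cdot> inv_arr V (LUnit V (IHom V X Y))"
    using self_vcomp(1)[of X Y Z] n' by (simp add: post_comp_def self_vcat_def in_hom)
  show h_hom: "?h \<in> hom V (IHom V X Y) (IHom V X Z)"
    unfolding h using c(1) by (auto intro!: comp_in_hom simp: in_hom)
  have "runcurry X Z ?h = (p \<cdot> LUnit V Y \<cdot> (Ident V (Unit V) \<odot> Ev V X Y) \<cdot> Assoc V (Unit V) (IHom V X Y) X) \<cdot>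
      (inv_arr V (LUnit V (IHom V X Y)) \<odot> Ident V X)"
    unfolding h using c p' n(2) by (simp add: uncurry_comp in_hom) (simp add: runcurry_def)
  also have "\<dots> = p \<cdot> (LUnit V Y \<cdot> (Ident V (Unit V) \<odot> Ev V X Y)) \<cdot> Assoc V (Unit V) (IHom V X Y) X \<cdot>
      (inv_arr V (LUnit V (IHom V X Y)) \<odot> Ident V X)"
    using p' by simp
  also have "\<dots> = p \<cdot> Ev V X Y \<cdot> (LUnit V (IHom V X Y \<otimes> X) \<cdot> Assoc V (Unit V) (IHom V X Y) X) \<cdot>
      (inv_arr V (LUnit V (IHom V X Y)) \<odot> Ident V X)"
    using p' LUnit_natural(1)[of "Ev V X Y" Y] by simp
  also have "\<dots> = p \<cdot> Ev V X Y"
    using p' by (simp add: LUnit_tensor)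
  finally have run: "runcurry X Z ?h = p \<cdot> Ev V X Y" .
  then show r: "runcurry X Z (?h \<cdot> g) = p \<cdot> runcurry X Y g"
    using h_hom g' p' by (simp add: uncurry_comp in_hom) (simp add: runcurry_def)
  have "?h \<cdot> g \<in> hom V E (IHom V X Z)"
    using h_hom g comp_in_hom by blast
  then have "luncurry X Z (?h \<cdot> g) \<cdot> Symm V E X = (p \<cdot> luncurry X Y g) \<cdot> Symm V E X"
    and "luncurry X Z (?h \<cdot> g) \<in> Arr V" "Dom V (luncurry X Z (?h \<cdot> g)) = X \<otimes> E"
    using r runcurry_eq[of X Z "?h \<cdot> g" E] runcurry_eq[of X Y g E] g g' p' by (simp_all add: in_hom)
  then show "luncurry X Z (?h \<cdot> g) = p \<cdot> luncurry X Y g"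
    using g' p' by - (rule iso_cancel_right[of "Symm V E X"], simp_all)
qed

lemma self_el_comp:
  assumes f: "f \<in> hom V X Y" and g: "g \<in> hom V Y Z"
  shows "el_comp V (self_vcat V) X Y Z (name_of V g) (name_of V f) = name_of V (g \<cdot> f)"
proof -
  have arr: "f \<in> Arr V" "Dom V f = X" "Cod V f = Y" "g \<in> Arr V" "Dom V g = Y" "Cod V g = Z"
    and o [simp]: "X \<in> Obj V" "Y \<in> Obj V" "Z \<in> Obj V"
    using f g by (auto simp: in_hom)
  note n = name_of[OF f] name_of[OF g] name_of[OF comp_in_hom[OF f g]]
  then have n': "name_of V f \<in> Arr V" "Dom V (name_of V f) = Unit V" "Cod V (name_of V f) = IHom V X Y"
    "name_of V g \<in> Arr V" "Dom V (name_of V g) = Unit V" "Cod V (name_of V g) = IHom V Y Z"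
    by (simp_all add: in_hom)
  note c = runcurry_self_comp[OF o n(3) n(1)]
  let ?c = "VComp (self_vcat V) X Y Z \<cdot> (name_of V g \<odot> name_of V f)"
  have e: "el_comp V (self_vcat V) X Y Z (name_of V g) (name_of V f) = ?c \<cdot> inv_arr V (LUnit V (Unit V))"
    using self_vcomp(1)[of X Y Z] n' by (simp add: el_comp_def in_hom)
  have "runcurry X Z (?c \<cdot> inv_arr V (LUnit V (Unit V))) = 
      (g \<cdot> LUnit V Y \<cdot> (Ident V (Unit V) \<odot> (f \<cdot> LUnit V X)) \<cdot> Assoc V (Unit V) (Unit V) X) \<cdot>
      (inv_arr V (LUnit V (Unit V)) \<odot> Ident V X)"
    using c n arr by (simp add: uncurry_comp in_hom)
  also have "\<dots> = g \<cdot> (LUnit V Y \<cdot> (Ident V (Unit V) \<odot> (f \<cdot> LUnit V X))) \<cdot> Assoc V (Unit V) (Unit V) X \<cdot>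
      (inv_arr V (LUnit V (Unit V)) \<odot> Ident V X)"
    using arr by simp
  also have "\<dots> = g \<cdot> f \<cdot> LUnit V X \<cdot> (LUnit V (Unit V \<otimes> X) \<cdot> Assoc V (Unit V) (Unit V) X) \<cdot>
      (inv_arr V (LUnit V (Unit V)) \<odot> Ident V X)"
    using arr LUnit_natural(1)[of "f \<cdot> LUnit V X" Y] by simp
  also have "\<dots> = g \<cdot> f \<cdot> LUnit V X"
    using arr by (simp add: LUnit_tensor)
  finally have "runcurry X Z (?c \<cdot> inv_arr V (LUnit V (Unit V))) = runcurry X Z (name_of V (g \<cdot> f))"
    using n arr by simp
  moreover have "?c \<cdot> inv_arr V (LUnit V (Unit V)) \<in> hom V (Unit V) (IHom V X Z)"
    using c(1) by (auto intro!: comp_in_hom simp: in_hom)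
  ultimately show ?thesis
    unfolding e using n(5) by (metis o(1,3) runcurry_cancel)
qed

lemma left_wedge_precomp:
  assumes D: "is_vcat V D" and F: "typed_functor D F" and G: "typed_functor D G"
    and w: "left_wedge D F G E \<rho>" and x: "x \<in> hom V E' E"
  shows "left_wedge D F G E' (\<lambda>d. \<rho> d \<cdot> (Ident V (VFObj F d) \<odot> x))"
  unfolding left_wedge_def
proof (intro conjI ballI)
  have x': "x \<in> Arr V" "Dom V x = E'" "Cod V x = E" "E \<in> Obj V" "E' \<in> Obj V"
    using x by (auto simp: in_hom)
  show "E' \<in> Obj V"
    by (rule x')
  have o: "VFObj F d \<in> Obj V" "VFObj G d \<in> Obj V" if "d \<in> VObj D" for d
    using F G that by (simp_all add: typed_functor_def)
  have \<rho>: "\<rho> d \<in> Arr V" "Dom V (\<rho> d) = VFObj F d \<otimes> E" "Cod V (\<rho> d) = VFObj G d" if "d \<in> VObj D" for d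
    using w that by (simp_all add: left_wedge_def in_hom)
  show "\<rho> d \<cdot> (Ident V (VFObj F d) \<odot> x) \<in> hom V (VFObj F d \<otimes> E') (VFObj G d)" if "d \<in> VObj D" for d
    using that \<rho> x' o by (simp add: in_hom)
  fix d d' assume d: "d \<in> VObj D" "d' \<in> VObj D"
  let ?X = "VHom D d d'"
  have X: "?X \<in> Obj V"
    using D d by simp
  have "act G d d' \<cdot> (Ident V ?X \<odot> (\<rho> d \<cdot> (Ident V (VFObj F d) \<odot> x))) \<cdot> Assoc V ?X (VFObj F d) E' =
      act G d d' \<cdot> (Ident V ?X \<odot> \<rho> d) \<cdot> ((Ident V ?X \<odot> (Ident V (VFObj F d) \<odot> x)) \<cdot> Assoc V ?X (VFObj F d) E')"
    using d F G \<rho> x' o X by simp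
  also have "\<dots> = act G d d' \<cdot> (Ident V ?X \<odot> \<rho> d) \<cdot> (Assoc V ?X (VFObj F d) E \<cdot> (Ident V (?X \<otimes> VFObj F d) \<odot> x))"
    using d x' o X by (subst Assoc_natural_Ident) simp_all
  also have "\<dots> = (act G d d' \<cdot> (Ident V ?X \<odot> \<rho> d) \<cdot> Assoc V ?X (VFObj F d) E) \<cdot> (Ident V (?X \<otimes> VFObj F d) \<odot> x)"
    using d F G \<rho> x' o X by simp
  also have "\<dots> = (\<rho> d' \<cdot> (act F d d' \<odot> Ident V E)) \<cdot> (Ident V (?X \<otimes> VFObj F d) \<odot> x)"
    using w d unfolding left_wedge_def by metis
  also have "\<dots> = (\<rho> d' \<cdot> (Ident V (VFObj F d') \<odot> x)) \<cdot> (act F d d' \<odot> Ident V E')"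
    using d F G \<rho> x' o X by simp
  finally show "act G d d' \<cdot> (Ident V ?X \<odot> (\<rho> d \<cdot> (Ident V (VFObj F d) \<odot> x))) \<cdot> Assoc V ?X (VFObj F d) E' =
      (\<rho> d' \<cdot> (Ident V (VFObj F d') \<odot> x)) \<cdot> (act F d d' \<odot> Ident V E')" .
qed

definition natural_family :: "('d, 'o, 'a) vcat \<Rightarrow> ('d, 'o, 'a) vfun \<Rightarrow> ('d, 'o, 'a) vfun \<Rightarrow> ('d \<Rightarrow> 'a) \<Rightarrow> bool" where
  "natural_family D F G \<tau> \<longleftrightarrow>
     (\<forall>d\<in>VObj D. \<tau> d \<in> hom V (VFObj F d) (VFObj G d)) \<and>
     (\<forall>d\<in>VObj D. \<forall>d'\<in>VObj D. \<tau> d' \<cdot> act F d d' = act G d d' \<cdot> (Ident V (VHom D d d') \<odot> \<tau> d))"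

lemma left_wedge_postcomp:
  assumes D: "is_vcat V D" and F: "typed_functor D F" and G: "typed_functor D G" and H: "typed_functor D H"
    and w: "left_wedge D F G E \<rho>" and \<tau>: "natural_family D G H \<tau>"
  shows "left_wedge D F H E (\<lambda>d. \<tau> d \<cdot> \<rho> d)"
  unfolding left_wedge_def
proof (intro conjI ballI)
  show E: "E \<in> Obj V"
    using w by (simp add: left_wedge_def)
  have o: "VFObj F d \<in> Obj V" "VFObj G d \<in> Obj V" "VFObj H d \<in> Obj V" if "d \<in> VObj D" for d
    using F G H that by (simp_all add: typed_functor_def)
  have \<rho>: "\<rho> d \<in> Arr V" "Dom V (\<rho> d) = VFObj F d \<otimes> E" "Cod V (\<rho> d) = VFObj G d"
      "\<tau> d \<in> Arr V" "Dom V (\<tau> d) = VFObj G d" "Cod V (\<tau> d) = VFObj H d" if "d \<in> VObj D" for d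
    using w \<tau> that by (simp_all add: left_wedge_def natural_family_def in_hom)
  show "\<tau> d \<cdot> \<rho> d \<in> hom V (VFObj F d \<otimes> E) (VFObj H d)" if "d \<in> VObj D" for d
    using that \<rho> by (simp add: in_hom)
  fix d d' assume d: "d \<in> VObj D" "d' \<in> VObj D"
  let ?X = "VHom D d d'"
  have X: "?X \<in> Obj V"
    using D d by simp
  have "act H d d' \<cdot> (Ident V ?X \<odot> (\<tau> d \<cdot> \<rho> d)) \<cdot> Assoc V ?X (VFObj F d) E =
      (act H d d' \<cdot> (Ident V ?X \<odot> \<tau> d)) \<cdot> (Ident V ?X \<odot> \<rho> d) \<cdot> Assoc V ?X (VFObj F d) E"
    using d G H \<rho> o X E by simp
  also have "\<dots> = (\<tau> d' \<cdot> act G d d') \<cdot> (Ident V ?X \<odot> \<rho> d) \<cdot> Assoc V ?X (VFObj F d) E"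
    using \<tau> d unfolding natural_family_def by metis
  also have "\<dots> = \<tau> d' \<cdot> (act G d d' \<cdot> (Ident V ?X \<odot> \<rho> d) \<cdot> Assoc V ?X (VFObj F d) E)"
    using d G \<rho> o X E by simp
  also have "\<dots> = \<tau> d' \<cdot> (\<rho> d' \<cdot> (act F d d' \<odot> Ident V E))"
    using w d unfolding left_wedge_def by metis
  finally show "act H d d' \<cdot> (Ident V ?X \<odot> (\<tau> d \<cdot> \<rho> d)) \<cdot> Assoc V ?X (VFObj F d) E =
      (\<tau> d' \<cdot> \<rho> d') \<cdot> (act F d d' \<odot> Ident V E)"
    using d F \<rho> E by simp
qed

lemma natural_family_left_wedge:
  assumes D: "is_vcat V D" and F: "typed_functor D F" and G: "typed_functor D G"
    and \<tau>: "natural_family D F G \<tau>"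
  shows "left_wedge D F G (Unit V) (\<lambda>d. \<tau> d \<cdot> RUnit V (VFObj F d))"
proof (rule left_wedge_postcomp[OF D F F G _ \<tau>])
  have o: "VFObj F d \<in> Obj V" "VFObj G d \<in> Obj V" if "d \<in> VObj D" for d
    using F G that by (simp_all add: typed_functor_def)
  show "left_wedge D F F (Unit V) (\<lambda>d. RUnit V (VFObj F d))"
    unfolding left_wedge_def
  proof (intro conjI ballI)
    show "RUnit V (VFObj F d) \<in> hom V (VFObj F d \<otimes> Unit V) (VFObj F d)" if "d \<in> VObj D" for d
      using o that by (simp add: in_hom)
    show "act F d d' \<cdot> (Ident V (VHom D d d') \<odot> RUnit V (VFObj F d)) \<cdot> Assoc V (VHom D d d') (VFObj F d) (Unit V) =
      RUnit V (VFObj F d') \<cdot> (act F d d' \<odot> Ident V (Unit V))" if "d \<in> VObj D" "d' \<in> VObj D" for d d'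
      using o that D F by (simp add: RUnit_tensor LUnit_natural)
  qed simp
qed

section \<open>Weighted limits and powers in uncurried form\<close>

text \<open>
  The universal properties are restated for families \<open>F d \<otimes> E \<rightarrow> G d\<close> and for composites of families of
  arrows. In this form they can be combined with associativity of composition directly.
\<close>

lemma hom_object_universal:
  assumes D: "is_vcat V D" and F: "typed_functor D F" and G: "typed_functor D G"
    and E: "is_hom_object V D F G E \<pi>"
  defines "\<rho> \<equiv> \<lambda>d. luncurry (VFObj F d) (VFObj G d) (\<pi> d)"
  shows "left_wedge D F G E \<rho>"
    and "left_wedge D F G E' \<sigma> \<Longrightarrow>
      \<exists>t. t \<in> hom V E' E \<and> (\<forall>d\<in>VObj D. \<rho> d \<cdot> (Ident V (VFObj F d) \<odot> t) = \<sigma> d)"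
    and "s \<in> hom V E' E \<Longrightarrow> t \<in> hom V E' E \<Longrightarrow>
      (\<And>d. d \<in> VObj D \<Longrightarrow> \<rho> d \<cdot> (Ident V (VFObj F d) \<odot> s) = \<rho> d \<cdot> (Ident V (VFObj F d) \<odot> t)) \<Longrightarrow> s = t"
proof -
  have \<pi>: "\<pi> d \<in> hom V E (IHom V (VFObj F d) (VFObj G d))" if "d \<in> VObj D" for d
    using E that by (simp add: is_hom_object_def is_hom_wedge_def)
  note * = hom_object_iff[where E = E and \<pi> = \<pi>, OF D F G \<pi>, THEN iffD1, OF _ E]
  show w: "left_wedge D F G E \<rho>"
    using * unfolding \<rho>_def by blast
  have univ: "\<exists>!t. t \<in> hom V E' E \<and> (\<forall>d\<in>VObj D. \<rho> d \<cdot> (Ident V (VFObj F d) \<odot> t) = \<sigma> d)"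
    if "left_wedge D F G E' \<sigma>" for E' \<sigma>
    using * that unfolding \<rho>_def by blast
  then show "\<exists>t. t \<in> hom V E' E \<and> (\<forall>d\<in>VObj D. \<rho> d \<cdot> (Ident V (VFObj F d) \<odot> t) = \<sigma> d)"
    if "left_wedge D F G E' \<sigma>" for E' \<sigma>
    using that by blast
  show "s = t" if "s \<in> hom V E' E" "t \<in> hom V E' E"
    "\<And>d. d \<in> VObj D \<Longrightarrow> \<rho> d \<cdot> (Ident V (VFObj F d) \<odot> s) = \<rho> d \<cdot> (Ident V (VFObj F d) \<odot> t)"
    using univ[OF left_wedge_precomp[OF D F G w that(1)]] that by (metis (no_types, lifting))
qed

lemma induced:
  assumes C: "is_vcat V C" and o: "b \<in> VObj C" "l \<in> VObj C" "c \<in> VObj C" and \<kappa>: "\<kappa> \<in> hom V X (VHom C l b)"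
  shows "induced V C X b l \<kappa> c \<in> hom V (VHom C c l) (IHom V X (VHom C c b))"
    and "luncurry X (VHom C c b) (induced V C X b l \<kappa> c) = VComp C c l b \<cdot> (\<kappa> \<odot> Ident V (VHom C c l))"
proof -
  have k: "\<kappa> \<in> Arr V" "Dom V \<kappa> = X" "Cod V \<kappa> = VHom C l b" "X \<in> Obj V"
    using \<kappa> by (auto simp: in_hom)
  have h: "VComp C c l b \<cdot> (\<kappa> \<odot> Ident V (VHom C c l)) \<in> hom V (X \<otimes> VHom C c l) (VHom C c b)"
    using C o k by (simp add: in_hom)
  have "induced V C X b l \<kappa> c = lcurry (VHom C c l) X (VHom C c b) (VComp C c l b \<cdot> (\<kappa> \<odot> Ident V (VHom C c l)))"
    using C o k by (simp add: induced_def lcurry_def)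
  then show "induced V C X b l \<kappa> c \<in> hom V (VHom C c l) (IHom V X (VHom C c b))"
    and "luncurry X (VHom C c b) (induced V C X b l \<kappa> c) = VComp C c l b \<cdot> (\<kappa> \<odot> Ident V (VHom C c l))"
    using luncurry_lcurry[OF _ _ _ h] C o k by simp_all
qed

lemma induced_comp:
  assumes C: "is_vcat V C" and o: "b \<in> VObj C" "l \<in> VObj C" "c \<in> VObj C" and \<kappa>: "\<kappa> \<in> hom V X (VHom C l b)"
    and t: "t \<in> hom V E (VHom C c l)"
  shows "luncurry X (VHom C c b) (induced V C X b l \<kappa> c \<cdot> t) = VComp C c l b \<cdot> (\<kappa> \<odot> t)"
    and "luncurry X (VHom C c b) (induced V C X b l \<kappa> c) \<cdot> (Ident V X \<odot> t) = VComp C c l b \<cdot> (\<kappa> \<odot> t)"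
proof -
  have k: "\<kappa> \<in> Arr V" "Dom V \<kappa> = X" "Cod V \<kappa> = VHom C l b" "X \<in> Obj V"
    "t \<in> Arr V" "Dom V t = E" "Cod V t = VHom C c l"
    using \<kappa> t by (auto simp: in_hom)
  show "luncurry X (VHom C c b) (induced V C X b l \<kappa> c) \<cdot> (Ident V X \<odot> t) = VComp C c l b \<cdot> (\<kappa> \<odot> t)"
    unfolding induced(2)[OF C o \<kappa>] using k C o by simp
  then show "luncurry X (VHom C c b) (induced V C X b l \<kappa> c \<cdot> t) = VComp C c l b \<cdot> (\<kappa> \<odot> t)"
    using induced(1)[OF C o \<kappa>] k C o by (simp add: uncurry_comp in_hom)
qed

lemma wlimit:
  assumes C: "is_vcat V C" and D: "is_vcat V D" and Q: "typed_functor D Q" and S: "is_vfunctor V D C S"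
    and lim: "is_wlimit V D C Q S l \<mu>"
  shows "l \<in> VObj C"
    and "d \<in> VObj D \<Longrightarrow> \<mu> d \<in> hom V (VFObj Q d) (VHom C l (VFObj S d))"
    and "d \<in> VObj D \<Longrightarrow> d' \<in> VObj D \<Longrightarrow>
      \<mu> d' \<cdot> act Q d d' = VComp C l (VFObj S d) (VFObj S d') \<cdot> (VFArr S d d' \<odot> \<mu> d)"
    and "c \<in> VObj C \<Longrightarrow> left_wedge D Q (vfun_comp V (hom_from V C c) S) E \<rho> \<Longrightarrow>
      \<exists>t. t \<in> hom V E (VHom C c l) \<and> (\<forall>d\<in>VObj D. VComp C c l (VFObj S d) \<cdot> (\<mu> d \<odot> t) = \<rho> d)"
    and "c \<in> VObj C \<Longrightarrow> s \<in> hom V E (VHom C c l) \<Longrightarrow> t \<in> hom V E (VHom C c l) \<Longrightarrow>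
      (\<And>d. d \<in> VObj D \<Longrightarrow> VComp C c l (VFObj S d) \<cdot> (\<mu> d \<odot> s) = VComp C c l (VFObj S d) \<cdot> (\<mu> d \<odot> t)) \<Longrightarrow>
      s = t"
proof -
  show \<mu>: "\<mu> d \<in> hom V (VFObj Q d) (VHom C l (VFObj S d))" if "d \<in> VObj D" for d
    using lim that by (simp add: is_wlimit_def)
  have S': "VFObj S d \<in> VObj C" if "d \<in> VObj D" for d
    using vfunctor_simps(1)[OF S] that by blast
  have l: "l \<in> VObj C"
    using lim by (simp add: is_wlimit_def)
  then show "l \<in> VObj C" .
  note h = hom_from_comp[OF C S D]
  have nat: "is_vnat V D (self_vcat V) Q (vfun_comp V (hom_from V C l) S) (\<lambda>d. name_of V (\<mu> d))"
    using lim by (simp add: is_wlimit_def)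
  have D': "VHom D d d' \<in> Obj V" if "d \<in> VObj D" "d' \<in> VObj D" for d d'
    using D that by simp
  have \<mu>': "\<mu> d \<in> hom V (VFObj Q d) (VFObj (vfun_comp V (hom_from V C l) S) d)" if "d \<in> VObj D" for d
    using \<mu>[OF that] by (simp add: h(2)[OF l])
  have nat': "\<mu> d' \<cdot> act Q d d' = act (vfun_comp V (hom_from V C l) S) d d' \<cdot> (Ident V (VHom D d d') \<odot> \<mu> d)"
    if "d \<in> VObj D" "d' \<in> VObj D" for d d'
    using vnat_self_iff[OF D' Q h(1)[OF l] \<mu>', THEN iffD1, OF _ _ _ nat] that by blast
  show "\<mu> d' \<cdot> act Q d d' = VComp C l (VFObj S d) (VFObj S d') \<cdot> (VFArr S d d' \<odot> \<mu> d)"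
    if "d \<in> VObj D" "d' \<in> VObj D" for d d'
    using nat'[OF that] that \<mu>[of d] vfunctor_simps[OF S] C D S' l by (simp add: h(3)[OF l] in_hom)
  fix c assume c: "c \<in> VObj C"
  have E: "is_hom_object V D Q (vfun_comp V (hom_from V C c) S)
          (VHom C c l) (\<lambda>d. induced V C (VFObj Q d) (VFObj S d) l (\<mu> d) c)"
    using lim c by (simp add: is_wlimit_def)
  note u = hom_object_universal[OF D Q h(1)[OF c] E, unfolded h(2)[OF c]]
  have comp: "luncurry (VFObj Q d) (VHom C c (VFObj S d)) (induced V C (VFObj Q d) (VFObj S d) l (\<mu> d) c) \<cdot> (Ident V (VFObj Q d) \<odot> t)
    = VComp C c l (VFObj S d) \<cdot> (\<mu> d \<odot> t)" if "d \<in> VObj D" "t \<in> hom V E (VHom C c l)" for d t E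
    using induced_comp(2)[OF C S'[OF that(1)] l c \<mu>[OF that(1)] that(2)] .
  show "\<exists>t. t \<in> hom V E (VHom C c l) \<and> (\<forall>d\<in>VObj D. VComp C c l (VFObj S d) \<cdot> (\<mu> d \<odot> t) = \<rho> d)"
    if "left_wedge D Q (vfun_comp V (hom_from V C c) S) E \<rho>" for E \<rho>
    using u(2)[OF that] comp by metis
  show "s = t" if "s \<in> hom V E (VHom C c l)" "t \<in> hom V E (VHom C c l)"
      "\<And>d. d \<in> VObj D \<Longrightarrow> VComp C c l (VFObj S d) \<cdot> (\<mu> d \<odot> s) = VComp C c l (VFObj S d) \<cdot> (\<mu> d \<odot> t)" for s t E
    using u(3)[OF that(1,2)] comp[OF _ that(1)] comp[OF _ that(2)] that(3) by metis
qed

lemma left_wedge_hom_from: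
  assumes C: "is_vcat V C" and D: "is_vcat V D" and Q: "typed_functor D Q" and S: "is_vfunctor V D C S"
    and c: "c \<in> VObj C" and E: "E \<in> Obj V"
    and \<rho>: "\<And>d. d \<in> VObj D \<Longrightarrow> \<rho> d \<in> hom V (VFObj Q d \<otimes> E) (VHom C c (VFObj S d))"
  shows "left_wedge D Q (vfun_comp V (hom_from V C c) S) E \<rho> \<longleftrightarrow>
    (\<forall>d\<in>VObj D. \<forall>d'\<in>VObj D.
      VComp C c (VFObj S d) (VFObj S d') \<cdot> (VFArr S d d' \<odot> \<rho> d) \<cdot> Assoc V (VHom D d d') (VFObj Q d) E =
      \<rho> d' \<cdot> (act Q d d' \<odot> Ident V E))"
proof -
  note h = hom_from_comp[OF C S D c]
  have "act (vfun_comp V (hom_from V C c) S) d d' \<cdot> (Ident V (VHom D d d') \<odot> \<rho> d) \<cdot> Assoc V (VHom D d d') (VFObj Q d) E =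
      VComp C c (VFObj S d) (VFObj S d') \<cdot> (VFArr S d d' \<odot> \<rho> d) \<cdot> Assoc V (VHom D d d') (VFObj Q d) E"
    if "d \<in> VObj D" "d' \<in> VObj D" for d d'
  proof -
    have "VFObj Q d \<in> Obj V"
      using Q that by (simp add: typed_functor_def)
    then show ?thesis
      using that \<rho>[of d] vfunctor_simps[OF S] C D c E by (simp add: h(3) in_hom)
  qed
  then show ?thesis
    unfolding left_wedge_def using \<rho> E by (simp add: h(2))
qed


text \<open>The universal property of the counit \<open>\<kappa> : X \<rightarrow> C(p, b)\<close> of a power.\<close>

definition exhibits_power :: "('c, 'o, 'a) vcat \<Rightarrow> 'o \<Rightarrow> 'c \<Rightarrow> 'c \<Rightarrow> 'a \<Rightarrow> bool" where
  "exhibits_power C X b p \<kappa> \<longleftrightarrow>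
     p \<in> VObj C \<and> \<kappa> \<in> hom V X (VHom C p b) \<and>
     (\<forall>c\<in>VObj C. \<forall>E\<in>Obj V. \<forall>\<rho>\<in>hom V (X \<otimes> E) (VHom C c b).
        \<exists>!t. t \<in> hom V E (VHom C c p) \<and> VComp C c p b \<cdot> (\<kappa> \<odot> t) = \<rho>)"

lemma induced_power:
  assumes C: "is_vcat V C" and b: "b \<in> VObj C" and X: "X \<in> Obj V" and p: "is_power V C X b p \<phi>"
    and \<kappa>: "\<kappa> \<in> hom V X (VHom C p b)" and \<phi>: "\<And>c. c \<in> VObj C \<Longrightarrow> \<phi> c = induced V C X b p \<kappa> c"
  shows "exhibits_power C X b p \<kappa>"
  unfolding exhibits_power_def
proof (intro conjI ballI)
  show p': "p \<in> VObj C"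
    using p by (simp add: is_power_def)
  fix c E \<rho>
  assume c: "c \<in> VObj C" and E: "E \<in> Obj V" and \<rho>: "\<rho> \<in> hom V (X \<otimes> E) (VHom C c b)"
  have iso: "is_iso V (\<phi> c)" and hom: "\<phi> c \<in> hom V (VHom C c p) (IHom V X (VHom C c b))"
    using p c by (simp_all add: is_power_def)
  have o: "VHom C c b \<in> Obj V"
    using C c b by simp
  have iff: "VComp C c p b \<cdot> (\<kappa> \<odot> t) = \<rho> \<longleftrightarrow> t = inv_arr V (\<phi> c) \<cdot> lcurry E X (VHom C c b) \<rho>"
    if t: "t \<in> hom V E (VHom C c p)" for t
  proof -
    note r = luncurry_lcurry[OF X o E \<rho>]
    have pt: "\<phi> c \<cdot> t \<in> hom V E (IHom V X (VHom C c b))"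
      using comp_in_hom[OF t hom] .
    have "VComp C c p b \<cdot> (\<kappa> \<odot> t) = luncurry X (VHom C c b) (\<phi> c \<cdot> t)"
      using induced_comp(1)[OF C b p' c \<kappa> t] \<phi>[OF c] by simp
    also have "\<dots> = \<rho> \<longleftrightarrow> \<phi> c \<cdot> t = lcurry E X (VHom C c b) \<rho>"
      using luncurry_cancel[OF X o pt r(1)] r(2) by auto
    also have "\<dots> \<longleftrightarrow> t = inv_arr V (\<phi> c) \<cdot> lcurry E X (VHom C c b) \<rho>"
    proof
      assume "\<phi> c \<cdot> t = lcurry E X (VHom C c b) \<rho>"
      then have "inv_arr V (\<phi> c) \<cdot> (\<phi> c \<cdot> t) = inv_arr V (\<phi> c) \<cdot> lcurry E X (VHom C c b) \<rho>"
        by simp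
      then show "t = inv_arr V (\<phi> c) \<cdot> lcurry E X (VHom C c b) \<rho>"
        using iso hom t by (simp add: in_hom)
    next
      assume "t = inv_arr V (\<phi> c) \<cdot> lcurry E X (VHom C c b) \<rho>"
      then show "\<phi> c \<cdot> t = lcurry E X (VHom C c b) \<rho>"
        using iso hom r(1) by (simp add: in_hom)
    qed
    finally show ?thesis .
  qed
  moreover have "inv_arr V (\<phi> c) \<cdot> lcurry E X (VHom C c b) \<rho> \<in> hom V E (VHom C c p)"
    using iso hom luncurry_lcurry(1)[OF X o E \<rho>] by (simp add: in_hom)
  ultimately show "\<exists>!t. t \<in> hom V E (VHom C c p) \<and> VComp C c p b \<cdot> (\<kappa> \<odot> t) = \<rho>"
    by metis
qed (rule \<kappa>)

text \<open>
  The Yoneda lemma for powers: by naturality between \<open>p\<close> and \<open>c\<close>, evaluated at the identity of \<open>p\<close>, the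
  isomorphism at \<open>c\<close> is composition with the counit.
\<close>

lemma power_counit:
  assumes C: "is_vcat V C" and b [simp]: "b \<in> VObj C" and X [simp]: "X \<in> Obj V" and p: "is_power V C X b p \<phi>"
  shows "power_counit V C X b p \<phi> \<in> hom V X (VHom C p b)"
    and "exhibits_power C X b p (power_counit V C X b p \<phi>)"
proof -
  note [simp] = C
  let ?I = "Unit V"
  let ?\<kappa> = "power_counit V C X b p \<phi>"
  have p' [simp]: "p \<in> VObj C"
    using p by (simp add: is_power_def)
  have \<phi>: "\<phi> c \<in> hom V (VHom C c p) (IHom V X (VHom C c b))" if "c \<in> VObj C" for c
    using p that by (simp add: is_power_def)
  let ?\<phi>1 = "\<phi> p \<cdot> VId C p"
  have \<phi>1: "?\<phi>1 \<in> hom V ?I (IHom V X (VHom C p b))"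
    using \<phi>[OF p'] by (simp add: in_hom)
  then have \<phi>1': "?\<phi>1 \<in> Arr V" "Dom V ?\<phi>1 = ?I" "Cod V ?\<phi>1 = IHom V X (VHom C p b)"
    by (auto simp: in_hom)
  have k: "?\<kappa> = runcurry X (VHom C p b) ?\<phi>1 \<cdot> inv_arr V (LUnit V X)"
    using \<phi>1' by (simp add: power_counit_def runcurry_def)
  then show \<kappa>: "?\<kappa> \<in> hom V X (VHom C p b)"
    using \<phi>1' by (simp add: in_hom)
  then have \<kappa>': "?\<kappa> \<in> Arr V" "Dom V ?\<kappa> = X" "Cod V ?\<kappa> = VHom C p b"
    by (auto simp: in_hom)
  have run1: "runcurry X (VHom C p b) ?\<phi>1 = ?\<kappa> \<cdot> LUnit V X"
    unfolding k using \<phi>1' by simp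
  let ?D = "op_vcat V C" and ?F = "hom_to V C p" and ?G = "vfun_comp V (hom_from V (self_vcat V) X) (hom_to V C b)"
  have hto: "VFArr (hom_to V C e) x y \<in> hom V (VHom C y x) (IHom V (VHom C x e) (VHom C y e))"
    "runcurry (VHom C x e) (VHom C y e) (VFArr (hom_to V C e) x y) = VComp C y x e \<cdot> Symm V (VHom C y x) (VHom C x e)"
    if "x \<in> VObj C" "y \<in> VObj C" "e \<in> VObj C" for x y e
    using that adjunct[of "VHom C x e" "VHom C y e" "VHom C y x" "VComp C y x e \<cdot> Symm V (VHom C y x) (VHom C x e)"]
    by (simp_all add: hom_to_def runcurry_def in_hom)
  have F: "typed_functor ?D ?F"
    using hto(1) by (simp add: typed_functor_def op_vcat_def) (simp add: hom_to_def)
  have hf: "VFArr (hom_from V (self_vcat V) X) Y Z \<in> hom V (IHom V Y Z) (IHom V (IHom V X Y) (IHom V X Z))"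
    "runcurry (IHom V X Y) (IHom V X Z) (VFArr (hom_from V (self_vcat V) X) Y Z) = VComp (self_vcat V) X Y Z"
    if "Y \<in> Obj V" "Z \<in> Obj V" for Y Z
    using that adjunct[of "IHom V X Y" "IHom V X Z" "IHom V Y Z" "VComp (self_vcat V) X Y Z"] self_vcomp(1)[OF X that]
    by (simp_all add: hom_from_def runcurry_def self_vcat_def)
  have G_eq: "VFObj ?G x = IHom V X (VHom C x b)"
    "VFArr ?G x y = VFArr (hom_from V (self_vcat V) X) (VHom C x b) (VHom C y b) \<cdot> VFArr (hom_to V C b) x y" for x y
    by (simp_all add: vfun_comp_def hom_from_def hom_to_def self_vcat_def)
  have G: "typed_functor ?D ?G"
    unfolding typed_functor_def G_eq using comp_in_hom[OF hto(1) hf(1)] by (simp add: op_vcat_def)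
  have "\<phi> c = induced V C X b p ?\<kappa> c" if c [simp]: "c \<in> VObj C" for c
  proof -
    let ?C = "VHom C c p"
    have fc: "\<phi> c \<in> Arr V" "Dom V (\<phi> c) = ?C" "Cod V (\<phi> c) = IHom V X (VHom C c b)"
      "\<phi> p \<in> Arr V" "Dom V (\<phi> p) = VHom C p p" "Cod V (\<phi> p) = IHom V X (VHom C p b)"
      using \<phi> by (auto simp: in_hom)
    have h: "VFArr (hom_to V C b) p c \<in> hom V ?C (IHom V (VHom C p b) (VHom C c b))"
      using hto(1) by simp
    then have h': "VFArr (hom_to V C b) p c \<in> Arr V" "Dom V (VFArr (hom_to V C b) p c) = ?C"
      "Cod V (VFArr (hom_to V C b) p c) = IHom V (VHom C p b) (VHom C c b)"
      by (simp_all add: in_hom)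
    have "\<forall>d\<in>VObj ?D. \<forall>d'\<in>VObj ?D. \<phi> d' \<cdot> act ?F d d' = act ?G d d' \<cdot> (Ident V (VHom ?D d d') \<odot> \<phi> d)"
    proof (rule vnat_self_iff[THEN iffD1])
      show "is_vnat V ?D (self_vcat V) ?F ?G (\<lambda>d. name_of V (\<phi> d))"
        using p by (simp add: is_power_def)
      show "VHom ?D d d' \<in> Obj V" if "d \<in> VObj ?D" "d' \<in> VObj ?D" for d d'
        using that by (simp add: op_vcat_def)
      show "\<phi> d \<in> hom V (VFObj ?F d) (VFObj ?G d)" if "d \<in> VObj ?D" for d
        using that \<phi>[of d] unfolding G_eq by (simp add: op_vcat_def hom_to_def)
    qed (rule F G)+
    then have nat: "\<phi> c \<cdot> act ?F p c = act ?G p c \<cdot> (Ident V ?C \<odot> \<phi> p)"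
      by (simp add: op_vcat_def)
    have aF: "act ?F p c = VComp C c p p \<cdot> Symm V ?C (VHom C p p)"
      using hto(2)[of p c p] by (simp add: act_def) (simp add: hom_to_def)
    have aG: "act ?G p c = VComp (self_vcat V) X (VHom C p b) (VHom C c b) \<cdot> (VFArr (hom_to V C b) p c \<odot> Ident V (IHom V X (VHom C p b)))"
      unfolding act_def G_eq using hf[of "VHom C p b" "VHom C c b"] h' by (simp add: uncurry_comp in_hom)
    have "\<phi> c \<cdot> RUnit V ?C = \<phi> c \<cdot> (VComp C c p p \<cdot> (VId C p \<odot> Ident V ?C)) \<cdot> Symm V ?C ?I"
      using vcomp_VId(1)[OF C c p', of "Ident V ?C" ?C] fc by (simp add: in_hom LUnit_Symm)
    also have "\<dots> = (\<phi> c \<cdot> act ?F p c) \<cdot> (Ident V ?C \<odot> VId C p)"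
      unfolding aF using fc by (simp add: Symm_natural)
    also have "\<dots> = VComp (self_vcat V) X (VHom C p b) (VHom C c b) \<cdot> (VFArr (hom_to V C b) p c \<odot> ?\<phi>1)"
      unfolding nat aG using fc h' self_vcomp(1)[of X "VHom C p b" "VHom C c b"] by (simp add: in_hom)
    finally have eq: "\<phi> c \<cdot> RUnit V ?C = VComp (self_vcat V) X (VHom C p b) (VHom C c b) \<cdot> (VFArr (hom_to V C b) p c \<odot> ?\<phi>1)" .
    have "runcurry X (VHom C c b) (\<phi> c) \<cdot> (RUnit V ?C \<odot> Ident V X) = runcurry X (VHom C c b) (\<phi> c \<cdot> RUnit V ?C)"
      using fc by (simp add: uncurry_comp)
    also have "\<dots> = (VComp C c p b \<cdot> Symm V ?C (VHom C p b)) \<cdot> (Ident V ?C \<odot> (?\<kappa> \<cdot> LUnit V X)) \<cdot> Assoc V ?C ?I X"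
      unfolding eq using runcurry_self_comp(2)[OF _ _ _ h \<phi>1] hto(2)[of p c b] run1 by simp
    also have "\<dots> = VComp C c p b \<cdot> (Symm V ?C (VHom C p b) \<cdot> (Ident V ?C \<odot> ?\<kappa>)) \<cdot>
        ((Ident V ?C \<odot> LUnit V X) \<cdot> Assoc V ?C ?I X)"
      using \<kappa>' by simp
    also have "\<dots> = (VComp C c p b \<cdot> (?\<kappa> \<odot> Ident V ?C) \<cdot> Symm V ?C X) \<cdot> (RUnit V ?C \<odot> Ident V X)"
      using \<kappa>' by (simp add: triangle Symm_natural)
    finally have "runcurry X (VHom C c b) (\<phi> c) = VComp C c p b \<cdot> (?\<kappa> \<odot> Ident V ?C) \<cdot> Symm V ?C X"
      using \<kappa>' fc by - (rule iso_cancel_right[rotated -1], assumption, simp_all add: tensor_iso)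
    also have "\<dots> = runcurry X (VHom C c b) (induced V C X b p ?\<kappa> c)"
      using runcurry_eq[OF _ _ induced(1)[OF C b p' c \<kappa>]] \<kappa>' by (simp add: induced(2)[OF C b p' c \<kappa>])
    finally show ?thesis
      using runcurry_cancel[OF _ _ \<phi>[OF c] induced(1)[OF C b p' c \<kappa>]] by simp
  qed
  then show "exhibits_power C X b p ?\<kappa>"
    by (rule induced_power[OF C b X p \<kappa>])
qed


section \<open>Constant families and the unit enriched category\<close>

lemma is_vcat_unit_vcat: "is_vcat V (unit_vcat V)"
  unfolding is_vcat_def unit_vcat_def using triangle[of "Unit V" "Unit V"]
  by (simp add: in_hom LUnit_eq_RUnit)

lemma inv_RUnit_tensor:
  assumes [simp]: "X \<in> Obj V" "Y \<in> Obj V"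
  shows "Assoc V X Y (Unit V) \<cdot> inv_arr V (RUnit V (X \<otimes> Y)) = Ident V X \<odot> inv_arr V (RUnit V Y)"
proof (rule iso_cancel_left[of "Ident V X \<odot> RUnit V Y"])
  have "((Ident V X \<odot> RUnit V Y) \<cdot> Assoc V X Y (Unit V)) \<cdot> inv_arr V (RUnit V (X \<otimes> Y)) = Ident V (X \<otimes> Y)"
    unfolding RUnit_tensor[OF assms] by simp
  then show "(Ident V X \<odot> RUnit V Y) \<cdot> (Assoc V X Y (Unit V) \<cdot> inv_arr V (RUnit V (X \<otimes> Y))) =
      (Ident V X \<odot> RUnit V Y) \<cdot> (Ident V X \<odot> inv_arr V (RUnit V Y))"
    by simp
qed (simp_all add: tensor_iso)

lemma inv_triangle:
  assumes [simp]: "X \<in> Obj V" "Y \<in> Obj V"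
  shows "Assoc V X (Unit V) Y \<cdot> (inv_arr V (RUnit V X) \<odot> Ident V Y) = Ident V X \<odot> inv_arr V (LUnit V Y)"
proof (rule iso_cancel_left[of "Ident V X \<odot> LUnit V Y"])
  have "((Ident V X \<odot> LUnit V Y) \<cdot> Assoc V X (Unit V) Y) \<cdot> (inv_arr V (RUnit V X) \<odot> Ident V Y) = Ident V (X \<otimes> Y)"
    unfolding triangle[OF assms] by simp
  then show "(Ident V X \<odot> LUnit V Y) \<cdot> (Assoc V X (Unit V) Y \<cdot> (inv_arr V (RUnit V X) \<odot> Ident V Y)) =
      (Ident V X \<odot> LUnit V Y) \<cdot> (Ident V X \<odot> inv_arr V (LUnit V Y))"
    by simp
qed (simp_all add: tensor_iso)

lemma luncurry_name_of:
  assumes "f \<in> hom V X Y"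
  shows "luncurry X Y (name_of V f) = f \<cdot> RUnit V X"
proof -
  have X: "X \<in> Obj V" "Y \<in> Obj V" "f \<in> Arr V" "Dom V f = X" "Cod V f = Y"
    using assms by (auto simp: in_hom)
  note n = name_of[OF assms]
  have "luncurry X Y (name_of V f) = runcurry X Y (name_of V f) \<cdot> Symm V X (Unit V)"
    using n(1) X by (simp add: luncurry_def runcurry_def in_hom)
  then show ?thesis
    using n X by (simp add: LUnit_Symm)
qed

text \<open>
  Associativity when one of the families is a single arrow. The associator is then absorbed by the
  inverse unit constraint contained in \<open>pre_comp\<close>.
\<close>

lemma vcomp_pre_comp:
  assumes C: "is_vcat V C" and obj: "a \<in> VObj C" "b \<in> VObj C" "c \<in> VObj C" "d \<in> VObj C"
    and g: "g \<in> hom V (Unit V) (VHom C a b)" and m: "m \<in> hom V X (VHom C b c)" and p: "p \<in> hom V Y (VHom C c d)"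
  shows "pre_comp V C a b d g \<cdot> VComp C b c d \<cdot> (p \<odot> m) = VComp C a c d \<cdot> (p \<odot> (pre_comp V C a b c g \<cdot> m))"
proof -
  have arr: "g \<in> Arr V" "Dom V g = Unit V" "Cod V g = VHom C a b" "m \<in> Arr V" "Dom V m = X" "Cod V m = VHom C b c"
    "p \<in> Arr V" "Dom V p = Y" "Cod V p = VHom C c d" "X \<in> Obj V" "Y \<in> Obj V"
    using g m p by (auto simp: in_hom)
  have pm: "VComp C b c d \<cdot> (p \<odot> m) \<in> hom V (Y \<otimes> X) (VHom C b d)"
    using arr C obj by (simp add: in_hom)
  have "pre_comp V C a b d g \<cdot> VComp C b c d \<cdot> (p \<odot> m) =
      (VComp C a b d \<cdot> ((VComp C b c d \<cdot> (p \<odot> m)) \<odot> g)) \<cdot> inv_arr V (RUnit V (Y \<otimes> X))"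
    using pre_comp_comp(2)[OF C obj(1,2,4) g pm] pm arr C obj by (simp add: in_hom)
  also have "\<dots> = (VComp C a c d \<cdot> (p \<odot> (VComp C a b c \<cdot> (m \<odot> g))) \<cdot> Assoc V Y X (Unit V)) \<cdot> inv_arr V (RUnit V (Y \<otimes> X))"
    using vcomp_assoc[OF C obj p m g] by simp
  also have "\<dots> = VComp C a c d \<cdot> (p \<odot> (VComp C a b c \<cdot> (m \<odot> g))) \<cdot> (Assoc V Y X (Unit V) \<cdot> inv_arr V (RUnit V (Y \<otimes> X)))"
    using arr C obj by simp
  also have "\<dots> = VComp C a c d \<cdot> (p \<odot> (VComp C a b c \<cdot> (m \<odot> g) \<cdot> inv_arr V (RUnit V X)))"
    using arr C obj by (simp add: inv_RUnit_tensor)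
  finally show ?thesis
    using pre_comp_comp(2)[OF C obj(1,2,3) g m] by simp
qed

lemma vcomp_el_comp:
  assumes C: "is_vcat V C" and obj: "a \<in> VObj C" "b \<in> VObj C" "c \<in> VObj C" "d \<in> VObj C"
    and f: "f \<in> hom V (Unit V) (VHom C a b)" and g: "g \<in> hom V (Unit V) (VHom C b c)" and m: "m \<in> hom V X (VHom C c d)"
  shows "VComp C a c d \<cdot> (m \<odot> el_comp V C a b c g f) = VComp C a b d \<cdot> ((pre_comp V C b c d g \<cdot> m) \<odot> f)"
    and "pre_comp V C a c d (el_comp V C a b c g f) \<cdot> m = pre_comp V C a b d f \<cdot> (pre_comp V C b c d g \<cdot> m)"
proof -
  have arr: "g \<in> Arr V" "Dom V g = Unit V" "Cod V g = VHom C b c" "m \<in> Arr V" "Dom V m = X" "Cod V m = VHom C c d"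
    "f \<in> Arr V" "Dom V f = Unit V" "Cod V f = VHom C a b" "X \<in> Obj V"
    using f g m by (auto simp: in_hom)
  have "VComp C a b d \<cdot> ((pre_comp V C b c d g \<cdot> m) \<odot> f) =
      (VComp C a b d \<cdot> ((VComp C b c d \<cdot> (m \<odot> g)) \<odot> f)) \<cdot> (inv_arr V (RUnit V X) \<odot> Ident V (Unit V))"
    using arr C obj pre_comp_comp(2)[OF C obj(2-4) g m] by simp
  also have "\<dots> = (VComp C a c d \<cdot> (m \<odot> (VComp C a b c \<cdot> (g \<odot> f))) \<cdot> Assoc V X (Unit V) (Unit V)) \<cdot>
      (inv_arr V (RUnit V X) \<odot> Ident V (Unit V))"
    using vcomp_assoc[OF C obj m g f] by simp
  also have "\<dots> = VComp C a c d \<cdot> (m \<odot> (VComp C a b c \<cdot> (g \<odot> f))) \<cdot>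
      (Assoc V X (Unit V) (Unit V) \<cdot> (inv_arr V (RUnit V X) \<odot> Ident V (Unit V)))"
    using arr C obj by simp
  also have "\<dots> = VComp C a c d \<cdot> (m \<odot> el_comp V C a b c g f)"
    using arr C obj by (simp add: inv_triangle el_comp_def)
  finally show *: "VComp C a c d \<cdot> (m \<odot> el_comp V C a b c g f) = VComp C a b d \<cdot> ((pre_comp V C b c d g \<cdot> m) \<odot> f)" ..
  have gm: "pre_comp V C b c d g \<cdot> m \<in> hom V X (VHom C b d)"
    using pre_comp_comp(1)[OF C obj(2-4) g m] m comp_in_hom by blast
  show "pre_comp V C a c d (el_comp V C a b c g f) \<cdot> m = pre_comp V C a b d f \<cdot> (pre_comp V C b c d g \<cdot> m)"
    using pre_comp_comp(2)[OF C obj(1,3,4) el_comp(1)[OF C obj(1-3) f g] m] pre_comp_comp(2)[OF C obj(1,2,4) f gm]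
      arg_cong[OF *, of "\<lambda>y. y \<cdot> inv_arr V (RUnit V X)"] arr C obj gm el_comp(1)[OF C obj(1-3) f g]
    by (simp add: in_hom)
qed

lemma el_comp_VId:
  assumes C: "is_vcat V C" and obj: "a \<in> VObj C" "b \<in> VObj C" and f: "f \<in> hom V (Unit V) (VHom C a b)"
  shows "el_comp V C a a b f (VId C a) = f"
proof -
  have arr: "f \<in> Arr V" "Dom V f = Unit V" "Cod V f = VHom C a b"
    using f by (auto simp: in_hom)
  have "el_comp V C a a b f (VId C a) = (VComp C a a b \<cdot> (f \<odot> VId C a)) \<cdot> inv_arr V (RUnit V (Unit V))"
    using arr C obj by (simp add: el_comp_def LUnit_eq_RUnit)
  then show ?thesis
    using vcomp_VId(2)[OF C obj f] arr by simp
qed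

lemma el_comp_assoc:
  assumes C: "is_vcat V C" and obj: "a \<in> VObj C" "b \<in> VObj C" "c \<in> VObj C" "d \<in> VObj C"
    and f: "f \<in> hom V (Unit V) (VHom C a b)" and g: "g \<in> hom V (Unit V) (VHom C b c)" and h: "h \<in> hom V (Unit V) (VHom C c d)"
  shows "el_comp V C a c d h (el_comp V C a b c g f) = el_comp V C a b d (el_comp V C b c d h g) f"
  using vcomp_el_comp(2)[OF C obj f g h] el_comp(2)[OF C obj(1,3,4) el_comp(1)[OF C obj(1-3) f g] h]
    el_comp(2)[OF C obj(2-4) g h] el_comp(2)[OF C obj(1,2,4) f el_comp(1)[OF C obj(2-4) g h]]
  by simp

end

section \<open>Homotopies of endomorphisms of a cofibrant weight\<close>

locale monoidal_model = model_category_with_unit V + closed_monoidal V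
  for V :: "('o, 'a, 'z) smmc_scheme" (structure) +
  fixes u :: "'u itself"
  assumes universe: "universe u" and complete: "small_complete u V"
begin

lemma cofibrant_replacement:
  assumes D: "is_vcat V D" and P: "is_vfunctor V D (unit_vcat V) P"
    and Q: "cofibrant_replacement_weight V D P Q"
  obtains q where "is_vfunctor V D (self_vcat V) Q" and "cofibrant_weight V D Q"
    and "pointwise_trivial_fibration V D Q (vfun_comp V (unit_select V) P) q"
    and "\<And>d. d \<in> VObj D \<Longrightarrow> q d \<in> hom V (VFObj Q d) (Unit V)"
    and "\<And>d. d \<in> VObj D \<Longrightarrow> q d \<in> Fib V \<inter> Weq V"
    and "natural_family D Q (vfun_comp V (unit_select V) P) q"
proof -
  obtain q where Q': "is_vfunctor V D (self_vcat V) Q" "cofibrant_weight V D Q"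
    and q: "pointwise_trivial_fibration V D Q (vfun_comp V (unit_select V) P) q"
    using Q by (auto simp: cofibrant_replacement_weight_def)
  note us = unit_select_comp[OF D P]
  have q': "q d \<in> hom V (VFObj Q d) (VFObj (vfun_comp V (unit_select V) P) d)" "q d \<in> Fib V \<inter> Weq V"
    if "d \<in> VObj D" for d
    using q that by (simp_all add: pointwise_trivial_fibration_def)
  have D': "VHom D d d' \<in> Obj V" if "d \<in> VObj D" "d' \<in> VObj D" for d d'
    using D that by simp
  have "natural_family D Q (vfun_comp V (unit_select V) P) q"
    using vnat_self_iff[OF D' typed_vfunctor[OF Q'(1)] typed_vfunctor[OF us(1)] q'(1)] q q'(1)
    unfolding natural_family_def pointwise_trivial_fibration_def by blast
  then show ?thesis
    using that[OF Q' q] q' by (simp add: us(2))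
qed

text \<open>
  Cofibrancy makes \<open>[D, V](Q, Q) \<rightarrow> [D, V](Q, IP)\<close>, composition with \<open>q\<close>, a trivial fibration. The identity and \<open>\<tau>\<close> are two
  points of the source over the same point of the target, and an interval can be lifted to join them.
\<close>

lemma cofibrant_weight_homotopy:
  assumes D: "is_vcat V D" and small: "small u (VObj D)" and P: "is_vfunctor V D (unit_vcat V) P"
    and Q: "is_vfunctor V D (self_vcat V) Q" and cof: "cofibrant_weight V D Q"
    and ptf: "pointwise_trivial_fibration V D Q (vfun_comp V (unit_select V) P) q"
    and q: "natural_family D Q (vfun_comp V (unit_select V) P) q"
    and \<tau>: "natural_family D Q Q \<tau>" and q\<tau>: "\<And>x. x \<in> VObj D \<Longrightarrow> q x \<cdot> \<tau> x = q x"
  obtains J d c e \<theta> where "is_interval V J d c e" and "left_wedge D Q Q J \<theta>"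
    and "\<And>x. x \<in> VObj D \<Longrightarrow> \<theta> x \<cdot> (Ident V (VFObj Q x) \<odot> d) = RUnit V (VFObj Q x)"
    and "\<And>x. x \<in> VObj D \<Longrightarrow> \<theta> x \<cdot> (Ident V (VFObj Q x) \<odot> c) = \<tau> x \<cdot> RUnit V (VFObj Q x)"
    and "\<And>x. x \<in> VObj D \<Longrightarrow> q x \<cdot> \<theta> x = q x \<cdot> RUnit V (VFObj Q x) \<cdot> (Ident V (VFObj Q x) \<odot> e)"
proof -
  let ?I = "Unit V"
  let ?G = "vfun_comp V (unit_select V) P"
  note us = unit_select_comp[OF D P]
  note tQ = typed_vfunctor[OF Q] and tG = typed_vfunctor[OF us(1)]
  have Qo [simp]: "VFObj Q x \<in> Obj V" if "x \<in> VObj D" for x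
    using tQ that by (simp add: typed_functor_def)
  have q_arr: "q x \<in> hom V (VFObj Q x) ?I" and \<tau>_arr: "\<tau> x \<in> hom V (VFObj Q x) (VFObj Q x)" if "x \<in> VObj D" for x
    using q \<tau> that by (simp_all add: natural_family_def us(2))
  have q': "q x \<in> Arr V" "Dom V (q x) = VFObj Q x" "Cod V (q x) = ?I"
    "\<tau> x \<in> Arr V" "Dom V (\<tau> x) = VFObj Q x" "Cod V (\<tau> x) = VFObj Q x" if "x \<in> VObj D" for x
    using q_arr \<tau>_arr that by (simp_all add: in_hom)
  obtain R \<pi> where R: "is_hom_object V D Q Q R \<pi>"
    using ex_hom_object[OF universe complete D small tQ tQ] by blast
  obtain R' \<pi>' where R': "is_hom_object V D Q ?G R' \<pi>'"
    using ex_hom_object[OF universe complete D small tQ tG] by blast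
  define \<rho> where "\<rho> x = luncurry (VFObj Q x) (VFObj Q x) (\<pi> x)" for x
  define \<rho>' where "\<rho>' x = luncurry (VFObj Q x) ?I (\<pi>' x)" for x
  note uR = hom_object_universal[OF D tQ tQ R, folded \<rho>_def]
  note uR' = hom_object_universal[OF D tQ tG R', unfolded us(2), folded \<rho>'_def]
  have \<pi>: "\<pi> x \<in> hom V R (IHom V (VFObj Q x) (VFObj Q x))" "\<pi>' x \<in> hom V R' (IHom V (VFObj Q x) ?I)" if "x \<in> VObj D" for x
    using R R' that by (simp_all add: is_hom_object_def is_hom_wedge_def us(2))
  have RO [simp]: "R \<in> Obj V" "R' \<in> Obj V"
    using uR(1) uR'(1) by (simp_all add: left_wedge_def)
  have \<rho>: "\<rho> x \<in> Arr V" "Dom V (\<rho> x) = VFObj Q x \<otimes> R" "Cod V (\<rho> x) = VFObj Q x"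
    "\<rho>' x \<in> Arr V" "Dom V (\<rho>' x) = VFObj Q x \<otimes> R'" "Cod V (\<rho>' x) = ?I" if "x \<in> VObj D" for x
    using uR(1) uR'(1) that by (simp_all add: left_wedge_def in_hom us(2))
  have "left_wedge D Q ?G R (\<lambda>x. q x \<cdot> \<rho> x)"
    by (rule left_wedge_postcomp[OF D tQ tQ tG uR(1) q])
  then obtain t where t: "t \<in> hom V R R'"
    and t_eq: "\<And>x. x \<in> VObj D \<Longrightarrow> \<rho>' x \<cdot> (Ident V (VFObj Q x) \<odot> t) = q x \<cdot> \<rho> x"
    using uR'(2) by blast
  then have t': "t \<in> Arr V" "Dom V t = R" "Cod V t = R'"
    by (simp_all add: in_hom)
  have "\<pi>' x \<cdot> t = post_comp V (self_vcat V) (VFObj Q x) (VFObj Q x) ?I (name_of V (q x)) \<cdot> \<pi> x"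
    if x: "x \<in> VObj D" for x
  proof (rule luncurry_cancel[OF Qo[OF x] Unit_Obj])
    note pc = self_post_comp[OF q_arr[OF x] Qo[OF x] \<pi>(1)[OF x]]
    show "post_comp V (self_vcat V) (VFObj Q x) (VFObj Q x) ?I (name_of V (q x)) \<cdot> \<pi> x \<in> hom V R (IHom V (VFObj Q x) ?I)"
      using pc(1) \<pi>(1)[OF x] comp_in_hom by blast
    show "\<pi>' x \<cdot> t \<in> hom V R (IHom V (VFObj Q x) ?I)"
      using t \<pi>(2)[OF x] comp_in_hom by blast
    have "luncurry (VFObj Q x) ?I (\<pi>' x \<cdot> t) = \<rho>' x \<cdot> (Ident V (VFObj Q x) \<odot> t)"
      using \<pi>(2)[OF x] t' x by (simp add: uncurry_comp in_hom \<rho>'_def)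
    then show "luncurry (VFObj Q x) ?I (\<pi>' x \<cdot> t) =
        luncurry (VFObj Q x) ?I (post_comp V (self_vcat V) (VFObj Q x) (VFObj Q x) ?I (name_of V (q x)) \<cdot> \<pi> x)"
      unfolding t_eq[OF x] pc(3) by (simp add: \<rho>_def)
  qed
  then have t_fib: "t \<in> Fib V \<inter> Weq V"
    using cof[unfolded cofibrant_weight_def, rule_format, of Q ?G q R \<pi> R' \<pi>' t] Q us(1) ptf R R' t
    by (simp add: us(2))
  \<comment> \<open>the points \<open>a\<close> and \<open>b\<close> of \<open>[D, V](Q, Q)\<close> are the identity and \<open>\<tau>\<close>\<close>
  have "natural_family D Q Q (\<lambda>x. Ident V (VFObj Q x))"
    using tQ D by (simp add: natural_family_def in_hom)
  then have "left_wedge D Q Q ?I (\<lambda>x. Ident V (VFObj Q x) \<cdot> RUnit V (VFObj Q x))"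
    by (rule natural_family_left_wedge[OF D tQ tQ])
  then obtain a where a: "a \<in> hom V ?I R"
    and a_eq: "\<And>x. x \<in> VObj D \<Longrightarrow> \<rho> x \<cdot> (Ident V (VFObj Q x) \<odot> a) = Ident V (VFObj Q x) \<cdot> RUnit V (VFObj Q x)"
    using uR(2) by blast
  obtain b where b: "b \<in> hom V ?I R"
    and b_eq: "\<And>x. x \<in> VObj D \<Longrightarrow> \<rho> x \<cdot> (Ident V (VFObj Q x) \<odot> b) = \<tau> x \<cdot> RUnit V (VFObj Q x)"
    using uR(2)[OF natural_family_left_wedge[OF D tQ tQ \<tau>]] by blast
  have ab: "a \<in> Arr V" "Dom V a = ?I" "Cod V a = R" "b \<in> Arr V" "Dom V b = ?I" "Cod V b = R"
    using a b by (simp_all add: in_hom)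
  have push: "\<rho>' x \<cdot> (Ident V (VFObj Q x) \<odot> (t \<cdot> y)) = q x \<cdot> \<rho> x \<cdot> (Ident V (VFObj Q x) \<odot> y)"
    if x: "x \<in> VObj D" and y: "y \<in> hom V Y R" for x y Y
  proof -
    have "\<rho>' x \<cdot> (Ident V (VFObj Q x) \<odot> (t \<cdot> y)) = (\<rho>' x \<cdot> (Ident V (VFObj Q x) \<odot> t)) \<cdot> (Ident V (VFObj Q x) \<odot> y)"
      using x y t' \<rho> by (simp add: in_hom)
    then show ?thesis
      unfolding t_eq[OF x] using x y \<rho> q' by (simp add: in_hom)
  qed
  have ta: "\<rho>' x \<cdot> (Ident V (VFObj Q x) \<odot> (t \<cdot> a)) = q x \<cdot> RUnit V (VFObj Q x)"
    and tb: "\<rho>' x \<cdot> (Ident V (VFObj Q x) \<odot> (t \<cdot> b)) = q x \<cdot> RUnit V (VFObj Q x)" if x: "x \<in> VObj D" for x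
  proof -
    have "q x \<cdot> (\<tau> x \<cdot> RUnit V (VFObj Q x)) = (q x \<cdot> \<tau> x) \<cdot> RUnit V (VFObj Q x)"
      using x q' by simp
    then show "\<rho>' x \<cdot> (Ident V (VFObj Q x) \<odot> (t \<cdot> a)) = q x \<cdot> RUnit V (VFObj Q x)"
      and "\<rho>' x \<cdot> (Ident V (VFObj Q x) \<odot> (t \<cdot> b)) = q x \<cdot> RUnit V (VFObj Q x)"
      unfolding push[OF x a] push[OF x b] a_eq[OF x] b_eq[OF x] using x q\<tau> by simp_all
  qed
  have "t \<cdot> a = t \<cdot> b"
    using uR'(3)[OF comp_in_hom[OF a t] comp_in_hom[OF b t]] ta tb by simp
  obtain J d c e where J: "is_interval V J d c e"
    using ex_interval by blast
  note J' = interval_hom[OF J]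
  have Ja: "J \<in> Obj V" "d \<in> Arr V" "Dom V d = ?I" "Cod V d = J" "c \<in> Arr V" "Dom V c = ?I" "Cod V c = J"
    "e \<in> Arr V" "Dom V e = J" "Cod V e = ?I"
    using J' by (simp_all add: in_hom)
  let ?v = "t \<cdot> a \<cdot> e"
  have v: "?v \<in> hom V J R'" "?v \<cdot> d = t \<cdot> a" "?v \<cdot> c = t \<cdot> a"
    using Ja ab t' J'(4,5) by (simp_all add: in_hom)
  obtain w where w: "w \<in> hom V J R" "w \<cdot> d = a" "w \<cdot> c = b" "t \<cdot> w = ?v"
    using interval_lifting[OF J t_fib t a b v(1)] v(2,3) \<open>t \<cdot> a = t \<cdot> b\<close> by metis
  then have w': "w \<in> Arr V" "Dom V w = J" "Cod V w = R"
    by (simp_all add: in_hom)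
  define \<theta> where "\<theta> x = \<rho> x \<cdot> (Ident V (VFObj Q x) \<odot> w)" for x
  show ?thesis
  proof (rule that[OF J, of \<theta>])
    show "left_wedge D Q Q J \<theta>"
      unfolding \<theta>_def by (rule left_wedge_precomp[OF D tQ tQ uR(1) w(1)])
    fix x assume x: "x \<in> VObj D"
    show "\<theta> x \<cdot> (Ident V (VFObj Q x) \<odot> d) = RUnit V (VFObj Q x)"
      and "\<theta> x \<cdot> (Ident V (VFObj Q x) \<odot> c) = \<tau> x \<cdot> RUnit V (VFObj Q x)"
      using x \<rho> w' Ja w(2,3) a_eq[OF x] b_eq[OF x] by (simp_all add: \<theta>_def)
    have "q x \<cdot> \<theta> x = \<rho>' x \<cdot> (Ident V (VFObj Q x) \<odot> (t \<cdot> w))"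
      unfolding push[OF x w(1)] \<theta>_def ..
    also have "\<dots> = (\<rho>' x \<cdot> (Ident V (VFObj Q x) \<odot> (t \<cdot> a))) \<cdot> (Ident V (VFObj Q x) \<odot> e)"
      unfolding w(4) using x \<rho> ab t' Ja by simp
    finally show "q x \<cdot> \<theta> x = q x \<cdot> RUnit V (VFObj Q x) \<cdot> (Ident V (VFObj Q x) \<odot> e)"
      unfolding ta[OF x] using x q' Ja by simp
  qed
qed

end

section \<open>Arrows under an object\<close>

locale adjoint_setting = monoidal_model V u
  for V :: "('o, 'a, 'z) smmc_scheme" (structure) and u :: "'u itself" +
  fixes B :: "('b, 'o, 'a) vcat" and A :: "('c, 'o, 'a) vcat" and U :: "('b, 'c, 'a) vfun" and a :: 'c
  assumes B [simp]: "is_vcat V B" and A [simp]: "is_vcat V A" and U: "is_vfunctor V B A U"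
    and a [simp]: "a \<in> VObj A"
begin

lemma U_simps [simp]:
  "b \<in> VObj B \<Longrightarrow> VFObj U b \<in> VObj A"
  "b \<in> VObj B \<Longrightarrow> b' \<in> VObj B \<Longrightarrow> VFArr U b b' \<in> Arr V"
  "b \<in> VObj B \<Longrightarrow> b' \<in> VObj B \<Longrightarrow> Dom V (VFArr U b b') = VHom B b b'"
  "b \<in> VObj B \<Longrightarrow> b' \<in> VObj B \<Longrightarrow> Cod V (VFArr U b b') = VHom A (VFObj U b) (VFObj U b')"
  using vfunctor_simps[OF U] by simp_all

text \<open>
  For \<open>f : a \<rightarrow> U b\<close>, the map \<open>B(b, b') \<rightarrow> A(a, U b')\<close> sending \<open>g\<close> to \<open>U g \<circ> f\<close>. A shrink-reflection is
  an \<open>f\<close> for which all these maps are shrinkable.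
\<close>

definition along :: "'a \<Rightarrow> 'b \<Rightarrow> 'b \<Rightarrow> 'a" where
  "along f b b' = pre_comp V A a (VFObj U b) (VFObj U b') f \<cdot> VFArr U b b'"

context
  fixes f b
  assumes f: "f \<in> hom V (Unit V) (VHom A a (VFObj U b))" and b [simp]: "b \<in> VObj B"
begin

lemma f_arr: "f \<in> Arr V" "Dom V f = Unit V" "Cod V f = VHom A a (VFObj U b)"
  using f by (auto simp: in_hom)

lemma along_simps:
  assumes [simp]: "b' \<in> VObj B"
  shows "along f b b' \<in> hom V (VHom B b b') (VHom A a (VFObj U b'))"
    and "along f b b' \<in> Arr V" and "Dom V (along f b b') = VHom B b b'" and "Cod V (along f b b') = VHom A a (VFObj U b')"
proof -
  show "along f b b' \<in> hom V (VHom B b b') (VHom A a (VFObj U b'))"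
    using f_arr by (simp add: along_def pre_comp_def in_hom)
  then show "along f b b' \<in> Arr V" and "Dom V (along f b b') = VHom B b b'" and "Cod V (along f b b') = VHom A a (VFObj U b')"
    by (simp_all add: in_hom)
qed

lemma along_comp:
  assumes b' [simp]: "b' \<in> VObj B" and g: "g \<in> hom V X (VHom B b b')"
  shows "along f b b' \<cdot> g \<cdot> RUnit V X = VComp A a (VFObj U b) (VFObj U b') \<cdot> ((VFArr U b b' \<cdot> g) \<odot> f)"
proof -
  have g': "g \<in> Arr V" "Dom V g = X" "Cod V g = VHom B b b'" "X \<in> Obj V"
    using g by (auto simp: in_hom)
  have Ug: "VFArr U b b' \<cdot> g \<in> hom V X (VHom A (VFObj U b) (VFObj U b'))"
    using g' by (simp add: in_hom)
  have "along f b b' \<cdot> g \<cdot> RUnit V X = pre_comp V A a (VFObj U b) (VFObj U b') f \<cdot> (VFArr U b b' \<cdot> g) \<cdot> RUnit V X"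
    using pre_comp_comp(1)[OF A a _ _ f Ug] g' unfolding along_def by (simp add: in_hom)
  also have "\<dots> = VComp A a (VFObj U b) (VFObj U b') \<cdot> ((VFArr U b b' \<cdot> g) \<odot> f)"
    using pre_comp_comp(3)[OF A a _ _ f Ug] by simp
  finally show ?thesis .
qed

text \<open>
  This is \<open>U (g \<circ> h) \<circ> f = U g \<circ> (U h \<circ> f)\<close>. It is first proved after
  tensoring with the domain \<open>I\<close> of \<open>f\<close>, where \<open>along f\<close> is a composite of families.
\<close>

lemma along_vcomp:
  assumes b' [simp]: "b' \<in> VObj B" "b'' \<in> VObj B" and g: "g \<in> hom V X (VHom B b' b'')" and h: "h \<in> hom V Y (VHom B b b')"
  shows "along f b b'' \<cdot> VComp B b b' b'' \<cdot> (g \<odot> h) =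
    VComp A a (VFObj U b') (VFObj U b'') \<cdot> ((VFArr U b' b'' \<cdot> g) \<odot> (along f b b' \<cdot> h))"
proof -
  have g': "g \<in> Arr V" "Dom V g = X" "Cod V g = VHom B b' b''" and [simp]: "X \<in> Obj V"
    and h': "h \<in> Arr V" "Dom V h = Y" "Cod V h = VHom B b b'" and [simp]: "Y \<in> Obj V"
    using g h by (auto simp: in_hom)
  have gh: "VComp B b b' b'' \<cdot> (g \<odot> h) \<in> hom V (X \<otimes> Y) (VHom B b b'')"
    and Ug: "VFArr U b' b'' \<cdot> g \<in> hom V X (VHom A (VFObj U b') (VFObj U b''))"
    and Uh: "VFArr U b b' \<cdot> h \<in> hom V Y (VHom A (VFObj U b) (VFObj U b'))"
    using g' h' by (simp_all add: in_hom)
  note al = along_simps[OF b'(1)] along_simps[OF b'(2)]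
  have "(along f b b'' \<cdot> VComp B b b' b'' \<cdot> (g \<odot> h)) \<cdot> RUnit V (X \<otimes> Y) =
      VComp A a (VFObj U b) (VFObj U b'') \<cdot> ((VFArr U b b'' \<cdot> VComp B b b' b'' \<cdot> (g \<odot> h)) \<odot> f)"
    using along_comp[OF b'(2) gh] g' h' al by simp
  also have "\<dots> = VComp A a (VFObj U b') (VFObj U b'') \<cdot>
      ((VFArr U b' b'' \<cdot> g) \<odot> (VComp A a (VFObj U b) (VFObj U b') \<cdot> ((VFArr U b b' \<cdot> h) \<odot> f))) \<cdot> Assoc V X Y (Unit V)"
    using vfunctor_vcomp[OF U B A b b' g h] vcomp_assoc[OF A a _ _ _ Ug Uh f] by simp
  also have "\<dots> = VComp A a (VFObj U b') (VFObj U b'') \<cdot> ((VFArr U b' b'' \<cdot> g) \<odot> (along f b b' \<cdot> h \<cdot> RUnit V Y)) \<cdot> Assoc V X Y (Unit V)"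
    using along_comp[OF b'(1) h] by simp
  also have "\<dots> = (VComp A a (VFObj U b') (VFObj U b'') \<cdot> ((VFArr U b' b'' \<cdot> g) \<odot> (along f b b' \<cdot> h))) \<cdot>
      ((Ident V X \<odot> RUnit V Y) \<cdot> Assoc V X Y (Unit V))"
    using g' h' al by simp
  finally have "(along f b b'' \<cdot> VComp B b b' b'' \<cdot> (g \<odot> h)) \<cdot> RUnit V (X \<otimes> Y) =
    (VComp A a (VFObj U b') (VFObj U b'') \<cdot> ((VFArr U b' b'' \<cdot> g) \<odot> (along f b b' \<cdot> h))) \<cdot> RUnit V (X \<otimes> Y)"
    by (simp only: RUnit_tensor \<open>X \<in> Obj V\<close> \<open>Y \<in> Obj V\<close>)
  then show ?thesis
    using g' h' al by - (rule iso_cancel_right[of "RUnit V (X \<otimes> Y)"], simp_all)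
qed

lemma along_VId: "along f b b \<cdot> VId B b = f"
proof -
  have "(along f b b \<cdot> VId B b) \<cdot> RUnit V (Unit V) = VComp A a (VFObj U b) (VFObj U b) \<cdot> ((VFArr U b b \<cdot> VId B b) \<odot> f)"
    using along_comp[OF b, of "VId B b" "Unit V"] along_simps[OF b] by (simp add: in_hom)
  also have "\<dots> = f \<cdot> RUnit V (Unit V)"
    using vfunctor_simps(5)[OF U b] vcomp_VId(1)[OF A a _ f] by (simp add: LUnit_eq_RUnit)
  finally show ?thesis
    using along_simps[OF b] f_arr by - (rule iso_cancel_right[of "RUnit V (Unit V)"], simp_all)
qed

end

lemma along_pre_comp:
  assumes f: "f \<in> hom V (Unit V) (VHom A a (VFObj U b))"
    and b [simp]: "b \<in> VObj B" "b' \<in> VObj B" "b'' \<in> VObj B"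
    and m: "m \<in> hom V (Unit V) (VHom B b b')" and h: "h \<in> hom V X (VHom B b' b'')"
  shows "along f b b'' \<cdot> pre_comp V B b b' b'' m \<cdot> h = along (along f b b' \<cdot> m) b' b'' \<cdot> h"
proof -
  have m': "m \<in> Arr V" "Dom V m = Unit V" "Cod V m = VHom B b b'" 
    and h': "h \<in> Arr V" "Dom V h = X" "Cod V h = VHom B b' b''" and [simp]: "X \<in> Obj V"
    using m h by (auto simp: in_hom)
  note al = along_simps[OF f b(1,2)] along_simps[OF f b(1,3)]
  have fm: "along f b b' \<cdot> m \<in> hom V (Unit V) (VHom A a (VFObj U b'))"
    using al m comp_in_hom by blast
  note fm' = along_comp[OF fm b(2,3) h] along_simps[OF fm b(2,3)]
  have "(along f b b'' \<cdot> pre_comp V B b b' b'' m \<cdot> h) \<cdot> RUnit V X = along f b b'' \<cdot> (pre_comp V B b b' b'' m \<cdot> h \<cdot> RUnit V X)"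
    using pre_comp_comp(1)[OF B b m h] al h' by (simp add: in_hom)
  also have "\<dots> = (along (along f b b' \<cdot> m) b' b'' \<cdot> h) \<cdot> RUnit V X"
    using pre_comp_comp(3)[OF B b m h] along_vcomp[OF f b h m] fm' h' by simp
  finally show ?thesis
    using pre_comp_comp(1)[OF B b m h] al h' fm' by - (rule iso_cancel_right[of "RUnit V X"], simp_all add: in_hom)
qed

definition comma_obj :: "'b \<times> 'a \<Rightarrow> bool" where
  "comma_obj x \<longleftrightarrow> fst x \<in> VObj B \<and> snd x \<in> hom V (Unit V) (VHom A a (VFObj U (fst x)))"

definition comma_arr :: "'b \<times> 'a \<Rightarrow> 'b \<times> 'a \<Rightarrow> 'a \<Rightarrow> bool" where
  "comma_arr x y g \<longleftrightarrow>
     g \<in> hom V (Unit V) (VHom B (fst x) (fst y)) \<and> along (snd x) (fst x) (fst y) \<cdot> g = snd y"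

text \<open>
  A homotopy has to be constant after restriction along the structure map of \<open>x\<close>: it is a map from an
  interval to the hom-object of the comma \<open>V\<close>-category.
\<close>

definition homotopic :: "'b \<times> 'a \<Rightarrow> 'b \<times> 'a \<Rightarrow> 'a \<Rightarrow> 'a \<Rightarrow> bool" where
  "homotopic x y g g' \<longleftrightarrow>
     (\<exists>J d c e h. is_interval V J d c e \<and> h \<in> hom V J (VHom B (fst x) (fst y)) \<and>
        h \<cdot> d = g \<and> h \<cdot> c = g' \<and> along (snd x) (fst x) (fst y) \<cdot> h = snd y \<cdot> e)"

lemma comma_obj_simps:
  assumes "comma_obj x"
  shows "fst x \<in> VObj B" and "snd x \<in> hom V (Unit V) (VHom A a (VFObj U (fst x)))"
    and "snd x \<in> Arr V" and "Dom V (snd x) = Unit V" and "Cod V (snd x) = VHom A a (VFObj U (fst x))"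
  using assms by (simp_all add: comma_obj_def in_hom)

lemma comma_arr_hom: "comma_arr x y g \<Longrightarrow> g \<in> hom V (Unit V) (VHom B (fst x) (fst y))"
  by (simp add: comma_arr_def)

lemma comma_along:
  assumes x: "comma_obj x" and y: "b \<in> VObj B"
  shows "along (snd x) (fst x) b \<in> hom V (VHom B (fst x) b) (VHom A a (VFObj U b))"
    and "along (snd x) (fst x) b \<in> Arr V" and "Dom V (along (snd x) (fst x) b) = VHom B (fst x) b"
    and "Cod V (along (snd x) (fst x) b) = VHom A a (VFObj U b)"
  using along_simps[OF comma_obj_simps(2)[OF x] comma_obj_simps(1)[OF x] y] by auto

lemma comma_arr_pre_comp:
  assumes x: "comma_obj x" and y: "comma_obj y" and b: "b \<in> VObj B" and g: "comma_arr x y g"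
    and h: "h \<in> hom V X (VHom B (fst y) b)"
  shows "along (snd x) (fst x) b \<cdot> pre_comp V B (fst x) (fst y) b g \<cdot> h = along (snd y) (fst y) b \<cdot> h"
  using along_pre_comp[OF comma_obj_simps(2,1)[OF x] comma_obj_simps(1)[OF y] b comma_arr_hom[OF g] h] g
  by (simp add: comma_arr_def)

lemma comma_arr_VId: "comma_obj x \<Longrightarrow> comma_arr x x (VId B (fst x))"
  using along_VId by (simp add: comma_arr_def comma_obj_def in_hom)

lemma comma_arr_comp:
  assumes x: "comma_obj x" and y: "comma_obj y" and z: "comma_obj z" and g: "comma_arr x y g" and h: "comma_arr y z h"
  shows "comma_arr x z (el_comp V B (fst x) (fst y) (fst z) h g)"
  using el_comp(1,2)[OF B comma_obj_simps(1)[OF x] comma_obj_simps(1)[OF y] comma_obj_simps(1)[OF z]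
      comma_arr_hom[OF g] comma_arr_hom[OF h]]
    comma_arr_pre_comp[OF x y comma_obj_simps(1)[OF z] g comma_arr_hom[OF h]] h
  by (simp add: comma_arr_def)

lemma homotopic_pre_comp:
  assumes x: "comma_obj x" and y: "comma_obj y" and z: "comma_obj z" and m: "comma_arr x y m"
    and gg': "homotopic y z g g'"
  shows "homotopic x z (el_comp V B (fst x) (fst y) (fst z) g m) (el_comp V B (fst x) (fst y) (fst z) g' m)"
proof -
  obtain J d c e h where J: "is_interval V J d c e" and h: "h \<in> hom V J (VHom B (fst y) (fst z))"
    "h \<cdot> d = g" "h \<cdot> c = g'" "along (snd y) (fst y) (fst z) \<cdot> h = snd z \<cdot> e"
    using gg' by (auto simp: homotopic_def)
  note J' = interval_hom[OF J] and o = comma_obj_simps(1)[OF x] comma_obj_simps(1)[OF y] comma_obj_simps(1)[OF z]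
  let ?p = "pre_comp V B (fst x) (fst y) (fst z) m"
  note p = pre_comp_comp(1)[OF B o comma_arr_hom[OF m] h(1)]
  have g: "g \<in> hom V (Unit V) (VHom B (fst y) (fst z))" "g' \<in> hom V (Unit V) (VHom B (fst y) (fst z))"
    using h J' comp_in_hom by blast+
  have "?p \<cdot> h \<in> hom V J (VHom B (fst x) (fst z))"
    using p h(1) comp_in_hom by blast
  moreover have "(?p \<cdot> h) \<cdot> d = el_comp V B (fst x) (fst y) (fst z) g m" "(?p \<cdot> h) \<cdot> c = el_comp V B (fst x) (fst y) (fst z) g' m"
    using p h J' el_comp(2)[OF B o comma_arr_hom[OF m] g(1)] el_comp(2)[OF B o comma_arr_hom[OF m] g(2)]
    by (simp_all add: in_hom)
  moreover have "along (snd x) (fst x) (fst z) \<cdot> ?p \<cdot> h = snd z \<cdot> e"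
    using comma_arr_pre_comp[OF x y o(3) m h(1)] h(4) by simp
  ultimately show ?thesis
    using J unfolding homotopic_def by blast
qed

lemma homotopic_post_comp:
  assumes x: "comma_obj x" and y: "comma_obj y" and z: "comma_obj z" and m: "comma_arr y z m"
    and gg': "homotopic x y g g'"
  shows "homotopic x z (el_comp V B (fst x) (fst y) (fst z) m g) (el_comp V B (fst x) (fst y) (fst z) m g')"
proof -
  obtain J d c e h where J: "is_interval V J d c e" and h: "h \<in> hom V J (VHom B (fst x) (fst y))"
    "h \<cdot> d = g" "h \<cdot> c = g'" "along (snd x) (fst x) (fst y) \<cdot> h = snd y \<cdot> e"
    using gg' by (auto simp: homotopic_def)
  note J' = interval_hom[OF J] and o [simp] = comma_obj_simps(1)[OF x] comma_obj_simps(1)[OF y] comma_obj_simps(1)[OF z]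
  note fx = comma_obj_simps(2-)[OF x] and fy = comma_obj_simps(2-)[OF y]
  note mh = comma_arr_hom[OF m]
  have m': "m \<in> Arr V" "Dom V m = Unit V" "Cod V m = VHom B (fst y) (fst z)"
    using mh by (simp_all add: in_hom)
  let ?p = "post_comp V B (fst x) (fst y) (fst z) m"
  note p = post_comp_comp(1,2)[OF B o mh h(1)]
  have Ja [simp]: "J \<in> Obj V" and Je: "d \<in> Arr V" "Dom V d = Unit V" "Cod V d = J" "c \<in> Arr V" "Dom V c = Unit V" "Cod V c = J"
     "e \<in> Arr V" "Dom V e = J" "Cod V e = Unit V" and ha: "h \<in> Arr V" "Dom V h = J" "Cod V h = VHom B (fst x) (fst y)"
    using J' h(1) by (simp_all add: in_hom)
  have g: "g \<in> hom V (Unit V) (VHom B (fst x) (fst y))" "g' \<in> hom V (Unit V) (VHom B (fst x) (fst y))"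
    using h J' comp_in_hom by blast+
  note al = comma_along[OF x o(3)] comma_along[OF x o(2)] comma_along[OF y o(3)]
  have "?p \<cdot> h \<in> hom V J (VHom B (fst x) (fst z))"
    using p h(1) comp_in_hom by blast
  moreover have "(?p \<cdot> h) \<cdot> d = el_comp V B (fst x) (fst y) (fst z) m g" "(?p \<cdot> h) \<cdot> c = el_comp V B (fst x) (fst y) (fst z) m g'"
    using p(1) h J' el_comp(3)[OF B o g(1) mh] el_comp(3)[OF B o g(2) mh]
    by (simp_all add: in_hom)
  moreover have "along (snd x) (fst x) (fst z) \<cdot> ?p \<cdot> h = snd z \<cdot> e"
  proof -
    have "along (snd x) (fst x) (fst z) \<cdot> ?p \<cdot> h =
        (along (snd x) (fst x) (fst z) \<cdot> VComp B (fst x) (fst y) (fst z) \<cdot> (m \<odot> h)) \<cdot> inv_arr V (LUnit V J)"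
      unfolding p(2) using al ha m' by simp
    also have "\<dots> = VComp A a (VFObj U (fst y)) (VFObj U (fst z)) \<cdot> ((VFArr U (fst y) (fst z) \<cdot> m) \<odot> (snd y \<cdot> e)) \<cdot> inv_arr V (LUnit V J)"
      unfolding along_vcomp[OF fx(1) o mh h(1)] h(4) using m' fy(2-) Je by simp
    also have "\<dots> = (VComp A a (VFObj U (fst y)) (VFObj U (fst z)) \<cdot> ((VFArr U (fst y) (fst z) \<cdot> m) \<odot> snd y)) \<cdot>
        ((Ident V (Unit V) \<odot> e) \<cdot> inv_arr V (LUnit V J))"
      using m' fy(2-) Je by simp
    also have "\<dots> = (snd z \<cdot> RUnit V (Unit V)) \<cdot> (inv_arr V (LUnit V (Unit V)) \<cdot> e)"
      using along_comp[OF fy(1) o(2,3) mh] m al m' inv_LUnit_natural(1)[of e J] Je unfolding comma_arr_def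
      by (simp flip: assoc)
    also have "\<dots> = snd z \<cdot> e"
      using comma_obj_simps[OF z] Je by (simp add: LUnit_eq_RUnit)
    finally show ?thesis .
  qed
  ultimately show ?thesis
    using J unfolding homotopic_def by blast
qed

lemma homotopic_trans:
  assumes x: "comma_obj x" and y: "comma_obj y" and 1: "homotopic x y g g'" and 2: "homotopic x y g' g''"
  shows "homotopic x y g g''"
proof -
  obtain J d c e h where J: "is_interval V J d c e" and h: "h \<in> hom V J (VHom B (fst x) (fst y))"
    "h \<cdot> d = g" "h \<cdot> c = g'" "along (snd x) (fst x) (fst y) \<cdot> h = snd y \<cdot> e"
    using 1 by (auto simp: homotopic_def)
  obtain J' d' c' e' h' where J': "is_interval V J' d' c' e'" and h': "h' \<in> hom V J' (VHom B (fst x) (fst y))"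
    "h' \<cdot> d' = g'" "h' \<cdot> c' = g''" "along (snd x) (fst x) (fst y) \<cdot> h' = snd y \<cdot> e'"
    using 2 by (auto simp: homotopic_def)
  show ?thesis
    using interval_concat[OF J J' h(1) h'(1) _ comma_obj_simps(2)[OF y] comma_along(1)[OF x comma_obj_simps(1)[OF y]] h(4) h'(4)]
      h h' unfolding homotopic_def by metis
qed

text \<open>
  The hom-object of the comma \<open>V\<close>-category from \<open>(b, f)\<close> to \<open>(b', f')\<close> is the pullback of
  \<open>B(b, b') \<rightarrow> A(a, U b')\<close> and \<open>f' : I \<rightarrow> A(a, U b')\<close>. The leg to \<open>I\<close> gives the functor to the unit
  \<open>V\<close>-category that the weight resolves.
\<close>

definition comma_pullback :: "'b \<times> 'a \<Rightarrow> 'b \<times> 'a \<Rightarrow> 'o \<times> 'a \<times> 'a \<Rightarrow> bool" where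
  "comma_pullback x y = (\<lambda>(w, i, j).
     i \<in> hom V w (VHom B (fst x) (fst y)) \<and> j \<in> hom V w (Unit V) \<and>
     along (snd x) (fst x) (fst y) \<cdot> i = snd y \<cdot> j \<and>
     (\<forall>X v k. v \<in> hom V X (VHom B (fst x) (fst y)) \<and> k \<in> hom V X (Unit V) \<and>
        along (snd x) (fst x) (fst y) \<cdot> v = snd y \<cdot> k \<longrightarrow>
        (\<exists>!t. t \<in> hom V X w \<and> i \<cdot> t = v \<and> j \<cdot> t = k)))"

definition comma_hom :: "'b \<times> 'a \<Rightarrow> 'b \<times> 'a \<Rightarrow> 'o" where
  "comma_hom x y = fst (SOME p. comma_pullback x y p)"

definition comma_proj :: "'b \<times> 'a \<Rightarrow> 'b \<times> 'a \<Rightarrow> 'a" where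
  "comma_proj x y = fst (snd (SOME p. comma_pullback x y p))"

definition comma_point :: "'b \<times> 'a \<Rightarrow> 'b \<times> 'a \<Rightarrow> 'a" where
  "comma_point x y = snd (snd (SOME p. comma_pullback x y p))"

definition comma_pair :: "'b \<times> 'a \<Rightarrow> 'b \<times> 'a \<Rightarrow> 'o \<Rightarrow> 'a \<Rightarrow> 'a \<Rightarrow> 'a" where
  "comma_pair x y X v k = (THE t. t \<in> hom V X (comma_hom x y) \<and> comma_proj x y \<cdot> t = v \<and> comma_point x y \<cdot> t = k)"

lemma comma_pullback:
  assumes x: "comma_obj x" and y: "comma_obj y"
  shows "comma_pullback x y (comma_hom x y, comma_proj x y, comma_point x y)"
proof -
  have "\<exists>w i j. comma_pullback x y (w, i, j)"
    using ex_pullback[OF universe complete category comma_along(1)[OF x comma_obj_simps(1)[OF y]] comma_obj_simps(2)[OF y]]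
    unfolding comma_pullback_def by simp
  then have "\<exists>p. comma_pullback x y p"
    by blast
  then have "comma_pullback x y (SOME p. comma_pullback x y p)"
    by (rule someI_ex)
  then show ?thesis
    by (simp add: comma_hom_def comma_proj_def comma_point_def)
qed

lemma comma_hom_simps [simp]:
  assumes x: "comma_obj x" and y: "comma_obj y"
  shows "comma_hom x y \<in> Obj V"
    and "comma_proj x y \<in> Arr V" and "Dom V (comma_proj x y) = comma_hom x y"
    and "Cod V (comma_proj x y) = VHom B (fst x) (fst y)"
    and "comma_point x y \<in> Arr V" and "Dom V (comma_point x y) = comma_hom x y" and "Cod V (comma_point x y) = Unit V"
proof -
  have *: "comma_proj x y \<in> hom V (comma_hom x y) (VHom B (fst x) (fst y))" "comma_point x y \<in> hom V (comma_hom x y) (Unit V)"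
    using comma_pullback[OF x y] by (simp_all add: comma_pullback_def)
  then show "comma_proj x y \<in> Arr V" and "Dom V (comma_proj x y) = comma_hom x y"
    and "Cod V (comma_proj x y) = VHom B (fst x) (fst y)"
    and "comma_point x y \<in> Arr V" and "Dom V (comma_point x y) = comma_hom x y" and "Cod V (comma_point x y) = Unit V"
    by (simp_all add: in_hom)
  then show "comma_hom x y \<in> Obj V"
    using Dom_Obj by metis
qed

lemma comma_square:
  assumes x: "comma_obj x" and y: "comma_obj y"
  shows "along (snd x) (fst x) (fst y) \<cdot> comma_proj x y = snd y \<cdot> comma_point x y"
  using comma_pullback[OF x y] by (simp add: comma_pullback_def)

lemma comma_pair:
  assumes x: "comma_obj x" and y: "comma_obj y" and "v \<in> hom V X (VHom B (fst x) (fst y))" and "k \<in> hom V X (Unit V)"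
    and "along (snd x) (fst x) (fst y) \<cdot> v = snd y \<cdot> k"
  shows "comma_pair x y X v k \<in> hom V X (comma_hom x y)"
    and "comma_proj x y \<cdot> comma_pair x y X v k = v" and "comma_point x y \<cdot> comma_pair x y X v k = k"
proof -
  have "\<exists>!t. t \<in> hom V X (comma_hom x y) \<and> comma_proj x y \<cdot> t = v \<and> comma_point x y \<cdot> t = k"
    using comma_pullback[OF x y] assms(3-5) unfolding comma_pullback_def by simp
  from theI'[OF this, folded comma_pair_def] show "comma_pair x y X v k \<in> hom V X (comma_hom x y)"
    and "comma_proj x y \<cdot> comma_pair x y X v k = v" and "comma_point x y \<cdot> comma_pair x y X v k = k"
    by auto
qed

lemma comma_cancel:
  assumes x: "comma_obj x" and y: "comma_obj y" and s: "s \<in> hom V X (comma_hom x y)" and t: "t \<in> hom V X (comma_hom x y)"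
    and "comma_proj x y \<cdot> s = comma_proj x y \<cdot> t" and "comma_point x y \<cdot> s = comma_point x y \<cdot> t"
  shows "s = t"
proof -
  have a: "s \<in> Arr V" "Dom V s = X" "Cod V s = comma_hom x y" "t \<in> Arr V" "Dom V t = X" "Cod V t = comma_hom x y"
    using s t by (simp_all add: in_hom)
  have h: "comma_proj x y \<cdot> t \<in> hom V X (VHom B (fst x) (fst y))" "comma_point x y \<cdot> t \<in> hom V X (Unit V)"
    using a x y by (simp_all add: in_hom)
  have "along (snd x) (fst x) (fst y) \<cdot> comma_proj x y \<cdot> t = (along (snd x) (fst x) (fst y) \<cdot> comma_proj x y) \<cdot> t"
    using a x y comma_along[OF x comma_obj_simps(1)[OF y]] by simp
  also have "\<dots> = snd y \<cdot> comma_point x y \<cdot> t"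
    unfolding comma_square[OF x y] using a x y comma_obj_simps[OF y] by simp
  finally have "\<exists>!r. r \<in> hom V X (comma_hom x y) \<and> comma_proj x y \<cdot> r = comma_proj x y \<cdot> t \<and> comma_point x y \<cdot> r = comma_point x y \<cdot> t"
    using comma_pullback[OF x y] h unfolding comma_pullback_def by simp
  then show ?thesis
    using assms by metis
qed

text \<open>The full sub-\<open>V\<close>-category of the comma \<open>V\<close>-category on a family of objects.\<close>

definition comma_vcat :: "'i set \<Rightarrow> ('i \<Rightarrow> 'b \<times> 'a) \<Rightarrow> ('i, 'o, 'a) vcat" where
  "comma_vcat T x =
     \<lparr>VObj = T,
      VHom = \<lambda>s t. comma_hom (x s) (x t),
      VId = \<lambda>s. comma_pair (x s) (x s) (Unit V) (VId B (fst (x s))) (Ident V (Unit V)),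
      VComp = \<lambda>r s t. comma_pair (x r) (x t) (comma_hom (x s) (x t) \<otimes> comma_hom (x r) (x s))
        (VComp B (fst (x r)) (fst (x s)) (fst (x t)) \<cdot> (comma_proj (x s) (x t) \<odot> comma_proj (x r) (x s)))
        (LUnit V (Unit V) \<cdot> (comma_point (x s) (x t) \<odot> comma_point (x r) (x s)))\<rparr>"

definition comma_forget :: "('i \<Rightarrow> 'b \<times> 'a) \<Rightarrow> ('i, 'b, 'a) vfun" where
  "comma_forget x = \<lparr>VFObj = \<lambda>s. fst (x s), VFArr = \<lambda>s t. comma_proj (x s) (x t)\<rparr>"

definition comma_terminal :: "('i \<Rightarrow> 'b \<times> 'a) \<Rightarrow> ('i, unit, 'a) vfun" where
  "comma_terminal x = \<lparr>VFObj = \<lambda>_. (), VFArr = \<lambda>s t. comma_point (x s) (x t)\<rparr>"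

lemma comma_vcomp_hom:
  assumes x: "comma_obj x" and y: "comma_obj y" and z: "comma_obj z"
  defines "v \<equiv> VComp B (fst x) (fst y) (fst z) \<cdot> (comma_proj y z \<odot> comma_proj x y)"
    and "k \<equiv> LUnit V (Unit V) \<cdot> (comma_point y z \<odot> comma_point x y)"
  shows "v \<in> hom V (comma_hom y z \<otimes> comma_hom x y) (VHom B (fst x) (fst z))"
    and "k \<in> hom V (comma_hom y z \<otimes> comma_hom x y) (Unit V)"
    and "along (snd x) (fst x) (fst z) \<cdot> v = snd z \<cdot> k"
proof -
  note o [simp] = comma_obj_simps(1)[OF x] comma_obj_simps(1)[OF y] comma_obj_simps(1)[OF z]
  note [simp] = x y z
  note fx = comma_obj_simps(2-)[OF x] and fy = comma_obj_simps(2-)[OF y] and fz = comma_obj_simps(2-)[OF z]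
  note al = comma_along[OF x o(3)] comma_along[OF x o(2)] comma_along[OF y o(3)]
  show "v \<in> hom V (comma_hom y z \<otimes> comma_hom x y) (VHom B (fst x) (fst z))"
    and "k \<in> hom V (comma_hom y z \<otimes> comma_hom x y) (Unit V)"
    by (simp_all add: v_def k_def in_hom)
  have j: "comma_proj y z \<in> hom V (comma_hom y z) (VHom B (fst y) (fst z))"
    "comma_proj x y \<in> hom V (comma_hom x y) (VHom B (fst x) (fst y))"
    by (simp_all add: in_hom)
  let ?I = "Ident V (comma_hom y z)"
  have "along (snd x) (fst x) (fst z) \<cdot> v = VComp A a (VFObj U (fst y)) (VFObj U (fst z)) \<cdot>
      ((VFArr U (fst y) (fst z) \<cdot> comma_proj y z) \<odot> (snd y \<cdot> comma_point x y))"
    unfolding v_def along_vcomp[OF fx(1) o j] comma_square[OF x y] ..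
  also have "\<dots> = (VComp A a (VFObj U (fst y)) (VFObj U (fst z)) \<cdot>
      ((VFArr U (fst y) (fst z) \<cdot> comma_proj y z) \<odot> snd y)) \<cdot> (?I \<odot> comma_point x y)"
    using fy by simp
  also have "\<dots> = ((along (snd y) (fst y) (fst z) \<cdot> comma_proj y z) \<cdot> RUnit V (comma_hom y z)) \<cdot> (?I \<odot> comma_point x y)"
    using along_comp[OF fy(1) o(2,3) j(1)] al by simp
  also have "\<dots> = snd z \<cdot> (comma_point y z \<cdot> RUnit V (comma_hom y z)) \<cdot> (?I \<odot> comma_point x y)"
    unfolding comma_square[OF y z] using fz by simp
  also have "\<dots> = snd z \<cdot> (RUnit V (Unit V) \<cdot> (comma_point y z \<odot> Ident V (Unit V))) \<cdot> (?I \<odot> comma_point x y)"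
    by (simp add: LUnit_natural)
  also have "\<dots> = snd z \<cdot> k"
    unfolding k_def by (simp add: LUnit_eq_RUnit)
  finally show "along (snd x) (fst x) (fst z) \<cdot> v = snd z \<cdot> k" .
qed

context
  fixes T :: "'i set" and x :: "'i \<Rightarrow> 'b \<times> 'a"
  assumes objs: "\<And>s. s \<in> T \<Longrightarrow> comma_obj (x s)"
begin

lemma comma_vcat_simps:
  "VObj (comma_vcat T x) = T" "VHom (comma_vcat T x) r s = comma_hom (x r) (x s)"
  by (simp_all add: comma_vcat_def)

lemma comma_vcat_VId:
  assumes "s \<in> T"
  shows "VId (comma_vcat T x) s \<in> hom V (Unit V) (comma_hom (x s) (x s))"
    and "comma_proj (x s) (x s) \<cdot> VId (comma_vcat T x) s = VId B (fst (x s))"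
    and "comma_point (x s) (x s) \<cdot> VId (comma_vcat T x) s = Ident V (Unit V)"
proof -
  note x = objs[OF assms]
  have "VId B (fst (x s)) \<in> hom V (Unit V) (VHom B (fst (x s)) (fst (x s)))" "Ident V (Unit V) \<in> hom V (Unit V) (Unit V)"
    "along (snd (x s)) (fst (x s)) (fst (x s)) \<cdot> VId B (fst (x s)) = snd (x s) \<cdot> Ident V (Unit V)"
    using comma_obj_simps[OF x] comma_arr_VId[OF x] by (simp_all add: in_hom comma_arr_def)
  from comma_pair[OF x x this] show "VId (comma_vcat T x) s \<in> hom V (Unit V) (comma_hom (x s) (x s))"
    and "comma_proj (x s) (x s) \<cdot> VId (comma_vcat T x) s = VId B (fst (x s))"
    and "comma_point (x s) (x s) \<cdot> VId (comma_vcat T x) s = Ident V (Unit V)"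
    by (simp_all add: comma_vcat_def)
qed

lemma comma_vcat_VComp:
  assumes "r \<in> T" and "s \<in> T" and "t \<in> T"
  shows "VComp (comma_vcat T x) r s t \<in> hom V (comma_hom (x s) (x t) \<otimes> comma_hom (x r) (x s)) (comma_hom (x r) (x t))"
    and "comma_proj (x r) (x t) \<cdot> VComp (comma_vcat T x) r s t =
      VComp B (fst (x r)) (fst (x s)) (fst (x t)) \<cdot> (comma_proj (x s) (x t) \<odot> comma_proj (x r) (x s))"
    and "comma_point (x r) (x t) \<cdot> VComp (comma_vcat T x) r s t =
      LUnit V (Unit V) \<cdot> (comma_point (x s) (x t) \<odot> comma_point (x r) (x s))"
  using comma_pair[OF objs[OF assms(1)] objs[OF assms(3)] comma_vcomp_hom[OF objs[OF assms(1)] objs[OF assms(2)] objs[OF assms(3)]]]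
  by (simp_all add: comma_vcat_def)

lemma comma_vcat_VComp_comp:
  assumes rst: "r \<in> T" "s \<in> T" "t \<in> T" and g: "g \<in> hom V X (comma_hom (x s) (x t))" and f: "f \<in> hom V Y (comma_hom (x r) (x s))"
  shows "VComp (comma_vcat T x) r s t \<cdot> (g \<odot> f) \<in> hom V (X \<otimes> Y) (comma_hom (x r) (x t))"
    and "comma_proj (x r) (x t) \<cdot> VComp (comma_vcat T x) r s t \<cdot> (g \<odot> f) =
      VComp B (fst (x r)) (fst (x s)) (fst (x t)) \<cdot> ((comma_proj (x s) (x t) \<cdot> g) \<odot> (comma_proj (x r) (x s) \<cdot> f))"
    and "comma_point (x r) (x t) \<cdot> VComp (comma_vcat T x) r s t \<cdot> (g \<odot> f) =
      LUnit V (Unit V) \<cdot> ((comma_point (x s) (x t) \<cdot> g) \<odot> (comma_point (x r) (x s) \<cdot> f))"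
proof -
  note [simp] = objs[OF rst(1)] objs[OF rst(2)] objs[OF rst(3)]
  note c = comma_vcat_VComp[OF rst]
  have C: "VComp (comma_vcat T x) r s t \<in> Arr V" "Dom V (VComp (comma_vcat T x) r s t) = comma_hom (x s) (x t) \<otimes> comma_hom (x r) (x s)"
    "Cod V (VComp (comma_vcat T x) r s t) = comma_hom (x r) (x t)"
    "g \<in> Arr V" "Dom V g = X" "Cod V g = comma_hom (x s) (x t)" "f \<in> Arr V" "Dom V f = Y" "Cod V f = comma_hom (x r) (x s)"
    using c(1) f g by (simp_all add: in_hom)
  show "VComp (comma_vcat T x) r s t \<cdot> (g \<odot> f) \<in> hom V (X \<otimes> Y) (comma_hom (x r) (x t))"
    using C by (simp add: in_hom)
  have "comma_proj (x r) (x t) \<cdot> VComp (comma_vcat T x) r s t \<cdot> (g \<odot> f) =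
      (comma_proj (x r) (x t) \<cdot> VComp (comma_vcat T x) r s t) \<cdot> (g \<odot> f)"
    "comma_point (x r) (x t) \<cdot> VComp (comma_vcat T x) r s t \<cdot> (g \<odot> f) =
      (comma_point (x r) (x t) \<cdot> VComp (comma_vcat T x) r s t) \<cdot> (g \<odot> f)"
    using C by simp_all
  then show "comma_proj (x r) (x t) \<cdot> VComp (comma_vcat T x) r s t \<cdot> (g \<odot> f) =
      VComp B (fst (x r)) (fst (x s)) (fst (x t)) \<cdot> ((comma_proj (x s) (x t) \<cdot> g) \<odot> (comma_proj (x r) (x s) \<cdot> f))"
    and "comma_point (x r) (x t) \<cdot> VComp (comma_vcat T x) r s t \<cdot> (g \<odot> f) =
      LUnit V (Unit V) \<cdot> ((comma_point (x s) (x t) \<cdot> g) \<odot> (comma_point (x r) (x s) \<cdot> f))"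
    unfolding c using C by (simp_all add: comma_obj_simps)
qed

text \<open>
  The two legs of the pullbacks are jointly monic, so the axioms are inherited from \<open>B\<close> and from the
  unit \<open>V\<close>-category.
\<close>

lemma is_vcat_comma_vcat: "is_vcat V (comma_vcat T x)"
proof -
  let ?D = "comma_vcat T x" and ?I = "Unit V"
  note U1 = is_vcat_unit_vcat
  have us: "VComp (unit_vcat V) () () () = LUnit V ?I" "VHom (unit_vcat V) () () = ?I" "VId (unit_vcat V) () = Ident V ?I"
     "() \<in> VObj (unit_vcat V)"
    by (simp_all add: unit_vcat_def)
  have assoc_law: "VComp ?D p q s \<cdot> (VComp ?D q r s \<odot> Ident V (VHom ?D p q)) =
        VComp ?D p r s \<cdot> (Ident V (VHom ?D r s) \<odot> VComp ?D p q r) \<cdot> Assoc V (VHom ?D r s) (VHom ?D q r) (VHom ?D p q)"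
    if o: "p \<in> T" "q \<in> T" "r \<in> T" "s \<in> T" for p q r s
  proof -
    note [simp] = objs[OF o(1)] objs[OF o(2)] objs[OF o(3)] objs[OF o(4)]
    let ?pq = "comma_hom (x p) (x q)" and ?qr = "comma_hom (x q) (x r)" and ?rs = "comma_hom (x r) (x s)"
    have id: "Ident V ?pq \<in> hom V ?pq ?pq" "Ident V ?rs \<in> hom V ?rs ?rs"
      by (simp_all add: in_hom)
    note l = comma_vcat_VComp_comp[OF o(1,2,4) comma_vcat_VComp(1)[OF o(2,3,4)] id(1)]
    note r = comma_vcat_VComp_comp[OF o(1,3,4) id(2) comma_vcat_VComp(1)[OF o(1,2,3)]]
    note cl = comma_vcat_VComp[OF o(2,3,4)] and cr = comma_vcat_VComp[OF o(1,2,3)] and cc = comma_vcat_VComp(1)[OF o(1,3,4)]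
    have arr: "VComp ?D p r s \<in> Arr V" "Dom V (VComp ?D p r s) = ?rs \<otimes> comma_hom (x p) (x r)" "Cod V (VComp ?D p r s) = comma_hom (x p) (x s)"
      "VComp ?D p q r \<in> Arr V" "Dom V (VComp ?D p q r) = ?qr \<otimes> ?pq" "Cod V (VComp ?D p q r) = comma_hom (x p) (x r)"
      using cr cc by (simp_all add: in_hom)
    have proj: "comma_proj (x r) (x s) \<in> hom V ?rs (VHom B (fst (x r)) (fst (x s)))"
      "comma_proj (x q) (x r) \<in> hom V ?qr (VHom B (fst (x q)) (fst (x r)))"
      "comma_proj (x p) (x q) \<in> hom V ?pq (VHom B (fst (x p)) (fst (x q)))"
      and point: "comma_point (x r) (x s) \<in> hom V ?rs (VHom (unit_vcat V) () ())"
      "comma_point (x q) (x r) \<in> hom V ?qr (VHom (unit_vcat V) () ())"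
      "comma_point (x p) (x q) \<in> hom V ?pq (VHom (unit_vcat V) () ())"
      by (simp_all add: in_hom us)
    note b = comma_obj_simps(1)[OF objs[OF o(1)]] comma_obj_simps(1)[OF objs[OF o(2)]] comma_obj_simps(1)[OF objs[OF o(3)]] comma_obj_simps(1)[OF objs[OF o(4)]]
    let ?al = "Assoc V ?rs ?qr ?pq"
    have R: "VComp ?D p r s \<cdot> (Ident V ?rs \<odot> VComp ?D p q r) \<cdot> ?al = (VComp ?D p r s \<cdot> (Ident V ?rs \<odot> VComp ?D p q r)) \<cdot> ?al"
      using arr by simp
    have "VComp ?D p q s \<cdot> (VComp ?D q r s \<odot> Ident V ?pq) = VComp ?D p r s \<cdot> (Ident V ?rs \<odot> VComp ?D p q r) \<cdot> ?al"
    proof (rule comma_cancel[OF objs[OF o(1)] objs[OF o(4)] l(1)])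
      show "VComp ?D p r s \<cdot> (Ident V ?rs \<odot> VComp ?D p q r) \<cdot> ?al \<in> hom V ((?rs \<otimes> ?qr) \<otimes> ?pq) (comma_hom (x p) (x s))"
        using arr by (simp add: in_hom)
      have "comma_proj (x p) (x s) \<cdot> VComp ?D p r s \<cdot> (Ident V ?rs \<odot> VComp ?D p q r) \<cdot> ?al
          = (comma_proj (x p) (x s) \<cdot> VComp ?D p r s \<cdot> (Ident V ?rs \<odot> VComp ?D p q r)) \<cdot> ?al"
        using arr by simp
      then show "comma_proj (x p) (x s) \<cdot> VComp ?D p q s \<cdot> (VComp ?D q r s \<odot> Ident V ?pq) =
          comma_proj (x p) (x s) \<cdot> VComp ?D p r s \<cdot> (Ident V ?rs \<odot> VComp ?D p q r) \<cdot> ?al"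
        unfolding l(2) r(2) cl(2) cr(2) using vcomp_assoc[OF B b proj] b by simp
      have "comma_point (x p) (x s) \<cdot> VComp ?D p r s \<cdot> (Ident V ?rs \<odot> VComp ?D p q r) \<cdot> ?al
          = (comma_point (x p) (x s) \<cdot> VComp ?D p r s \<cdot> (Ident V ?rs \<odot> VComp ?D p q r)) \<cdot> ?al"
        using arr by simp
      then show "comma_point (x p) (x s) \<cdot> VComp ?D p q s \<cdot> (VComp ?D q r s \<odot> Ident V ?pq) =
          comma_point (x p) (x s) \<cdot> VComp ?D p r s \<cdot> (Ident V ?rs \<odot> VComp ?D p q r) \<cdot> ?al"
        unfolding l(3) r(3) cl(3) cr(3) using vcomp_assoc[OF U1 us(4) us(4) us(4) us(4) point] by (simp add: us)
    qed
    then show ?thesis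
      by (simp add: comma_vcat_simps)
  qed
  have unit_law: "VComp ?D r s s \<cdot> (VId ?D s \<odot> Ident V (VHom ?D r s)) = LUnit V (VHom ?D r s)"
    "VComp ?D r r s \<cdot> (Ident V (VHom ?D r s) \<odot> VId ?D r) = RUnit V (VHom ?D r s)"
    if o: "r \<in> T" "s \<in> T" for r s
  proof -
    note [simp] = objs[OF o(1)] objs[OF o(2)]
    let ?rs = "comma_hom (x r) (x s)"
    have id: "Ident V ?rs \<in> hom V ?rs ?rs"
      by (simp_all add: in_hom)
    note l = comma_vcat_VComp_comp[OF o(1,2,2) comma_vcat_VId(1)[OF o(2)] id]
    note r = comma_vcat_VComp_comp[OF o(1,1,2) id comma_vcat_VId(1)[OF o(1)]]
    have proj: "comma_proj (x r) (x s) \<in> hom V ?rs (VHom B (fst (x r)) (fst (x s)))"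
      and point: "comma_point (x r) (x s) \<in> hom V ?rs (VHom (unit_vcat V) () ())"
      by (simp_all add: in_hom us)
    note b = comma_obj_simps(1)[OF objs[OF o(1)]] comma_obj_simps(1)[OF objs[OF o(2)]]
    have "VComp ?D r s s \<cdot> (VId ?D s \<odot> Ident V ?rs) = LUnit V ?rs"
    proof (rule comma_cancel[OF objs[OF o(1)] objs[OF o(2)] l(1)])
      show "LUnit V ?rs \<in> hom V (Unit V \<otimes> ?rs) ?rs"
        by (simp add: in_hom)
      show "comma_proj (x r) (x s) \<cdot> VComp ?D r s s \<cdot> (VId ?D s \<odot> Ident V ?rs) = comma_proj (x r) (x s) \<cdot> LUnit V ?rs"
        unfolding l(2) comma_vcat_VId(2)[OF o(2)] using vcomp_VId(1)[OF B b proj] by simp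
      show "comma_point (x r) (x s) \<cdot> VComp ?D r s s \<cdot> (VId ?D s \<odot> Ident V ?rs) = comma_point (x r) (x s) \<cdot> LUnit V ?rs"
        unfolding l(3) comma_vcat_VId(3)[OF o(2)] using vcomp_VId(1)[OF U1 us(4) us(4) point] by (simp add: us)
    qed
    moreover have "VComp ?D r r s \<cdot> (Ident V ?rs \<odot> VId ?D r) = RUnit V ?rs"
    proof (rule comma_cancel[OF objs[OF o(1)] objs[OF o(2)] r(1)])
      show "RUnit V ?rs \<in> hom V (?rs \<otimes> Unit V) ?rs"
        by (simp add: in_hom)
      show "comma_proj (x r) (x s) \<cdot> VComp ?D r r s \<cdot> (Ident V ?rs \<odot> VId ?D r) = comma_proj (x r) (x s) \<cdot> RUnit V ?rs"
        unfolding r(2) comma_vcat_VId(2)[OF o(1)] using vcomp_VId(2)[OF B b proj] by simp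
      show "comma_point (x r) (x s) \<cdot> VComp ?D r r s \<cdot> (Ident V ?rs \<odot> VId ?D r) = comma_point (x r) (x s) \<cdot> RUnit V ?rs"
        unfolding r(3) comma_vcat_VId(3)[OF o(1)] using vcomp_VId(2)[OF U1 us(4) us(4) point] by (simp add: us)
    qed
    ultimately show "VComp ?D r s s \<cdot> (VId ?D s \<odot> Ident V (VHom ?D r s)) = LUnit V (VHom ?D r s)"
      "VComp ?D r r s \<cdot> (Ident V (VHom ?D r s) \<odot> VId ?D r) = RUnit V (VHom ?D r s)"
      by (simp_all add: comma_vcat_simps)
  qed
  show ?thesis
    unfolding is_vcat_def
  proof (intro conjI ballI)
    show "VHom ?D r s \<in> Obj V" if "r \<in> VObj ?D" "s \<in> VObj ?D" for r s
      using that objs by (simp add: comma_vcat_simps)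
    show "VId ?D r \<in> hom V (Unit V) (VHom ?D r r)" if "r \<in> VObj ?D" for r
      using that comma_vcat_VId(1) by (simp add: comma_vcat_simps)
    show "VComp ?D r s t \<in> hom V (VHom ?D s t \<otimes> VHom ?D r s) (VHom ?D r t)"
      if "r \<in> VObj ?D" "s \<in> VObj ?D" "t \<in> VObj ?D" for r s t
      using that comma_vcat_VComp(1) by (simp add: comma_vcat_simps)
  qed (use assoc_law unit_law in \<open>simp_all add: comma_vcat_simps(1)\<close>)
qed

lemma comma_forget: "is_vfunctor V (comma_vcat T x) B (comma_forget x)"
  unfolding is_vfunctor_def comma_vcat_simps comma_forget_def
  using objs comma_obj_simps(1) comma_vcat_VId(2) comma_vcat_VComp(2) by (simp add: in_hom)

lemma comma_terminal: "is_vfunctor V (comma_vcat T x) (unit_vcat V) (comma_terminal x)"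
  unfolding is_vfunctor_def comma_vcat_simps comma_terminal_def
  using objs comma_vcat_VId(3) comma_vcat_VComp(3) by (simp add: in_hom unit_vcat_def)

end

end

section \<open>The weighted limit of a small family of arrows under an object\<close>

text \<open>
  The comma objects \<open>x s\<close> for \<open>s \<in> T\<close> span a small full sub-\<open>V\<close>-category of \<open>a / U\<close>. Its constant weight
  is replaced by a cofibrant weight \<open>Q\<close>, with trivial fibrations \<open>q s : Q s \<rightarrow> I\<close>, and \<open>l\<close> is the
  \<open>Q\<close>-weighted limit of the underlying objects of \<open>B\<close>.
\<close>

locale comma_limit = adjoint_setting V u B A U a
  for V :: "('o, 'a, 'z) smmc_scheme" (structure) and u :: "'u itself"
    and B :: "('b, 'o, 'a) vcat" and A :: "('c, 'o, 'a) vcat" and U :: "('b, 'c, 'a) vfun" and a :: 'c +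
  fixes T :: "'u set" and x :: "'u \<Rightarrow> 'b \<times> 'a" and Q :: "('u, 'o, 'a) vfun" and q :: "'u \<Rightarrow> 'a"
    and l :: 'b and \<mu> :: "'u \<Rightarrow> 'a"
  assumes small_T: "small u T" and objs: "s \<in> T \<Longrightarrow> comma_obj (x s)"
    and Q: "is_vfunctor V (comma_vcat T x) (self_vcat V) Q" and cofibrant_Q: "cofibrant_weight V (comma_vcat T x) Q"
    and ptf: "pointwise_trivial_fibration V (comma_vcat T x) Q (vfun_comp V (unit_select V) (comma_terminal x)) q"
    and q_hom: "s \<in> T \<Longrightarrow> q s \<in> hom V (VFObj Q s) (Unit V)" and q_tfib: "s \<in> T \<Longrightarrow> q s \<in> Fib V \<inter> Weq V"
    and q_natural: "natural_family (comma_vcat T x) Q (vfun_comp V (unit_select V) (comma_terminal x)) q"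
    and lim: "is_wlimit V (comma_vcat T x) B Q (comma_forget x) l \<mu>"
    and limA: "is_wlimit V (comma_vcat T x) A Q (vfun_comp V U (comma_forget x)) (VFObj U l)
       (\<lambda>s. VFArr U l (VFObj (comma_forget x) s) \<cdot> \<mu> s)"
begin

abbreviation D :: "('u, 'o, 'a) vcat" where "D \<equiv> comma_vcat T x"

abbreviation ob :: "'u \<Rightarrow> 'b" where "ob s \<equiv> fst (x s)"

abbreviation H :: "'u \<Rightarrow> 'u \<Rightarrow> 'o" where "H s t \<equiv> comma_hom (x s) (x t)"

lemma vcat_D [simp]: "is_vcat V D"
  using is_vcat_comma_vcat objs by blast

lemma D_simps [simp]: "VObj D = T" "VHom D s t = H s t"
  using comma_vcat_simps[of T x] objs by auto

lemmas typed_Q = typed_vfunctor[OF Q]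

lemma Q_Obj [simp]: "s \<in> T \<Longrightarrow> VFObj Q s \<in> Obj V"
  using typed_Q by (simp add: typed_functor_def)

lemma act_Q [simp]:
  assumes "s \<in> T" "t \<in> T"
  shows "act Q s t \<in> Arr V" "Dom V (act Q s t) = H s t \<otimes> VFObj Q s" "Cod V (act Q s t) = VFObj Q t"
  using act_simps[OF typed_Q] assms by auto

lemma objs_simps [simp]:
  assumes "s \<in> T"
  shows "comma_obj (x s)" "ob s \<in> VObj B" "snd (x s) \<in> Arr V" "Dom V (snd (x s)) = Unit V"
    "Cod V (snd (x s)) = VHom A a (VFObj U (ob s))"
  using objs[OF assms] comma_obj_simps[OF objs[OF assms]] by auto

lemma q_simps [simp]:
  assumes "s \<in> T"
  shows "q s \<in> Arr V" "Dom V (q s) = VFObj Q s" "Cod V (q s) = Unit V"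
  using q_hom[OF assms] by (auto simp: in_hom)

lemma forget_simps [simp]: "VFObj (comma_forget x) s = ob s" "VFArr (comma_forget x) s t = comma_proj (x s) (x t)"
  by (simp_all add: comma_forget_def)

lemma forget: "is_vfunctor V D B (comma_forget x)"
  using comma_forget objs by blast

lemma terminal: "is_vfunctor V D (unit_vcat V) (comma_terminal x)"
  using comma_terminal objs by blast

lemma q_act:
  assumes "s \<in> T" "t \<in> T"
  shows "q t \<cdot> act Q s t = comma_point (x s) (x t) \<cdot> RUnit V (H s t) \<cdot> (Ident V (H s t) \<odot> q s)"
proof -
  have "q t \<cdot> act Q s t = act (vfun_comp V (unit_select V) (comma_terminal x)) s t \<cdot> (Ident V (H s t) \<odot> q s)"
    using q_natural assms by (simp add: natural_family_def)
  also have "act (vfun_comp V (unit_select V) (comma_terminal x)) s t = comma_point (x s) (x t) \<cdot> RUnit V (H s t)"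
    using unit_select_comp(3)[OF vcat_D terminal, of s t] assms by (simp add: comma_terminal_def)
  finally show ?thesis
    using assms by simp
qed

lemmas lim_univ = wlimit[OF B vcat_D typed_Q forget lim, unfolded D_simps forget_simps]

lemma l_Obj [simp]: "l \<in> VObj B"
  by (rule lim_univ(1))

lemma \<mu>_simps [simp]:
  assumes "s \<in> T"
  shows "\<mu> s \<in> Arr V" "Dom V (\<mu> s) = VFObj Q s" "Cod V (\<mu> s) = VHom B l (ob s)"
  using lim_univ(2)[OF assms] by (auto simp: in_hom)

lemma U_forget: "is_vfunctor V D A (vfun_comp V U (comma_forget x))"
  unfolding is_vfunctor_def
proof (intro conjI ballI)
  have UF: "VFObj (vfun_comp V U (comma_forget x)) s = VFObj U (ob s)"
    "VFArr (vfun_comp V U (comma_forget x)) s t = VFArr U (ob s) (ob t) \<cdot> comma_proj (x s) (x t)" for s t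
    by (simp_all add: vfun_comp_def)
  fix r s t assume "r \<in> VObj D" "s \<in> VObj D" "t \<in> VObj D"
  then have o [simp]: "r \<in> T" "s \<in> T" "t \<in> T"
    by simp_all
  show "VFObj (vfun_comp V U (comma_forget x)) r \<in> VObj A"
    by (simp add: UF)
  show "VFArr (vfun_comp V U (comma_forget x)) r s \<in>
      hom V (VHom D r s) (VHom A (VFObj (vfun_comp V U (comma_forget x)) r) (VFObj (vfun_comp V U (comma_forget x)) s))"
    by (simp add: UF in_hom)
  note c = comma_vcat_VComp[of T x, OF objs o] and i = comma_vcat_VId[of T x, OF objs o(1)]
  have arr: "VId D r \<in> Arr V" "Dom V (VId D r) = Unit V" "Cod V (VId D r) = H r r"
    using i(1) by (auto simp: in_hom)
  show "VFArr (vfun_comp V U (comma_forget x)) r r \<cdot> VId D r = VId A (VFObj (vfun_comp V U (comma_forget x)) r)"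
    using arr i(2) vfunctor_simps(5)[OF U, of "ob r"] by (simp add: UF)
  have arr: "VComp D r s t \<in> Arr V" "Dom V (VComp D r s t) = H s t \<otimes> H r s" "Cod V (VComp D r s t) = H r t"
    using c(1) by (simp_all add: in_hom)
  have j: "comma_proj (x s) (x t) \<in> hom V (H s t) (VHom B (ob s) (ob t))" "comma_proj (x r) (x s) \<in> hom V (H r s) (VHom B (ob r) (ob s))"
    by (simp_all add: in_hom)
  show "VFArr (vfun_comp V U (comma_forget x)) r t \<cdot> VComp D r s t =
      VComp A (VFObj (vfun_comp V U (comma_forget x)) r) (VFObj (vfun_comp V U (comma_forget x)) s) (VFObj (vfun_comp V U (comma_forget x)) t) \<cdot>
      (VFArr (vfun_comp V U (comma_forget x)) s t \<odot> VFArr (vfun_comp V U (comma_forget x)) r s)"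
    using arr c(2) vfunctor_vcomp[OF U B A _ _ _ j] by (simp add: UF)
qed

lemma U_forget_simps [simp]:
  "VFObj (vfun_comp V U (comma_forget x)) s = VFObj U (ob s)"
  "VFArr (vfun_comp V U (comma_forget x)) s t = VFArr U (ob s) (ob t) \<cdot> comma_proj (x s) (x t)"
  by (simp_all add: vfun_comp_def)

lemmas limA_univ = wlimit[OF A vcat_D typed_Q U_forget limA, unfolded D_simps forget_simps U_forget_simps]

text \<open>
  The cone \<open>Q \<rightarrow> IP \<rightarrow> A(a, U x -)\<close> corresponds to an arrow \<open>a \<rightarrow> U l\<close>, because \<open>U\<close> preserves the limit.
\<close>

lemma ex_cone:
  "\<exists>\<eta>. \<eta> \<in> hom V (Unit V) (VHom A a (VFObj U l)) \<and> (\<forall>s\<in>T. along \<eta> l (ob s) \<cdot> \<mu> s = snd (x s) \<cdot> q s)"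
proof -
  define \<rho> where "\<rho> s = snd (x s) \<cdot> q s \<cdot> RUnit V (VFObj Q s)" for s
  have \<rho>: "\<rho> s \<in> hom V (VFObj Q s \<otimes> Unit V) (VHom A a (VFObj U (ob s)))" if "s \<in> T" for s
    using that by (simp add: \<rho>_def in_hom)
  have "left_wedge D Q (vfun_comp V (hom_from V A a) (vfun_comp V U (comma_forget x))) (Unit V) \<rho>"
  proof (subst left_wedge_hom_from[OF A vcat_D typed_Q U_forget a])
    show "\<forall>s\<in>VObj D. \<forall>t\<in>VObj D.
      VComp A a (VFObj (vfun_comp V U (comma_forget x)) s) (VFObj (vfun_comp V U (comma_forget x)) t) \<cdot>
        (VFArr (vfun_comp V U (comma_forget x)) s t \<odot> \<rho> s) \<cdot> Assoc V (VHom D s t) (VFObj Q s) (Unit V) =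
      \<rho> t \<cdot> (act Q s t \<odot> Ident V (Unit V))"
    proof (intro ballI)
      fix s t assume "s \<in> VObj D" "t \<in> VObj D"
      then have o [simp]: "s \<in> T" "t \<in> T"
        by simp_all
      let ?j = "VFArr U (ob s) (ob t) \<cdot> comma_proj (x s) (x t)" and ?c = "VComp A a (VFObj U (ob s)) (VFObj U (ob t))"
      let ?id = "Ident V (H s t)"
      note f = comma_obj_simps(2)[OF objs[OF o(1)]]
      note al = comma_along[OF objs[OF o(1)], of "ob t"]
      have jf: "?c \<cdot> (?j \<odot> snd (x s)) = (snd (x t) \<cdot> comma_point (x s) (x t)) \<cdot> RUnit V (H s t)"
      proof -
        have "?c \<cdot> (?j \<odot> snd (x s)) = (along (snd (x s)) (ob s) (ob t) \<cdot> comma_proj (x s) (x t)) \<cdot> RUnit V (H s t)"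
          using along_comp[OF f, of "ob t" "comma_proj (x s) (x t)" "H s t"] al by (simp add: in_hom)
        then show ?thesis
          by (simp only: comma_square objs o)
      qed
      have "?c \<cdot> (?j \<odot> \<rho> s) \<cdot> Assoc V (H s t) (VFObj Q s) (Unit V) =
          (?c \<cdot> (?j \<odot> snd (x s))) \<cdot> (?id \<odot> q s) \<cdot> ((?id \<odot> RUnit V (VFObj Q s)) \<cdot> Assoc V (H s t) (VFObj Q s) (Unit V))"
        by (simp add: \<rho>_def)
      also have "\<dots> = snd (x t) \<cdot> (comma_point (x s) (x t) \<cdot> RUnit V (H s t) \<cdot> (?id \<odot> q s)) \<cdot> RUnit V (H s t \<otimes> VFObj Q s)"
        unfolding jf by (simp add: RUnit_tensor)
      also have "\<dots> = snd (x t) \<cdot> q t \<cdot> act Q s t \<cdot> RUnit V (H s t \<otimes> VFObj Q s)"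
        by (simp flip: q_act)
      also have "\<dots> = \<rho> t \<cdot> (act Q s t \<odot> Ident V (Unit V))"
        by (simp add: \<rho>_def LUnit_natural)
      finally show "VComp A a (VFObj (vfun_comp V U (comma_forget x)) s) (VFObj (vfun_comp V U (comma_forget x)) t) \<cdot>
        (VFArr (vfun_comp V U (comma_forget x)) s t \<odot> \<rho> s) \<cdot> Assoc V (VHom D s t) (VFObj Q s) (Unit V) =
      \<rho> t \<cdot> (act Q s t \<odot> Ident V (Unit V))"
        by simp
    qed
  qed (use \<rho> in simp_all)
  then obtain \<eta> where \<eta>: "\<eta> \<in> hom V (Unit V) (VHom A a (VFObj U l))"
    and \<eta>_eq: "\<forall>s\<in>T. VComp A a (VFObj U l) (VFObj U (ob s)) \<cdot> ((VFArr U l (ob s) \<cdot> \<mu> s) \<odot> \<eta>) = \<rho> s"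
    using limA_univ(4)[OF a] by blast
  have "along \<eta> l (ob s) \<cdot> \<mu> s = snd (x s) \<cdot> q s" if s: "s \<in> T" for s
  proof -
    have "(along \<eta> l (ob s) \<cdot> \<mu> s) \<cdot> RUnit V (VFObj Q s) = (snd (x s) \<cdot> q s) \<cdot> RUnit V (VFObj Q s)"
      using along_comp[OF \<eta> l_Obj objs_simps(2)[OF s] lim_univ(2)[OF s]] \<eta>_eq s along_simps[OF \<eta> l_Obj objs_simps(2)[OF s]]
      by (simp add: \<rho>_def)
    then show ?thesis
      using s along_simps[OF \<eta> l_Obj objs_simps(2)[OF s]] by - (rule iso_cancel_right[of "RUnit V (VFObj Q s)"], simp_all)
  qed
  with \<eta> show ?thesis
    by blast
qed

definition \<eta> :: 'a where
  "\<eta> = (SOME \<eta>. \<eta> \<in> hom V (Unit V) (VHom A a (VFObj U l)) \<and> (\<forall>s\<in>T. along \<eta> l (ob s) \<cdot> \<mu> s = snd (x s) \<cdot> q s))"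

lemma \<eta>: "\<eta> \<in> hom V (Unit V) (VHom A a (VFObj U l))"
  and along_\<eta>: "s \<in> T \<Longrightarrow> along \<eta> l (ob s) \<cdot> \<mu> s = snd (x s) \<cdot> q s"
  using someI_ex[OF ex_cone] unfolding \<eta>_def by blast+

lemma limit_obj: "comma_obj (l, \<eta>)"
  using \<eta> by (simp add: comma_obj_def)

text \<open>
  Points of the weight over \<open>1 : I \<rightarrow> I\<close> give the projections of the limit. They exist because \<open>I\<close> is
  cofibrant, and any two are homotopic because \<open>Q s \<rightarrow> I\<close> is a trivial fibration.
\<close>

definition weight_point :: "'u \<Rightarrow> 'a \<Rightarrow> bool" where
  "weight_point s e \<longleftrightarrow> e \<in> hom V (Unit V) (VFObj Q s) \<and> q s \<cdot> e = Ident V (Unit V)"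

lemma ex_weight_point:
  assumes "s \<in> T"
  obtains e where "weight_point s e"
  using cofibrant_lifting[OF unit q_tfib[OF assms] q_hom[OF assms], of "Ident V (Unit V)"] unfolding weight_point_def
  by (metis Ident_Arr Dom_Ident Cod_Ident Unit_Obj in_hom)

lemma along_\<eta>_comp:
  assumes s: "s \<in> T" and e: "e \<in> hom V X (VFObj Q s)"
  shows "along \<eta> l (ob s) \<cdot> \<mu> s \<cdot> e = snd (x s) \<cdot> q s \<cdot> e"
proof -
  have "along \<eta> l (ob s) \<cdot> \<mu> s \<cdot> e = (along \<eta> l (ob s) \<cdot> \<mu> s) \<cdot> e"
    using s e along_simps[OF \<eta> l_Obj objs_simps(2)[OF s]] by (simp add: in_hom)
  then show ?thesis
    unfolding along_\<eta>[OF s] using s e by (simp add: in_hom)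
qed

lemma projection:
  assumes s: "s \<in> T" and e: "weight_point s e"
  shows "comma_arr (l, \<eta>) (x s) (\<mu> s \<cdot> e)"
  using along_\<eta>_comp[OF s, of e "Unit V"] e s unfolding comma_arr_def weight_point_def by (simp add: in_hom)

lemma projections_homotopic:
  assumes s: "s \<in> T" and e: "weight_point s e" and e': "weight_point s e'"
  shows "homotopic (l, \<eta>) (x s) (\<mu> s \<cdot> e) (\<mu> s \<cdot> e')"
proof -
  have "e \<in> hom V (Unit V) (VFObj Q s)" "e' \<in> hom V (Unit V) (VFObj Q s)" "q s \<in> Weq V"
    "q s \<cdot> e = Ident V (Unit V)" "q s \<cdot> e' = Ident V (Unit V)"
    using e e' q_tfib[OF s] by (simp_all add: weight_point_def)
  then obtain J d c e1 h where J: "is_interval V J d c e1" and h: "h \<in> hom V J (VFObj Q s)"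
    "h \<cdot> d = e" "h \<cdot> c = e'" "q s \<cdot> h = e1"
    using interval_over[of e "VFObj Q s" e' "q s"] q_hom[OF s] by metis
  have "\<mu> s \<cdot> h \<in> hom V J (VHom B (fst (l, \<eta>)) (ob s))" "(\<mu> s \<cdot> h) \<cdot> d = \<mu> s \<cdot> e" "(\<mu> s \<cdot> h) \<cdot> c = \<mu> s \<cdot> e'"
    using h s interval_hom[OF J] by (simp_all add: in_hom)
  moreover have "along (snd (l, \<eta>)) (fst (l, \<eta>)) (ob s) \<cdot> \<mu> s \<cdot> h = snd (x s) \<cdot> e1"
    using along_\<eta>_comp[OF s h(1)] h(4) by simp
  ultimately show ?thesis
    using J unfolding homotopic_def by blast
qed

text \<open>
  The action of \<open>Q\<close> on points shows that a projection followed by an arrow of the diagram is again a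
  projection.
\<close>

lemma transport_point:
  assumes o [simp]: "s \<in> T" "t \<in> T" and e: "weight_point s e" and g: "comma_arr (x s) (x t) g"
  obtains e' where "weight_point t e'" and "\<mu> t \<cdot> e' = el_comp V B l (ob s) (ob t) g (\<mu> s \<cdot> e)"
proof -
  let ?I = "Unit V"
  have ea: "e \<in> Arr V" "Dom V e = ?I" "Cod V e = VFObj Q s" "q s \<cdot> e = Ident V ?I"
    using e by (simp_all add: weight_point_def in_hom)
  have gh: "g \<in> hom V ?I (VHom B (ob s) (ob t))" "Ident V ?I \<in> hom V ?I ?I"
    "along (snd (x s)) (ob s) (ob t) \<cdot> g = snd (x t) \<cdot> Ident V ?I"
    using g by (simp_all add: comma_arr_def in_hom)
  define p where "p = comma_pair (x s) (x t) ?I g (Ident V ?I)"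
  have p: "p \<in> hom V ?I (H s t)" "comma_proj (x s) (x t) \<cdot> p = g" "comma_point (x s) (x t) \<cdot> p = Ident V ?I"
    using comma_pair[OF objs[OF o(1)] objs[OF o(2)] gh] by (simp_all add: p_def)
  have pa: "p \<in> Arr V" "Dom V p = ?I" "Cod V p = H s t"
    using p by (simp_all add: in_hom)
  let ?e = "act Q s t \<cdot> (p \<odot> e) \<cdot> inv_arr V (LUnit V ?I)"
  show ?thesis
  proof (rule that[of ?e])
    have "q t \<cdot> ?e = (q t \<cdot> act Q s t) \<cdot> (p \<odot> e) \<cdot> inv_arr V (LUnit V ?I)"
      using pa ea by simp
    also have "\<dots> = comma_point (x s) (x t) \<cdot> (RUnit V (H s t) \<cdot> (p \<odot> Ident V ?I)) \<cdot> inv_arr V (LUnit V ?I)"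
      unfolding q_act[OF o] using pa ea by simp
    also have "\<dots> = (comma_point (x s) (x t) \<cdot> p) \<cdot> RUnit V ?I \<cdot> inv_arr V (LUnit V ?I)"
      using pa by (simp add: LUnit_natural del: p(3))
    also have "\<dots> = Ident V ?I"
      unfolding p(3) by (simp add: LUnit_eq_RUnit)
    finally show "weight_point t ?e"
      using pa ea by (simp add: weight_point_def in_hom)
    have "\<mu> t \<cdot> ?e = (\<mu> t \<cdot> act Q s t) \<cdot> (p \<odot> e) \<cdot> inv_arr V (LUnit V ?I)"
      using pa ea by simp
    also have "\<dots> = VComp B l (ob s) (ob t) \<cdot> ((comma_proj (x s) (x t) \<cdot> p) \<odot> (\<mu> s \<cdot> e)) \<cdot> inv_arr V (LUnit V ?I)"
      unfolding lim_univ(3)[OF o] using pa ea by simp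
    finally show "\<mu> t \<cdot> ?e = el_comp V B l (ob s) (ob t) g (\<mu> s \<cdot> e)"
      unfolding p(2) by (simp add: el_comp_def)
  qed
qed


text \<open>
  An endomorphism \<open>l \<rightarrow> x s \<rightarrow> l\<close> comes from the endomorphism \<open>Q \<rightarrow> D(s, -) \<rightarrow> Q\<close> of the weight, whose
  second factor is the Yoneda transform of the point \<open>e\<close>. By cofibrancy of the weight it is homotopic
  to the identity, and the homotopy induces one on the limit.
\<close>

lemma endomorphism_homotopic:
  assumes s [simp]: "s \<in> T" and e: "weight_point s e" and g: "comma_arr (x s) (l, \<eta>) g"
  shows "homotopic (l, \<eta>) (l, \<eta>) (VId B l) (el_comp V B l (ob s) l g (\<mu> s \<cdot> e))"
proof -
  let ?I = "Unit V"
  have ea: "e \<in> Arr V" "Dom V e = ?I" "Cod V e = VFObj Q s" "q s \<cdot> e = Ident V ?I"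
    using e by (simp_all add: weight_point_def in_hom)
  have gh: "g \<in> hom V ?I (VHom B (ob s) l)"
    using g by (simp add: comma_arr_def)
  then have ga: "g \<in> Arr V" "Dom V g = ?I" "Cod V g = VHom B (ob s) l"
    by (simp_all add: in_hom)
  let ?pre = "\<lambda>t. pre_comp V B (ob s) l (ob t) g"
  have pre: "?pre t \<in> Arr V" "Dom V (?pre t) = VHom B l (ob t)" "Cod V (?pre t) = VHom B (ob s) (ob t)" if "t \<in> T" for t
    using that ga by (simp_all add: pre_comp_def)
  \<comment> \<open>the factor \<open>Q \<rightarrow> D(s, -)\<close>, which precomposes the limit cylinder with \<open>g\<close>\<close>
  define h where "h t = comma_pair (x s) (x t) (VFObj Q t) (?pre t \<cdot> \<mu> t) (q t)" for t
  have h: "h t \<in> hom V (VFObj Q t) (H s t)" "comma_proj (x s) (x t) \<cdot> h t = ?pre t \<cdot> \<mu> t"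
    "comma_point (x s) (x t) \<cdot> h t = q t" if t: "t \<in> T" for t
  proof -
    have "?pre t \<cdot> \<mu> t \<in> hom V (VFObj Q t) (VHom B (fst (x s)) (fst (x t)))"
      using t pre[OF t] by (simp add: in_hom)
    moreover have "along (snd (x s)) (fst (x s)) (fst (x t)) \<cdot> ?pre t \<cdot> \<mu> t = snd (x t) \<cdot> q t"
      using comma_arr_pre_comp[OF objs[OF s] limit_obj objs_simps(2)[OF t] g, of "\<mu> t"] lim_univ(2)[OF t] along_\<eta>[OF t] by simp
    ultimately show "h t \<in> hom V (VFObj Q t) (H s t)" "comma_proj (x s) (x t) \<cdot> h t = ?pre t \<cdot> \<mu> t"
      "comma_point (x s) (x t) \<cdot> h t = q t"
      unfolding h_def using comma_pair[OF objs[OF s] objs[OF t] _ q_hom[OF t]] by blast+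
  qed
  have ha: "h t \<in> Arr V" "Dom V (h t) = VFObj Q t" "Cod V (h t) = H s t" if "t \<in> T" for t
    using h(1)[OF that] by (simp_all add: in_hom)
  have h_natural: "h t \<cdot> act Q r t = VComp D s r t \<cdot> (Ident V (H r t) \<odot> h r)" if o [simp]: "r \<in> T" "t \<in> T" for r t
  proof (rule comma_cancel[OF objs[OF s] objs[OF o(2)]])
    have id: "Ident V (H r t) \<in> hom V (H r t) (H r t)"
      by (simp add: in_hom)
    note c = comma_vcat_VComp_comp[of T x, OF objs s o id h(1)[OF o(1)]]
    show "h t \<cdot> act Q r t \<in> hom V (H r t \<otimes> VFObj Q r) (H s t)"
      using ha[OF o(2)] by (simp add: in_hom)
    show "VComp D s r t \<cdot> (Ident V (H r t) \<odot> h r) \<in> hom V (H r t \<otimes> VFObj Q r) (H s t)"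
      using c(1) by simp
    have "comma_proj (x s) (x t) \<cdot> h t \<cdot> act Q r t = (comma_proj (x s) (x t) \<cdot> h t) \<cdot> act Q r t"
      using ha by simp
    also have "\<dots> = ?pre t \<cdot> VComp B l (ob r) (ob t) \<cdot> (comma_proj (x r) (x t) \<odot> \<mu> r)"
      unfolding h(2)[OF o(2)] using pre[OF o(2)] lim_univ(3)[OF o] by simp
    also have "\<dots> = VComp B (ob s) (ob r) (ob t) \<cdot> (comma_proj (x r) (x t) \<odot> (?pre r \<cdot> \<mu> r))"
      by (rule vcomp_pre_comp[OF B _ _ _ _ gh lim_univ(2)[OF o(1)]]) (simp_all add: in_hom)
    finally show "comma_proj (x s) (x t) \<cdot> h t \<cdot> act Q r t = comma_proj (x s) (x t) \<cdot> VComp D s r t \<cdot> (Ident V (H r t) \<odot> h r)"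
      using c(2) h(2)[OF o(1)] by simp
    have "comma_point (x s) (x t) \<cdot> h t \<cdot> act Q r t = (comma_point (x s) (x t) \<cdot> h t) \<cdot> act Q r t"
      using ha by simp
    also have "\<dots> = (comma_point (x r) (x t) \<cdot> RUnit V (H r t)) \<cdot> (Ident V (H r t) \<odot> q r)"
      unfolding h(3)[OF o(2)] q_act[OF o] by simp
    also have "\<dots> = (RUnit V ?I \<cdot> (comma_point (x r) (x t) \<odot> Ident V ?I)) \<cdot> (Ident V (H r t) \<odot> q r)"
      by (simp add: LUnit_natural)
    also have "\<dots> = RUnit V ?I \<cdot> (comma_point (x r) (x t) \<odot> q r)"
      by simp
    finally show "comma_point (x s) (x t) \<cdot> h t \<cdot> act Q r t = comma_point (x s) (x t) \<cdot> VComp D s r t \<cdot> (Ident V (H r t) \<odot> h r)"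
      using c(3) h(3)[OF o(1)] by (simp add: LUnit_eq_RUnit)
  qed
  \<comment> \<open>followed by the factor \<open>D(s, -) \<rightarrow> Q\<close>, which acts on the point \<open>e\<close>\<close>
  define \<tau> where "\<tau> t = act Q s t \<cdot> (h t \<odot> e) \<cdot> inv_arr V (RUnit V (VFObj Q t))" for t
  have \<tau>: "\<tau> t \<in> hom V (VFObj Q t) (VFObj Q t)" if "t \<in> T" for t
    using that ha[OF that] ea by (simp add: \<tau>_def in_hom)
  then have \<tau>a: "\<tau> t \<in> Arr V" "Dom V (\<tau> t) = VFObj Q t" "Cod V (\<tau> t) = VFObj Q t" if "t \<in> T" for t
    using that by (auto simp: in_hom)
  have "\<tau> t \<cdot> act Q r t = act Q r t \<cdot> (Ident V (H r t) \<odot> \<tau> r)" if o [simp]: "r \<in> T" "t \<in> T" for r t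
  proof -
    let ?id = "Ident V (H r t)" and ?\<alpha> = "Assoc V (H r t) (VFObj Q r) ?I"
    note har = ha[OF o(1)] and hat = ha[OF o(2)]
    have id: "?id \<in> hom V (VHom D r t) (VHom D r t)" "h r \<in> hom V (VFObj Q r) (VHom D s r)" "e \<in> hom V ?I (VFObj Q s)"
      using har ea by (simp_all add: in_hom)
    have "\<tau> t \<cdot> act Q r t = act Q s t \<cdot> (h t \<odot> e) \<cdot> (inv_arr V (RUnit V (VFObj Q t)) \<cdot> act Q r t)"
      using hat ea by (simp add: \<tau>_def)
    also have "inv_arr V (RUnit V (VFObj Q t)) \<cdot> act Q r t = (act Q r t \<odot> Ident V ?I) \<cdot> inv_arr V (RUnit V (H r t \<otimes> VFObj Q r))"
      using inv_LUnit_natural(2)[of "act Q r t" "H r t \<otimes> VFObj Q r"] by simp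
    also have "act Q s t \<cdot> (h t \<odot> e) \<cdot> \<dots> = (act Q s t \<cdot> ((h t \<cdot> act Q r t) \<odot> e)) \<cdot> inv_arr V (RUnit V (H r t \<otimes> VFObj Q r))"
      using hat ea by simp
    also have "\<dots> = (act Q r t \<cdot> (?id \<odot> (act Q s r \<cdot> (h r \<odot> e))) \<cdot> ?\<alpha>) \<cdot> inv_arr V (RUnit V (H r t \<otimes> VFObj Q r))"
      unfolding h_natural[OF o] using act_vcomp[OF Q vcat_D _ _ _ id] by simp
    also have "\<dots> = act Q r t \<cdot> (?id \<odot> (act Q s r \<cdot> (h r \<odot> e))) \<cdot> (?\<alpha> \<cdot> inv_arr V (RUnit V (H r t \<otimes> VFObj Q r)))"
      using har ea by simp
    also have "\<dots> = act Q r t \<cdot> (?id \<odot> \<tau> r)"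
      using har ea by (simp add: inv_RUnit_tensor \<tau>_def)
    finally show ?thesis .
  qed
  then have \<tau>_natural: "natural_family D Q Q \<tau>"
    using \<tau> by (simp add: natural_family_def)
  have q\<tau>: "q t \<cdot> \<tau> t = q t" if t [simp]: "t \<in> T" for t
  proof -
    note hat = ha[OF t]
    have "q t \<cdot> \<tau> t = (q t \<cdot> act Q s t) \<cdot> (h t \<odot> e) \<cdot> inv_arr V (RUnit V (VFObj Q t))"
      using hat ea by (simp add: \<tau>_def)
    also have "\<dots> = comma_point (x s) (x t) \<cdot> (RUnit V (H s t) \<cdot> (h t \<odot> Ident V ?I)) \<cdot> inv_arr V (RUnit V (VFObj Q t))"
      unfolding q_act[OF s t] using hat ea by simp
    also have "\<dots> = (comma_point (x s) (x t) \<cdot> h t) \<cdot> RUnit V (VFObj Q t) \<cdot> inv_arr V (RUnit V (VFObj Q t))"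
      using hat by (simp add: LUnit_natural)
    also have "\<dots> = q t"
      unfolding h(3)[OF t] by simp
    finally show ?thesis .
  qed
  obtain J d c \<epsilon> \<theta> where J: "is_interval V J d c \<epsilon>" and \<theta>: "left_wedge D Q Q J \<theta>"
    and \<theta>d: "\<And>t. t \<in> T \<Longrightarrow> \<theta> t \<cdot> (Ident V (VFObj Q t) \<odot> d) = RUnit V (VFObj Q t)"
    and \<theta>c: "\<And>t. t \<in> T \<Longrightarrow> \<theta> t \<cdot> (Ident V (VFObj Q t) \<odot> c) = \<tau> t \<cdot> RUnit V (VFObj Q t)"
    and q\<theta>: "\<And>t. t \<in> T \<Longrightarrow> q t \<cdot> \<theta> t = q t \<cdot> RUnit V (VFObj Q t) \<cdot> (Ident V (VFObj Q t) \<odot> \<epsilon>)"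
    using cofibrant_weight_homotopy[OF vcat_D _ terminal Q cofibrant_Q ptf q_natural \<tau>_natural] small_T q\<tau>
    by (metis D_simps(1))
  have Ja [simp]: "J \<in> Obj V" "d \<in> Arr V" "Dom V d = ?I" "Cod V d = J" "c \<in> Arr V" "Dom V c = ?I" "Cod V c = J"
    "\<epsilon> \<in> Arr V" "Dom V \<epsilon> = J" "Cod V \<epsilon> = ?I"
    using interval_hom[OF J] by (simp_all add: in_hom)
  have \<theta>a: "\<theta> t \<in> Arr V" "Dom V (\<theta> t) = VFObj Q t \<otimes> J" "Cod V (\<theta> t) = VFObj Q t" if "t \<in> T" for t
    using \<theta> that by (simp_all add: left_wedge_def in_hom)
  note hf = hom_from_comp[OF B forget vcat_D l_Obj]
  have "natural_family D Q (vfun_comp V (hom_from V B l) (comma_forget x)) \<mu>"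
    unfolding natural_family_def using lim_univ(2,3) by (simp add: hf)
  then have "left_wedge D Q (vfun_comp V (hom_from V B l) (comma_forget x)) J (\<lambda>t. \<mu> t \<cdot> \<theta> t)"
    by (rule left_wedge_postcomp[OF vcat_D typed_Q typed_Q hf(1) \<theta>])
  then obtain w where w: "w \<in> hom V J (VHom B l l)"
    and w_eq: "\<forall>t\<in>T. VComp B l l (ob t) \<cdot> (\<mu> t \<odot> w) = \<mu> t \<cdot> \<theta> t"
    using lim_univ(4)[OF l_Obj] by blast
  have wa [simp]: "w \<in> Arr V" "Dom V w = J" "Cod V w = VHom B l l"
    using w by (simp_all add: in_hom)
  \<comment> \<open>maps into \<open>B(l, l)\<close> are compared after composition with the limit cylinder\<close>
  have endpoint: "w \<cdot> y = y'" if y: "y \<in> hom V ?I J" and y': "y' \<in> hom V ?I (VHom B l l)"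
    and eq: "\<And>t. t \<in> T \<Longrightarrow> \<mu> t \<cdot> \<theta> t \<cdot> (Ident V (VFObj Q t) \<odot> y) = VComp B l l (ob t) \<cdot> (\<mu> t \<odot> y')" for y y'
  proof (rule lim_univ(5)[OF l_Obj comp_in_hom[OF y w] y'])
    fix t assume t [simp]: "t \<in> T"
    have ya: "y \<in> Arr V" "Dom V y = ?I" "Cod V y = J"
      using y by (simp_all add: in_hom)
    have "VComp B l l (ob t) \<cdot> (\<mu> t \<odot> (w \<cdot> y)) = (VComp B l l (ob t) \<cdot> (\<mu> t \<odot> w)) \<cdot> (Ident V (VFObj Q t) \<odot> y)"
      using ya by simp
    also have "\<dots> = \<mu> t \<cdot> \<theta> t \<cdot> (Ident V (VFObj Q t) \<odot> y)"
      using w_eq \<theta>a[OF t] ya by simp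
    finally show "VComp B l l (ob t) \<cdot> (\<mu> t \<odot> (w \<cdot> y)) = VComp B l l (ob t) \<cdot> (\<mu> t \<odot> y')"
      using eq[OF t] by simp
  qed
  let ?t = "el_comp V B l (ob s) l g (\<mu> s \<cdot> e)"
  have \<mu>e: "\<mu> s \<cdot> e \<in> hom V ?I (VHom B l (ob s))"
    using ea by (simp add: in_hom)
  have wd: "w \<cdot> d = VId B l"
  proof (rule endpoint)
    show "\<mu> t \<cdot> \<theta> t \<cdot> (Ident V (VFObj Q t) \<odot> d) = VComp B l l (ob t) \<cdot> (\<mu> t \<odot> VId B l)" if "t \<in> T" for t
      using that \<theta>d vcomp_VId(2)[OF B l_Obj _ lim_univ(2)[OF that]] by simp
  qed (simp_all add: in_hom)
  have wc: "w \<cdot> c = ?t"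
  proof (rule endpoint)
    show "?t \<in> hom V ?I (VHom B l l)"
      by (rule el_comp(1)[OF B _ _ _ \<mu>e gh]) simp_all
    fix t assume t [simp]: "t \<in> T"
    note hat = ha[OF t]
    have "\<mu> t \<cdot> \<theta> t \<cdot> (Ident V (VFObj Q t) \<odot> c) = (\<mu> t \<cdot> act Q s t) \<cdot> (h t \<odot> e)"
      unfolding \<theta>c[OF t] using hat ea by (simp add: \<tau>_def)
    also have "\<dots> = VComp B l (ob s) (ob t) \<cdot> ((?pre t \<cdot> \<mu> t) \<odot> (\<mu> s \<cdot> e))"
      unfolding lim_univ(3)[OF s t] using hat ea h(2)[OF t] by simp
    also have "\<dots> = VComp B l l (ob t) \<cdot> (\<mu> t \<odot> ?t)"
      using vcomp_el_comp(1)[OF B _ _ _ _ \<mu>e gh lim_univ(2)[OF t]] by simp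
    finally show "\<mu> t \<cdot> \<theta> t \<cdot> (Ident V (VFObj Q t) \<odot> c) = VComp B l l (ob t) \<cdot> (\<mu> t \<odot> ?t)" .
  qed (simp add: in_hom)
  have \<eta>a: "\<eta> \<in> Arr V" "Dom V \<eta> = ?I" "Cod V \<eta> = VHom A a (VFObj U l)"
    using \<eta> by (simp_all add: in_hom)
  note al = along_simps[OF \<eta> l_Obj]
  have "along \<eta> l l \<cdot> w = \<eta> \<cdot> \<epsilon>"
  proof (rule limA_univ(5)[OF a])
    show "along \<eta> l l \<cdot> w \<in> hom V J (VHom A a (VFObj U l))" "\<eta> \<cdot> \<epsilon> \<in> hom V J (VHom A a (VFObj U l))"
      using al[OF l_Obj] \<eta>a by (simp_all add: in_hom)
    fix t assume t [simp]: "t \<in> T"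
    note alt = al[OF objs_simps(2)[OF t]] and \<theta>t = \<theta>a[OF t]
    let ?c = "VComp A a (VFObj U l) (VFObj U (ob t))"
    have "?c \<cdot> ((VFArr U l (ob t) \<cdot> \<mu> t) \<odot> (along \<eta> l l \<cdot> w)) = along \<eta> l (ob t) \<cdot> \<mu> t \<cdot> \<theta> t"
      using along_vcomp[OF \<eta> l_Obj l_Obj _ lim_univ(2)[OF t] w] w_eq by simp
    also have "\<dots> = snd (x t) \<cdot> (q t \<cdot> RUnit V (VFObj Q t)) \<cdot> (Ident V (VFObj Q t) \<odot> \<epsilon>)"
      using along_\<eta>_comp[OF t, of "\<theta> t" "VFObj Q t \<otimes> J"] \<theta>t q\<theta>[OF t] by (simp add: in_hom)
    also have "\<dots> = ((along \<eta> l (ob t) \<cdot> \<mu> t) \<cdot> RUnit V (VFObj Q t)) \<cdot> (Ident V (VFObj Q t) \<odot> \<epsilon>)"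
      unfolding along_\<eta>[OF t] by simp
    also have "\<dots> = (?c \<cdot> ((VFArr U l (ob t) \<cdot> \<mu> t) \<odot> \<eta>)) \<cdot> (Ident V (VFObj Q t) \<odot> \<epsilon>)"
      using along_comp[OF \<eta> l_Obj _ lim_univ(2)[OF t]] alt by simp
    also have "\<dots> = ?c \<cdot> ((VFArr U l (ob t) \<cdot> \<mu> t) \<odot> (\<eta> \<cdot> \<epsilon>))"
      using \<eta>a by simp
    finally show "?c \<cdot> ((VFArr U l (ob t) \<cdot> \<mu> t) \<odot> (along \<eta> l l \<cdot> w)) = ?c \<cdot> ((VFArr U l (ob t) \<cdot> \<mu> t) \<odot> (\<eta> \<cdot> \<epsilon>))" .
  qed
  then show ?thesis
    unfolding homotopic_def fst_conv snd_conv using J w wd wc by blast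
qed

end

section \<open>The adjoint functor theorem\<close>

locale adjoint_functor_setting = adjoint_setting V u B A U a
  for V :: "('o, 'a, 'z) smmc_scheme" (structure) and u :: "'u itself"
    and B :: "('b, 'o, 'a) vcat" and A :: "('c, 'o, 'a) vcat" and U :: "('b, 'c, 'a) vfun" and a :: 'c +
  assumes powers: "has_powers V B" and preserves_powers: "preserves_powers V B A U"
    and preserves_limits: "preserves_enough_cofibrantly_weighted_limits u V B A U"
begin

lemma ex_comma_limit:
  assumes small: "small u X" and obj: "\<And>y. y \<in> X \<Longrightarrow> comma_obj y"
  obtains T x Q q l \<mu> where "comma_limit V u B A U a T x Q q l \<mu>" and "x ` T = X"
proof -
  obtain \<iota> :: "'b \<times> 'a \<Rightarrow> 'u" where \<iota>: "inj_on \<iota> X"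
    using small_embedding[OF small] by blast
  define T where "T = \<iota> ` X"
  define x where "x = inv_into X \<iota>"
  have small_T: "small u T"
    unfolding T_def by (rule small_image[OF small])
  have xT: "x ` T = X"
    using \<iota> by (force simp: T_def x_def)
  then have objs: "comma_obj (x s)" if "s \<in> T" for s
    using obj that by blast
  have D: "is_vcat V (comma_vcat T x)" and P: "is_vfunctor V (comma_vcat T x) (unit_vcat V) (comma_terminal x)"
    and F: "is_vfunctor V (comma_vcat T x) B (comma_forget x)"
    using is_vcat_comma_vcat comma_terminal comma_forget objs by blast+
  have VT: "VObj (comma_vcat T x) = T"
    by (simp add: comma_vcat_def)
  then obtain Q where Q: "cofibrant_replacement_weight V (comma_vcat T x) (comma_terminal x) Q"
    and has: "has_wlimits V (comma_vcat T x) Q B" and pres: "preserves_wlimits V (comma_vcat T x) Q B A U"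
    using preserves_limits D P small_T unfolding preserves_enough_cofibrantly_weighted_limits_def by metis
  obtain q where q: "is_vfunctor V (comma_vcat T x) (self_vcat V) Q" "cofibrant_weight V (comma_vcat T x) Q"
    "pointwise_trivial_fibration V (comma_vcat T x) Q (vfun_comp V (unit_select V) (comma_terminal x)) q"
    "\<And>s. s \<in> T \<Longrightarrow> q s \<in> hom V (VFObj Q s) (Unit V)" "\<And>s. s \<in> T \<Longrightarrow> q s \<in> Fib V \<inter> Weq V"
    "natural_family (comma_vcat T x) Q (vfun_comp V (unit_select V) (comma_terminal x)) q"
    using cofibrant_replacement[OF D P Q] VT by metis
  obtain l \<mu> where lim: "is_wlimit V (comma_vcat T x) B Q (comma_forget x) l \<mu>"
    using has F unfolding has_wlimits_def by blast
  then have "is_wlimit V (comma_vcat T x) A Q (vfun_comp V U (comma_forget x)) (VFObj U l)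
       (\<lambda>s. VFArr U l (VFObj (comma_forget x) s) \<cdot> \<mu> s)"
    using pres F unfolding preserves_wlimits_def by blast
  then have "comma_limit V u B A U a T x Q q l \<mu>"
    using small_T objs q lim by unfold_locales
  then show ?thesis
    using that xT by blast
qed

text \<open>
  If every object of the comma category receives an arrow from a member of a small family, the
  limit \<open>l\<close> of that family is initial up to homotopy. Arrows out of \<open>l\<close> factor through a projection. Two
  arrows \<open>v, v' : l \<rightarrow> z\<close> become homotopic after composition with some endomorphism of \<open>l\<close> that is itself
  homotopic to the identity: enlarge the family by \<open>l\<close> and \<open>z\<close>, let \<open>l'\<close> be its limit, and take the
  composite \<open>l \<rightarrow> l' \<rightarrow> l\<close> in which the first arrow factors through a member of the original family.
\<close>

lemma homotopically_initial:
  assumes small: "small u X" and obj: "\<And>y. y \<in> X \<Longrightarrow> comma_obj y"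
    and weakly_initial: "\<And>z. comma_obj z \<Longrightarrow> \<exists>y\<in>X. \<exists>g. comma_arr y z g"
  obtains L where "comma_obj L" and "\<And>z. comma_obj z \<Longrightarrow> \<exists>g. comma_arr L z g"
    and "\<And>z v v'. comma_obj z \<Longrightarrow> comma_arr L z v \<Longrightarrow> comma_arr L z v' \<Longrightarrow>
      \<exists>t. comma_arr L L t \<and> homotopic L L (VId B (fst L)) t \<and>
        homotopic L z (el_comp V B (fst L) (fst L) (fst z) v t) (el_comp V B (fst L) (fst L) (fst z) v' t)"
proof -
  obtain T x Q q l \<mu> where lim: "comma_limit V u B A U a T x Q q l \<mu>" and xT: "x ` T = X"
    using ex_comma_limit[OF small obj] by blast
  interpret L: comma_limit V u B A U a T x Q q l \<mu>
    by (rule lim)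
  let ?L = "(l, L.\<eta>)"
  note Lo = L.limit_obj
  have arr: "\<exists>s\<in>T. \<exists>e g. L.weight_point s e \<and> comma_arr (x s) z g" if "comma_obj z" for z
    using weakly_initial[OF that] xT L.ex_weight_point by (metis imageE)
  show ?thesis
  proof (rule that[OF Lo])
    fix z assume z: "comma_obj z"
    obtain s e g where "s \<in> T" "L.weight_point s e" "comma_arr (x s) z g"
      using arr[OF z] by blast
    then show "\<exists>g. comma_arr ?L z g"
      using comma_arr_comp[OF Lo L.objs z L.projection] by blast
  next
    fix z v v' assume z: "comma_obj z" and v: "comma_arr ?L z v" and v': "comma_arr ?L z v'"
    have small': "small u (insert ?L (insert z X))"
      by (intro small_insert universe small)
    have obj': "comma_obj y" if "y \<in> insert ?L (insert z X)" for y
      using that Lo z obj by blast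
    obtain T' x' Q' q' l' \<mu>' where lim': "comma_limit V u B A U a T' x' Q' q' l' \<mu>'"
      and xT': "x' ` T' = insert ?L (insert z X)"
      using ex_comma_limit[OF small' obj'] by blast
    interpret L': comma_limit V u B A U a T' x' Q' q' l' \<mu>'
      by (rule lim')
    let ?L' = "(l', L'.\<eta>)"
    note Lo' = L'.limit_obj
    obtain i j where i: "i \<in> T'" "x' i = ?L" and j: "j \<in> T'" "x' j = z"
      using xT' by (metis imageE insertI1 insertI2)
    obtain e where e: "L'.weight_point i e"
      using L'.ex_weight_point[OF i(1)] .
    define p where "p = \<mu>' i \<cdot> e"
    have p: "comma_arr ?L' ?L p"
      using L'.projection[OF i(1) e] i(2) by (simp add: p_def)
    obtain e1 where e1: "L'.weight_point j e1" "\<mu>' j \<cdot> e1 = el_comp V B l' l (fst z) v p"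
      using L'.transport_point[OF i(1) j(1) e, of v] v i(2) j(2) by (auto simp: p_def)
    obtain e2 where e2: "L'.weight_point j e2" "\<mu>' j \<cdot> e2 = el_comp V B l' l (fst z) v' p"
      using L'.transport_point[OF i(1) j(1) e, of v'] v' i(2) j(2) by (auto simp: p_def)
    have vp: "homotopic ?L' z (el_comp V B l' l (fst z) v p) (el_comp V B l' l (fst z) v' p)"
      using L'.projections_homotopic[OF j(1) e1(1) e2(1)] e1(2) e2(2) j(2) by simp
    obtain s r m where s: "s \<in> T" and r: "L.weight_point s r" and m: "comma_arr (x s) ?L' m"
      using arr[OF Lo'] by blast
    note xs = L.objs[OF s] and pr = L.projection[OF s r]
    define n where "n = el_comp V B l (fst (x s)) l' m (\<mu> s \<cdot> r)"
    have n: "comma_arr ?L ?L' n"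
      using comma_arr_comp[OF Lo xs Lo' pr m] by (simp add: n_def)
    define t where "t = el_comp V B l l' l p n"
    have t: "comma_arr ?L ?L t"
      using comma_arr_comp[OF Lo Lo' Lo n p] by (simp add: t_def)
    have l: "l \<in> VObj B" "l' \<in> VObj B" "fst z \<in> VObj B" "fst (x s) \<in> VObj B"
      using L.l_Obj L'.l_Obj comma_obj_simps(1)[OF z] comma_obj_simps(1)[OF xs] by auto
    have ph: "p \<in> hom V (Unit V) (VHom B l' l)" and nh: "n \<in> hom V (Unit V) (VHom B l l')"
      and mh: "m \<in> hom V (Unit V) (VHom B (fst (x s)) l')" and prh: "\<mu> s \<cdot> r \<in> hom V (Unit V) (VHom B l (fst (x s)))"
      and vh: "v \<in> hom V (Unit V) (VHom B l (fst z))" "v' \<in> hom V (Unit V) (VHom B l (fst z))"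
      using comma_arr_hom[OF p] comma_arr_hom[OF n] comma_arr_hom[OF m] comma_arr_hom[OF pr] comma_arr_hom[OF v] comma_arr_hom[OF v']
      by simp_all
    have "t = el_comp V B l (fst (x s)) l (el_comp V B (fst (x s)) l' l p m) (\<mu> s \<cdot> r)"
      unfolding t_def n_def by (rule el_comp_assoc[OF B l(1,4,2,1) prh mh ph])
    moreover have "comma_arr (x s) ?L (el_comp V B (fst (x s)) l' l p m)"
      using comma_arr_comp[OF xs Lo' Lo m p] by simp
    ultimately have "homotopic ?L ?L (VId B l) t"
      using L.endomorphism_homotopic[OF s r] by simp
    moreover have "homotopic ?L z (el_comp V B l l (fst z) v t) (el_comp V B l l (fst z) v' t)"
      unfolding t_def el_comp_assoc[OF B l(1,2,1,3) nh ph vh(1)] el_comp_assoc[OF B l(1,2,1,3) nh ph vh(2)]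
      using homotopic_pre_comp[OF Lo Lo' z n vp] by simp
    ultimately show "\<exists>t. comma_arr ?L ?L t \<and> homotopic ?L ?L (VId B (fst ?L)) t \<and>
        homotopic ?L z (el_comp V B (fst ?L) (fst ?L) (fst z) v t) (el_comp V B (fst ?L) (fst ?L) (fst z) v' t)"
      using t by auto
  qed
qed

lemma power_transpose:
  assumes C: "is_vcat V C" and p: "exhibits_power C X b p \<kappa>" and c: "c \<in> VObj C" and E: "E \<in> Obj V"
  shows "\<rho> \<in> hom V (X \<otimes> E) (VHom C c b) \<Longrightarrow> \<exists>t. t \<in> hom V E (VHom C c p) \<and> VComp C c p b \<cdot> (\<kappa> \<odot> t) = \<rho>"
    and "b \<in> VObj C \<Longrightarrow> s \<in> hom V E (VHom C c p) \<Longrightarrow> t \<in> hom V E (VHom C c p) \<Longrightarrow>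
      VComp C c p b \<cdot> (\<kappa> \<odot> s) = VComp C c p b \<cdot> (\<kappa> \<odot> t) \<Longrightarrow> s = t"
proof -
  have u: "\<exists>!t. t \<in> hom V E (VHom C c p) \<and> VComp C c p b \<cdot> (\<kappa> \<odot> t) = \<rho>" if "\<rho> \<in> hom V (X \<otimes> E) (VHom C c b)" for \<rho>
    using p c E that unfolding exhibits_power_def by blast
  then show "\<exists>t. t \<in> hom V E (VHom C c p) \<and> VComp C c p b \<cdot> (\<kappa> \<odot> t) = \<rho>" if "\<rho> \<in> hom V (X \<otimes> E) (VHom C c b)"
    using that by blast
  have k: "\<kappa> \<in> hom V X (VHom C p b)" "p \<in> VObj C"
    using p by (simp_all add: exhibits_power_def)
  show "s = t" if "b \<in> VObj C" "s \<in> hom V E (VHom C c p)" "t \<in> hom V E (VHom C c p)"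
      "VComp C c p b \<cdot> (\<kappa> \<odot> s) = VComp C c p b \<cdot> (\<kappa> \<odot> t)"
  proof -
    have "VComp C c p b \<cdot> (\<kappa> \<odot> t) \<in> hom V (X \<otimes> E) (VHom C c b)"
      using k that C c by (simp add: in_hom)
    then show ?thesis
      using u that by metis
  qed
qed

lemma ex_preserved_power:
  assumes X: "X \<in> Obj V" and b: "b \<in> VObj B"
  obtains p \<kappa> where "p \<in> VObj B" and "\<kappa> \<in> hom V X (VHom B p b)" and "exhibits_power B X b p \<kappa>"
    and "exhibits_power A X (VFObj U b) (VFObj U p) (VFArr U p b \<cdot> \<kappa>)"
proof -
  obtain p \<phi> where p: "is_power V B X b p \<phi>"
    using powers X b unfolding has_powers_def by blast
  then have pB: "p \<in> VObj B"
    by (simp add: is_power_def)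
  note k = power_counit[OF B b X p]
  have "is_power V A X (VFObj U b) (VFObj U p)
          (induced V A X (VFObj U b) (VFObj U p) (VFArr U p b \<cdot> power_counit V B X b p \<phi>))"
    using preserves_powers X b p unfolding preserves_powers_def by blast
  moreover have "VFArr U p b \<cdot> power_counit V B X b p \<phi> \<in> hom V X (VHom A (VFObj U p) (VFObj U b))"
    using k(1) pB b by (simp add: in_hom)
  ultimately have "exhibits_power A X (VFObj U b) (VFObj U p) (VFArr U p b \<cdot> power_counit V B X b p \<phi>)"
    using induced_power[OF A _ X] b by simp
  then show ?thesis
    using that pB k by blast
qed

text \<open>
  Powers turn statements about maps of hom-objects into statements about arrows. Let
  \<open>F : B(l, b) \<rightarrow> A(a, U b)\<close> be restriction along \<open>\<eta>\<close>. The identity of \<open>A(a, U b)\<close> corresponds to a map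
  from \<open>a\<close> to \<open>U\<close> of the power of \<open>b\<close> by \<open>A(a, U b)\<close>, and an arrow of the comma category from \<open>(l, \<eta>)\<close> to
  this object is a section \<open>s\<close> of \<open>F\<close>. The identity of \<open>B(l, b)\<close> and \<open>s \<circ> F\<close> correspond to two arrows \<open>v\<close>
  and \<open>v'\<close> from \<open>l\<close> to the power of \<open>b\<close> by \<open>B(l, b)\<close>. They are parallel in the comma category because
  \<open>F \<circ> s \<circ> F = F\<close>, hence \<open>v \<simeq> v \<circ> t \<simeq> v' \<circ> t\<close> for an endomorphism \<open>t\<close> of \<open>(l, \<eta>)\<close>. The composite \<open>v' \<circ> t\<close>
  corresponds to \<open>s' \<circ> F\<close>, where \<open>s'\<close> is \<open>s\<close> followed by restriction along \<open>t\<close>, and \<open>s'\<close> is the section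
  that exhibits \<open>F\<close> as shrinkable.
\<close>

lemma shrink_reflection:
  assumes L: "comma_obj (l, \<eta>)" and weakly_initial: "\<And>z. comma_obj z \<Longrightarrow> \<exists>g. comma_arr (l, \<eta>) z g"
    and equalise: "\<And>z v v'. comma_obj z \<Longrightarrow> comma_arr (l, \<eta>) z v \<Longrightarrow> comma_arr (l, \<eta>) z v' \<Longrightarrow>
      \<exists>t. comma_arr (l, \<eta>) (l, \<eta>) t \<and> homotopic (l, \<eta>) (l, \<eta>) (VId B l) t \<and>
        homotopic (l, \<eta>) z (el_comp V B l l (fst z) v t) (el_comp V B l l (fst z) v' t)"
  shows "shrink_reflection V B A U a l \<eta>"
  unfolding shrink_reflection_def
proof (intro conjI ballI)
  let ?I = "Unit V"
  show l [simp]: "l \<in> VObj B" and \<eta>: "\<eta> \<in> hom V ?I (VHom A a (VFObj U l))"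
    using comma_obj_simps(1,2)[OF L] by simp_all
  fix b assume b [simp]: "b \<in> VObj B"
  let ?Y = "VHom B l b" and ?X = "VHom A a (VFObj U b)"
  define F where "F = along \<eta> l b"
  note al = along_simps[OF \<eta> l]
  have F: "F \<in> hom V ?Y ?X" "F \<in> Arr V" "Dom V F = ?Y" "Cod V F = ?X"
    using al[OF b] by (simp_all add: F_def)
  have Y [simp]: "?Y \<in> Obj V" and X [simp]: "?X \<in> Obj V"
    by simp_all
  \<comment> \<open>composition with the image of a power counit is transposed along \<open>\<eta>\<close>\<close>
  have image: "VComp A a (VFObj U p) (VFObj U b) \<cdot> ((VFArr U p b \<cdot> \<kappa>) \<odot> (along \<eta> l p \<cdot> w)) = F \<cdot> VComp B l p b \<cdot> (\<kappa> \<odot> w)"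
    if "p \<in> VObj B" "\<kappa> \<in> hom V W (VHom B p b)" "w \<in> hom V E (VHom B l p)" for p \<kappa> w W E
    unfolding F_def using along_vcomp[OF \<eta> l that(1) b that(2,3)] by simp
  obtain s where s: "s \<in> hom V ?X ?Y" "F \<cdot> s = Ident V ?X"
  proof -
    obtain p \<kappa> where p [simp]: "p \<in> VObj B" and \<kappa>: "\<kappa> \<in> hom V ?X (VHom B p b)" and pB: "exhibits_power B ?X b p \<kappa>"
      and pA: "exhibits_power A ?X (VFObj U b) (VFObj U p) (VFArr U p b \<cdot> \<kappa>)"
      using ex_preserved_power[OF X b] by metis
    have \<kappa>a: "\<kappa> \<in> Arr V" "Dom V \<kappa> = ?X" "Cod V \<kappa> = VHom B p b"
      using \<kappa> by (simp_all add: in_hom)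
    obtain z where z: "z \<in> hom V ?I (VHom A a (VFObj U p))"
      "VComp A a (VFObj U p) (VFObj U b) \<cdot> ((VFArr U p b \<cdot> \<kappa>) \<odot> z) = RUnit V ?X"
      using power_transpose(1)[OF A pA a, of ?I "RUnit V ?X"] by (auto simp: in_hom)
    then have "comma_obj (p, z)"
      by (simp add: comma_obj_def)
    then obtain v where v: "comma_arr (l, \<eta>) (p, z) v"
      using weakly_initial by blast
    then have vh: "v \<in> hom V ?I (VHom B l p)" "along \<eta> l p \<cdot> v = z"
      by (simp_all add: comma_arr_def)
    then have va: "v \<in> Arr V" "Dom V v = ?I" "Cod V v = VHom B l p"
      by (simp_all add: in_hom)
    let ?s = "VComp B l p b \<cdot> (\<kappa> \<odot> v) \<cdot> inv_arr V (RUnit V ?X)"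
    have FR: "F \<cdot> VComp B l p b \<cdot> (\<kappa> \<odot> v) = RUnit V ?X"
      using image[OF p \<kappa> vh(1)] vh(2) z(2) by (simp only:)
    have "F \<cdot> ?s = (F \<cdot> VComp B l p b \<cdot> (\<kappa> \<odot> v)) \<cdot> inv_arr V (RUnit V ?X)"
      using F \<kappa>a va by simp
    also have "\<dots> = Ident V ?X"
      unfolding FR by simp
    finally show ?thesis
      using that[of ?s] \<kappa>a va by (simp add: in_hom)
  qed
  have sa: "s \<in> Arr V" "Dom V s = ?X" "Cod V s = ?Y"
    using s(1) by (simp_all add: in_hom)
  obtain p \<kappa> where p [simp]: "p \<in> VObj B" and \<kappa>: "\<kappa> \<in> hom V ?Y (VHom B p b)" and pB: "exhibits_power B ?Y b p \<kappa>"
    and pA: "exhibits_power A ?Y (VFObj U b) (VFObj U p) (VFArr U p b \<cdot> \<kappa>)"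
    using ex_preserved_power[OF Y b] by metis
  have \<kappa>a: "\<kappa> \<in> Arr V" "Dom V \<kappa> = ?Y" "Cod V \<kappa> = VHom B p b"
    using \<kappa> by (simp_all add: in_hom)
  obtain v where v: "v \<in> hom V ?I (VHom B l p)" "VComp B l p b \<cdot> (\<kappa> \<odot> v) = RUnit V ?Y"
    using power_transpose(1)[OF B pB l, of ?I "RUnit V ?Y"] by (auto simp: in_hom)
  obtain v' where v': "v' \<in> hom V ?I (VHom B l p)" "VComp B l p b \<cdot> (\<kappa> \<odot> v') = (s \<cdot> F) \<cdot> RUnit V ?Y"
    using power_transpose(1)[OF B pB l, of ?I "(s \<cdot> F) \<cdot> RUnit V ?Y"] F sa by (auto simp: in_hom)
  define z where "z = along \<eta> l p \<cdot> v"
  have z: "z \<in> hom V ?I (VHom A a (VFObj U p))"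
    unfolding z_def by (rule comp_in_hom[OF v(1) al(1)[OF p]])
  have zF: "VComp A a (VFObj U p) (VFObj U b) \<cdot> ((VFArr U p b \<cdot> \<kappa>) \<odot> z) = F \<cdot> RUnit V ?Y"
    unfolding z_def image[OF p \<kappa> v(1)] v(2) ..
  have "along \<eta> l p \<cdot> v' = z"
  proof (rule power_transpose(2)[OF A pA a Unit_Obj])
    show "along \<eta> l p \<cdot> v' \<in> hom V ?I (VHom A a (VFObj U p))"
      by (rule comp_in_hom[OF v'(1) al(1)[OF p]])
    have "F \<cdot> ((s \<cdot> F) \<cdot> RUnit V ?Y) = ((F \<cdot> s) \<cdot> F) \<cdot> RUnit V ?Y"
      using F sa by (simp del: s(2))
    then show "VComp A a (VFObj U p) (VFObj U b) \<cdot> ((VFArr U p b \<cdot> \<kappa>) \<odot> (along \<eta> l p \<cdot> v')) =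
        VComp A a (VFObj U p) (VFObj U b) \<cdot> ((VFArr U p b \<cdot> \<kappa>) \<odot> z)"
      unfolding zF image[OF p \<kappa> v'(1)] v'(2) using s(2) F by simp
  qed (use z in simp_all)
  then have vv': "comma_arr (l, \<eta>) (p, z) v" "comma_arr (l, \<eta>) (p, z) v'" and zo: "comma_obj (p, z)"
    using v v' z by (simp_all add: comma_arr_def comma_obj_def z_def)
  obtain t where t: "comma_arr (l, \<eta>) (l, \<eta>) t" and ht: "homotopic (l, \<eta>) (l, \<eta>) (VId B l) t"
    and hv: "homotopic (l, \<eta>) (p, z) (el_comp V B l l p v t) (el_comp V B l l p v' t)"
    using equalise[OF zo vv'] by auto
  have th: "t \<in> hom V ?I (VHom B l l)"
    using comma_arr_hom[OF t] by simp
  have "homotopic (l, \<eta>) (p, z) v (el_comp V B l l p v t)"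
    using homotopic_post_comp[OF L L zo vv'(1) ht] el_comp_VId[OF B l p v(1)] by simp
  then have "homotopic (l, \<eta>) (p, z) v (el_comp V B l l p v' t)"
    using homotopic_trans[OF L zo _ hv] by blast
  then obtain J d c e w where J: "is_interval V J d c e" and w: "w \<in> hom V J (VHom B l p)"
    "w \<cdot> d = v" "w \<cdot> c = el_comp V B l l p v' t" "along \<eta> l p \<cdot> w = z \<cdot> e"
    by (auto simp: homotopic_def)
  have Ja [simp]: "J \<in> Obj V" "d \<in> Arr V" "Dom V d = ?I" "Cod V d = J" "c \<in> Arr V" "Dom V c = ?I" "Cod V c = J"
    "e \<in> Arr V" "Dom V e = J" "Cod V e = ?I"
    using interval_hom[OF J] by (simp_all add: in_hom)
  have wa: "w \<in> Arr V" "Dom V w = J" "Cod V w = VHom B l p"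
    using w(1) by (simp_all add: in_hom)
  define s' where "s' = pre_comp V B l l b t \<cdot> s"
  note pt = pre_comp_comp(1)[OF B l l b th s(1)]
  have s': "s' \<in> hom V ?X ?Y"
    unfolding s'_def by (rule comp_in_hom[OF s(1) pt])
  then have s'a: "s' \<in> Arr V" "Dom V s' = ?X" "Cod V s' = ?Y"
    by (simp_all add: in_hom)
  have Fs': "F \<cdot> s' = Ident V ?X"
    using comma_arr_pre_comp[OF L L b t, of s ?X] s by (simp add: s'_def F_def)
  let ?h0 = "VComp B l p b \<cdot> (\<kappa> \<odot> w)"
  define h where "h = lcurry J ?Y ?Y ?h0"
  have h: "h \<in> hom V J (IHom V ?Y ?Y)" "luncurry ?Y ?Y h = ?h0"
    using luncurry_lcurry[OF Y Y, of J ?h0] \<kappa>a wa by (simp_all add: h_def in_hom)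
  have ha: "h \<in> Arr V" "Dom V h = J" "Cod V h = IHom V ?Y ?Y"
    using h(1) by (simp_all add: in_hom)
  \<comment> \<open>\<open>h\<close> is the transpose of the homotopy \<open>w\<close> from \<open>v\<close> to \<open>v' \<circ> t\<close>, and its endpoints are names\<close>
  have h_end: "h \<cdot> y = name_of V k" if y: "y \<in> hom V ?I J" and k: "k \<in> hom V ?Y ?Y"
    and eq: "VComp B l p b \<cdot> (\<kappa> \<odot> (w \<cdot> y)) = k \<cdot> RUnit V ?Y" for y k
  proof (rule luncurry_cancel[OF Y Y comp_in_hom[OF y h(1)] name_of(1)[OF k]])
    have "luncurry ?Y ?Y (h \<cdot> y) = ?h0 \<cdot> (Ident V ?Y \<odot> y)"
      using uncurry_comp(2)[OF Y Y ha(1,3), of y] y h(2) ha by (simp add: in_hom)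
    also have "\<dots> = VComp B l p b \<cdot> (\<kappa> \<odot> (w \<cdot> y))"
      using y \<kappa>a wa by (simp add: in_hom)
    finally show "luncurry ?Y ?Y (h \<cdot> y) = luncurry ?Y ?Y (name_of V k)"
      unfolding eq luncurry_name_of[OF k] .
  qed
  have hd: "h \<cdot> d = name_of V (Ident V ?Y)"
    by (rule h_end) (simp_all add: in_hom w(2) v(2))
  have hc: "h \<cdot> c = name_of V (s' \<cdot> F)"
  proof (rule h_end)
    show "s' \<cdot> F \<in> hom V ?Y ?Y"
      using s'a F by (simp add: in_hom)
    have pv: "pre_comp V B l p b v' \<cdot> \<kappa> = s \<cdot> F"
    proof -
      have "pre_comp V B l p b v' \<cdot> \<kappa> = (VComp B l p b \<cdot> (\<kappa> \<odot> v')) \<cdot> inv_arr V (RUnit V ?Y)"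
        using pre_comp_comp(2)[OF B l p b v'(1) \<kappa>] \<kappa>a v'(1) by (simp add: in_hom)
      then show ?thesis
        unfolding v'(2) using sa F by simp
    qed
    have sF: "s \<cdot> F \<in> hom V ?Y ?Y"
      using sa F by (simp add: in_hom)
    have "VComp B l p b \<cdot> (\<kappa> \<odot> (w \<cdot> c)) = VComp B l l b \<cdot> ((s \<cdot> F) \<odot> t)"
      unfolding w(3) vcomp_el_comp(1)[OF B l l p b th v'(1) \<kappa>] pv ..
    also have "\<dots> = (s' \<cdot> F) \<cdot> RUnit V ?Y"
      using pre_comp_comp(3)[OF B l l b th sF] pt sa F by (simp add: s'_def in_hom)
    finally show "VComp B l p b \<cdot> (\<kappa> \<odot> (w \<cdot> c)) = (s' \<cdot> F) \<cdot> RUnit V ?Y" .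
  qed (simp add: in_hom)
  note nF = name_of[OF F(1)] and ns' = name_of[OF s']
  have he: "post_comp V (self_vcat V) ?Y ?Y ?X (name_of V F) \<cdot> h = name_of V F \<cdot> e"
  proof (rule luncurry_cancel[OF Y X])
    note pc = self_post_comp[OF F(1) Y h(1)]
    show "post_comp V (self_vcat V) ?Y ?Y ?X (name_of V F) \<cdot> h \<in> hom V J (IHom V ?Y ?X)"
      by (rule comp_in_hom[OF h(1) pc(1)])
    show ne: "name_of V F \<cdot> e \<in> hom V J (IHom V ?Y ?X)"
      using nF(1) by (simp add: in_hom)
    have za: "z \<in> Arr V" "Dom V z = ?I" "Cod V z = VHom A a (VFObj U p)"
      using z by (simp_all add: in_hom)
    have "luncurry ?Y ?X (post_comp V (self_vcat V) ?Y ?Y ?X (name_of V F) \<cdot> h) = F \<cdot> ?h0"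
      unfolding pc(3) h(2) ..
    also have "\<dots> = VComp A a (VFObj U p) (VFObj U b) \<cdot> ((VFArr U p b \<cdot> \<kappa>) \<odot> (z \<cdot> e))"
      using image[OF p \<kappa> w(1)] w(4) by simp
    also have "\<dots> = (VComp A a (VFObj U p) (VFObj U b) \<cdot> ((VFArr U p b \<cdot> \<kappa>) \<odot> z)) \<cdot> (Ident V ?Y \<odot> e)"
      using \<kappa>a za by simp
    also have "\<dots> = luncurry ?Y ?X (name_of V F) \<cdot> (Ident V ?Y \<odot> e)"
      unfolding zF luncurry_name_of[OF F(1)] ..
    also have "\<dots> = luncurry ?Y ?X (name_of V F \<cdot> e)"
      using nF(1) by (simp add: uncurry_comp in_hom)
    finally show "luncurry ?Y ?X (post_comp V (self_vcat V) ?Y ?Y ?X (name_of V F) \<cdot> h) =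
        luncurry ?Y ?X (name_of V F \<cdot> e)" .
  qed
  have "shrinkable V (self_vcat V) ?Y ?X (name_of V F)"
    unfolding shrinkable_def
  proof (intro conjI exI)
    show "name_of V F \<in> hom V ?I (VHom (self_vcat V) ?Y ?X)" "name_of V s' \<in> hom V ?I (VHom (self_vcat V) ?X ?Y)"
      "h \<in> hom V J (VHom (self_vcat V) ?Y ?Y)"
      using nF ns' h by (simp_all add: self_vcat_def)
    show "el_comp V (self_vcat V) ?X ?Y ?X (name_of V F) (name_of V s') = VId (self_vcat V) ?X"
      unfolding self_el_comp[OF s' F(1)] Fs' by (simp add: self_vcat_def)
    show "h \<cdot> d = VId (self_vcat V) ?Y"
      unfolding hd by (simp add: self_vcat_def)
    show "h \<cdot> c = el_comp V (self_vcat V) ?Y ?X ?Y (name_of V s') (name_of V F)"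
      unfolding hc self_el_comp[OF F(1) s'] ..
  qed (rule J he)+
  then show "shrinkable_in_base V (pre_comp V A a (VFObj U l) (VFObj U b) \<eta> \<cdot> VFArr U l b)"
    unfolding shrinkable_in_base_def using F by (simp add: F_def along_def)
qed

end

text \<open>Conversely, a section of \<open>B(a', b) \<rightarrow> A(a, U b)\<close> lifts each arrow \<open>a \<rightarrow> U b\<close>.\<close>

lemma (in adjoint_setting) shrink_reflection_weakly_initial:
  assumes r: "shrink_reflection V B A U a a' \<eta>" and b: "b \<in> VObj B" and f: "f \<in> hom V (Unit V) (VHom A a (VFObj U b))"
  obtains g where "g \<in> hom V (Unit V) (VHom B a' b)" and "along \<eta> a' b \<cdot> g = f"
proof -
  have a': "a' \<in> VObj B" and \<eta>: "\<eta> \<in> hom V (Unit V) (VHom A a (VFObj U a'))"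
    and sh: "shrinkable_in_base V (along \<eta> a' b)"
    using r b by (simp_all add: shrink_reflection_def along_def)
  let ?F = "along \<eta> a' b" and ?Y = "VHom B a' b" and ?X = "VHom A a (VFObj U b)"
  note F = along_simps[OF \<eta> a' b]
  have o [simp]: "?Y \<in> Obj V" "?X \<in> Obj V"
    using a' b by simp_all
  obtain \<sigma> where \<sigma>: "\<sigma> \<in> hom V (Unit V) (IHom V ?X ?Y)"
    and eq: "el_comp V (self_vcat V) ?X ?Y ?X (name_of V ?F) \<sigma> = name_of V (Ident V ?X)"
    using sh F unfolding shrinkable_in_base_def shrinkable_def by (auto simp: self_vcat_def)
  have \<sigma>a: "\<sigma> \<in> Arr V" "Dom V \<sigma> = Unit V" "Cod V \<sigma> = IHom V ?X ?Y"
    using \<sigma> by (simp_all add: in_hom)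
  define s where "s = runcurry ?X ?Y \<sigma> \<cdot> inv_arr V (LUnit V ?X)"
  have s: "s \<in> hom V ?X ?Y"
    using \<sigma>a by (simp add: s_def in_hom)
  then have sa: "s \<in> Arr V" "Dom V s = ?X" "Cod V s = ?Y"
    by (simp_all add: in_hom)
  have "runcurry ?X ?Y (name_of V s) = runcurry ?X ?Y \<sigma>"
    unfolding name_of(2)[OF s] using \<sigma>a by (simp add: s_def)
  then have "\<sigma> = name_of V s"
    using runcurry_cancel[OF o(2,1) name_of(1)[OF s] \<sigma>] by simp
  then have "name_of V (?F \<cdot> s) = name_of V (Ident V ?X)"
    using eq self_el_comp[OF s F(1)] by simp
  moreover have "?F \<cdot> s \<in> hom V ?X ?X" "Ident V ?X \<in> hom V ?X ?X"
    using F sa by (simp_all add: in_hom)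
  ultimately have "(?F \<cdot> s) \<cdot> LUnit V ?X = Ident V ?X \<cdot> LUnit V ?X"
    using name_of(2) by metis
  then have Fs: "?F \<cdot> s = Ident V ?X"
    using F sa by - (rule iso_cancel_right[of "LUnit V ?X"], simp_all)
  have "?F \<cdot> (s \<cdot> f) = (?F \<cdot> s) \<cdot> f"
    using F sa f by (simp add: in_hom)
  then show ?thesis
    using that[OF comp_in_hom[OF f s]] Fs f by (simp add: in_hom)
qed

lemma (in adjoint_setting) el_comp_along:
  assumes f: "f \<in> hom V (Unit V) (VHom A a (VFObj U b))" and b [simp]: "b \<in> VObj B" "b' \<in> VObj B"
    and g: "g \<in> hom V (Unit V) (VHom B b b')"
  shows "el_comp V A a (VFObj U b) (VFObj U b') (VFArr U b b' \<cdot> g) f = along f b b' \<cdot> g"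
proof -
  have Ug: "VFArr U b b' \<cdot> g \<in> hom V (Unit V) (VHom A (VFObj U b) (VFObj U b'))"
    using g by (simp add: in_hom)
  show ?thesis
    using el_comp(2)[OF A a _ _ f Ug] pre_comp_comp(1)[OF A a _ _ f Ug] g by (simp add: along_def in_hom)
qed

theorem theorem7p7:
  fixes V :: "('o, 'a) smmc"
    and B :: "('b, 'o, 'a) vcat"
    and A :: "('c, 'o, 'a) vcat"
    and U :: "('b, 'c, 'a) vfun"
  assumes "universe TYPE('u)"
    and "is_monoidal_model_category TYPE('u) V"
    and "cofibrant V (Unit V)"
    and "is_vcat V B"
    and "is_vcat V A"
    and "is_vfunctor V B A U"
    and "has_powers V B"
    and "enough_cofibrantly_weighted_limits TYPE('u) V B"
    and "preserves_powers V B A U"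
    and "preserves_enough_cofibrantly_weighted_limits TYPE('u) V B A U"
  shows "has_left_shrink_adjoint V B A U \<longleftrightarrow>
    solution_set_condition TYPE('u) (underlying_cat V B) (underlying_cat V A)
      (underlying_functor V U)"
proof -
  have smcc: "is_smcc V" and complete: "small_complete TYPE('u) V" and cocomplete: "small_cocomplete TYPE('u) V"
    and model: "is_model_structure V"
    using assms(2) by (simp_all add: is_monoidal_model_category_def)
  have category: "is_category V"
    using smcc by (simp add: is_smcc_def is_symmetric_monoidal_def)
  have setting: "adjoint_functor_setting V TYPE('u) B A U a" if "a \<in> VObj A" for a
    using assms smcc complete model category that ex_pushout[OF assms(1) cocomplete category]
    by unfold_locales
  have hom_underlying: "hom (underlying_cat V C) c d = {(c, d, f) |f. f \<in> hom V (Unit V) (VHom C c d)}"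
    if "c \<in> VObj C" "d \<in> VObj C" for C :: "('e, 'o, 'a) vcat" and c d
    using that by (auto simp: underlying_cat_def hom_def)
  have Obj_underlying: "Obj (underlying_cat V C) = VObj C" for C :: "('e, 'o, 'a) vcat"
    by (simp add: underlying_cat_def)
  have FObj: "FObj (underlying_functor V U) = VFObj U"
    by (simp add: underlying_functor_def)
  have UB: "VFObj U b \<in> VObj A" if "b \<in> VObj B" for b
    using assms(6) that by (simp add: is_vfunctor_def)
  have comp_underlying: "FArr (underlying_functor V U) (b, b', g) \<cdot>\<^bsub>underlying_cat V A\<^esub> (a, VFObj U b, f) =
      (a, VFObj U b', adjoint_setting.along V A U a f b b' \<cdot>\<^bsub>V\<^esub> g)"
    if "a \<in> VObj A" "b \<in> VObj B" "b' \<in> VObj B" "f \<in> hom V (Unit V) (VHom A a (VFObj U b))"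
      "g \<in> hom V (Unit V) (VHom B b b')" for a b b' f g
  proof -
    interpret adjoint_functor_setting V "TYPE('u)" B A U a
      using setting that(1) .
    show ?thesis
      using el_comp_along that(2-5) by (simp add: underlying_cat_def underlying_functor_def)
  qed
  show ?thesis
  proof
    assume adj: "has_left_shrink_adjoint V B A U"
    show "solution_set_condition TYPE('u) (underlying_cat V B) (underlying_cat V A) (underlying_functor V U)"
      unfolding solution_set_condition_def Obj_underlying FObj
    proof
      fix a assume a: "a \<in> VObj A"
      interpret adjoint_functor_setting V "TYPE('u)" B A U a
        using setting a .
      obtain a' \<eta> where r: "shrink_reflection V B A U a a' \<eta>"
        using adj a unfolding has_left_shrink_adjoint_def by blast
      then have a': "a' \<in> VObj B" and \<eta>: "\<eta> \<in> hom V (Unit V) (VHom A a (VFObj U a'))"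
        by (simp_all add: shrink_reflection_def)
      let ?S = "{(a', (a, VFObj U a', \<eta>))}"
      show "\<exists>S. small TYPE('u) S \<and>
        (\<forall>(b, \<eta>)\<in>S. b \<in> VObj B \<and> \<eta> \<in> hom (underlying_cat V A) a (VFObj U b)) \<and>
        (\<forall>c\<in>VObj B. \<forall>f\<in>hom (underlying_cat V A) a (VFObj U c).
           \<exists>(b, \<eta>)\<in>S. \<exists>g\<in>hom (underlying_cat V B) b c.
             f = FArr (underlying_functor V U) g \<cdot>\<^bsub>underlying_cat V A\<^esub> \<eta>)"
      proof (intro exI[of _ ?S] conjI ballI)
        show "small TYPE('u) ?S"
          by (simp add: small_finite[OF assms(1)])
        show "case y of (b, \<eta>) \<Rightarrow> b \<in> VObj B \<and> \<eta> \<in> hom (underlying_cat V A) a (VFObj U b)" if "y \<in> ?S" for y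
          using that a' \<eta> a UB by (simp add: hom_underlying)
        fix c f assume c: "c \<in> VObj B" and f: "f \<in> hom (underlying_cat V A) a (VFObj U c)"
        then obtain f' where f': "f = (a, VFObj U c, f')" "f' \<in> hom V (Unit V) (VHom A a (VFObj U c))"
          using a UB by (auto simp: hom_underlying)
        obtain g where g: "g \<in> hom V (Unit V) (VHom B a' c)" "along \<eta> a' c \<cdot>\<^bsub>V\<^esub> g = f'"
          using shrink_reflection_weakly_initial[OF r c f'(2)] .
        have "(a', c, g) \<in> hom (underlying_cat V B) a' c"
          using g(1) a' c by (simp add: hom_underlying)
        moreover have "f = FArr (underlying_functor V U) (a', c, g) \<cdot>\<^bsub>underlying_cat V A\<^esub> (a, VFObj U a', \<eta>)"
          using comp_underlying[OF a a' c \<eta> g(1)] g(2) f'(1) by simp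
        ultimately show "\<exists>(b, \<eta>)\<in>?S. \<exists>g\<in>hom (underlying_cat V B) b c.
             f = FArr (underlying_functor V U) g \<cdot>\<^bsub>underlying_cat V A\<^esub> \<eta>"
          by blast
      qed
    qed
  next
    assume sol: "solution_set_condition TYPE('u) (underlying_cat V B) (underlying_cat V A) (underlying_functor V U)"
    show "has_left_shrink_adjoint V B A U"
      unfolding has_left_shrink_adjoint_def
    proof
      fix a assume a: "a \<in> VObj A"
      interpret adjoint_functor_setting V "TYPE('u)" B A U a
        using setting a .
      obtain S where small: "small TYPE('u) S"
        and S: "\<And>b \<eta>. (b, \<eta>) \<in> S \<Longrightarrow> b \<in> VObj B \<and> \<eta> \<in> hom (underlying_cat V A) a (VFObj U b)"
        and factor: "\<And>c f. c \<in> VObj B \<Longrightarrow> f \<in> hom (underlying_cat V A) a (VFObj U c) \<Longrightarrow>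
           \<exists>(b, \<eta>)\<in>S. \<exists>g\<in>hom (underlying_cat V B) b c. f = FArr (underlying_functor V U) g \<cdot>\<^bsub>underlying_cat V A\<^esub> \<eta>"
        using sol a unfolding solution_set_condition_def Obj_underlying FObj by fast
      define X where "X = (\<lambda>(b, _, _, f). (b, f)) ` S"
      have obj: "comma_obj y" if y: "y \<in> X" for y
      proof -
        obtain b \<eta>' where b: "(b, \<eta>') \<in> S" "y = (b, snd (snd \<eta>'))"
          using y by (auto simp: X_def)
        then show ?thesis
          using S[OF b(1)] a UB by (auto simp: hom_underlying comma_obj_def)
      qed
      have wi: "\<exists>y\<in>X. \<exists>g. comma_arr y z g" if z: "comma_obj z" for z
      proof -
        note z' = comma_obj_simps(1,2)[OF z]
        have "(a, VFObj U (fst z), snd z) \<in> hom (underlying_cat V A) a (VFObj U (fst z))"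
          using z' a by (simp add: hom_underlying)
        then obtain b \<eta>' g' where b: "(b, \<eta>') \<in> S" and g': "g' \<in> hom (underlying_cat V B) b (fst z)"
          and eq: "(a, VFObj U (fst z), snd z) = FArr (underlying_functor V U) g' \<cdot>\<^bsub>underlying_cat V A\<^esub> \<eta>'"
          using factor[OF z'(1)] by blast
        have bo: "b \<in> VObj B"
          using S[OF b] by blast
        obtain f where f: "\<eta>' = (a, VFObj U b, f)" "f \<in> hom V (Unit V) (VHom A a (VFObj U b))"
          using S[OF b] a UB by (auto simp: hom_underlying)
        obtain g where g: "g' = (b, fst z, g)" "g \<in> hom V (Unit V) (VHom B b (fst z))"
          using g' bo z'(1) by (auto simp: hom_underlying)
        have "comma_arr (b, f) z g"
          using eq comp_underlying[OF a bo z'(1) f(2) g(2)] f(1) g by (simp add: comma_arr_def)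
        moreover have "(b, f) \<in> X"
          unfolding X_def using b f(1) by force
        ultimately show ?thesis
          by blast
      qed
      have "small TYPE('u) X"
        unfolding X_def by (rule small_image[OF small])
      then obtain L where L: "comma_obj L" "\<And>z. comma_obj z \<Longrightarrow> \<exists>g. comma_arr L z g"
        and eq: "\<And>z v v'. comma_obj z \<Longrightarrow> comma_arr L z v \<Longrightarrow> comma_arr L z v' \<Longrightarrow>
          \<exists>t. comma_arr L L t \<and> homotopic L L (VId B (fst L)) t \<and>
            homotopic L z (el_comp V B (fst L) (fst L) (fst z) v t) (el_comp V B (fst L) (fst L) (fst z) v' t)"
        using homotopically_initial[OF _ obj wi] by metis
      have "shrink_reflection V B A U a (fst L) (snd L)"
        using L eq by (intro shrink_reflection) simp_all
      then show "\<exists>a' \<eta>. shrink_reflection V B A U a a' \<eta>"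
        by blast
    qed
  qed
qed

end
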